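(* Let $\Phi$ be a locally bounded edge loading operator and let $\mathbb P_i$ ($i\in I$) be probability measures on cost predictors. (i) If, for some $T\in[0,\infty)$, $\Phi_T$ is sequentially weak-weak continuous with respect to $\|\cdot\|_p$, and for every $i\in I$, for $\mathbb P_i$-almost all $\hat C$, for almost all $\theta<T$ and all $P\in\mathcal P$ the map $f\mapsto\hat C_P(\theta,f)$ is sequentially weak-strong continuous with respect to $(\mathcal F_T^{E\times I\times\{+,-\}},\|\cdot\|_p)$ and $\mathbb R$, then there exists a stochastic prediction equilibrium until time $T$. (ii) If the assumptions of (i) hold for all $T\in[0,\infty)$ and if $\Phi$ as well as, for every $i\in I$, $\mathbb P_i$-almost all $\hat C$ are causal, then there exists a stochastic prediction equilibrium until time $\infty$. (iii) Suppose that $\Phi$ is uniformly strictly causal and essentially bounded; that the network inflow rates $u$ are contained in $L^\infty_{\mathrm{loc}}(\mathbb R)^{V\times I}$; that $\hat C$ is causal for $\mathbb P_i$-almost all $\hat C$ (for every $i\in I$); that there exists some $B>0$ such that for every two distinct paths $P,Q$, every flow $f$ and almost all $\theta$, the random variable $\hat Z_{P,Q}(\theta,f)=\hat C_P(\theta,f)-\hat C_Q(\theta,f)$ has a probability density function bounded by $B$ with respect to every $\mathbb P_i$; and that for all $T\in[0,\infty)$ there exists some $L>0$ such that for every $i\in I$ and $\mathbb P_i$-almost all $\hat C$, the mapping $f\mapsto\mathbf 1_{[0,T]}(\theta)\cdot\hat C(\theta,f)$ is Lipschitz continuous with constant $L$ with respect to $(\mathcal F_T^{E\times I\times\{+,-\}},\|\cdot\|_1)$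 and $\mathbb R$ (componentwise) for almost all $\theta\in[0,T]$. Then there exists a unique stochastic prediction equilibrium until $\infty$.
   Context: Fix $p\in(1,\infty)$. $\lambda$ is Lebesgue measure; (in)equalities between functions of time are meant almost everywhere, and functions are identified if equal almost everywhere. $\mathbf 1_J$ is the indicator function of $J\subseteq\mathbb R$; $\mathbf 1_A\in\{0,1\}$ is the truth value of a statement $A$. $\mathcal F\subset L^p_{\mathrm{loc}}(\mathbb R)$ is the set of non-negative locally $p$-integrable functions vanishing on $(-\infty,0)$; $\mathcal S$ is the set of measurable functions $\mathbb R\to[0,1]$. For $T\in[0,\infty]$, $\mathcal F_T,\mathcal S_T$ are the subsets of functions vanishing outside $[0,T)$. Finite products of normed spaces carry the maximum of the component norms. Two vectors $f,g$ of measurable functions coincide until $T\in[0,\infty]$ if $\mathbf 1_{[0,T)}f=\mathbf 1_{[0,T)}g$ a.e. Network: $G=(V,E)$ is a finite directed graph; $\delta^+(v),\delta^-(v)$ are the sets of edges leaving and entering $v$; $e=vw$ means $e$ leads from $v$ to $w$. $I$ is a finite set of commodities; each $i\in I$ has a destination $t_i\in V$ reachable from every node, and network inflow rates $u_{v,i}\in\mathcal F$ ($v\in V$). A flow is a vector $f=(f^+,f^-)\in\mathcal F^{E\times I\times\{+,-\}}$ of edge inflow rates $f^+_{e,i}$ and edge outflow rates $f^-_{e,i}$. $\mathcal P_{v,w}$ is the set of simple $v$-$w$-paths and $\mathcal P$ the set of all simple paths. An edge loading operator is a map $\Phi:\mathcal F^{E\times I}\to\mathcal F^{E\times I}$. It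 is locally bounded if for every $T\in[0,\infty)$ there is $B'_T\ge 0$ with $\|\mathbf 1_{[0,T]}\Phi(f^+)\|_p\le B'_T$ for all $f^+$; essentially bounded if for every $T\in[0,\infty)$, $\sup_{f^+\in\mathcal F^{E\times I}}\|\mathbf 1_{[0,T]}\Phi(f^+)\|_\infty<\infty$; causal if whenever $f^+,g^+$ coincide until some time $T$, there is $\alpha\ge0$ such that $\Phi(f^+),\Phi(g^+)$ coincide until $T+\alpha$; uniformly strictly causal if moreover $\alpha$ can be chosen strictly positive and independent of $g^+$ (possibly dependent on $T$ and $f^+$). For finite $T$, $\Phi_T:\mathcal F_T^{E\times I}\to\mathcal F_T^{E\times I}$, $f^+\mapsto \mathbf 1_{[0,T]}\Phi(f^+)$. A map is sequentially weak-weak (weak-strong) continuous if it maps weakly convergent sequences with limit in the domain to sequences converging weakly (strongly) to the image of the limit. Cost predictors: a cost predictor is a map $\hat C:\mathbb R\times\mathcal F^{E\times I\times\{+,-\}}\to\mathbb R^{\mathcal P}$, $(\theta,f)\mapsto(\hat C_P(\theta,f))_{P\in\mathcal P}$; $\hat C$ is causal if whenever flows $f,g$ coincide until $T$, then $\hat C(\cdot,f),\hat C(\cdot,g)$ coincide until $T$. Each $\mathbb P_i$ is a probability measure over such predictors, and it is assumed throughout that $(\hat C,\theta)\mapsto\hat C_P(\theta,f)$ is $(\mathbb P_i\otimes\lambda)$-measurable for every flow $f$, path $P$ and commodity $i$. $\tilde E_i(\theta,f,\hat C)$ is the set of edges $e=vw$ for which some simple $v$-$t_i$-path starting with $e$ minimizes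 $\hat C_P(\theta,f)$ over $P\in\mathcal P_{v,t_i}$ (edges leaving $t_i$ are never in this set). For $v\in V$, $M\subseteq\delta^+(v)$ set $\pi_{v,M,i}(\theta,f)=\mathbb P_i(\{\hat C: M=\tilde E_i(\theta,f,\hat C)\cap\delta^+(v)\})$. Let $\mathcal E$ be the set of pairs $(M,e)$ with $M\subseteq\delta^+(v)$ for some $v\in V$ and $e\in M$. Define the routing operator $$\mathcal R(f)=\Bigl\{\bigl(\textstyle\sum_{M\ni e}r_{M,e,i}\bigr)_{e,i} : (r_{M,e,i})\in\mathcal S^{\mathcal E\times I},\ \forall v\in V,\ \emptyset\ne M\subseteq\delta^+(v),\ i\in I:\ \sum_{e\in M}r_{M,e,i}=\pi_{v,M,i}(\cdot,f)\Bigr\}\subseteq\mathcal S^{E\times I}.$$ A stochastic prediction equilibrium until $T\in[0,\infty]$ is a flow $f$ such that for almost all $\theta<T$ and all $i\in I$: (a) $f^-_{e,i}(\theta)=\Phi(f^+)_{e,i}(\theta)$ for all $e\in E$; (b) $\sum_{e\in\delta^+(v)}f^+_{e,i}(\theta)=\mathbf 1_{v\ne t_i}\bigl(u_{v,i}(\theta)+\sum_{e\in\delta^-(v)}f^-_{e,i}(\theta)\bigr)$ for all $v\in V$; and (c) there is a single $r\in\mathcal R(f)$ (independent of $\theta,i$) with $f^+_{e,i}(\theta)=r_{e,i}(\theta)\sum_{e'\in\delta^+(v)}f^+_{e',i}(\theta)$ for all $e=vw\in E$. *)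

theory Defs
  imports
    "HOL-Probability.Probability"
    "HOL-Probability.Essential_Supremum"
    "Graph_Theory.Graph_Theory"
begin

section \<open>Functions of time\<close>

text \<open>
  Functions of time are represented by Lebesgue measurable representatives. Vectors indexed by a
  finite set \<open>J\<close> are functions on the index type of which only the components in \<open>J\<close> matter. The
  identification of functions that are equal almost everywhere is made explicit by
  \<open>ae_equal\<close>: operators on vectors are required to respect it, and uniqueness is
  stated up to it.
\<close>

type_synonym 'j vec = "'j \<Rightarrow> real \<Rightarrow> real"

definition ae_equal :: "'j set \<Rightarrow> 'j vec \<Rightarrow> 'j vec \<Rightarrow> bool" where
  "ae_equal J f g \<longleftrightarrow> (\<forall>j\<in>J. AE t in lebesgue. f j t = g j t)"

definition before :: "ereal \<Rightarrow> real set" where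
  "before T = {t. 0 \<le> t \<and> ereal t < T}"

definition cut :: "real set \<Rightarrow> 'j vec \<Rightarrow> 'j vec" where
  "cut A f = (\<lambda>j t. indicator A t * f j t)"

definition coincide_until :: "'j set \<Rightarrow> ereal \<Rightarrow> 'j vec \<Rightarrow> 'j vec \<Rightarrow> bool" where
  "coincide_until J T f g \<longleftrightarrow> ae_equal J (cut (before T) f) (cut (before T) g)"

definition rates :: "real \<Rightarrow> (real \<Rightarrow> real) set" where
  "rates p = {f \<in> borel_measurable lebesgue.
     (\<forall>a b. set_integrable lebesgue {a..b} (\<lambda>t. \<bar>f t\<bar> powr p)) \<and>
     (AE t in lebesgue. 0 \<le> f t) \<and> (AE t in lebesgue. t < 0 \<longrightarrow> f t = 0)}"

definition rates_until :: "real \<Rightarrow> ereal \<Rightarrow> (real \<Rightarrow> real) set" where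
  "rates_until p T = {f \<in> rates p. AE t in lebesgue. t \<notin> before T \<longrightarrow> f t = 0}"

definition splits :: "(real \<Rightarrow> real) set" where
  "splits = {f \<in> borel_measurable lebesgue. AE t in lebesgue. f t \<in> {0..1}}"

section \<open>The spaces \<open>L\<^sup>p\<close> and weak convergence\<close>

definition Lp_space :: "real \<Rightarrow> (real \<Rightarrow> real) set" where
  "Lp_space p = {f \<in> borel_measurable lebesgue. integrable lebesgue (\<lambda>t. \<bar>f t\<bar> powr p)}"

definition Lp_norm :: "real \<Rightarrow> (real \<Rightarrow> real) \<Rightarrow> real" where
  "Lp_norm p f = (LINT t|lebesgue. \<bar>f t\<bar> powr p) powr (1 / p)"

text \<open>The inserted \<open>0\<close> only matters for the empty product.\<close>

definition vec_norm :: "real \<Rightarrow> 'j set \<Rightarrow> 'j vec \<Rightarrow> real" where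
  "vec_norm p J f = Max (insert 0 ((\<lambda>j. Lp_norm p (f j)) ` J))"

definition Linf_norm :: "(real \<Rightarrow> real) \<Rightarrow> ereal" where
  "Linf_norm f = esssup lebesgue (\<lambda>t. ereal \<bar>f t\<bar>)"

text \<open>Boundedness makes every such functional independent of the chosen representatives.\<close>

definition bounded_functional :: "real \<Rightarrow> 'j set \<Rightarrow> ('j vec \<Rightarrow> real) \<Rightarrow> bool" where
  "bounded_functional p J \<phi> \<longleftrightarrow>
     (\<forall>f \<in> J \<rightarrow> Lp_space p. \<forall>g \<in> J \<rightarrow> Lp_space p. \<phi> (\<lambda>j t. f j t + g j t) = \<phi> f + \<phi> g) \<and>
     (\<forall>c. \<forall>f \<in> J \<rightarrow> Lp_space p. \<phi> (\<lambda>j t. c * f j t) = c * \<phi> f) \<and>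
     (\<exists>K. \<forall>f \<in> J \<rightarrow> Lp_space p. \<bar>\<phi> f\<bar> \<le> K * vec_norm p J f)"

definition weakly_converges :: "real \<Rightarrow> 'j set \<Rightarrow> (nat \<Rightarrow> 'j vec) \<Rightarrow> 'j vec \<Rightarrow> bool" where
  "weakly_converges p J X f \<longleftrightarrow>
     (\<forall>\<phi>. bounded_functional p J \<phi> \<longrightarrow> (\<lambda>n. \<phi> (X n)) \<longlonglongrightarrow> \<phi> f)"

definition weak_weak_continuous_on ::
    "real \<Rightarrow> 'j set \<Rightarrow> 'j vec set \<Rightarrow> ('j vec \<Rightarrow> 'j vec) \<Rightarrow> bool" where
  "weak_weak_continuous_on p J D F \<longleftrightarrow>
     (\<forall>X. \<forall>f\<in>D. range X \<subseteq> D \<longrightarrow> weakly_converges p J X f \<longrightarrow>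
        weakly_converges p J (\<lambda>n. F (X n)) (F f))"

definition weak_strong_continuous_on ::
    "real \<Rightarrow> 'j set \<Rightarrow> 'j vec set \<Rightarrow> ('j vec \<Rightarrow> real) \<Rightarrow> bool" where
  "weak_strong_continuous_on p J D F \<longleftrightarrow>
     (\<forall>X. \<forall>f\<in>D. range X \<subseteq> D \<longrightarrow> weakly_converges p J X f \<longrightarrow> (\<lambda>n. F (X n)) \<longlonglongrightarrow> F f)"

section \<open>Edge loading\<close>

definition edge_loading_operator ::
    "real \<Rightarrow> ('v, 'e) pre_digraph \<Rightarrow> 'i set \<Rightarrow> (('e \<times> 'i) vec \<Rightarrow> ('e \<times> 'i) vec) \<Rightarrow> bool" where
  "edge_loading_operator p G I \<Phi> \<longleftrightarrow>
     \<Phi> \<in> (arcs G \<times> I \<rightarrow> rates p) \<rightarrow> (arcs G \<times> I \<rightarrow> rates p) \<and>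
     (\<forall>f \<in> arcs G \<times> I \<rightarrow> rates p. \<forall>g \<in> arcs G \<times> I \<rightarrow> rates p.
        ae_equal (arcs G \<times> I) f g \<longrightarrow> ae_equal (arcs G \<times> I) (\<Phi> f) (\<Phi> g))"

definition locally_bounded_loading ::
    "real \<Rightarrow> ('v, 'e) pre_digraph \<Rightarrow> 'i set \<Rightarrow> (('e \<times> 'i) vec \<Rightarrow> ('e \<times> 'i) vec) \<Rightarrow> bool" where
  "locally_bounded_loading p G I \<Phi> \<longleftrightarrow>
     (\<forall>T\<ge>0. \<exists>B\<ge>0. \<forall>f \<in> arcs G \<times> I \<rightarrow> rates p.
        vec_norm p (arcs G \<times> I) (cut {0..T} (\<Phi> f)) \<le> B)"

definition essentially_bounded_loading ::
    "real \<Rightarrow> ('v, 'e) pre_digraph \<Rightarrow> 'i set \<Rightarrow> (('e \<times> 'i) vec \<Rightarrow> ('e \<times> 'i) vec) \<Rightarrow> bool" where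
  "essentially_bounded_loading p G I \<Phi> \<longleftrightarrow>
     (\<forall>T::real\<ge>0. (SUP f \<in> arcs G \<times> I \<rightarrow> rates p. SUP j \<in> arcs G \<times> I.
        Linf_norm (cut {0..T} (\<Phi> f) j)) < \<infinity>)"

definition causal_loading ::
    "real \<Rightarrow> ('v, 'e) pre_digraph \<Rightarrow> 'i set \<Rightarrow> (('e \<times> 'i) vec \<Rightarrow> ('e \<times> 'i) vec) \<Rightarrow> bool" where
  "causal_loading p G I \<Phi> \<longleftrightarrow>
     (\<forall>T\<ge>0. \<forall>f \<in> arcs G \<times> I \<rightarrow> rates p. \<forall>g \<in> arcs G \<times> I \<rightarrow> rates p.
        coincide_until (arcs G \<times> I) T f g \<longrightarrow>
        (\<exists>\<alpha>\<ge>0. coincide_until (arcs G \<times> I) (T + ereal \<alpha>) (\<Phi> f) (\<Phi> g)))"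

definition uniformly_strictly_causal_loading ::
    "real \<Rightarrow> ('v, 'e) pre_digraph \<Rightarrow> 'i set \<Rightarrow> (('e \<times> 'i) vec \<Rightarrow> ('e \<times> 'i) vec) \<Rightarrow> bool" where
  "uniformly_strictly_causal_loading p G I \<Phi> \<longleftrightarrow>
     (\<forall>T\<ge>0. \<forall>f \<in> arcs G \<times> I \<rightarrow> rates p. \<exists>\<alpha>>0. \<forall>g \<in> arcs G \<times> I \<rightarrow> rates p.
        coincide_until (arcs G \<times> I) T f g \<longrightarrow>
        coincide_until (arcs G \<times> I) (T + ereal \<alpha>) (\<Phi> f) (\<Phi> g))"

section \<open>Flows and cost predictors\<close>

datatype sign = Plus | Minus

definition flow_index :: "('v, 'e) pre_digraph \<Rightarrow> 'i set \<Rightarrow> ('e \<times> 'i \<times> sign) set" where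
  "flow_index G I = arcs G \<times> I \<times> UNIV"

definition flows :: "real \<Rightarrow> ('v, 'e) pre_digraph \<Rightarrow> 'i set \<Rightarrow> ('e \<times> 'i \<times> sign) vec set" where
  "flows p G I = flow_index G I \<rightarrow> rates p"

definition flows_until ::
    "real \<Rightarrow> ('v, 'e) pre_digraph \<Rightarrow> 'i set \<Rightarrow> ereal \<Rightarrow> ('e \<times> 'i \<times> sign) vec set" where
  "flows_until p G I T = flow_index G I \<rightarrow> rates_until p T"

definition edge_inflow :: "('e \<times> 'i \<times> sign) vec \<Rightarrow> ('e \<times> 'i) vec" where
  "edge_inflow f = (\<lambda>(e, i). f (e, i, Plus))"

definition edge_outflow :: "('e \<times> 'i \<times> sign) vec \<Rightarrow> ('e \<times> 'i) vec" where
  "edge_outflow f = (\<lambda>(e, i). f (e, i, Minus))"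

text \<open>
  A path is the nonempty list of its edges, so that it determines its end points. The trivial
  paths are left out: they start with no edge and play no role for routing, hence no
  condition is imposed on their predicted costs.
\<close>

definition simple_paths_between :: "('v, 'e) pre_digraph \<Rightarrow> 'v \<Rightarrow> 'v \<Rightarrow> 'e list set" where
  "simple_paths_between G v w = {q. q \<noteq> [] \<and> pre_digraph.apath G v q w}"

definition simple_paths :: "('v, 'e) pre_digraph \<Rightarrow> 'e list set" where
  "simple_paths G = (\<Union>v\<in>verts G. \<Union>w\<in>verts G. simple_paths_between G v w)"

type_synonym ('e, 'i) predictor = "real \<Rightarrow> ('e \<times> 'i \<times> sign) vec \<Rightarrow> 'e list \<Rightarrow> real"

definition cost_predictor ::
    "real \<Rightarrow> ('v, 'e) pre_digraph \<Rightarrow> 'i set \<Rightarrow> ('e, 'i) predictor \<Rightarrow> bool" where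
  "cost_predictor p G I C \<longleftrightarrow>
     (\<forall>f \<in> flows p G I. \<forall>g \<in> flows p G I. ae_equal (flow_index G I) f g \<longrightarrow>
        (\<forall>\<theta>. \<forall>q \<in> simple_paths G. C \<theta> f q = C \<theta> g q))"

definition causal_predictor ::
    "real \<Rightarrow> ('v, 'e) pre_digraph \<Rightarrow> 'i set \<Rightarrow> ('e, 'i) predictor \<Rightarrow> bool" where
  "causal_predictor p G I C \<longleftrightarrow>
     (\<forall>T\<ge>0. \<forall>f \<in> flows p G I. \<forall>g \<in> flows p G I. coincide_until (flow_index G I) T f g \<longrightarrow>
        coincide_until (simple_paths G) T (\<lambda>q \<theta>. C \<theta> f q) (\<lambda>q \<theta>. C \<theta> g q))"

definition predictor_distribution ::
    "real \<Rightarrow> ('v, 'e) pre_digraph \<Rightarrow> 'i set \<Rightarrow> ('e, 'i) predictor measure \<Rightarrow> bool" where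
  "predictor_distribution p G I \<mu> \<longleftrightarrow>
     prob_space \<mu> \<and> space \<mu> \<subseteq> {C. cost_predictor p G I C} \<and>
     (\<forall>f \<in> flows p G I. \<forall>q \<in> simple_paths G.
        (\<lambda>(C, \<theta>). C \<theta> f q) \<in> borel_measurable (\<mu> \<Otimes>\<^sub>M lebesgue))"

section \<open>Stochastic prediction equilibria\<close>

text \<open>In the following, \<open>d i\<close> is the destination of commodity \<open>i\<close>.\<close>

definition optimal_edges ::
    "('v, 'e) pre_digraph \<Rightarrow> ('i \<Rightarrow> 'v) \<Rightarrow> 'i \<Rightarrow> real \<Rightarrow> ('e \<times> 'i \<times> sign) vec \<Rightarrow>
     ('e, 'i) predictor \<Rightarrow> 'e set" where
  "optimal_edges G d i \<theta> f C =
     {e \<in> arcs G. \<exists>q. is_arg_min (C \<theta> f) (\<lambda>q'. q' \<in> simple_paths_between G (tail G e) (d i)) (e # q)}"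

definition choice_prob ::
    "('v, 'e) pre_digraph \<Rightarrow> ('i \<Rightarrow> 'v) \<Rightarrow> ('i \<Rightarrow> ('e, 'i) predictor measure) \<Rightarrow>
     'v \<Rightarrow> 'e set \<Rightarrow> 'i \<Rightarrow> real \<Rightarrow> ('e \<times> 'i \<times> sign) vec \<Rightarrow> real" where
  "choice_prob G d \<mu> v M i \<theta> f =
     measure (\<mu> i) {C \<in> space (\<mu> i). M = optimal_edges G d i \<theta> f C \<inter> out_arcs G v}"

definition choice_pairs :: "('v, 'e) pre_digraph \<Rightarrow> ('e set \<times> 'e) set" where
  "choice_pairs G = {(M, e). (\<exists>v\<in>verts G. M \<subseteq> out_arcs G v) \<and> e \<in> M}"

definition routing ::
    "('v, 'e) pre_digraph \<Rightarrow> 'i set \<Rightarrow> ('i \<Rightarrow> 'v) \<Rightarrow> ('i \<Rightarrow> ('e, 'i) predictor measure) \<Rightarrow>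
     ('e \<times> 'i \<times> sign) vec \<Rightarrow> ('e \<times> 'i) vec set" where
  "routing G I d \<mu> f =
     {r. \<exists>\<rho>. (\<forall>(M, e) \<in> choice_pairs G. \<forall>i\<in>I. \<rho> (M, e, i) \<in> splits) \<and>
        (\<forall>v \<in> verts G. \<forall>M i. M \<noteq> {} \<and> M \<subseteq> out_arcs G v \<and> i \<in> I \<longrightarrow>
           (AE \<theta> in lebesgue. (\<Sum>e\<in>M. \<rho> (M, e, i) \<theta>) = choice_prob G d \<mu> v M i \<theta> f)) \<and>
        ae_equal (arcs G \<times> I) r
          (\<lambda>(e, i) \<theta>. \<Sum>M | (M, e) \<in> choice_pairs G. \<rho> (M, e, i) \<theta>)}"

definition prediction_equilibrium ::
    "real \<Rightarrow> ('v, 'e) pre_digraph \<Rightarrow> 'i set \<Rightarrow> ('i \<Rightarrow> 'v) \<Rightarrow> ('v \<times> 'i) vec \<Rightarrow>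
     (('e \<times> 'i) vec \<Rightarrow> ('e \<times> 'i) vec) \<Rightarrow> ('i \<Rightarrow> ('e, 'i) predictor measure) \<Rightarrow>
     ereal \<Rightarrow> ('e \<times> 'i \<times> sign) vec \<Rightarrow> bool" where
  "prediction_equilibrium p G I d u \<Phi> \<mu> T f \<longleftrightarrow>
     f \<in> flows p G I \<and>
     (\<exists>r \<in> routing G I d \<mu> f. AE \<theta> in lebesgue. ereal \<theta> < T \<longrightarrow> (\<forall>i\<in>I.
        (\<forall>e \<in> arcs G. edge_outflow f (e, i) \<theta> = \<Phi> (edge_inflow f) (e, i) \<theta>) \<and>
        (\<forall>v \<in> verts G. (\<Sum>e\<in>out_arcs G v. edge_inflow f (e, i) \<theta>) =
           of_bool (v \<noteq> d i) * (u (v, i) \<theta> + (\<Sum>e\<in>in_arcs G v. edge_outflow f (e, i) \<theta>))) \<and>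
        (\<forall>e \<in> arcs G. edge_inflow f (e, i) \<theta> =
           r (e, i) \<theta> * (\<Sum>e'\<in>out_arcs G (tail G e). edge_inflow f (e', i) \<theta>))))"

section \<open>Conditions for existence and uniqueness\<close>

definition continuity_until ::
    "real \<Rightarrow> ('v, 'e) pre_digraph \<Rightarrow> 'i set \<Rightarrow> (('e \<times> 'i) vec \<Rightarrow> ('e \<times> 'i) vec) \<Rightarrow>
     ('i \<Rightarrow> ('e, 'i) predictor measure) \<Rightarrow> real \<Rightarrow> bool" where
  "continuity_until p G I \<Phi> \<mu> T \<longleftrightarrow>
     weak_weak_continuous_on p (arcs G \<times> I) (arcs G \<times> I \<rightarrow> rates_until p T) (\<lambda>f. cut {0..T} (\<Phi> f)) \<and>
     (\<forall>i\<in>I. AE C in \<mu> i. AE \<theta> in lebesgue. \<theta> < T \<longrightarrow> (\<forall>q \<in> simple_paths G.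
        weak_strong_continuous_on p (flow_index G I) (flows_until p G I T) (\<lambda>f. C \<theta> f q)))"

definition bounded_cost_densities ::
    "real \<Rightarrow> ('v, 'e) pre_digraph \<Rightarrow> 'i set \<Rightarrow> ('i \<Rightarrow> ('e, 'i) predictor measure) \<Rightarrow> bool" where
  "bounded_cost_densities p G I \<mu> \<longleftrightarrow>
     (\<exists>B>0. \<forall>q \<in> simple_paths G. \<forall>q' \<in> simple_paths G. q \<noteq> q' \<longrightarrow>
        (\<forall>f \<in> flows p G I. AE \<theta> in lebesgue. \<forall>i\<in>I. \<exists>h.
           distributed (\<mu> i) lborel (\<lambda>C. C \<theta> f q - C \<theta> f q') h \<and> (\<forall>x. h x \<le> ennreal B)))"

definition locally_Lipschitz_predictors ::
    "real \<Rightarrow> ('v, 'e) pre_digraph \<Rightarrow> 'i set \<Rightarrow> ('i \<Rightarrow> ('e, 'i) predictor measure) \<Rightarrow> bool" where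
  "locally_Lipschitz_predictors p G I \<mu> \<longleftrightarrow>
     (\<forall>T\<ge>0. \<exists>L>0. \<forall>i\<in>I. AE C in \<mu> i. AE \<theta> in lebesgue. \<theta> \<in> {0..T} \<longrightarrow>
        (\<forall>f \<in> flows_until p G I (ereal T). \<forall>g \<in> flows_until p G I (ereal T). \<forall>q \<in> simple_paths G.
           \<bar>indicator {0..T} \<theta> * C \<theta> f q - indicator {0..T} \<theta> * C \<theta> g q\<bar>
             \<le> L * vec_norm 1 (flow_index G I) (\<lambda>j t. f j t - g j t)))"

definition locally_essentially_bounded :: "(real \<Rightarrow> real) \<Rightarrow> bool" where
  "locally_essentially_bounded h \<longleftrightarrow>
     h \<in> borel_measurable lebesgue \<and> (\<forall>a b. Linf_norm (\<lambda>t. indicator {a..b} t * h t) < \<infinity>)"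

end

theory Submission
  imports Defs "HOL-Complex_Analysis.Great_Picard"
begin

text \<open>
  Under weak continuity, the choice of optimal edges is replaced by a softmax rule and the edge inflow
  rates by their averages over dyadic intervals. The average then depends on finitely many
  numbers, and Brouwer's theorem yields an equilibrium of the smoothed problem. Refining partition and
  softmax together, bounded sequences in \<open>L\<^sup>p\<close> have weakly convergent subsequences; predicted costs
  converge pointwise, so that the share of each class of optimal edges converges strongly, and a
  product of a strongly and a weakly convergent sequence converges weakly. The limit is therefore an
  equilibrium. All weak limits are taken by testing with indicators of dyadic intervals. That weak
  convergence in this sense is weak convergence in \<open>L\<^sup>p\<close> rests on the convergence of bounded
  martingales along the dyadic partitions, which follows from uniform convexity.

  With bounded densities, ties between paths are null events and the splitting rates are the probabilities
  that an edge is the only optimal one. These are Lipschitz in the flow. As the outflow rates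
  just after time \<open>T\<close> are determined by the inflow rates until \<open>T\<close>, the edge inflow rates are a fixed
  point of an operator that contracts in the supremum norm on a short interval after \<open>T\<close>. This makes equilibria
  unique and extensible, and essential boundedness makes them extensible up to time \<open>\<infinity>\<close>.
\<close>

section \<open>Uniform convexity\<close>

text \<open>Three obstacles shape the argument. Weak limits do not commute with products, so one
  factor of each product must converge strongly: weak-strong continuity of the costs makes
  probabilities converge pointwise, while rates of flow converge only weakly. Where optimal paths
  tie in the limit, softmax weights need not converge at all. The shares are therefore decomposed by
  the set \<open>M\<close> of edges that are optimal for the limiting flow. Compactness is applied
  to the flow of each class and not to its splitting rates, which are recovered at the end through
  division by the node inflow. In this way a single-valued fixed point theorem suffices for a
  set-valued routing operator. An infinite horizon is approached by finite ones, and causality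
  reduces what happens in one dyadic cell to a fixed finite horizon. In the unique case the delay
  granted by strict causality depends on the flow, so the short intervals of contraction have no
  common lower bound on their lengths; uniqueness and existence are both obtained from suprema of
  times, and the bounds survive there because they hold for all inflows alike.\<close>

lemma powr_midpoint_strict_nonneg:
  fixes a b p :: real
  assumes "1 < p" "0 \<le> a" "a < b"
  shows "2 * ((a + b) / 2) powr p < a powr p + b powr p"
proof -
  define m where "m = (a + b) / 2"
  have m: "a < m" "m < b" "b - m = m - a" using assms by (auto simp: m_def field_simps)
  have cont: "continuous_on S (\<lambda>x. x powr p)" if "S \<subseteq> {0..}" for S
    using assms that by (intro continuous_on_powr') auto
  have der: "((\<lambda>x. x powr p) has_real_derivative p * x powr (p - 1)) (at x)" if "0 < x" for x
    using that by (auto intro!: derivative_eq_intros)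
  have dif: "(\<lambda>x. x powr p) differentiable (at x)" if "0 < x" for x
    using der[OF that] by (auto simp: real_differentiable_def)
  \<comment> \<open>The power has a strictly increasing derivative on the positive axis, so its
    increment over the right half exceeds that over the left half. The mean value theorem needs
    differentiability only inside, which matters when \<open>a = 0\<close>.\<close>
  obtain l1 z1 where z1: "a < z1" "z1 < m" "DERIV (\<lambda>x. x powr p) z1 :> l1"
      "m powr p - a powr p = (m - a) * l1"
    using MVT[of a m "\<lambda>x. x powr p"] m assms dif cont[of "{a..m}"] by auto
  obtain l2 z2 where z2: "m < z2" "z2 < b" "DERIV (\<lambda>x. x powr p) z2 :> l2"
      "b powr p - m powr p = (b - m) * l2"
    using MVT[of m b "\<lambda>x. x powr p"] m assms dif cont[of "{m..b}"] by auto
  have l: "l1 = p * z1 powr (p - 1)" "l2 = p * z2 powr (p - 1)"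
    using z1 z2 assms m by (auto intro!: DERIV_unique[OF _ der])
  have "z1 powr (p - 1) < z2 powr (p - 1)"
    using z1 z2 assms by (intro powr_less_mono2) auto
  hence "l1 < l2" using assms l by simp
  hence "(m - a) * l1 < (m - a) * l2" using m by simp
  moreover have "b powr p - m powr p = (m - a) * l2" using z2(4) m(3) by simp
  ultimately show ?thesis using z1(4) unfolding m_def[symmetric] by linarith
qed

text \<open>Passing to absolute values can only enlarge the midpoint. Strictness survives because
  equal moduli with \<open>a \<noteq> b\<close> mean \<open>b = - a\<close>, where the midpoint is
  0.\<close>

lemma powr_midpoint_strict:
  fixes a b p :: real
  assumes p: "1 < p" and "a \<noteq> b"
  shows "2 * \<bar>(a + b) / 2\<bar> powr p < \<bar>a\<bar> powr p + \<bar>b\<bar> powr p"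
proof (cases "\<bar>a\<bar> = \<bar>b\<bar>")
  case True
  with assms have "b = - a" "a \<noteq> 0" by auto
  thus ?thesis using p by simp
next
  case False
  have "2 * ((\<bar>a\<bar> + \<bar>b\<bar>) / 2) powr p < \<bar>a\<bar> powr p + \<bar>b\<bar> powr p"
  proof (cases "\<bar>a\<bar> < \<bar>b\<bar>")
    case True thus ?thesis using powr_midpoint_strict_nonneg[OF p, of "\<bar>a\<bar>" "\<bar>b\<bar>"] by simp
  next
    case F: False
    hence "\<bar>b\<bar> < \<bar>a\<bar>" using False by simp
    thus ?thesis using powr_midpoint_strict_nonneg[OF p, of "\<bar>b\<bar>" "\<bar>a\<bar>"] by (simp add: add.commute)
  qed
  moreover have "\<bar>(a + b) / 2\<bar> powr p \<le> ((\<bar>a\<bar> + \<bar>b\<bar>) / 2) powr p"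
    using p by (intro powr_mono2) auto
  ultimately show ?thesis by linarith
qed

lemma powr_midpoint_le:
  fixes a b p :: real
  assumes p: "1 < p"
  shows "2 * \<bar>(a + b) / 2\<bar> powr p \<le> \<bar>a\<bar> powr p + \<bar>b\<bar> powr p"
  using powr_midpoint_strict[OF p, of a b] by (cases "a = b") auto

text \<open>Both sides are homogeneous of degree \<open>p\<close>, so it suffices to treat pairs
  with \<open>\<bar>a\<bar> powr p + \<bar>b\<bar> powr p = 1\<close>. Where the entries are close
  the first term suffices. The remaining pairs form a compact set, on which the strict midpoint
  inequality has a positive minimum. Integrated over time this is uniform convexity of L^p, for all
  \<open>1 < p\<close> alike.\<close>

lemma powr_uniform_convexity:
  fixes p :: real
  assumes p: "1 < p" and "0 < e"
  obtains C where "0 \<le> C"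
    "\<And>a b :: real. \<bar>a - b\<bar> powr p \<le> e * (\<bar>a\<bar> powr p + \<bar>b\<bar> powr p)
        + C * (\<bar>a\<bar> powr p + \<bar>b\<bar> powr p - 2 * \<bar>(a + b) / 2\<bar> powr p)"
proof -
  define gap where "gap = (\<lambda>z::real\<times>real. \<bar>fst z\<bar> powr p + \<bar>snd z\<bar> powr p
     - 2 * \<bar>(fst z + snd z) / 2\<bar> powr p)"
  define S where "S = {z::real\<times>real. \<bar>fst z\<bar> powr p + \<bar>snd z\<bar> powr p = 1 \<and>
      e \<le> \<bar>fst z - snd z\<bar> powr p}"
  have contgap: "continuous_on UNIV gap"
    unfolding gap_def using p
    by (intro continuous_on_diff continuous_on_add continuous_on_mult continuous_on_powr' continuous_intros) auto
  have le1: "\<bar>x\<bar> \<le> 1" if "\<bar>x\<bar> powr p \<le> 1" for x :: real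
  proof (rule ccontr)
    assume "\<not> \<bar>x\<bar> \<le> 1"
    hence "1 powr p < \<bar>x\<bar> powr p" using p by (intro powr_less_mono2) auto
    thus False using that by simp
  qed
  have S1: "\<bar>fst z\<bar> \<le> 1 \<and> \<bar>snd z\<bar> \<le> 1" if "z \<in> S" for z
    using that unfolding S_def
    by (auto intro!: le1 simp: ) (smt (verit) powr_ge_zero)+
  have "closed S" unfolding S_def Collect_conj_eq
    by (intro closed_Int closed_Collect_eq closed_Collect_le continuous_on_diff continuous_on_add
        continuous_on_powr' continuous_intros) (use p in auto)
  moreover have "bounded S"
  proof -
    have "S \<subseteq> cbox (-1,-1) (1,1)" using S1 by (force simp: cbox_Pair_eq abs_le_iff)
    thus ?thesis using bounded_cbox bounded_subset by blast
  qed
  ultimately have cS: "compact S" by (simp add: compact_eq_bounded_closed)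
  have "\<exists>c>0. \<forall>z\<in>S. c \<le> gap z"
  proof (cases "S = {}")
    case False
    obtain w where w: "w \<in> S" "\<And>z. z \<in> S \<Longrightarrow> gap w \<le> gap z"
      using continuous_attains_inf[OF cS False, of gap] continuous_on_subset[OF contgap] by blast
    have "fst w \<noteq> snd w" using w(1) \<open>0 < e\<close> p by (auto simp: S_def)
    from powr_midpoint_strict[OF p this] have "0 < gap w" by (simp add: gap_def)
    thus ?thesis using w by blast
  qed (auto intro: exI[of _ 1])
  then obtain c where c: "0 < c" "\<And>z. z \<in> S \<Longrightarrow> c \<le> gap z" by blast
  \<comment> \<open>On the normalized set both entries are at most 1 in modulus, so the left side is
    at most \<open>2 powr p\<close>, while \<open>gap\<close> is at least \<open>c\<close>.\<close>
  define C where "C = 2 powr p / c"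
  have C0: "0 < C" using c by (simp add: C_def)
  have main: "\<bar>a - b\<bar> powr p \<le> e * (\<bar>a\<bar> powr p + \<bar>b\<bar> powr p)
        + C * (\<bar>a\<bar> powr p + \<bar>b\<bar> powr p - 2 * \<bar>(a + b) / 2\<bar> powr p)" for a b :: real
  proof -
    define r where "r = \<bar>a\<bar> powr p + \<bar>b\<bar> powr p"
    have gap0: "0 \<le> \<bar>a\<bar> powr p + \<bar>b\<bar> powr p - 2 * \<bar>(a + b) / 2\<bar> powr p"
      using powr_midpoint_le[OF p, of a b] by simp
    show ?thesis
    proof (cases "a = b")
      case True
      thus ?thesis using C0 gap0 \<open>0 < e\<close> p by auto
    next
      case ne: False
      have "0 < r"
      proof -
        have "0 < \<bar>a\<bar> powr p \<or> 0 < \<bar>b\<bar> powr p" using ne by auto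
        thus ?thesis unfolding r_def by (smt (verit) powr_ge_zero)
      qed
      define k where "k = r powr (1/p)"
      have k: "0 < k" "k powr p = r" using \<open>0 < r\<close> p by (auto simp: k_def powr_powr)
      have sc: "\<bar>x / k\<bar> powr p = \<bar>x\<bar> powr p / r" for x
        using k by (simp add: powr_divide)
      define z where "z = (a / k, b / k)"
      have z1: "\<bar>fst z\<bar> powr p + \<bar>snd z\<bar> powr p = 1"
        using \<open>0 < r\<close> unfolding z_def fst_conv snd_conv sc by (simp add: r_def add_divide_distrib[symmetric])
      have zd: "\<bar>fst z - snd z\<bar> powr p = \<bar>a - b\<bar> powr p / r"
        unfolding z_def fst_conv snd_conv using sc[of "a - b"] by (simp add: diff_divide_distrib)
      have zg: "gap z = (\<bar>a\<bar> powr p + \<bar>b\<bar> powr p - 2 * \<bar>(a + b) / 2\<bar> powr p) / r"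
      proof -
        have "(a / k + b / k) / 2 = ((a + b) / 2) / k" by (simp add: add_divide_distrib)
        thus ?thesis unfolding gap_def z_def fst_conv snd_conv
          by (simp only: sc) (simp only: add_divide_distrib diff_divide_distrib times_divide_eq_right)
      qed
      show ?thesis
      proof (cases "e \<le> \<bar>fst z - snd z\<bar> powr p")
        case True
        hence zS: "z \<in> S" using z1 by (simp add: S_def)
        have "\<bar>fst z - snd z\<bar> powr p \<le> 2 powr p"
          using S1[OF zS] p by (intro powr_mono2) auto
        also have "\<dots> = C * c" using c by (simp add: C_def)
        also have "\<dots> \<le> C * gap z" using c(2)[OF zS] C0 by simp
        finally have "\<bar>a - b\<bar> powr p / r \<le> C * (\<bar>a\<bar> powr p + \<bar>b\<bar> powr p - 2 * \<bar>(a + b) / 2\<bar> powr p) / r"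
          using zd zg by simp
        hence "\<bar>a - b\<bar> powr p \<le> C * (\<bar>a\<bar> powr p + \<bar>b\<bar> powr p - 2 * \<bar>(a + b) / 2\<bar> powr p)"
          using \<open>0 < r\<close> by (simp add: divide_le_cancel)
        moreover have "0 \<le> e * (\<bar>a\<bar> powr p + \<bar>b\<bar> powr p)" using \<open>0 < e\<close> by simp
        ultimately show ?thesis by linarith
      next
        case False
        hence "\<bar>a - b\<bar> powr p \<le> e * r" using zd \<open>0 < r\<close> by (simp add: field_simps)
        moreover have "0 \<le> C * (\<bar>a\<bar> powr p + \<bar>b\<bar> powr p - 2 * \<bar>(a + b) / 2\<bar> powr p)"
          using C0 gap0 by simp
        ultimately show ?thesis unfolding r_def by linarith
      qed
    qed
  qed
  show ?thesis by (rule that[of C]) (use C0 main in auto)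
qed

text \<open>Above the threshold \<open>K\<close> the factor
  \<open>\<bar>x\<bar> powr (1 - p)\<close> is at most \<open>K powr (1 - p)\<close>, which tends to
  0 as \<open>K\<close> grows since \<open>1 < p\<close>. This is the uniform integrability of sets
  bounded in L^p, and it stands in for Hoelder's inequality in the estimates against bounded test
  functions.\<close>

lemma abs_le_powr_split:
  fixes x p K :: real
  assumes "1 < p" "0 < K"
  shows "\<bar>x\<bar> \<le> K + K powr (1 - p) * \<bar>x\<bar> powr p"
proof (cases "\<bar>x\<bar> \<le> K")
  case False
  have "\<bar>x\<bar> = \<bar>x\<bar> powr (1 - p) * \<bar>x\<bar> powr p" using False assms by (simp flip: powr_add)
  also have "\<dots> \<le> K powr (1 - p) * \<bar>x\<bar> powr p"
    using False assms by (intro mult_right_mono powr_mono2') auto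
  finally show ?thesis using assms by linarith
qed (use assms in \<open>auto intro: order_trans\<close>)

lemma powr_add_le:
  fixes x y p :: real
  assumes "1 < p"
  shows "\<bar>x + y\<bar> powr p \<le> 2 powr p * (\<bar>x\<bar> powr p + \<bar>y\<bar> powr p)"
proof -
  have "\<bar>x + y\<bar> powr p \<le> (2 * max \<bar>x\<bar> \<bar>y\<bar>) powr p" using assms by (intro powr_mono2) auto
  also have "\<dots> = 2 powr p * (max \<bar>x\<bar> \<bar>y\<bar>) powr p" by (subst powr_mult) auto
  also have "\<dots> \<le> 2 powr p * (\<bar>x\<bar> powr p + \<bar>y\<bar> powr p)"
    by (intro mult_left_mono) (auto simp: max_def)
  finally show ?thesis .
qed

section \<open>Dyadic averages\<close>

definition dyad :: "nat \<Rightarrow> nat \<Rightarrow> real set" where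
  "dyad n k = {real k / 2 ^ n ..< real (Suc k) / 2 ^ n}"

text \<open>For negative \<open>t\<close> the cut-off by \<open>nat\<close> yields 0, so the value
  is meaningful only for \<open>0 \<le> t\<close>; hence the separate sign test in
  \<open>step\<close> and \<open>mem_dyad\<close>.\<close>

definition cell :: "nat \<Rightarrow> real \<Rightarrow> nat" where
  "cell n t = nat \<lfloor>2 ^ n * t\<rfloor>"

definition cell_integral :: "(real \<Rightarrow> real) \<Rightarrow> nat \<Rightarrow> nat \<Rightarrow> real" where
  "cell_integral f n k = (LINT t|lebesgue. indicator (dyad n k) t * f t)"

text \<open>The coefficients are integrals over the cells and not values: the factor
  \<open>2 ^ n\<close> divides by the cell length. With this normalization
  \<open>cell_integral\<close> is a left inverse of \<open>step\<close>.\<close>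

definition step :: "nat \<Rightarrow> (nat \<Rightarrow> real) \<Rightarrow> real \<Rightarrow> real" where
  "step n c t = (if 0 \<le> t then 2 ^ n * c (cell n t) else 0)"

text \<open>Conditional expectation given the dyadic partition of level \<open>n\<close> of the
  half-line; negative times, where rates vanish, get 0.\<close>

definition avg :: "nat \<Rightarrow> (real \<Rightarrow> real) \<Rightarrow> real \<Rightarrow> real" where
  "avg n f = step n (cell_integral f n)"

lemma mem_dyad: "t \<in> dyad n k \<longleftrightarrow> 0 \<le> t \<and> cell n t = k"
proof -
  have "t \<in> dyad n k \<longleftrightarrow> real k \<le> 2^n * t \<and> 2^n * t < real k + 1"
    by (auto simp: dyad_def field_simps)
  also have "\<dots> \<longleftrightarrow> \<lfloor>2^n * t\<rfloor> = int k" by (auto simp: floor_eq_iff)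
  also have "\<dots> \<longleftrightarrow> 0 \<le> t \<and> cell n t = k"
  proof -
    have "0 \<le> t \<longleftrightarrow> 0 \<le> 2^n * t"
      by (metis mult_le_cancel_left_pos mult_zero_right zero_less_numeral zero_less_power)
    hence "0 \<le> t \<longleftrightarrow> 0 \<le> \<lfloor>2^n * t\<rfloor>" by simp
    thus ?thesis unfolding cell_def by (metis int_nat_eq nat_int of_nat_0_le_iff)
  qed
  finally show ?thesis .
qed

lemma cell_Suc: "0 \<le> t \<Longrightarrow> cell n t = cell (Suc n) t div 2"
proof -
  assume "0 \<le> t"
  define x where "x = 2^Suc n * t"
  have "\<lfloor>x / 2\<rfloor> = \<lfloor>x\<rfloor> div 2" using floor_divide_real_eq_div[of 2 x] by simp
  thus ?thesis unfolding cell_def x_def by (simp add: nat_div_distrib)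
qed

lemma dyad_lebesgue [measurable]: "dyad n k \<in> sets lebesgue"
  and dyad_lmeasurable: "dyad n k \<in> lmeasurable"
  and measure_dyad: "measure lebesgue (dyad n k) = 1 / 2 ^ n"
  by (auto simp: dyad_def divide_simps intro!: fmeasurableI)

lemma dyad_borel [measurable]: "dyad n k \<in> sets borel"
  by (simp add: dyad_def)

lemma dyad_split: "indicator (dyad n k) t =
    (indicator (dyad (Suc n) (2 * k)) t + indicator (dyad (Suc n) (2 * k + 1)) t :: real)"
proof (cases "0 \<le> t")
  case True
  have "cell (Suc n) t div 2 = k \<longleftrightarrow> cell (Suc n) t = 2 * k \<or> cell (Suc n) t = 2 * k + 1" by arith
  thus ?thesis using True by (auto simp: indicator_def mem_dyad cell_Suc[of t n])
qed (auto simp: indicator_def mem_dyad)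

lemma cell_measurable [measurable]: "cell n \<in> borel \<rightarrow>\<^sub>M count_space UNIV"
  unfolding cell_def by measurable

lemma step_borel [measurable]: "step n c \<in> borel_measurable borel"
  unfolding step_def[abs_def] by measurable

lemma borel_measurable_lebesgue [measurable (raw)]:
  "f \<in> borel_measurable borel \<Longrightarrow> f \<in> borel_measurable lebesgue"
  by (rule measurable_completion) simp

lemma avg_measurable [measurable]: "avg n f \<in> borel_measurable borel"
  unfolding avg_def by measurable

text \<open>An integer is an end point of cells at every level, so \<open>[0, N)\<close> is a union
  of whole cells and averaging never mixes values from both sides of \<open>N\<close>. This is why
  the bounded intervals of \<open>Lp_on\<close> and \<open>restr\<close> end at integers.\<close>

lemma cell_less: "0 \<le> t \<Longrightarrow> t < real N \<longleftrightarrow> cell n t < N * 2 ^ n"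
proof -
  assume t: "0 \<le> t"
  have "t < real N \<longleftrightarrow> 2^n * t < real (N * 2^n)" by (simp add: field_simps)
  also have "\<dots> \<longleftrightarrow> \<lfloor>2^n * t\<rfloor> < int (N * 2^n)" by (metis floor_less_iff of_int_of_nat_eq)
  also have "\<dots> \<longleftrightarrow> cell n t < N * 2 ^ n" unfolding cell_def using t by (subst nat_less_iff) auto
  finally show ?thesis .
qed

lemma dyad_subset: "k < N * 2 ^ n \<Longrightarrow> dyad n k \<subseteq> {0..<real N}"
  using cell_less by (auto simp: mem_dyad)

lemma dyad_disjoint: "\<not> k < N * 2 ^ n \<Longrightarrow> dyad n k \<inter> {0..<real N} = {}"
  using cell_less by (auto simp: mem_dyad)

lemma step_eq_sum:
  assumes "\<And>k. N * 2 ^ n \<le> k \<Longrightarrow> c k = 0"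
  shows "step n c t = (\<Sum>k<N * 2 ^ n. 2 ^ n * c k * indicator (dyad n k) t)"
proof (cases "0 \<le> t")
  case True
  have "(\<Sum>k<N * 2 ^ n. 2 ^ n * c k * indicator (dyad n k) t)
     = (\<Sum>k<N * 2 ^ n. if k = cell n t then 2 ^ n * c k else 0)"
    using True by (intro sum.cong) (auto simp: mem_dyad indicator_def)
  also have "\<dots> = step n c t" using True assms by (auto simp: step_def not_less)
  finally show ?thesis by simp
qed (auto simp: step_def mem_dyad indicator_def)

section \<open>The spaces \<open>L\<^sup>p\<close> on bounded intervals\<close>

text \<open>The support condition holds at every point rather than almost everywhere, so that cell
  integrals beyond \<open>N\<close> vanish by rewriting and step functions reduce to finite
  sums.\<close>

definition Lp_on :: "real \<Rightarrow> nat \<Rightarrow> (real \<Rightarrow> real) set" where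
  "Lp_on p N = {f \<in> borel_measurable lebesgue. integrable lebesgue (\<lambda>t. \<bar>f t\<bar> powr p) \<and>
     (\<forall>t. t \<notin> {0..<real N} \<longrightarrow> f t = 0)}"

text \<open>The \<open>p\<close>-th power of the norm. Without the root it is additive over cells
  and fits pointwise inequalities between powers.\<close>

definition modular :: "real \<Rightarrow> (real \<Rightarrow> real) \<Rightarrow> real" where
  "modular p f = (LINT t|lebesgue. \<bar>f t\<bar> powr p)"

lemma modular_nonneg [simp]: "0 \<le> modular p f"
  unfolding modular_def by simp

lemma Lp_onD:
  assumes "f \<in> Lp_on p N"
  shows "f \<in> borel_measurable lebesgue" "integrable lebesgue (\<lambda>t. \<bar>f t\<bar> powr p)"
    "\<And>t. t \<notin> {0..<real N} \<Longrightarrow> f t = 0"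
  using assms by (auto simp: Lp_on_def)

lemma indicator_integrable [simp]:
  "integrable lebesgue (indicator {0..<real N} :: real \<Rightarrow> real)"
  "integrable lebesgue (indicator (dyad n k) :: real \<Rightarrow> real)"
  using dyad_lmeasurable by (auto simp: integrable_indicator_iff fmeasurable_def)

lemma Lp_on_integrable:
  assumes "1 < p" "f \<in> Lp_on p N"
  shows "integrable lebesgue f"
proof (rule Bochner_Integration.integrable_bound)
  show "integrable lebesgue (\<lambda>t. indicator {0..<real N} t + \<bar>f t\<bar> powr p)"
    using Lp_onD[OF assms(2)] by simp
  show "AE t in lebesgue. norm (f t) \<le> norm (indicator {0..<real N} t + \<bar>f t\<bar> powr p)"
    using abs_le_powr_split[OF assms(1), of 1] Lp_onD(3)[OF assms(2)]
    by (intro AE_I2) (auto simp: indicator_def)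
qed (use Lp_onD[OF assms(2)] in auto)

lemma Lp_on_bounded:
  assumes "f \<in> borel_measurable lebesgue" "\<And>t. t \<notin> {0..<real N} \<Longrightarrow> f t = 0"
    "\<And>t. \<bar>f t\<bar> \<le> c" "0 < p"
  shows "f \<in> Lp_on p N"
proof -
  have "integrable lebesgue (\<lambda>t. \<bar>f t\<bar> powr p)"
  proof (rule Bochner_Integration.integrable_bound)
    show "integrable lebesgue (\<lambda>t. c powr p * indicator {0..<real N} t)" by simp
    show "AE t in lebesgue. norm (\<bar>f t\<bar> powr p) \<le> norm (c powr p * indicator {0..<real N} t)"
    proof (intro AE_I2)
      fix t show "norm (\<bar>f t\<bar> powr p) \<le> norm (c powr p * indicator {0..<real N} t)"
        using assms(2)[of t] assms(3)[of t] \<open>0 < p\<close>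
        by (cases "t \<in> {0..<real N}") (auto intro!: powr_mono2)
    qed
  qed (use assms in auto)
  thus ?thesis using assms by (auto simp: Lp_on_def)
qed

lemma Lp_on_add:
  assumes "1 < p" "f \<in> Lp_on p N" "g \<in> Lp_on p N"
  shows "(\<lambda>t. f t + g t) \<in> Lp_on p N"
proof -
  have "integrable lebesgue (\<lambda>t. \<bar>f t + g t\<bar> powr p)"
    by (rule Bochner_Integration.integrable_bound
        [where f="\<lambda>t. 2 powr p * (\<bar>f t\<bar> powr p + \<bar>g t\<bar> powr p)"])
      (use Lp_onD[OF assms(2)] Lp_onD[OF assms(3)] powr_add_le[OF assms(1)] in auto)
  thus ?thesis using assms by (auto simp: Lp_on_def)
qed

lemma Lp_on_scale: "f \<in> Lp_on p N \<Longrightarrow> (\<lambda>t. c * f t) \<in> Lp_on p N"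
  by (auto simp: Lp_on_def abs_mult powr_mult)

lemma Lp_on_diff:
  assumes "1 < p" "f \<in> Lp_on p N" "g \<in> Lp_on p N"
  shows "(\<lambda>t. f t - g t) \<in> Lp_on p N"
  using Lp_on_add[OF assms(1,2) Lp_on_scale[OF assms(3), of "-1"]] by simp

lemma Lp_on_sum:
  assumes "1 < p" "\<And>j. j \<in> J \<Longrightarrow> f j \<in> Lp_on p N"
  shows "(\<lambda>t. \<Sum>j\<in>J. f j t) \<in> Lp_on p N"
  using assms(2)
proof (induction J rule: infinite_finite_induct)
  case (insert x F)
  thus ?case using Lp_on_add[OF assms(1)] by simp
qed (auto simp: Lp_on_def)

lemma modular_scale: "modular p (\<lambda>t. c * f t) = \<bar>c\<bar> powr p * modular p f"
  by (simp add: modular_def abs_mult powr_mult)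

lemma modular_add:
  assumes "1 < p" "f \<in> Lp_on p N" "g \<in> Lp_on p N"
  shows "modular p (\<lambda>t. f t + g t) \<le> 2 powr p * (modular p f + modular p g)"
proof -
  have "modular p (\<lambda>t. f t + g t) \<le> (LINT t|lebesgue. 2 powr p * (\<bar>f t\<bar> powr p + \<bar>g t\<bar> powr p))"
    unfolding modular_def using Lp_onD(2)[OF Lp_on_add[OF assms]] Lp_onD[OF assms(2)] Lp_onD[OF assms(3)]
    by (intro integral_mono powr_add_le assms) auto
  also have "\<dots> = 2 powr p * (modular p f + modular p g)"
    using Lp_onD[OF assms(2)] Lp_onD[OF assms(3)] by (simp add: modular_def)
  finally show ?thesis .
qed

lemma modular_mono:
  assumes "AE t in lebesgue. \<bar>f t\<bar> \<le> \<bar>g t\<bar>" "1 < p" "g \<in> Lp_on p N" "f \<in> borel_measurable lebesgue"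
  shows "modular p f \<le> modular p g"
proof -
  have ae: "AE t in lebesgue. \<bar>f t\<bar> powr p \<le> \<bar>g t\<bar> powr p"
    using assms(1) by eventually_elim (use assms(2) in \<open>auto intro!: powr_mono2\<close>)
  have "integrable lebesgue (\<lambda>t. \<bar>f t\<bar> powr p)"
    by (rule Bochner_Integration.integrable_bound[OF Lp_onD(2)[OF assms(3)]])
      (use assms ae in \<open>auto elim: eventually_mono\<close>)
  thus ?thesis unfolding modular_def using Lp_onD[OF assms(3)] ae by (intro integral_mono_AE) auto
qed

text \<open>Splitting \<open>h\<close> at the height \<open>K\<close> bounds the values below
  \<open>K\<close> by the L^1 norm of \<open>z\<close> and those above by the modular of
  \<open>h\<close>. A large \<open>K\<close> makes the second term small uniformly in
  \<open>h\<close>; after that a small L^1 norm of \<open>z\<close> makes the first one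
  small.\<close>

lemma integral_mult_modular_bound:
  assumes "1 < p" "0 < K" "h \<in> Lp_on p N" "modular p h \<le> B"
    and "0 \<le> c"
    and z: "z \<in> borel_measurable lebesgue" "AE t in lebesgue. \<bar>z t\<bar> \<le> c" "integrable lebesgue z"
  shows "\<bar>LINT t|lebesgue. h t * z t\<bar> \<le> K * (LINT t|lebesgue. \<bar>z t\<bar>) + c * K powr (1 - p) * B"
proof -
  have pw: "AE t in lebesgue. \<bar>h t * z t\<bar> \<le> K * \<bar>z t\<bar> + c * K powr (1 - p) * \<bar>h t\<bar> powr p"
    using z(2)
  proof eventually_elim
    fix t assume zc: "\<bar>z t\<bar> \<le> c"
    have "\<bar>h t * z t\<bar> \<le> (K + K powr (1 - p) * \<bar>h t\<bar> powr p) * \<bar>z t\<bar>"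
      unfolding abs_mult by (intro mult_right_mono abs_le_powr_split assms) auto
    also have "\<dots> = K * \<bar>z t\<bar> + (K powr (1 - p) * \<bar>h t\<bar> powr p) * \<bar>z t\<bar>" by (simp add: distrib_right)
    also have "\<dots> \<le> K * \<bar>z t\<bar> + (K powr (1 - p) * \<bar>h t\<bar> powr p) * c"
      by (intro add_left_mono mult_left_mono zc) auto
    finally show "\<bar>h t * z t\<bar> \<le> K * \<bar>z t\<bar> + c * K powr (1 - p) * \<bar>h t\<bar> powr p" by (simp add: ac_simps)
  qed
  have int: "integrable lebesgue (\<lambda>t. K * \<bar>z t\<bar> + c * K powr (1 - p) * \<bar>h t\<bar> powr p)"
    using Lp_onD[OF assms(3)] z by simp
  have inth: "integrable lebesgue (\<lambda>t. \<bar>h t * z t\<bar>)"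
  proof (rule Bochner_Integration.integrable_bound[OF int])
    show "AE t in lebesgue. norm \<bar>h t * z t\<bar> \<le> norm (K * \<bar>z t\<bar> + c * K powr (1 - p) * \<bar>h t\<bar> powr p)"
      using pw by eventually_elim (metis abs_ge_self abs_idempotent order_trans real_norm_def)
  qed (use Lp_onD[OF assms(3)] z in auto)
  have "\<bar>LINT t|lebesgue. h t * z t\<bar> \<le> (LINT t|lebesgue. \<bar>h t * z t\<bar>)" by (rule integral_abs_bound)
  also have "\<dots> \<le> (LINT t|lebesgue. K * \<bar>z t\<bar> + c * K powr (1 - p) * \<bar>h t\<bar> powr p)"
    by (rule integral_mono_AE[OF inth int]) (use pw in auto)
  also have "\<dots> = K * (LINT t|lebesgue. \<bar>z t\<bar>) + c * K powr (1 - p) * modular p h"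
    using Lp_onD[OF assms(3)] z by (simp add: modular_def)
  also have "\<dots> \<le> K * (LINT t|lebesgue. \<bar>z t\<bar>) + c * K powr (1 - p) * B"
    using assms(4) \<open>0 \<le> c\<close> by (intro add_left_mono mult_left_mono) auto
  finally show ?thesis .
qed

section \<open>Cell integrals and step functions\<close>

lemma Lp_on_cell_integrable:
  "1 < p \<Longrightarrow> f \<in> Lp_on p N \<Longrightarrow> integrable lebesgue (\<lambda>t. indicator (dyad n k) t * f t)"
  using integrable_mult_indicator[OF dyad_lebesgue Lp_on_integrable] by (simp add: real_scaleR_def)

lemma cell_integral_outside:
  assumes "\<And>t. t \<notin> {0..<real N} \<Longrightarrow> f t = 0" "N * 2 ^ n \<le> k"
  shows "cell_integral f n k = 0"
proof -
  have "indicator (dyad n k) t * f t = 0" for t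
    using assms dyad_disjoint[of k N n] by (cases "t \<in> dyad n k") (auto simp: disjoint_iff)
  thus ?thesis unfolding cell_integral_def by (simp only: Bochner_Integration.integral_zero)
qed

lemma cell_integral_add:
  assumes "1 < p" "f \<in> Lp_on p N" "g \<in> Lp_on p N"
  shows "cell_integral (\<lambda>t. f t + g t) n k = cell_integral f n k + cell_integral g n k"
  using Lp_on_cell_integrable[OF assms(1)] assms by (simp add: cell_integral_def distrib_left)

lemma cell_integral_diff:
  assumes "1 < p" "f \<in> Lp_on p N" "g \<in> Lp_on p N"
  shows "cell_integral (\<lambda>t. f t - g t) n k = cell_integral f n k - cell_integral g n k"
  using Lp_on_cell_integrable[OF assms(1)] assms by (simp add: cell_integral_def right_diff_distrib)

lemma cell_integral_scale: "cell_integral (\<lambda>t. c * f t) n k = c * cell_integral f n k"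
proof -
  have "cell_integral (\<lambda>t. c * f t) n k = (LINT t|lebesgue. c * (indicator (dyad n k) t * f t))"
    unfolding cell_integral_def by (rule arg_cong[where f="integral\<^sup>L lebesgue"]) (auto simp: ac_simps)
  thus ?thesis by (simp add: cell_integral_def)
qed

lemma cell_integral_split:
  assumes "1 < p" "f \<in> Lp_on p N"
  shows "cell_integral f n k = cell_integral f (Suc n) (2 * k) + cell_integral f (Suc n) (2 * k + 1)"
proof -
  note [simp] = Lp_on_cell_integrable[OF assms]
  show ?thesis unfolding cell_integral_def dyad_split[of n k] distrib_right
    by (rule Bochner_Integration.integral_add) auto
qed

lemma cell_integral_coarser:
  assumes "1 < p" "f \<in> Lp_on p N" "g \<in> Lp_on p N'"
    and "\<And>k. cell_integral f m k = cell_integral g m k" and "n \<le> m"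
  shows "cell_integral f n k = cell_integral g n k"
  using assms(5)
proof (induction n arbitrary: k rule: inc_induct)
  case (step n)
  show ?case
    unfolding cell_integral_split[OF assms(1,2), of n] cell_integral_split[OF assms(1,3), of n] step.IH ..
qed (use assms(4) in auto)

lemma step_Lp_on:
  assumes "1 < p" "\<And>k. N * 2 ^ n \<le> k \<Longrightarrow> c k = 0"
  shows "step n c \<in> Lp_on p N"
proof -
  have "step n c = (\<lambda>t. \<Sum>k<N * 2 ^ n. 2 ^ n * c k * indicator (dyad n k) t)"
    using step_eq_sum[of N n c] assms(2) by blast
  moreover have "\<dots> \<in> Lp_on p N"
  proof (rule Lp_on_sum[OF assms(1)])
    fix k assume k: "k \<in> {..<N * 2 ^ n}"
    have "(indicator (dyad n k) :: real \<Rightarrow> real) \<in> Lp_on p N"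
      using dyad_subset[of k N n] k assms(1) by (intro Lp_on_bounded[of _ _ 1]) (auto simp: indicator_def)
    thus "(\<lambda>t. 2 ^ n * c k * indicator (dyad n k) t) \<in> Lp_on p N" by (rule Lp_on_scale)
  qed
  ultimately show ?thesis by simp
qed

lemma indicator_dyad_times_step: "indicator (dyad n k) t * step n c t = 2 ^ n * c k * indicator (dyad n k) t"
  by (auto simp: indicator_def mem_dyad step_def)

lemma cell_integral_step [simp]: "cell_integral (step n c) n k = c k"
  unfolding cell_integral_def indicator_dyad_times_step by (simp add: measure_dyad)

lemma modular_step:
  assumes "1 < p" "\<And>k. N * 2 ^ n \<le> k \<Longrightarrow> c k = 0"
  shows "modular p (step n c) = (\<Sum>k<N * 2 ^ n. \<bar>2 ^ n * c k\<bar> powr p / 2 ^ n)"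
proof -
  have "\<bar>step n c t\<bar> powr p = step n (\<lambda>k. \<bar>2 ^ n * c k\<bar> powr p / 2 ^ n) t" for t
    using assms(1) by (simp add: step_def)
  also have "\<dots> t = (\<Sum>k<N * 2 ^ n. 2 ^ n * (\<bar>2 ^ n * c k\<bar> powr p / 2 ^ n) * indicator (dyad n k) t)" for t
    using assms by (intro step_eq_sum) auto
  finally have "modular p (step n c) = (LINT t|lebesgue. (\<Sum>k<N * 2 ^ n. \<bar>2 ^ n * c k\<bar> powr p * indicator (dyad n k) t))"
    unfolding modular_def by simp
  also have "\<dots> = (\<Sum>k<N * 2 ^ n. LINT t|lebesgue. \<bar>2 ^ n * c k\<bar> powr p * indicator (dyad n k) t)"
    by (rule Bochner_Integration.integral_sum) simp
  finally show ?thesis by (simp add: measure_dyad)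
qed

text \<open>A step function sees another function only through finitely many cell integrals.
  Convergence of all cell integrals therefore suffices for convergence against step
  functions.\<close>

lemma integral_times_step:
  assumes "1 < p" "f \<in> Lp_on p N" "\<And>k. N * 2 ^ n \<le> k \<Longrightarrow> c k = 0"
  shows "(LINT t|lebesgue. f t * step n c t) = (\<Sum>k<N * 2 ^ n. 2 ^ n * c k * cell_integral f n k)"
proof -
  have "(LINT t|lebesgue. f t * step n c t)
      = (LINT t|lebesgue. (\<Sum>k<N * 2 ^ n. 2 ^ n * c k * (indicator (dyad n k) t * f t)))"
  proof (intro Bochner_Integration.integral_cong refl)
    fix t
    have "step n c t = (\<Sum>k<N * 2 ^ n. 2 ^ n * c k * indicator (dyad n k) t)"
      by (rule step_eq_sum) (use assms(3) in simp)
    thus "f t * step n c t = (\<Sum>k<N * 2 ^ n. 2 ^ n * c k * (indicator (dyad n k) t * f t))"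
      by (simp only: sum_distrib_left ac_simps)
  qed
  also have "\<dots> = (\<Sum>k<N * 2 ^ n. LINT t|lebesgue. 2 ^ n * c k * (indicator (dyad n k) t * f t))"
    by (intro Bochner_Integration.integral_sum integrable_mult_right Lp_on_cell_integrable[OF assms(1,2)])
  finally show ?thesis by (simp add: cell_integral_def)
qed

section \<open>Averaging as conditional expectation\<close>

lemma avg_Lp_on:
  assumes "1 < p" "f \<in> Lp_on p N"
  shows "avg n f \<in> Lp_on p N"
  unfolding avg_def using cell_integral_outside[OF Lp_onD(3)[OF assms(2)]]
  by (intro step_Lp_on assms) auto

lemma cell_integral_avg: "cell_integral (avg n f) n k = cell_integral f n k"
  by (simp add: avg_def)

lemma cell_integral_avg_coarser:
  assumes "1 < p" "f \<in> Lp_on p N" "n \<le> m"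
  shows "cell_integral (avg m f) n k = cell_integral f n k"
  by (rule cell_integral_coarser[OF assms(1) avg_Lp_on[OF assms(1,2)] assms(2) cell_integral_avg assms(3)])

text \<open>Tower property of conditional expectations: averaging over finer cells leaves the
  integrals over coarser ones unchanged.\<close>

lemma avg_avg:
  assumes "1 < p" "f \<in> Lp_on p N" "n \<le> m"
  shows "avg n (avg m f) = avg n f"
  using cell_integral_avg_coarser[OF assms] by (simp add: avg_def cong: step_def) (metis ext)

text \<open>Averaging is self-adjoint: both sides equal the sum over the cells of the product of the
  two cell integrals, divided by the cell length.\<close>

lemma integral_avg_swap:
  assumes "1 < p" "f \<in> Lp_on p N" "g \<in> Lp_on p N"
  shows "(LINT t|lebesgue. avg n f t * g t) = (LINT t|lebesgue. f t * avg n g t)"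
  using integral_times_step[OF assms(1,2), of n "cell_integral g n"]
    integral_times_step[OF assms(1,3), of n "cell_integral f n"]
    cell_integral_outside[OF Lp_onD(3)[OF assms(2)]] cell_integral_outside[OF Lp_onD(3)[OF assms(3)]]
  by (simp add: avg_def ac_simps)

text \<open>Jensen's inequality on one cell. With \<open>a\<close> the modulus of the average,
  Young's inequality for \<open>\<bar>f t\<bar>\<close> and \<open>a powr (p - 1)\<close> is
  integrated over the cell; the conjugate exponent turns the second term into a multiple of
  \<open>a powr p\<close>, which is then absorbed on the left.\<close>

lemma cell_integral_powr_le:
  assumes p: "1 < p" and f: "f \<in> Lp_on p N"
  shows "\<bar>2 ^ n * cell_integral f n k\<bar> powr p / 2 ^ n \<le> (LINT t|lebesgue. indicator (dyad n k) t * \<bar>f t\<bar> powr p)"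
proof -
  define a where "a = \<bar>2 ^ n * cell_integral f n k\<bar>"
  define q where "q = p / (p - 1)"
  have q: "1 < q" "1 / p + 1 / q = 1" "(p - 1) * q = p" using p by (auto simp: q_def field_simps)
  have intp: "integrable lebesgue (\<lambda>t. indicator (dyad n k) t * \<bar>f t\<bar> powr p)"
    using integrable_mult_indicator[OF dyad_lebesgue Lp_onD(2)[OF f]] by simp
  have inta: "integrable lebesgue (\<lambda>t. indicator (dyad n k) t * \<bar>f t\<bar>)"
    using integrable_mult_indicator[OF dyad_lebesgue, of "\<lambda>t. \<bar>f t\<bar>"] Lp_on_integrable[OF p f] by simp
  have "\<bar>f t\<bar> * a powr (p - 1) \<le> \<bar>f t\<bar> powr p / p + a powr p / q" for t
    using Youngs_inequality[OF p q(1,2), of "\<bar>f t\<bar>" "a powr (p - 1)"] by (simp add: powr_powr q)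
  hence "(LINT t|lebesgue. indicator (dyad n k) t * (\<bar>f t\<bar> * a powr (p - 1)))
     \<le> (LINT t|lebesgue. indicator (dyad n k) t * (\<bar>f t\<bar> powr p / p + a powr p / q))"
  proof (intro integral_mono)
    show "integrable lebesgue (\<lambda>t. indicator (dyad n k) t * (\<bar>f t\<bar> * a powr (p - 1)))"
      using integrable_mult_left[OF inta, of "a powr (p - 1)"] by (simp only: mult.assoc)
    show "integrable lebesgue (\<lambda>t. indicator (dyad n k) t * (\<bar>f t\<bar> powr p / p + a powr p / q))"
      using intp by (simp add: distrib_left)
  qed (auto intro!: mult_left_mono)
  also have "\<dots> = (LINT t|lebesgue. indicator (dyad n k) t * \<bar>f t\<bar> powr p) / p + a powr p / q / 2 ^ n"
    using intp by (simp add: distrib_left measure_dyad)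
  also have "(LINT t|lebesgue. indicator (dyad n k) t * (\<bar>f t\<bar> * a powr (p - 1)))
      = (LINT t|lebesgue. indicator (dyad n k) t * \<bar>f t\<bar>) * a powr (p - 1)"
    by (simp flip: mult.assoc)
  finally have 1: "(LINT t|lebesgue. indicator (dyad n k) t * \<bar>f t\<bar>) * a powr (p - 1)
     \<le> (LINT t|lebesgue. indicator (dyad n k) t * \<bar>f t\<bar> powr p) / p + a powr p / q / 2 ^ n" .
  have "\<bar>cell_integral f n k\<bar> \<le> (LINT t|lebesgue. indicator (dyad n k) t * \<bar>f t\<bar>)"
    unfolding cell_integral_def by (rule order_trans[OF integral_abs_bound]) (simp add: abs_mult)
  hence "a / 2 ^ n * a powr (p - 1) \<le> (LINT t|lebesgue. indicator (dyad n k) t * \<bar>f t\<bar>) * a powr (p - 1)"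
    by (intro mult_right_mono) (auto simp: a_def abs_mult)
  moreover have "a / 2 ^ n * a powr (p - 1) = a powr p / 2 ^ n"
  proof (cases "a = 0")
    case False
    hence "0 < a" by (auto simp: a_def)
    thus ?thesis using powr_add[of a 1 "p - 1"] by simp
  qed (use p in auto)
  ultimately have "a powr p / 2 ^ n \<le> (LINT t|lebesgue. indicator (dyad n k) t * \<bar>f t\<bar> powr p) / p + a powr p / 2 ^ n / q"
    using 1 by (simp add: mult.commute)
  moreover have "1 / q = 1 - 1 / p" using q by simp
  hence "a powr p / 2 ^ n / q = a powr p / 2 ^ n - a powr p / 2 ^ n / p"
    by (metis (no_types, lifting) mult.right_neutral right_diff_distrib times_divide_eq_right)
  ultimately have "a powr p / 2 ^ n / p \<le> (LINT t|lebesgue. indicator (dyad n k) t * \<bar>f t\<bar> powr p) / p"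
    by linarith
  hence "a powr p / 2 ^ n \<le> (LINT t|lebesgue. indicator (dyad n k) t * \<bar>f t\<bar> powr p)"
    using p by (simp only: divide_le_cancel)
  thus ?thesis by (simp only: a_def)
qed

text \<open>Jensen's inequality summed over the cells that make up \<open>[0, N)\<close>.\<close>

lemma modular_avg_le:
  assumes p: "1 < p" and f: "f \<in> Lp_on p N"
  shows "modular p (avg n f) \<le> modular p f"
proof -
  have "modular p (avg n f) = (\<Sum>k<N * 2 ^ n. \<bar>2 ^ n * cell_integral f n k\<bar> powr p / 2 ^ n)"
    unfolding avg_def using cell_integral_outside[OF Lp_onD(3)[OF f]] by (intro modular_step p) auto
  also have "\<dots> \<le> (\<Sum>k<N * 2 ^ n. LINT t|lebesgue. indicator (dyad n k) t * \<bar>f t\<bar> powr p)"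
    by (intro sum_mono cell_integral_powr_le[OF p f])
  also have "\<dots> = (LINT t|lebesgue. (\<Sum>k<N * 2 ^ n. indicator (dyad n k) t * \<bar>f t\<bar> powr p))"
    using integrable_mult_indicator[OF dyad_lebesgue Lp_onD(2)[OF f]]
    by (intro Bochner_Integration.integral_sum[symmetric]) simp
  also have "\<dots> = modular p f" unfolding modular_def
  proof (rule arg_cong[where f="integral\<^sup>L lebesgue"], rule ext)
    fix t
    \<comment> \<open>The coefficients \<open>1 / 2 ^ n\<close> cancel the normalization of
      \<open>step\<close>, so that \<open>step n c\<close> is the indicator of
      \<open>[0, N)\<close>, written as the sum of the indicators of its cells.\<close>
    define c :: "nat \<Rightarrow> real" where "c k = (if k < N * 2 ^ n then 1 / 2 ^ n else 0)" for k
    have "step n c t = (\<Sum>k<N * 2 ^ n. 2 ^ n * c k * indicator (dyad n k) t)"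
      by (rule step_eq_sum) (simp add: c_def)
    also have "\<dots> = (\<Sum>k<N * 2 ^ n. indicator (dyad n k) t)" by (intro sum.cong) (auto simp: c_def)
    finally have "(\<Sum>k<N * 2 ^ n. indicator (dyad n k) t * \<bar>f t\<bar> powr p) = step n c t * \<bar>f t\<bar> powr p"
      by (simp only: sum_distrib_right)
    also have "\<dots> = \<bar>f t\<bar> powr p"
      using Lp_onD(3)[OF f, of t] p cell_less[of t N n] by (auto simp: step_def c_def)
    finally show "(\<Sum>k<N * 2 ^ n. indicator (dyad n k) t * \<bar>f t\<bar> powr p) = \<bar>f t\<bar> powr p" .
  qed
  finally show ?thesis .
qed

text \<open>Averaging over the coarser partition maps the midpoint of two members of a martingale to the
  earlier one, so its modular is not smaller; uniform convexity does the rest.\<close>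

lemma bounded_martingale_Cauchy:
  assumes p: "1 < p" and s: "\<And>m. s m \<in> Lp_on p N" "\<And>n m. n \<le> m \<Longrightarrow> avg n (s m) = s n"
    and B: "\<And>m. modular p (s m) \<le> B" and "0 < e"
  shows "\<exists>M. \<forall>m\<ge>M. \<forall>n\<ge>m. modular p (\<lambda>t. s n t - s m t) \<le> e"
proof -
  have B0: "0 \<le> B" using B[of 0] modular_nonneg order_trans by blast
  \<comment> \<open>Both summands of the convexity bound get \<open>e / 2\<close>: the two modulars
    add up to at most \<open>2 * B\<close>, and two late modulars differ by less than
    \<open>e / (2 * (C + 1))\<close>. Adding 1 to \<open>B\<close> and to \<open>C\<close> keeps the
    denominators positive.\<close>
  define e' where "e' = e / (4 * (B + 1))"
  have "0 < e'" using B0 \<open>0 < e\<close> by (simp add: e'_def)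
  then obtain C where C: "0 \<le> C" "\<And>a b :: real. \<bar>a - b\<bar> powr p \<le> e' * (\<bar>a\<bar> powr p + \<bar>b\<bar> powr p)
        + C * (\<bar>a\<bar> powr p + \<bar>b\<bar> powr p - 2 * \<bar>(a + b) / 2\<bar> powr p)"
    using powr_uniform_convexity[OF p] by metis
  have mono: "modular p (s m) \<le> modular p (s n)" if "m \<le> n" for m n
    using modular_avg_le[OF p s(1)[of n], of m] s(2)[OF that] by simp
  hence "convergent (\<lambda>m. modular p (s m))"
    using B by (intro Bseq_mono_convergent BseqI'[of _ B]) (auto intro: monoI)
  hence "Cauchy (\<lambda>m. modular p (s m))" by (simp add: Cauchy_convergent_iff)
  moreover have "0 < e / (2 * (C + 1))" using C \<open>0 < e\<close> by simp
  ultimately obtain M where M: "\<And>m n. M \<le> m \<Longrightarrow> M \<le> n \<Longrightarrow>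
      dist (modular p (s m)) (modular p (s n)) < e / (2 * (C + 1))"
    unfolding Cauchy_def by blast
  show ?thesis
  proof (intro exI[of _ M] allI impI)
    fix m n assume mn: "M \<le> m" "m \<le> n"
    define h where "h = (\<lambda>t. (s n t + s m t) / 2)"
    have sum: "(\<lambda>t. s n t + s m t) \<in> Lp_on p N" by (intro Lp_on_add p s)
    hence h: "h \<in> Lp_on p N" using Lp_on_scale[OF sum, of "1/2"] by (simp add: h_def)
    have "cell_integral h m k = cell_integral (s m) m k" for k
    proof -
      have "cell_integral (s n) m k = cell_integral (s m) m k"
        using s(2)[OF mn(2)] cell_integral_avg[of m "s n" k] by simp
      thus ?thesis using cell_integral_scale[of "1/2" "\<lambda>t. s n t + s m t" m k] cell_integral_add[OF p s(1) s(1)]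
        by (simp add: h_def)
    qed
    hence "avg m h = avg m (s m)" by (simp add: avg_def) (metis ext)
    hence "avg m h = s m" using s(2) by simp
    hence hm: "modular p (s m) \<le> modular p h" using modular_avg_le[OF p h, of m] by simp
    note I = Lp_onD(2)[OF s(1)] Lp_onD(2)[OF h]
    have "modular p (\<lambda>t. s n t - s m t) \<le> (LINT t|lebesgue. e' * (\<bar>s n t\<bar> powr p + \<bar>s m t\<bar> powr p)
        + C * (\<bar>s n t\<bar> powr p + \<bar>s m t\<bar> powr p - 2 * \<bar>h t\<bar> powr p))"
      unfolding modular_def h_def
      by (rule integral_mono) (use I Lp_onD(2)[OF Lp_on_diff[OF p s(1) s(1)]] C(2) in \<open>auto simp: h_def\<close>)
    also have "\<dots> = e' * (modular p (s n) + modular p (s m))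
        + C * (modular p (s n) + modular p (s m) - 2 * modular p h)"
      using I by (simp add: modular_def)
    also have "\<dots> \<le> e' * (2 * B) + C * (modular p (s n) - modular p (s m))"
    proof (intro add_mono mult_left_mono)
      show "modular p (s n) + modular p (s m) \<le> 2 * B" using B[of n] B[of m] by linarith
      show "modular p (s n) + modular p (s m) - 2 * modular p h \<le> modular p (s n) - modular p (s m)"
        using hm by linarith
    qed (use C \<open>0 < e'\<close> in auto)
    also have "\<dots> \<le> e / 2 + e / 2"
    proof (intro add_mono)
      show "e' * (2 * B) \<le> e / 2" using B0 \<open>0 < e\<close> by (simp add: e'_def field_simps)
      have "modular p (s n) - modular p (s m) \<le> e / (2 * (C + 1))"
        using M[of m n] mn by (simp add: dist_real_def)
      hence "C * (modular p (s n) - modular p (s m)) \<le> (C + 1) * (e / (2 * (C + 1)))"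
        using mono[OF mn(2)] C by (intro mult_mono) auto
      also have "\<dots> = e / 2" using C by (simp add: field_simps)
      finally show "C * (modular p (s n) - modular p (s m)) \<le> e / 2" .
    qed
    finally show "modular p (\<lambda>t. s n t - s m t) \<le> e" by simp
  qed
qed

text \<open>On an interval of finite length the part of \<open>h m\<close> below a height
  \<open>K\<close> has integral at most \<open>K * N\<close>. This height is fixed first, small
  enough for \<open>e\<close>, and the modular then disposes of the larger values.\<close>

lemma modular_tendsto_0_imp_L1:
  assumes p: "1 < p" and h: "\<And>m. h m \<in> Lp_on p N" and "(\<lambda>m. modular p (h m)) \<longlonglongrightarrow> 0"
  shows "(\<lambda>m. LINT t|lebesgue. \<bar>h m t\<bar>) \<longlonglongrightarrow> 0"
proof (rule LIMSEQ_I)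
  fix e :: real assume "0 < e"
  define K where "K = e / (2 * (real N + 1))"
  have K: "0 < K" using \<open>0 < e\<close> by (simp add: K_def)
  have bd: "(LINT t|lebesgue. \<bar>h m t\<bar>) \<le> K * real N + K powr (1 - p) * modular p (h m)" for m
  proof -
    have "(LINT t|lebesgue. \<bar>h m t\<bar>)
       \<le> (LINT t|lebesgue. K * indicator {0..<real N} t + K powr (1 - p) * \<bar>h m t\<bar> powr p)"
    proof (rule integral_mono)
      show "integrable lebesgue (\<lambda>t. \<bar>h m t\<bar>)" using Lp_on_integrable[OF p h] by simp
      show "integrable lebesgue (\<lambda>t. K * indicator {0..<real N} t + K powr (1 - p) * \<bar>h m t\<bar> powr p)"
        using Lp_onD(2)[OF h] by simp
      show "\<bar>h m t\<bar> \<le> K * indicator {0..<real N} t + K powr (1 - p) * \<bar>h m t\<bar> powr p" for t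
        using abs_le_powr_split[OF p K, of "h m t"] Lp_onD(3)[OF h, of t m] by (cases "t \<in> {0..<real N}") auto
    qed
    also have "\<dots> = K * real N + K powr (1 - p) * modular p (h m)"
      using Lp_onD(2)[OF h] by (simp add: modular_def)
    finally show ?thesis .
  qed
  have "0 < e / 2 / K powr (1 - p)" using \<open>0 < e\<close> K by simp
  then obtain M where M: "\<And>m. M \<le> m \<Longrightarrow> modular p (h m) < e / 2 / K powr (1 - p)"
    using LIMSEQ_D[OF assms(3), of "e / 2 / K powr (1 - p)"] by auto
  have "\<bar>LINT t|lebesgue. \<bar>h m t\<bar>\<bar> < e" if "M \<le> m" for m
  proof -
    have "K powr (1 - p) * modular p (h m) < e / 2"
      using M[OF that] K by (simp add: pos_less_divide_eq mult.commute)
    moreover have "K * real N \<le> e / 2" using \<open>0 < e\<close> by (simp add: K_def field_simps)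
    ultimately have "(LINT t|lebesgue. \<bar>h m t\<bar>) < e" using bd[of m] by linarith
    thus ?thesis by simp
  qed
  thus "\<exists>M. \<forall>m\<ge>M. norm ((LINT t|lebesgue. \<bar>h m t\<bar>) - 0) < e" by auto
qed

section \<open>Completeness on bounded intervals\<close>

lemma AE_convergent_if_summable_increments:
  fixes g :: "nat \<Rightarrow> 'a \<Rightarrow> real"
  assumes "\<And>k. integrable M (g k)" "summable (\<lambda>k. LINT t|M. \<bar>g (Suc k) t - g k t\<bar>)"
  shows "AE t in M. convergent (\<lambda>k. g k t)"
proof -
  have "AE t in M. summable (\<lambda>k. norm (g (Suc k) t - g k t))"
  proof -
    have nn: "(\<integral>\<^sup>+t. (\<Sum>k. ennreal \<bar>g (Suc k) t - g k t\<bar>) \<partial>M) = (\<Sum>k. ennreal (LINT t|M. \<bar>g (Suc k) t - g k t\<bar>))"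
      using assms(1) by (subst nn_integral_suminf) (auto simp: nn_integral_eq_integral)
    also have "\<dots> < \<infinity>" using assms(2) by (simp add: suminf_ennreal2 less_top[symmetric])
    finally have "AE t in M. (\<Sum>k. ennreal \<bar>g (Suc k) t - g k t\<bar>) \<noteq> \<infinity>"
      using assms(1) by (intro nn_integral_PInf_AE) auto
    thus ?thesis
    proof eventually_elim
      fix t assume "(\<Sum>k. ennreal \<bar>g (Suc k) t - g k t\<bar>) \<noteq> \<infinity>"
      hence "summable (\<lambda>k. \<bar>g (Suc k) t - g k t\<bar>)"
        by (intro summable_suminf_not_top) (simp_all only: abs_ge_zero infinity_ennreal_def not_False_eq_True)
      thus "summable (\<lambda>k. norm (g (Suc k) t - g k t))" by simp
    qed
  qed
  thus ?thesis
  proof eventually_elim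
    fix t assume "summable (\<lambda>k. norm (g (Suc k) t - g k t))"
    hence "summable (\<lambda>k. g (Suc k) t - g k t)" by (rule summable_norm_cancel)
    hence "convergent (\<lambda>n. \<Sum>k<n. g (Suc k) t - g k t)" by (simp add: summable_iff_convergent)
    hence "convergent (\<lambda>n. g n t - g 0 t)" unfolding sum_lessThan_telescope[of "\<lambda>k. g k t"] .
    hence "convergent (\<lambda>n. (g n t - g 0 t) + g 0 t)" by (intro convergent_add convergent_const)
    thus "convergent (\<lambda>k. g k t)" by simp
  qed
qed

text \<open>The argument of Riesz and Fischer: a subsequence whose L^1 increments are geometrically
  small converges almost everywhere, and Fatou's lemma carries the Cauchy bound over to its
  limit.\<close>

lemma Lp_on_complete:
  assumes p: "1 < p" and s: "\<And>m. s m \<in> Lp_on p N"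
    and C: "\<And>e. 0 < e \<Longrightarrow> \<exists>M. \<forall>m\<ge>M. \<forall>n\<ge>m. modular p (\<lambda>t. s n t - s m t) \<le> e"
  obtains f where "f \<in> Lp_on p N" "(\<lambda>m. modular p (\<lambda>t. s m t - f t)) \<longlonglongrightarrow> 0"
proof -
  have "\<exists>M. \<forall>m\<ge>M. \<forall>n\<ge>m. (LINT t|lebesgue. \<bar>s n t - s m t\<bar>) \<le> (1/2) ^ k" for k
  proof (rule ccontr)
    assume "\<not> ?thesis"
    then obtain m n where mn: "\<And>M. M \<le> m M" "\<And>M. m M \<le> n M"
        "\<And>M. \<not> (LINT t|lebesgue. \<bar>s (n M) t - s (m M) t\<bar>) \<le> (1/2) ^ k"
      by metis
    have "(\<lambda>M. modular p (\<lambda>t. s (n M) t - s (m M) t)) \<longlonglongrightarrow> 0"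
    proof (rule LIMSEQ_I)
      fix e :: real assume "0 < e"
      then obtain M0 where "\<forall>m\<ge>M0. \<forall>n\<ge>m. modular p (\<lambda>t. s n t - s m t) \<le> e / 2"
        using C[of "e/2"] by auto
      hence "\<forall>M\<ge>M0. modular p (\<lambda>t. s (n M) t - s (m M) t) < e"
      proof (intro allI impI)
        fix M assume "M0 \<le> M"
        hence "M0 \<le> m M" using mn(1)[of M] by linarith
        hence "modular p (\<lambda>t. s (n M) t - s (m M) t) \<le> e / 2"
          using \<open>\<forall>m\<ge>M0. _ m\<close> mn(2)[of M] by blast
        thus "modular p (\<lambda>t. s (n M) t - s (m M) t) < e" using \<open>0 < e\<close> by linarith
      qed
      thus "\<exists>M0. \<forall>M\<ge>M0. norm (modular p (\<lambda>t. s (n M) t - s (m M) t) - 0) < e" by auto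
    qed
    from modular_tendsto_0_imp_L1[OF p Lp_on_diff[OF p s s] this]
    have "(\<lambda>M. LINT t|lebesgue. \<bar>s (n M) t - s (m M) t\<bar>) \<longlonglongrightarrow> 0" .
    from LIMSEQ_D[OF this, of "(1/2)^k"] obtain M where "(LINT t|lebesgue. \<bar>s (n M) t - s (m M) t\<bar>) < (1/2) ^ k"
      by auto
    thus False using mn(3)[of M] by simp
  qed
  then obtain r0 where r0: "\<And>k m n. r0 k \<le> m \<Longrightarrow> m \<le> n \<Longrightarrow> (LINT t|lebesgue. \<bar>s n t - s m t\<bar>) \<le> (1/2) ^ k"
    by metis
  \<comment> \<open>The running maximum makes \<open>r\<close> nondecreasing while keeping
    \<open>r0 k \<le> r k\<close>, so consecutive members of the subsequence are within
    \<open>(1/2) ^ k\<close> in L^1. The summand \<open>k\<close> makes \<open>r\<close> tend to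
    infinity.\<close>
  define r where "r k = k + Max (r0 ` {..k})" for k
  have r: "r0 k \<le> r k" "r k \<le> r (Suc k)" "k \<le> r k" for k
  proof -
    have "r0 k \<le> Max (r0 ` {..k})" by (intro Max_ge) auto
    thus "r0 k \<le> r k" unfolding r_def by linarith
    have "Max (r0 ` {..k}) \<le> Max (r0 ` {..Suc k})" by (intro Max_mono) auto
    thus "r k \<le> r (Suc k)" "k \<le> r k" unfolding r_def by linarith+
  qed
  have int: "integrable lebesgue (s m)" for m using Lp_on_integrable[OF p s] .
  have "summable (\<lambda>k. LINT t|lebesgue. \<bar>s (r (Suc k)) t - s (r k) t\<bar>)"
    by (rule summable_comparison_test'[of "\<lambda>k. (1/2)^k :: real" 0]) (use r0 r in \<open>auto intro: summable_geometric\<close>)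
  hence conv: "AE t in lebesgue. convergent (\<lambda>k. s (r k) t)"
    by (intro AE_convergent_if_summable_increments int)
  define f where "f = (\<lambda>t. lim (\<lambda>k. s (r k) t))"
  have fm: "f \<in> borel_measurable lebesgue"
    unfolding f_def by (intro borel_measurable_lim_metric Lp_onD(1)[OF s])
  note [measurable] = fm Lp_onD(1)[OF s]
  have f0: "f t = 0" if "t \<notin> {0..<real N}" for t
    using Lp_onD(3)[OF s that] by (simp add: f_def)
  have lim: "AE t in lebesgue. (\<lambda>k. s (r k) t) \<longlonglongrightarrow> f t"
    using conv by eventually_elim (simp add: f_def convergent_LIMSEQ_iff)
  have Fatou: "(\<integral>\<^sup>+t. ennreal (\<bar>s m t - f t\<bar> powr p) \<partial>lebesgue) \<le> ennreal e"
    if "\<forall>n\<ge>m. modular p (\<lambda>t. s n t - s m t) \<le> e" for m e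
  proof -
    have "AE t in lebesgue. ennreal (\<bar>s m t - f t\<bar> powr p) = liminf (\<lambda>k. ennreal (\<bar>s (r k) t - s m t\<bar> powr p))"
      using lim
    proof eventually_elim
      fix t assume "(\<lambda>k. s (r k) t) \<longlonglongrightarrow> f t"
      hence "(\<lambda>k. \<bar>s (r k) t - s m t\<bar> powr p) \<longlonglongrightarrow> \<bar>f t - s m t\<bar> powr p"
        using p by (intro tendsto_powr' tendsto_intros) auto
      hence "(\<lambda>k. ennreal (\<bar>s (r k) t - s m t\<bar> powr p)) \<longlonglongrightarrow> ennreal (\<bar>s m t - f t\<bar> powr p)"
        by (intro tendsto_ennrealI) (simp add: abs_minus_commute)
      thus "ennreal (\<bar>s m t - f t\<bar> powr p) = liminf (\<lambda>k. ennreal (\<bar>s (r k) t - s m t\<bar> powr p))"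
        by (intro lim_imp_Liminf[symmetric]) auto
    qed
    hence "(\<integral>\<^sup>+t. ennreal (\<bar>s m t - f t\<bar> powr p) \<partial>lebesgue)
        = (\<integral>\<^sup>+t. liminf (\<lambda>k. ennreal (\<bar>s (r k) t - s m t\<bar> powr p)) \<partial>lebesgue)"
      by (rule nn_integral_cong_AE)
    also have "\<dots> \<le> liminf (\<lambda>k. \<integral>\<^sup>+t. ennreal (\<bar>s (r k) t - s m t\<bar> powr p) \<partial>lebesgue)"
      by (intro nn_integral_liminf) measurable
    also have "\<dots> = liminf (\<lambda>k. ennreal (modular p (\<lambda>t. s (r k) t - s m t)))"
      unfolding modular_def using Lp_onD(2)[OF Lp_on_diff[OF p s s]]
      by (subst nn_integral_eq_integral) auto
    also have "\<dots> \<le> ennreal e"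
    proof (rule Liminf_le)
      show "\<forall>\<^sub>F k in sequentially. ennreal (modular p (\<lambda>t. s (r k) t - s m t)) \<le> ennreal e"
        using eventually_ge_at_top[of m]
      proof eventually_elim
        fix k assume "m \<le> k"
        hence "m \<le> r k" using r(3)[of k] by linarith
        thus "ennreal (modular p (\<lambda>t. s (r k) t - s m t)) \<le> ennreal e" using that by (intro ennreal_leI) blast
      qed
    qed simp
    finally show ?thesis .
  qed
  have diff: "(\<lambda>t. s m t - f t) \<in> Lp_on p N \<and> modular p (\<lambda>t. s m t - f t) \<le> e"
    if "0 < e" "\<forall>n\<ge>m. modular p (\<lambda>t. s n t - s m t) \<le> e" for m e
  proof -
    have i: "integrable lebesgue (\<lambda>t. \<bar>s m t - f t\<bar> powr p)"
    proof (rule integrableI_bounded)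
      show "(\<integral>\<^sup>+t. ennreal (norm (\<bar>s m t - f t\<bar> powr p)) \<partial>lebesgue) < \<infinity>"
        using Fatou[OF that(2)] by (simp add: le_less_trans)
    qed measurable
    hence "ennreal (modular p (\<lambda>t. s m t - f t)) \<le> ennreal e"
      using Fatou[OF that(2)] unfolding modular_def by (subst (asm) nn_integral_eq_integral) auto
    thus ?thesis using i fm Lp_onD[OF s] f0 that(1) by (auto simp: Lp_on_def)
  qed
  obtain M1 where M1: "\<forall>m\<ge>M1. \<forall>n\<ge>m. modular p (\<lambda>t. s n t - s m t) \<le> 1" using C[of 1] by auto
  \<comment> \<open>Fatou's lemma bounds only differences to the limit, so integrability of
    \<open>f\<close> itself comes from one member of the sequence at finite distance.\<close>
  have "(\<lambda>t. s M1 t - (s M1 t - f t)) \<in> Lp_on p N"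
    by (intro Lp_on_diff p s conjunct1[OF diff[of 1 M1]]) (use M1 in auto)
  moreover have "s M1 t - (s M1 t - f t) = f t" for t by linarith
  ultimately have "f \<in> Lp_on p N" by (simp only:)
  moreover have "(\<lambda>m. modular p (\<lambda>t. s m t - f t)) \<longlonglongrightarrow> 0"
  proof (rule LIMSEQ_I)
    fix e :: real assume "0 < e"
    then obtain M where "\<forall>m\<ge>M. \<forall>n\<ge>m. modular p (\<lambda>t. s n t - s m t) \<le> e / 2" using C[of "e/2"] by auto
    hence "\<forall>m\<ge>M. modular p (\<lambda>t. s m t - f t) \<le> e / 2" using diff[of "e/2"] \<open>0 < e\<close> by auto
    thus "\<exists>M. \<forall>m\<ge>M. norm (modular p (\<lambda>t. s m t - f t) - 0) < e" using \<open>0 < e\<close> by (intro exI[of _ M]) auto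
  qed
  ultimately show ?thesis using that by blast
qed

lemma cell_integral_tendsto:
  assumes p: "1 < p" and s: "\<And>m. s m \<in> Lp_on p N" "f \<in> Lp_on p N"
    and l: "(\<lambda>m. modular p (\<lambda>t. s m t - f t)) \<longlonglongrightarrow> 0"
  shows "(\<lambda>m. cell_integral (s m) n k) \<longlonglongrightarrow> cell_integral f n k"
proof -
  have d: "(\<lambda>t. s m t - f t) \<in> Lp_on p N" for m by (intro Lp_on_diff p s)
  have "\<bar>cell_integral (s m) n k - cell_integral f n k\<bar> \<le> (LINT t|lebesgue. \<bar>s m t - f t\<bar>)" for m
  proof -
    have "cell_integral (s m) n k - cell_integral f n k = cell_integral (\<lambda>t. s m t - f t) n k"
      using cell_integral_diff[OF p s] by simp
    also have "\<bar>\<dots>\<bar> \<le> (LINT t|lebesgue. \<bar>indicator (dyad n k) t * (s m t - f t)\<bar>)"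
      unfolding cell_integral_def by (rule integral_abs_bound)
    also have "\<dots> \<le> (LINT t|lebesgue. \<bar>s m t - f t\<bar>)"
      using Lp_on_cell_integrable[OF p d] Lp_on_integrable[OF p d]
    proof (intro integral_mono)
      show "integrable lebesgue (\<lambda>t. \<bar>indicator (dyad n k) t * (s m t - f t)\<bar>)"
        using Lp_on_cell_integrable[OF p d] by (intro integrable_abs)
    qed (auto simp: indicator_def abs_mult)
    finally show ?thesis .
  qed
  hence "(\<lambda>m. cell_integral (s m) n k - cell_integral f n k) \<longlonglongrightarrow> 0"
    by (intro Lim_null_comparison[OF _ modular_tendsto_0_imp_L1[OF p d l]]) auto
  thus ?thesis by (simp add: LIM_zero_iff)
qed

text \<open>As \<open>ennreal\<close> sends negative numbers to 0, \<open>P 1\<close> and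
  \<open>P (-1)\<close> are the measures with the positive and the negative part of \<open>h\<close>
  as density. They agree on all half-lines, hence everywhere, so the two parts agree almost
  everywhere. Both parts of one number are equal only at 0.\<close>

lemma AE_0_if_integrals_Ioi_0:
  fixes h :: "real \<Rightarrow> real"
  assumes h: "integrable lborel h" and "\<And>x. (LINT t|lborel. indicator {x<..} t * h t) = 0"
  shows "AE t in lborel. h t = 0"
proof -
  define P where "P s = density lborel (\<lambda>t. ennreal (s * h t))" for s :: real
  have em: "emeasure (P s) {x<..} = ennreal (LINT t|lborel. indicator {x<..} t * max 0 (s * h t))" for s x
  proof -
    have i: "integrable lborel (\<lambda>t. indicator {x<..} t * max 0 (s * h t))"
      using integrable_mult_indicator[of "{x<..}" lborel "\<lambda>t. max 0 (s * h t)"] h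
      by (auto intro!: Bochner_Integration.integrable_max)
    have "emeasure (P s) {x<..} = (\<integral>\<^sup>+t. ennreal (s * h t) * indicator {x<..} t \<partial>lborel)"
      unfolding P_def using h by (subst emeasure_density) auto
    also have "\<dots> = (\<integral>\<^sup>+t. ennreal (indicator {x<..} t * max 0 (s * h t)) \<partial>lborel)"
      by (intro nn_integral_cong) (auto simp: indicator_def max_def ennreal_neg)
    also have "\<dots> = ennreal (LINT t|lborel. indicator {x<..} t * max 0 (s * h t))"
      by (rule nn_integral_eq_integral[OF i]) auto
    finally show ?thesis .
  qed
  have "P 1 = P (-1)"
  proof (rule measure_eqI_lessThan)
    fix x :: real
    have i: "integrable lborel (\<lambda>t. indicator {x<..} t * max 0 (s * h t))" for s
      using integrable_mult_indicator[of "{x<..}" lborel "\<lambda>t. max 0 (s * h t)"] h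
      by (auto intro!: Bochner_Integration.integrable_max)
    have "(LINT t|lborel. indicator {x<..} t * max 0 (1 * h t)) - (LINT t|lborel. indicator {x<..} t * max 0 (-1 * h t))
        = (LINT t|lborel. indicator {x<..} t * max 0 (1 * h t) - indicator {x<..} t * max 0 (-1 * h t))"
      by (rule Bochner_Integration.integral_diff[OF i i, symmetric])
    also have "\<dots> = (LINT t|lborel. indicator {x<..} t * h t)"
      by (rule arg_cong[where f="integral\<^sup>L lborel"]) (auto simp: max_def indicator_def)
    finally show "emeasure (P 1) {x<..} = emeasure (P (-1)) {x<..}" unfolding em assms(2) by simp
    show "emeasure (P 1) {x<..} < \<infinity>" unfolding em by simp
  qed (auto simp: P_def)
  hence "AE t in lborel. ennreal (1 * h t) = ennreal (-1 * h t)"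
    unfolding P_def using h by (intro sigma_finite_measure.density_unique sigma_finite_lborel) auto
  thus ?thesis
  proof eventually_elim
    fix t assume *: "ennreal (1 * h t) = ennreal (-1 * h t)"
    show "h t = 0"
    proof (cases "0 \<le> h t")
      case True
      hence "ennreal (h t) = 0" using * by (simp add: ennreal_neg)
      thus ?thesis using True by (simp add: ennreal_eq_0_iff)
    next
      case False
      hence "ennreal (- h t) = 0" using * by (simp add: ennreal_neg)
      thus ?thesis using False by (simp add: ennreal_eq_0_iff)
    qed
  qed
qed

text \<open>A half-line that starts at a nonnegative dyadic point meets \<open>[0, N)\<close> in
  whole cells, so the integral of \<open>h\<close> over it vanishes. Other starting points are
  approached from the right by dyadic ones, and a function whose integrals over all half-lines
  vanish is 0.\<close>

lemma AE_0_if_cell_integrals_0: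
  assumes p: "1 < p" and h: "h \<in> Lp_on p N" and z: "\<And>n k. cell_integral h n k = 0"
  shows "AE t in lebesgue. h t = 0"
proof -
  have hi: "integrable lebesgue h" by (rule Lp_on_integrable[OF p h])
  have ge: "(LINT t|lebesgue. indicator {real j / 2 ^ n..} t * h t) = 0" for n j
  proof -
    define c :: "nat \<Rightarrow> real" where "c k = (if j \<le> k \<and> k < N * 2 ^ n then 1 / 2 ^ n else 0)" for k
    have "indicator {real j / 2 ^ n..} t * h t = h t * step n c t" for t
    proof (cases "t \<in> {0..<real N}")
      case True
      have "real j / 2 ^ n \<le> t \<longleftrightarrow> real j \<le> 2 ^ n * t" by (simp add: field_simps)
      also have "\<dots> \<longleftrightarrow> j \<le> cell n t" using True by (simp add: cell_def le_nat_iff le_floor_iff)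
      finally show ?thesis using True cell_less[of t N n] by (auto simp: step_def c_def)
    qed (use Lp_onD(3)[OF h] in auto)
    hence "(LINT t|lebesgue. indicator {real j / 2 ^ n..} t * h t) = (LINT t|lebesgue. h t * step n c t)"
      by (simp only:)
    also have "\<dots> = 0" using integral_times_step[OF p h, of n c] z by (simp add: c_def)
    finally show ?thesis .
  qed
  have gt: "(LINT t|lebesgue. indicator {x<..} t * h t) = 0" for x :: real
  proof (cases "0 \<le> x")
    case True
    \<comment> \<open>The right end point of the cell of \<open>x\<close> lies strictly above
      \<open>x\<close>. Hence \<open>{y n..}\<close> never contains \<open>x\<close>, and the closed
      half-lines tend to the open one.\<close>
    define j where "j n = Suc (cell n x)" for n
    define y where "y n = real (j n) / 2 ^ n" for n
    have y: "x < y n" "y n \<le> x + 1 / 2 ^ n" for n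
    proof -
      have "x \<in> dyad n (cell n x)" using True by (simp add: mem_dyad)
      thus "x < y n" "y n \<le> x + 1 / 2 ^ n" by (auto simp: dyad_def y_def j_def field_simps)
    qed
    have ylim: "y \<longlonglongrightarrow> x"
    proof (rule tendsto_sandwich[where f="\<lambda>n. x"])
      have "(\<lambda>n. x + (1/2) ^ n) \<longlonglongrightarrow> x + 0" by (intro tendsto_add tendsto_const LIMSEQ_power_zero) auto
      thus "(\<lambda>n. x + 1 / 2 ^ n) \<longlonglongrightarrow> x" by (simp add: power_one_over)
    qed (use y in \<open>auto intro!: always_eventually less_imp_le\<close>)
    have "(\<lambda>n. LINT t|lebesgue. indicator {y n..} t * h t) \<longlonglongrightarrow> (LINT t|lebesgue. indicator {x<..} t * h t)"
    proof (rule integral_dominated_convergence[where w="\<lambda>t. \<bar>h t\<bar>"])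
      show "AE t in lebesgue. (\<lambda>n. indicator {y n..} t * h t) \<longlonglongrightarrow> indicator {x<..} t * h t"
      proof (intro AE_I2)
        fix t
        show "(\<lambda>n. indicator {y n..} t * h t) \<longlonglongrightarrow> indicator {x<..} t * h t"
        proof (cases "x < t")
          case True
          have "\<forall>\<^sub>F n in sequentially. indicator {y n..} t * h t = h t"
            using order_tendstoD(2)[OF ylim True] by eventually_elim simp
          thus ?thesis using True by (simp add: tendsto_eventually)
        next
          case False
          hence "indicator {y n..} t = (0::real)" for n using y(1)[of n] by (auto simp: indicator_def)
          thus ?thesis using False by simp
        qed
      qed
    qed (use hi Lp_onD(1)[OF h] in \<open>auto simp: indicator_def abs_mult\<close>)
    thus ?thesis unfolding y_def ge by (simp add: LIMSEQ_const_iff)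
  next
    case False
    have "indicator {x<..} t * h t = indicator {real 0 / 2 ^ 0..} t * h t" for t
      using False Lp_onD(3)[OF h, of t] by (auto simp: indicator_def)
    thus ?thesis using ge[of 0 0] by (simp only:)
  qed
  \<comment> \<open>The comparison of measures on half-lines lives on Borel sets, so a Borel
    representative replaces the Lebesgue measurable one.\<close>
  obtain h' where h': "h' \<in> borel_measurable lborel" "AE t in lborel. h t = h' t"
    using completion_ex_borel_measurable_real[OF Lp_onD(1)[OF h]] by auto
  have ae: "AE t in lebesgue. h t = h' t" using h'(2) by (rule AE_completion)
  have h'm: "h' \<in> borel_measurable borel" using h'(1) by simp
  have "AE t in lborel. h' t = 0"
  proof (rule AE_0_if_integrals_Ioi_0)
    have "integrable lebesgue h'"
      by (rule integrable_cong_AE_imp[OF hi borel_measurable_lebesgue[OF h'm]])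
        (use ae in eventually_elim, simp)
    thus "integrable lborel h'" using h'm by (simp add: integrable_completion)
    fix x :: real
    have "(LINT t|lborel. indicator {x<..} t * h' t) = (LINT t|lebesgue. indicator {x<..} t * h' t)"
      using h'm by (intro integral_completion[symmetric]) simp
    also have "\<dots> = (LINT t|lebesgue. indicator {x<..} t * h t)"
    proof (rule integral_cong_AE)
      note [measurable] = Lp_onD(1)[OF h] h'm
      show "(\<lambda>t. indicator {x<..} t * h' t) \<in> borel_measurable lebesgue" by measurable
      show "(\<lambda>t. indicator {x<..} t * h t) \<in> borel_measurable lebesgue" by measurable
      show "AE t in lebesgue. indicator {x<..} t * h' t = indicator {x<..} t * h t"
        using ae by eventually_elim simp
    qed
    finally show "(LINT t|lborel. indicator {x<..} t * h' t) = 0" using gt by simp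
  qed
  hence "AE t in lebesgue. h' t = 0" by (rule AE_completion)
  with ae show ?thesis by eventually_elim simp
qed

text \<open>The averages form a bounded martingale and converge to some \<open>g\<close>. By the
  tower property the cell integrals of \<open>avg m f\<close> are eventually those of
  \<open>f\<close>, so \<open>f\<close> and \<open>g\<close> have the same cell integrals and agree
  almost everywhere.\<close>

lemma avg_tendsto:
  assumes p: "1 < p" and f: "f \<in> Lp_on p N"
  shows "(\<lambda>m. modular p (\<lambda>t. avg m f t - f t)) \<longlonglongrightarrow> 0"
proof -
  have s: "avg m f \<in> Lp_on p N" for m by (rule avg_Lp_on[OF p f])
  obtain g where g: "g \<in> Lp_on p N" "(\<lambda>m. modular p (\<lambda>t. avg m f t - g t)) \<longlonglongrightarrow> 0"
    using Lp_on_complete[OF p s bounded_martingale_Cauchy[OF p s avg_avg[OF p f] modular_avg_le[OF p f]]] by blast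
  have d: "(\<lambda>t. g t - f t) \<in> Lp_on p N" by (intro Lp_on_diff p g f)
  have "AE t in lebesgue. g t - f t = 0"
  proof (rule AE_0_if_cell_integrals_0[OF p d])
    fix n k
    have "(\<lambda>m. cell_integral (avg m f) n k) \<longlonglongrightarrow> cell_integral f n k"
      by (intro tendsto_eventually eventually_sequentiallyI[of n] cell_integral_avg_coarser[OF p f])
    with cell_integral_tendsto[OF p s g] have "cell_integral g n k = cell_integral f n k"
      by (rule LIMSEQ_unique)
    thus "cell_integral (\<lambda>t. g t - f t) n k = 0" using cell_integral_diff[OF p g(1) f] by simp
  qed
  hence ae: "AE t in lebesgue. g t = f t" by eventually_elim simp
  have "modular p (\<lambda>t. avg m f t - g t) = modular p (\<lambda>t. avg m f t - f t)" for m
    unfolding modular_def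
  proof (rule integral_cong_AE)
    note [measurable] = Lp_onD(1)[OF g(1)] Lp_onD(1)[OF f]
    show "(\<lambda>t. \<bar>avg m f t - g t\<bar> powr p) \<in> borel_measurable lebesgue" by measurable
    show "(\<lambda>t. \<bar>avg m f t - f t\<bar> powr p) \<in> borel_measurable lebesgue" by measurable
    show "AE t in lebesgue. \<bar>avg m f t - g t\<bar> powr p = \<bar>avg m f t - f t\<bar> powr p"
      using ae by eventually_elim simp
  qed
  thus ?thesis using g(2) by simp
qed

section \<open>Weak convergence\<close>

definition restr :: "nat \<Rightarrow> (real \<Rightarrow> real) \<Rightarrow> real \<Rightarrow> real" where
  "restr N f = (\<lambda>t. indicator {0..<real N} t * f t)"

text \<open>Apart from measurability nothing is required on the negative half-line, where rates
  vanish. This is why equalities derived from cell integrals carry the guard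
  \<open>0 \<le> t\<close>.\<close>

definition loc_Lp :: "real \<Rightarrow> (real \<Rightarrow> real) \<Rightarrow> bool" where
  "loc_Lp p f \<longleftrightarrow> f \<in> borel_measurable lebesgue \<and> (\<forall>N. restr N f \<in> Lp_on p N)"

definition loc_bounded :: "real \<Rightarrow> (nat \<Rightarrow> real \<Rightarrow> real) \<Rightarrow> bool" where
  "loc_bounded p X \<longleftrightarrow> (\<forall>m. loc_Lp p (X m)) \<and> (\<forall>N. \<exists>B. \<forall>m. modular p (restr N (X m)) \<le> B)"

text \<open>On locally bounded sequences, convergence of the integrals over all dyadic intervals is
  weak convergence in \<open>L\<^sup>p\<close> on bounded intervals.\<close>

definition wconv :: "(nat \<Rightarrow> real \<Rightarrow> real) \<Rightarrow> (real \<Rightarrow> real) \<Rightarrow> bool" where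
  "wconv X f \<longleftrightarrow> (\<forall>n k. (\<lambda>m. cell_integral (X m) n k) \<longlonglongrightarrow> cell_integral f n k)"

lemma loc_LpD: "loc_Lp p f \<Longrightarrow> restr N f \<in> Lp_on p N" "loc_Lp p f \<Longrightarrow> f \<in> borel_measurable lebesgue"
  by (auto simp: loc_Lp_def)

lemma loc_boundedD: "loc_bounded p X \<Longrightarrow> loc_Lp p (X m)"
  by (auto simp: loc_bounded_def)

lemma restr_outside: "t \<notin> {0..<real N} \<Longrightarrow> restr N f t = 0"
  by (simp add: restr_def)

lemma restr_inside: "t \<in> {0..<real N} \<Longrightarrow> restr N f t = f t"
  by (simp add: restr_def)

lemma cell_integral_restr: "k < N * 2 ^ n \<Longrightarrow> cell_integral (restr N f) n k = cell_integral f n k"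
  unfolding cell_integral_def using dyad_subset[of k N n]
  by (intro Bochner_Integration.integral_cong) (auto simp: indicator_def restr_def)

lemma cell_integral_restr_outside: "\<not> k < N * 2 ^ n \<Longrightarrow> cell_integral (restr N f) n k = 0"
  by (intro cell_integral_outside[of N]) (auto simp: restr_outside)

text \<open>Cell \<open>k\<close> lies in \<open>[0, Suc k)\<close> at every level, which gives a
  bounded interval around a cell without reference to the level.\<close>

lemma less_Suc_mult: "k < Suc k * 2 ^ n"
  by (metis Suc_le_lessD le_add1 mult.commute mult_Suc_right mult_le_mono1 nat_mult_1 one_le_numeral
      one_le_power order_trans lessI less_le_trans)

lemma wconv_restr: "wconv X f \<Longrightarrow> wconv (\<lambda>m. restr N (X m)) (restr N f)"
  unfolding wconv_def
proof (intro allI)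
  fix n k assume *: "\<forall>n k. (\<lambda>m. cell_integral (X m) n k) \<longlonglongrightarrow> cell_integral f n k"
  show "(\<lambda>m. cell_integral (restr N (X m)) n k) \<longlonglongrightarrow> cell_integral (restr N f) n k"
    using * by (cases "k < N * 2 ^ n") (auto simp: cell_integral_restr cell_integral_restr_outside)
qed

lemma loc_Lp_cell_integrable:
  assumes "1 < p" "loc_Lp p f"
  shows "integrable lebesgue (\<lambda>t. indicator (dyad n k) t * f t)"
proof -
  have "indicator (dyad n k) t * restr (Suc k) f t = indicator (dyad n k) t * f t" for t
    using dyad_subset[OF less_Suc_mult[of k n]] by (auto simp: indicator_def restr_def)
  thus ?thesis using Lp_on_cell_integrable[OF assms(1) loc_LpD(1)[OF assms(2)], of n k "Suc k"] by (simp only:)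
qed

lemma AE_eq_if_cell_integrals_eq:
  assumes p: "1 < p" and f: "loc_Lp p f" "loc_Lp p g" and "\<And>n k. cell_integral f n k = cell_integral g n k"
  shows "AE t in lebesgue. 0 \<le> t \<longrightarrow> f t = g t"
proof -
  have "AE t in lebesgue. restr N f t - restr N g t = 0" for N
  proof (rule AE_0_if_cell_integrals_0[OF p])
    show "(\<lambda>t. restr N f t - restr N g t) \<in> Lp_on p N" by (intro Lp_on_diff p loc_LpD f)
    show "cell_integral (\<lambda>t. restr N f t - restr N g t) n k = 0" for n k
      using cell_integral_diff[OF p loc_LpD(1)[OF f(1)] loc_LpD(1)[OF f(2)]] assms(4)
      by (cases "k < N * 2 ^ n") (auto simp: cell_integral_restr cell_integral_restr_outside)
  qed
  hence "AE t in lebesgue. \<forall>N. restr N f t - restr N g t = 0" by (simp add: AE_all_countable)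
  thus ?thesis
  proof eventually_elim
    fix t assume *: "\<forall>N. restr N f t - restr N g t = 0"
    obtain N :: nat where "t < real N" using reals_Archimedean2 by blast
    thus "0 \<le> t \<longrightarrow> f t = g t" using spec[OF *, of N] by (auto simp: restr_def)
  qed
qed

lemma wconv_unique:
  assumes "1 < p" "loc_Lp p f" "loc_Lp p g" "wconv X f" "wconv X g"
  shows "AE t in lebesgue. 0 \<le> t \<longrightarrow> f t = g t"
proof (rule AE_eq_if_cell_integrals_eq[OF assms(1-3)])
  show "cell_integral f n k = cell_integral g n k" for n k
    using assms(4,5) LIMSEQ_unique unfolding wconv_def by blast
qed

lemma cell_integral_cong_AE:
  assumes "AE t in lebesgue. 0 \<le> t \<longrightarrow> f t = g t" "f \<in> borel_measurable lebesgue" "g \<in> borel_measurable lebesgue"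
  shows "cell_integral f n k = cell_integral g n k"
  unfolding cell_integral_def
proof (rule integral_cong_AE)
  show "AE t in lebesgue. indicator (dyad n k) t * f t = indicator (dyad n k) t * g t"
    using assms(1) by eventually_elim (auto simp: indicator_def mem_dyad)
qed (use assms in measurable)

lemma abs_avg_le:
  assumes "1 < p" "f \<in> Lp_on p N" "AE t in lebesgue. \<bar>f t\<bar> \<le> c" "0 \<le> c"
  shows "\<bar>avg n f t\<bar> \<le> c"
proof -
  have "\<bar>cell_integral f n k\<bar> \<le> c / 2 ^ n" for k
  proof -
    have "\<bar>cell_integral f n k\<bar> \<le> (LINT t|lebesgue. \<bar>indicator (dyad n k) t * f t\<bar>)"
      unfolding cell_integral_def by (rule integral_abs_bound)
    also have "\<dots> \<le> (LINT t|lebesgue. c * indicator (dyad n k) t)"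
    proof (rule integral_mono_AE)
      show "AE t in lebesgue. \<bar>indicator (dyad n k) t * f t\<bar> \<le> c * indicator (dyad n k) t"
        using assms(3) by eventually_elim (auto simp: indicator_def)
      show "integrable lebesgue (\<lambda>t. \<bar>indicator (dyad n k) t * f t\<bar>)"
        by (intro integrable_abs Lp_on_cell_integrable[OF assms(1,2)])
    qed simp
    also have "\<dots> = c / 2 ^ n" by (simp add: measure_dyad)
    finally show ?thesis .
  qed
  hence "2 ^ n * \<bar>cell_integral f n k\<bar> \<le> c" for k
    by (metis mult.commute pos_le_divide_eq zero_less_numeral zero_less_power)
  thus ?thesis using assms(4) by (simp add: avg_def step_def abs_mult)
qed

text \<open>The threshold \<open>\<delta>\<close> depends neither on the particular \<open>h\<close>
  nor on the interval: the part of \<open>h\<close> above a large height is negligible by the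
  modular bound, and below that height the L^1 norm of \<open>z\<close> decides.\<close>

lemma small_integral_if_L1_small:
  fixes B c e p :: real
  assumes p: "1 < p" and "0 < e" "0 \<le> c" "0 \<le> B"
  obtains \<delta> where "0 < \<delta>"
    "\<And>h (z :: real \<Rightarrow> real) N. h \<in> Lp_on p N \<Longrightarrow> modular p h \<le> B \<Longrightarrow> z \<in> borel_measurable lebesgue \<Longrightarrow>
      AE t in lebesgue. \<bar>z t\<bar> \<le> c \<Longrightarrow> integrable lebesgue z \<Longrightarrow> (LINT t|lebesgue. \<bar>z t\<bar>) \<le> \<delta> \<Longrightarrow>
      \<bar>LINT t|lebesgue. h t * z t\<bar> \<le> e"
proof -
  define D where "D = 2 * (c * B + 1)"
  \<comment> \<open>Chosen to solve \<open>K powr (1 - p) = e / D\<close>, so that the large values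
    of \<open>h\<close> contribute at most \<open>c * (e / D) * B\<close>, which is at most
    \<open>e / 2\<close>.\<close>
  define K where "K = (D / e) powr (1 / (p - 1))"
  have D: "0 < D" using assms by (simp add: D_def add_nonneg_pos)
  have K: "0 < K" using D \<open>0 < e\<close> by (simp add: K_def)
  have "K powr (1 - p) = (D / e) powr (- 1)"
  proof -
    have "1 / (p - 1) * (1 - p) = - 1" using p by (simp add: field_simps)
    thus ?thesis by (simp only: K_def powr_powr)
  qed
  also have "\<dots> = e / D" using D \<open>0 < e\<close> by (simp add: powr_minus_divide)
  finally have Kp: "K powr (1 - p) = e / D" .
  have "c * (e / D) * B \<le> e / 2"
  proof -
    have "c * (e / D) * B = e * (c * B) / D" by simp
    also have "\<dots> \<le> e * (c * B + 1) / D" using \<open>0 < e\<close> D by (intro divide_right_mono mult_left_mono) auto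
    also have "\<dots> = e / 2" using D unfolding D_def by (simp add: field_simps)
    finally show ?thesis .
  qed
  show ?thesis
  proof (rule that[of "e / (2 * K)"])
    show "0 < e / (2 * K)" using K \<open>0 < e\<close> by simp
    fix h z :: "real \<Rightarrow> real" and N assume h: "h \<in> Lp_on p N" "modular p h \<le> B" "z \<in> borel_measurable lebesgue"
      "AE t in lebesgue. \<bar>z t\<bar> \<le> c" "integrable lebesgue z" "(LINT t|lebesgue. \<bar>z t\<bar>) \<le> e / (2 * K)"
    have "\<bar>LINT t|lebesgue. h t * z t\<bar> \<le> K * (LINT t|lebesgue. \<bar>z t\<bar>) + c * K powr (1 - p) * B"
      by (rule integral_mult_modular_bound[OF p K h(1,2) assms(3) h(3-5)])
    also have "\<dots> \<le> K * (e / (2 * K)) + e / 2"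
      using K h(6) Kp \<open>c * (e / D) * B \<le> e / 2\<close> by (intro add_mono mult_left_mono) auto
    also have "\<dots> = e" using K by (simp add: field_simps)
    finally show "\<bar>LINT t|lebesgue. h t * z t\<bar> \<le> e" .
  qed
qed

lemma Lp_on_mult_integrable:
  assumes p: "1 < p" and h: "h \<in> Lp_on p N"
    and z: "z \<in> borel_measurable lebesgue" "AE t in lebesgue. \<bar>z t\<bar> \<le> c"
  shows "integrable lebesgue (\<lambda>t. h t * z t)"
proof (rule Bochner_Integration.integrable_bound)
  show "integrable lebesgue (\<lambda>t. c * h t)" using Lp_on_integrable[OF p h] by simp
  show "AE t in lebesgue. norm (h t * z t) \<le> norm (c * h t)"
    using z(2)
  proof eventually_elim
    fix t assume *: "\<bar>z t\<bar> \<le> c"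
    have "\<bar>h t\<bar> * \<bar>z t\<bar> \<le> \<bar>h t\<bar> * \<bar>c\<bar>" using * by (intro mult_left_mono) auto
    thus "norm (h t * z t) \<le> norm (c * h t)" by (simp add: abs_mult mult.commute)
  qed
qed (use Lp_onD(1)[OF h] z in measurable)

text \<open>Both \<open>y m\<close> and its limit \<open>z\<close> are replaced by one step
  function, an average of \<open>z\<close>. The errors are small uniformly in \<open>m\<close>
  because the sequence is bounded in L^p and the test functions are bounded and close in L^1;
  against the step function only cell integrals matter.\<close>

lemma weak_test:
  assumes p: "1 < p" and X: "loc_bounded p X" "loc_Lp p f" "wconv X f"
    and y: "\<And>m. y m \<in> borel_measurable lebesgue" "\<And>m. AE t in lebesgue. \<bar>y m t\<bar> \<le> c"
      "\<And>m t. t \<notin> {0..<real N} \<Longrightarrow> y m t = 0"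
    and z: "z \<in> borel_measurable lebesgue" "\<And>t. \<bar>z t\<bar> \<le> c" "\<And>t. t \<notin> {0..<real N} \<Longrightarrow> z t = 0"
    and l: "(\<lambda>m. LINT t|lebesgue. \<bar>y m t - z t\<bar>) \<longlonglongrightarrow> 0"
  shows "(\<lambda>m. LINT t|lebesgue. X m t * y m t) \<longlonglongrightarrow> (LINT t|lebesgue. f t * z t)"
proof -
  have c0: "0 \<le> c" using z(2)[of 0] by linarith
  have zL: "z \<in> Lp_on p N" using Lp_on_bounded[OF z(1,3,2)] p by simp
  have yi: "integrable lebesgue (y m)" for m
  proof (rule Bochner_Integration.integrable_bound)
    show "integrable lebesgue (\<lambda>t. c * indicator {0..<real N} t)" by simp
    show "AE t in lebesgue. norm (y m t) \<le> norm (c * indicator {0..<real N} t)"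
      using y(2)[of m]
    proof eventually_elim
      fix t assume "\<bar>y m t\<bar> \<le> c"
      thus "norm (y m t) \<le> norm (c * indicator {0..<real N} t)"
        using y(3)[of t m] c0 by (cases "t \<in> {0..<real N}") auto
    qed
  qed (rule y)
  have zi: "integrable lebesgue z" by (rule Lp_on_integrable[OF p zL])
  obtain B0 where B0: "\<And>m. modular p (restr N (X m)) \<le> B0" using X(1) unfolding loc_bounded_def by blast
  define B where "B = max B0 (modular p (restr N f))"
  have B: "modular p (restr N (X m)) \<le> B" "modular p (restr N f) \<le> B" "0 \<le> B" for m
    using B0[of m] by (auto simp: B_def le_max_iff_disj)
  have XL: "restr N (X m) \<in> Lp_on p N" for m using X(1) by (auto simp: loc_bounded_def loc_LpD)
  have fL: "restr N f \<in> Lp_on p N" by (rule loc_LpD[OF X(2)])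
  have X': "X m t * y m t = restr N (X m) t * y m t" for m t
    using y(3)[of t m] by (cases "t \<in> {0..<real N}") (auto simp: restr_def)
  have f': "f t * z t = restr N f t * z t" for t
    using z(3)[of t] by (cases "t \<in> {0..<real N}") (auto simp: restr_def)
  show ?thesis unfolding X' f'
  proof (rule LIMSEQ_I)
    fix e :: real assume "0 < e"
    \<comment> \<open>The test functions here are differences of two functions bounded by
      \<open>c\<close>, hence the bound \<open>2 * c\<close>. Three errors of \<open>e / 4\<close>
      arise: from replacing \<open>y m\<close>, from replacing \<open>z\<close>, and from weak
      convergence against the step function.\<close>
    obtain \<delta> where \<delta>: "0 < \<delta>"
      "\<And>h (z :: real \<Rightarrow> real) N. h \<in> Lp_on p N \<Longrightarrow> modular p h \<le> B \<Longrightarrow> z \<in> borel_measurable lebesgue \<Longrightarrow>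
        AE t in lebesgue. \<bar>z t\<bar> \<le> 2 * c \<Longrightarrow> integrable lebesgue z \<Longrightarrow> (LINT t|lebesgue. \<bar>z t\<bar>) \<le> \<delta> \<Longrightarrow>
        \<bar>LINT t|lebesgue. h t * z t\<bar> \<le> e / 4"
      using small_integral_if_L1_small[OF p divide_pos_pos[OF \<open>0 < e\<close>, of 4] _ B(3), of "2 * c" thesis] c0
      by auto
    have "(\<lambda>k. LINT t|lebesgue. \<bar>avg k z t - z t\<bar>) \<longlonglongrightarrow> 0"
      by (rule modular_tendsto_0_imp_L1[OF p Lp_on_diff[OF p avg_Lp_on[OF p zL] zL] avg_tendsto[OF p zL]])
    from LIMSEQ_D[OF this, of "\<delta>/2"] \<delta>(1) obtain k where k: "(LINT t|lebesgue. \<bar>avg k z t - z t\<bar>) < \<delta> / 2" by auto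
    define a where "a = avg k z"
    have a: "a \<in> Lp_on p N" "\<And>t. \<bar>a t\<bar> \<le> c"
      unfolding a_def using abs_avg_le[OF p zL _ c0] z(2) avg_Lp_on[OF p zL] by auto
    have ai: "integrable lebesgue a" by (rule Lp_on_integrable[OF p a(1)])
    have l1: "\<forall>\<^sub>F m in sequentially. (LINT t|lebesgue. \<bar>y m t - z t\<bar>) < \<delta> / 2"
      using order_tendstoD(2)[OF l, of "\<delta> / 2"] \<delta>(1) by simp
    have "(\<lambda>m. LINT t|lebesgue. restr N (X m) t * a t) \<longlonglongrightarrow> (LINT t|lebesgue. restr N f t * a t)"
    proof -
      have "(LINT t|lebesgue. h t * a t) = (\<Sum>j<N * 2 ^ k. 2 ^ k * cell_integral z k j * cell_integral h k j)"
        if "h \<in> Lp_on p N" for h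
        unfolding a_def avg_def
        by (rule integral_times_step[OF p that]) (rule cell_integral_outside[OF Lp_onD(3)[OF zL]])
      note eqs = this[OF XL] this[OF fL]
      show ?thesis
        unfolding eqs
        using wconv_restr[OF X(3), of N] by (intro tendsto_sum tendsto_mult tendsto_const) (auto simp: wconv_def)
    qed
    from tendstoD[OF this, of "e/4"] have l2: "\<forall>\<^sub>F m in sequentially. \<bar>(LINT t|lebesgue. restr N (X m) t * a t) - (LINT t|lebesgue. restr N f t * a t)\<bar> < e / 4"
      using \<open>0 < e\<close> by (simp add: dist_real_def)
    have "\<forall>\<^sub>F m in sequentially. norm ((LINT t|lebesgue. restr N (X m) t * y m t) - (LINT t|lebesgue. restr N f t * z t)) < e"
      using l1 l2
    proof eventually_elim
      fix m assume m: "(LINT t|lebesgue. \<bar>y m t - z t\<bar>) < \<delta> / 2"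
        "\<bar>(LINT t|lebesgue. restr N (X m) t * a t) - (LINT t|lebesgue. restr N f t * a t)\<bar> < e / 4"
      have "(LINT t|lebesgue. \<bar>y m t - a t\<bar>) \<le> (LINT t|lebesgue. \<bar>y m t - z t\<bar> + \<bar>a t - z t\<bar>)"
        using yi zi ai by (intro integral_mono) auto
      also have "\<dots> \<le> \<delta>" using m(1) k yi zi ai by (simp add: a_def[symmetric])
      finally have ya: "(LINT t|lebesgue. \<bar>y m t - a t\<bar>) \<le> \<delta>" .
      have "AE t in lebesgue. \<bar>y m t - a t\<bar> \<le> 2 * c"
        using y(2)[of m]
      proof eventually_elim
        fix t assume "\<bar>y m t\<bar> \<le> c" thus "\<bar>y m t - a t\<bar> \<le> 2 * c" using a(2)[of t] by linarith
      qed
      hence 1: "\<bar>LINT t|lebesgue. restr N (X m) t * (y m t - a t)\<bar> \<le> e / 4"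
        using yi ai y(1)[of m] Lp_onD(1)[OF a(1)] ya by (intro \<delta>(2)[OF XL B(1)]) auto
      have "\<bar>a t - z t\<bar> \<le> 2 * c" for t using a(2)[of t] z(2)[of t] by linarith
      hence 2: "\<bar>LINT t|lebesgue. restr N f t * (a t - z t)\<bar> \<le> e / 4"
        using ai zi Lp_onD(1)[OF a(1)] z(1) k \<delta>(1) by (intro \<delta>(2)[OF fL B(2)]) (auto simp: a_def)
      have aAE: "AE t in lebesgue. \<bar>a t\<bar> \<le> c" "AE t in lebesgue. \<bar>z t\<bar> \<le> c" using a(2) z(2) by auto
      note i = Lp_on_mult_integrable[OF p XL y(1,2)] Lp_on_mult_integrable[OF p XL Lp_onD(1)[OF a(1)] aAE(1)]
        Lp_on_mult_integrable[OF p fL Lp_onD(1)[OF a(1)] aAE(1)] Lp_on_mult_integrable[OF p fL z(1) aAE(2)]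
      have "(LINT t|lebesgue. restr N (X m) t * y m t) - (LINT t|lebesgue. restr N (X m) t * a t)
          = (LINT t|lebesgue. restr N (X m) t * (y m t - a t))"
        using i by (simp add: right_diff_distrib)
      moreover have "(LINT t|lebesgue. restr N f t * a t) - (LINT t|lebesgue. restr N f t * z t)
          = (LINT t|lebesgue. restr N f t * (a t - z t))"
        using i by (simp add: right_diff_distrib)
      ultimately show "norm ((LINT t|lebesgue. restr N (X m) t * y m t) - (LINT t|lebesgue. restr N f t * z t)) < e"
        using 1 2 m(2) unfolding real_norm_def by linarith
    qed
    thus "\<exists>no. \<forall>m\<ge>no. norm ((LINT t|lebesgue. restr N (X m) t * y m t) - (LINT t|lebesgue. restr N f t * z t)) < e"
      by (simp add: eventually_sequentially)
  qed
qed

section \<open>Products and sums of weakly convergent sequences\<close>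

lemma loc_Lp_mult:
  assumes "1 < p" "loc_Lp p f" "a \<in> borel_measurable lebesgue" "AE t in lebesgue. \<bar>a t\<bar> \<le> c"
  shows "loc_Lp p (\<lambda>t. a t * f t)"
    and "modular p (restr N (\<lambda>t. a t * f t)) \<le> \<bar>c\<bar> powr p * modular p (restr N f)"
proof -
  have m: "(\<lambda>t. a t * f t) \<in> borel_measurable lebesgue" using assms(3) loc_LpD(2)[OF assms(2)] by measurable
  have L: "(\<lambda>t. c * restr N f t) \<in> Lp_on p N" for N by (intro Lp_on_scale loc_LpD assms)
  have ae: "AE t in lebesgue. \<bar>restr N (\<lambda>t. a t * f t) t\<bar> \<le> \<bar>c * restr N f t\<bar>" for N
    using assms(4) by eventually_elim (auto simp: restr_def indicator_def abs_mult intro!: mult_right_mono)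
  have mr: "restr N (\<lambda>t. a t * f t) \<in> borel_measurable lebesgue" for N
    unfolding restr_def using m by measurable
  have "restr N (\<lambda>t. a t * f t) \<in> Lp_on p N" for N
  proof -
    have "integrable lebesgue (\<lambda>t. \<bar>restr N (\<lambda>t. a t * f t) t\<bar> powr p)"
    proof (rule Bochner_Integration.integrable_bound[OF Lp_onD(2)[OF L]])
      show "AE t in lebesgue. norm (\<bar>restr N (\<lambda>t. a t * f t) t\<bar> powr p) \<le> norm (\<bar>c * restr N f t\<bar> powr p)"
        using ae[of N] by eventually_elim (use assms(1) in \<open>auto intro!: powr_mono2\<close>)
    qed (use mr in measurable)
    thus ?thesis using mr by (auto simp: Lp_on_def restr_outside)
  qed
  thus "loc_Lp p (\<lambda>t. a t * f t)" using m by (simp add: loc_Lp_def)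
  have "modular p (restr N (\<lambda>t. a t * f t)) \<le> modular p (\<lambda>t. c * restr N f t)"
    by (rule modular_mono[OF ae assms(1) L mr])
  thus "modular p (restr N (\<lambda>t. a t * f t)) \<le> \<bar>c\<bar> powr p * modular p (restr N f)"
    by (simp add: modular_scale)
qed

lemma loc_bounded_mult:
  assumes "1 < p" "loc_bounded p X" "\<And>m. a m \<in> borel_measurable lebesgue" "\<And>m. AE t in lebesgue. \<bar>a m t\<bar> \<le> c"
  shows "loc_bounded p (\<lambda>m t. a m t * X m t)"
  unfolding loc_bounded_def
proof (intro conjI allI)
  fix N m
  show "loc_Lp p (\<lambda>t. a m t * X m t)" using assms by (intro loc_Lp_mult(1) loc_boundedD) auto
next
  fix N
  obtain B where B: "\<And>m. modular p (restr N (X m)) \<le> B" using assms(2) unfolding loc_bounded_def by blast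
  have "modular p (restr N (\<lambda>t. a m t * X m t)) \<le> \<bar>c\<bar> powr p * B" for m
    by (rule order_trans[OF loc_Lp_mult(2)[OF assms(1) loc_boundedD[OF assms(2)] assms(3,4)]])
      (intro mult_left_mono B, simp)
  thus "\<exists>B. \<forall>m. modular p (restr N (\<lambda>t. a m t * X m t)) \<le> B" by blast
qed

lemma L1_tendsto_0_if_bounded_AE:
  fixes y :: "nat \<Rightarrow> real \<Rightarrow> real"
  assumes "\<And>m. y m \<in> borel_measurable lebesgue" "\<And>m. AE t in lebesgue. \<bar>y m t\<bar> \<le> c"
    "\<And>m t. t \<notin> {0..<real N} \<Longrightarrow> y m t = 0" "AE t in lebesgue. (\<lambda>m. y m t) \<longlonglongrightarrow> 0"
  shows "(\<lambda>m. LINT t|lebesgue. \<bar>y m t\<bar>) \<longlonglongrightarrow> 0"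
proof -
  have "(\<lambda>m. LINT t|lebesgue. \<bar>y m t\<bar>) \<longlonglongrightarrow> integral\<^sup>L lebesgue (\<lambda>t :: real. 0 :: real)"
  proof (rule integral_dominated_convergence[where w="\<lambda>t. c * indicator {0..<real N} t"])
    show "AE t in lebesgue. (\<lambda>m. \<bar>y m t\<bar>) \<longlonglongrightarrow> 0"
      using assms(4) by eventually_elim (rule tendsto_rabs_zero)
    fix m show "AE t in lebesgue. norm \<bar>y m t\<bar> \<le> c * indicator {0..<real N} t"
      using assms(2)[of m]
    proof eventually_elim
      fix t assume "\<bar>y m t\<bar> \<le> c"
      thus "norm \<bar>y m t\<bar> \<le> c * indicator {0..<real N} t"
        using assms(3)[of t m] by (cases "t \<in> {0..<real N}") auto
    qed
  qed (use assms(1) in auto)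
  thus ?thesis by simp
qed

text \<open>Integrating the product over a cell means testing \<open>X m\<close> with the cell
  indicator times \<open>a m\<close>. By dominated convergence this bounded test function converges
  in L^1, so it may be paired with a weakly convergent bounded sequence.\<close>

lemma wconv_mult:
  assumes p: "1 < p" and X: "loc_bounded p X" "loc_Lp p f" "wconv X f"
    and a: "\<And>m. a m \<in> borel_measurable lebesgue" "\<And>m. AE t in lebesgue. \<bar>a m t\<bar> \<le> c"
    and b: "b \<in> borel_measurable lebesgue" "\<And>t. \<bar>b t\<bar> \<le> c"
    and l: "AE t in lebesgue. 0 \<le> t \<longrightarrow> (\<lambda>m. a m t) \<longlonglongrightarrow> b t"
  shows "wconv (\<lambda>m t. a m t * X m t) (\<lambda>t. b t * f t)"
  unfolding wconv_def
proof (intro allI)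
  fix n k
  define N where "N = Suc k"
  have sub: "dyad n k \<subseteq> {0..<real N}" unfolding N_def by (rule dyad_subset[OF less_Suc_mult])
  have eq: "cell_integral (\<lambda>t. a t * g t) n k = (LINT t|lebesgue. g t * (indicator (dyad n k) t * a t))" for a g
    unfolding cell_integral_def by (rule arg_cong[where f="integral\<^sup>L lebesgue"]) (auto simp: ac_simps)
  show "(\<lambda>m. cell_integral (\<lambda>t. a m t * X m t) n k) \<longlonglongrightarrow> cell_integral (\<lambda>t. b t * f t) n k"
    unfolding eq
  proof (rule weak_test[OF p X, where c=c and N=N])
    have c: "0 \<le> c" using b(2)[of 0] by linarith
    show "AE t in lebesgue. \<bar>indicator (dyad n k) t * a m t\<bar> \<le> c" for m
      using a(2)[of m] c by (auto elim!: AE_mp simp: indicator_def)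
    show "(\<lambda>m. LINT t|lebesgue. \<bar>indicator (dyad n k) t * a m t - indicator (dyad n k) t * b t\<bar>) \<longlonglongrightarrow> 0"
    proof (rule L1_tendsto_0_if_bounded_AE[where c="2*c" and N=N])
      fix m show "AE t in lebesgue. \<bar>indicator (dyad n k) t * a m t - indicator (dyad n k) t * b t\<bar> \<le> 2 * c"
        using a(2)[of m]
      proof eventually_elim
        fix t assume "\<bar>a m t\<bar> \<le> c"
        thus "\<bar>indicator (dyad n k) t * a m t - indicator (dyad n k) t * b t\<bar> \<le> 2 * c"
          using b(2)[of t] c by (cases "t \<in> dyad n k") auto
      qed
    next
      show "AE t in lebesgue. (\<lambda>m. indicator (dyad n k) t * a m t - indicator (dyad n k) t * b t) \<longlonglongrightarrow> 0"
        using l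
      proof eventually_elim
        fix t assume "0 \<le> t \<longrightarrow> (\<lambda>m. a m t) \<longlonglongrightarrow> b t"
        thus "(\<lambda>m. indicator (dyad n k) t * a m t - indicator (dyad n k) t * b t) \<longlonglongrightarrow> 0"
          by (cases "t \<in> dyad n k") (auto simp: LIM_zero_iff mem_dyad)
      qed
    qed (use a(1) b(1) sub in \<open>auto simp: indicator_def\<close>)
    show "\<bar>indicator (dyad n k) t * b t\<bar> \<le> c" for t using b(2)[of t] c by (auto simp: indicator_def)
  qed (use a(1) b(1) sub in \<open>auto simp: indicator_def\<close>)
qed

lemma cell_integral_add_loc:
  assumes "1 < p" "loc_Lp p f" "loc_Lp p g"
  shows "cell_integral (\<lambda>t. f t + g t) n k = cell_integral f n k + cell_integral g n k"
  using loc_Lp_cell_integrable[OF assms(1,2)] loc_Lp_cell_integrable[OF assms(1,3)]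
  by (simp add: cell_integral_def distrib_left)

lemma loc_Lp_add: assumes "1 < p" "loc_Lp p f" "loc_Lp p g" shows "loc_Lp p (\<lambda>t. f t + g t)"
proof -
  have "restr N (\<lambda>t. f t + g t) = (\<lambda>t. restr N f t + restr N g t)" for N
    by (auto simp: restr_def distrib_left)
  thus ?thesis using assms Lp_on_add[OF assms(1)] by (auto simp: loc_Lp_def)
qed

lemma loc_Lp_0 [simp]: "loc_Lp p (\<lambda>t. 0)"
  by (auto simp: loc_Lp_def restr_def Lp_on_def)

lemma loc_Lp_sum:
  assumes "1 < p" "\<And>j. j \<in> J \<Longrightarrow> loc_Lp p (f j)"
  shows "loc_Lp p (\<lambda>t. \<Sum>j\<in>J. f j t)"
  using assms(2) by (induction J rule: infinite_finite_induct) (auto intro: loc_Lp_add[OF assms(1)])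

lemma wconv_add:
  assumes "1 < p" "\<And>m. loc_Lp p (X m)" "\<And>m. loc_Lp p (Y m)" "loc_Lp p f" "loc_Lp p g" "wconv X f" "wconv Y g"
  shows "wconv (\<lambda>m t. X m t + Y m t) (\<lambda>t. f t + g t)"
  using assms by (auto simp: wconv_def cell_integral_add_loc[OF assms(1)] intro!: tendsto_add)

lemma wconv_sum:
  assumes "1 < p" "\<And>j m. j \<in> J \<Longrightarrow> loc_Lp p (X m j)" "\<And>j. j \<in> J \<Longrightarrow> loc_Lp p (f j)"
    "\<And>j. j \<in> J \<Longrightarrow> wconv (\<lambda>m. X m j) (f j)"
  shows "wconv (\<lambda>m t. \<Sum>j\<in>J. X m j t) (\<lambda>t. \<Sum>j\<in>J. f j t)"
  using assms(2-)
proof (induction J rule: infinite_finite_induct)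
  case (insert x F)
  thus ?case by (auto intro!: wconv_add[OF assms(1)] loc_Lp_sum[OF assms(1)])
qed (auto simp: wconv_def)

lemma loc_bounded_add:
  assumes p: "1 < p" and "loc_bounded p X" "loc_bounded p Y"
  shows "loc_bounded p (\<lambda>m t. X m t + Y m t)"
  unfolding loc_bounded_def
proof (intro conjI allI)
  show "loc_Lp p (\<lambda>t. X m t + Y m t)" for m using assms by (intro loc_Lp_add loc_boundedD)
  fix N
  obtain A B where *: "\<And>m. modular p (restr N (X m)) \<le> A" "\<And>m. modular p (restr N (Y m)) \<le> B"
    using assms(2,3) by (auto simp: loc_bounded_def) metis
  have "modular p (restr N (\<lambda>t. X m t + Y m t)) \<le> 2 powr p * (A + B)" for m
  proof -
    have "restr N (\<lambda>t. X m t + Y m t) = (\<lambda>t. restr N (X m) t + restr N (Y m) t)"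
      by (auto simp: restr_def distrib_left)
    hence "modular p (restr N (\<lambda>t. X m t + Y m t)) \<le> 2 powr p * (modular p (restr N (X m)) + modular p (restr N (Y m)))"
      using modular_add[OF p loc_LpD(1)[OF loc_boundedD[OF assms(2)]] loc_LpD(1)[OF loc_boundedD[OF assms(3)]]] by simp
    also have "\<dots> \<le> 2 powr p * (A + B)" by (intro mult_left_mono add_mono *) simp
    finally show ?thesis .
  qed
  thus "\<exists>B. \<forall>m. modular p (restr N (\<lambda>t. X m t + Y m t)) \<le> B" by blast
qed

lemma loc_bounded_sum:
  assumes "1 < p" "\<And>j. j \<in> J \<Longrightarrow> loc_bounded p (\<lambda>m. X m j)"
  shows "loc_bounded p (\<lambda>m t. \<Sum>j\<in>J. X m j t)"
  using assms(2)
proof (induction J rule: infinite_finite_induct)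
  case (insert x F)
  thus ?case using loc_bounded_add[OF assms(1), of "\<lambda>m. X m x" "\<lambda>m t. \<Sum>j\<in>F. X m j t"] by simp
qed (auto simp: loc_bounded_def restr_def modular_def)

lemma loc_bounded_const: "loc_Lp p f \<Longrightarrow> loc_bounded p (\<lambda>m. f)"
  by (auto simp: loc_bounded_def)

lemma loc_bounded_subseq: "loc_bounded p X \<Longrightarrow> loc_bounded p (\<lambda>m. X (s m))"
proof -
  assume *: "loc_bounded p X"
  have "\<exists>B. \<forall>m. modular p (restr N (X (s m))) \<le> B" for N
  proof -
    from * obtain B where "\<forall>m. modular p (restr N (X m)) \<le> B" unfolding loc_bounded_def by blast
    thus ?thesis by (intro exI[of _ B]) simp
  qed
  thus ?thesis using * by (simp add: loc_bounded_def)
qed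

lemma wconv_const: "wconv (\<lambda>m. f) f"
  by (auto simp: wconv_def)

lemma wconv_subseq: "wconv X f \<Longrightarrow> strict_mono s \<Longrightarrow> wconv (\<lambda>m. X (s m)) f"
  unfolding wconv_def using LIMSEQ_subseq_LIMSEQ[of _ _ s] by (auto simp: o_def)

lemma wconv_cong_AE:
  assumes "wconv X f" "\<And>m. AE t in lebesgue. 0 \<le> t \<longrightarrow> X m t = Y m t" "AE t in lebesgue. 0 \<le> t \<longrightarrow> f t = g t"
    "\<And>m. X m \<in> borel_measurable lebesgue" "\<And>m. Y m \<in> borel_measurable lebesgue"
    "f \<in> borel_measurable lebesgue" "g \<in> borel_measurable lebesgue"
  shows "wconv Y g"
  using assms(1) unfolding wconv_def
  using cell_integral_cong_AE[OF assms(2,4,5)] cell_integral_cong_AE[OF assms(3,6,7)] by simp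

text \<open>Let \<open>y\<close> be the indicator of the set where the limit is negative. The cell
  integrals of \<open>y * f\<close> are limits of nonnegative numbers, while the function itself is
  nowhere positive; so they all vanish, and \<open>f\<close> is negative at most on a null set of
  nonnegative times.\<close>

lemma wconv_nonneg:
  assumes p: "1 < p" and X: "loc_bounded p X" "loc_Lp p f" "wconv X f" and "\<And>m. AE t in lebesgue. 0 \<le> X m t"
  shows "AE t in lebesgue. 0 \<le> t \<longrightarrow> 0 \<le> f t"
proof -
  define y where "y = (\<lambda>t. if f t < 0 then 1 else 0 :: real)"
  have ym [measurable]: "y \<in> borel_measurable lebesgue"
    unfolding y_def using loc_LpD(2)[OF X(2)] by measurable
  have Xm [measurable]: "X m \<in> borel_measurable lebesgue" for m using loc_LpD(2)[OF loc_boundedD[OF X(1)]] .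
  have fy: "loc_Lp p (\<lambda>t. y t * f t)"
    by (rule loc_Lp_mult(1)[OF p X(2) ym, of 1]) (simp add: y_def)
  have w: "wconv (\<lambda>m t. y t * X m t) (\<lambda>t. y t * f t)"
    by (rule wconv_mult[OF p X, where c=1]) (auto simp: y_def intro: ym[unfolded y_def])
  have ge: "0 \<le> cell_integral (\<lambda>t. y t * X m t) n k" for m n k
    unfolding cell_integral_def
  proof (rule integral_nonneg_AE)
    show "AE t in lebesgue. 0 \<le> indicator (dyad n k) t * (y t * X m t)"
      using assms(5)[of m] by eventually_elim (simp add: y_def)
  qed
  have le: "indicator (dyad n k) t * (y t * f t) \<le> 0" for n k t
    by (auto simp: y_def indicator_def)
  have "cell_integral (\<lambda>t. y t * f t) n k = 0" for n k
  proof (rule antisym)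
    show "0 \<le> cell_integral (\<lambda>t. y t * f t) n k"
    proof (rule LIMSEQ_le_const)
      show "(\<lambda>m. cell_integral (\<lambda>t. y t * X m t) n k) \<longlonglongrightarrow> cell_integral (\<lambda>t. y t * f t) n k"
        using w by (simp add: wconv_def)
    qed (use ge in auto)
    have "cell_integral (\<lambda>t. y t * f t) n k \<le> integral\<^sup>L lebesgue (\<lambda>t :: real. 0 :: real)"
      unfolding cell_integral_def by (intro integral_mono loc_Lp_cell_integrable[OF p fy] le) auto
    thus "cell_integral (\<lambda>t. y t * f t) n k \<le> 0" by simp
  qed
  hence "AE t in lebesgue. 0 \<le> t \<longrightarrow> y t * f t = 0"
    by (intro AE_eq_if_cell_integrals_eq[OF p fy loc_Lp_0]) (simp add: cell_integral_def)
  thus ?thesis by eventually_elim (auto simp: y_def split: if_splits)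
qed

lemma cell_coarse: "0 \<le> t \<Longrightarrow> cell n t div 2 ^ n = cell 0 t"
proof (induction n)
  case (Suc n)
  have "cell (Suc n) t div 2 ^ Suc n = cell (Suc n) t div 2 div 2 ^ n" by (simp add: div_mult2_eq)
  thus ?case using Suc cell_Suc[of t n] by simp
qed simp

lemma dyad_unit: "t \<in> dyad n k \<Longrightarrow> cell 0 t = k div 2 ^ n"
  using cell_coarse[of t n] by (simp add: mem_dyad)

text \<open>Cell integrals are numbers indexed by a countable set, so one subsequence makes all of
  them converge. Their limits are additive under splitting of cells and define a martingale that
  inherits the modular bound; its limit in L^p is the weak limit on \<open>[0, N)\<close>. In this
  form weak compactness requires no duality.\<close>

lemma wconv_subseq_exists:
  fixes X :: "nat \<Rightarrow> 'j \<Rightarrow> real \<Rightarrow> real"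
  assumes p: "1 < p" and "finite J" and X: "\<And>j. j \<in> J \<Longrightarrow> loc_bounded p (\<lambda>m. X m j)"
  obtains s :: "nat \<Rightarrow> nat" and f where "strict_mono s" "\<And>j. j \<in> J \<Longrightarrow> loc_Lp p (f j)"
    "\<And>j. j \<in> J \<Longrightarrow> wconv (\<lambda>m. X (s m) j) (f j)"
proof -
  have "\<exists>D>0. \<forall>m. \<bar>cell_integral (X m j) n k\<bar> \<le> D" if j: "j \<in> J" for j n k
  proof -
    define N where "N = Suc k"
    have kN: "k < N * 2 ^ n" unfolding N_def by (rule less_Suc_mult)
    have L: "restr N (X m j) \<in> Lp_on p N" for m using X[OF j] by (auto simp: loc_bounded_def loc_LpD)
    obtain B where B: "\<And>m. modular p (restr N (X m j)) \<le> B"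
      using X[OF j] unfolding loc_bounded_def by blast
    have "\<bar>cell_integral (X m j) n k\<bar> \<le> 1 + 1 + B" for m
    proof -
      have "\<bar>cell_integral (X m j) n k\<bar> = \<bar>LINT t|lebesgue. restr N (X m j) t * indicator (dyad n k) t\<bar>"
        using cell_integral_restr[OF kN, of "X m j"] by (simp add: cell_integral_def mult.commute)
      also have "\<dots> \<le> 1 * (LINT t|lebesgue. \<bar>indicator (dyad n k) t :: real\<bar>) + 1 * 1 powr (1 - p) * B"
        by (rule integral_mult_modular_bound[OF p _ L B]) (auto intro!: AE_I2 split: split_indicator)
      also have "\<dots> = 1 / 2 ^ n + B" by (simp add: measure_dyad)
      also have "\<dots> \<le> 1 + B" by simp
      also have "\<dots> \<le> 1 + 1 + B" by simp
      finally show ?thesis .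
    qed
    moreover have "0 < 1 + 1 + B" using B[of 0] modular_nonneg[of p "restr N (X 0 j)"] by linarith
    ultimately show ?thesis by blast
  qed
  hence "\<forall>x. \<exists>D>0. fst x \<in> J \<longrightarrow> (\<forall>m. \<bar>cell_integral (X m (fst x)) (fst (snd x)) (snd (snd x))\<bar> \<le> D)"
    by (metis zero_less_one)
  then obtain D where D: "\<And>x. 0 < D x"
    "\<And>x m. fst x \<in> J \<Longrightarrow> \<bar>cell_integral (X m (fst x)) (fst (snd x)) (snd (snd x))\<bar> \<le> D x"
    by metis
  define F where "F m x = cell_integral (X m (fst x)) (fst (snd x)) (snd (snd x)) / D x" for m x
  have "countable (J \<times> (UNIV :: (nat \<times> nat) set))" using \<open>finite J\<close> by (simp add: countable_finite)
  then obtain s :: "nat \<Rightarrow> nat" where s: "strict_mono s"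
    "\<And>x. x \<in> J \<times> UNIV \<Longrightarrow> \<exists>l. (\<lambda>m. F (s m) x) \<longlonglongrightarrow> l"
  proof (rule function_convergent_subsequence[where f=F and M=1])
    fix m x assume "x \<in> J \<times> (UNIV :: (nat \<times> nat) set)"
    hence "fst x \<in> J" by auto
    thus "norm (F m x) \<le> 1" using D(1)[of x] D(2)[of x m] by (simp add: F_def abs_divide divide_le_eq)
  qed blast
  have "\<exists>l. (\<lambda>m. cell_integral (X (s m) j) n k) \<longlonglongrightarrow> l" if j: "j \<in> J" for j n k
  proof -
    obtain l where "(\<lambda>m. F (s m) (j, n, k)) \<longlonglongrightarrow> l" using s(2)[of "(j, n, k)"] j by auto
    hence "(\<lambda>m. F (s m) (j, n, k) * D (j, n, k)) \<longlonglongrightarrow> l * D (j, n, k)" by (intro tendsto_mult tendsto_const)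
    thus ?thesis using D(1)[of "(j, n, k)"] by (auto simp: F_def)
  qed
  then obtain L where L: "\<And>j n k. j \<in> J \<Longrightarrow> (\<lambda>m. cell_integral (X (s m) j) n k) \<longlonglongrightarrow> L j n k" by metis
  have "\<exists>g. g \<in> Lp_on p N \<and> (\<forall>n k. k < N * 2 ^ n \<longrightarrow> cell_integral g n k = L j n k)" if j: "j \<in> J" for j N
  proof -
    have R: "restr N (X m j) \<in> Lp_on p N" for m using X[OF j] by (auto simp: loc_bounded_def loc_LpD)
    obtain B where B: "\<And>m. modular p (restr N (X m j)) \<le> B" using X[OF j] unfolding loc_bounded_def by blast
    define c where "c n k = (if k < N * 2 ^ n then L j n k else 0)" for n k
    have c: "(\<lambda>m. cell_integral (restr N (X (s m) j)) n k) \<longlonglongrightarrow> c n k" for n k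
      using L[OF j, of n k] by (auto simp: c_def cell_integral_restr cell_integral_restr_outside)
    have c0: "N * 2 ^ n \<le> k \<Longrightarrow> c n k = 0" for n k by (simp add: c_def)
    define g where "g n = step n (c n)" for n
    have gL: "g n \<in> Lp_on p N" for n unfolding g_def by (rule step_Lp_on[OF p c0])
    have co: "cell_integral (g m) n k = c n k" if "n \<le> m" for n m k
      using that
    proof (induction n arbitrary: k rule: inc_induct)
      case base show ?case by (simp add: g_def)
    next
      case (step n)
      have "(\<lambda>i. cell_integral (restr N (X (s i) j)) (Suc n) (2 * k) + cell_integral (restr N (X (s i) j)) (Suc n) (2 * k + 1))
          \<longlonglongrightarrow> c (Suc n) (2 * k) + c (Suc n) (2 * k + 1)"
        by (intro tendsto_add c)
      hence "c n k = c (Suc n) (2 * k) + c (Suc n) (2 * k + 1)"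
        unfolding cell_integral_split[OF p R, symmetric] by (rule LIMSEQ_unique[OF c])
      thus ?case using cell_integral_split[OF p gL, of m n k] step.IH by simp
    qed
    have av: "avg n (g m) = g n" if "n \<le> m" for n m
    proof -
      have "cell_integral (g m) n = c n" using co[OF that] by blast
      thus ?thesis by (simp add: avg_def g_def)
    qed
    \<comment> \<open>The modular of a step function is a finite sum of powers of its cell
      integrals, so the bound passes to the limit of these numbers.\<close>
    have mg: "modular p (g n) \<le> B" for n
    proof -
      have "(\<lambda>m. \<Sum>k<N * 2 ^ n. \<bar>2 ^ n * cell_integral (restr N (X (s m) j)) n k\<bar> powr p / 2 ^ n)
          \<longlonglongrightarrow> (\<Sum>k<N * 2 ^ n. \<bar>2 ^ n * c n k\<bar> powr p / 2 ^ n)"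
        using p c by (intro tendsto_sum tendsto_divide tendsto_powr' tendsto_intros) auto
      moreover have "(\<Sum>k<N * 2 ^ n. \<bar>2 ^ n * cell_integral (restr N (X (s m) j)) n k\<bar> powr p / 2 ^ n) \<le> B" for m
      proof -
        have "(\<Sum>k<N * 2 ^ n. \<bar>2 ^ n * cell_integral (restr N (X (s m) j)) n k\<bar> powr p / 2 ^ n)
            = modular p (avg n (restr N (X (s m) j)))"
          unfolding avg_def by (rule modular_step[OF p, symmetric]) (simp add: cell_integral_restr_outside)
        also have "\<dots> \<le> B" by (rule order_trans[OF modular_avg_le[OF p R] B])
        finally show ?thesis .
      qed
      ultimately have "(\<Sum>k<N * 2 ^ n. \<bar>2 ^ n * c n k\<bar> powr p / 2 ^ n) \<le> B"
        by (intro LIMSEQ_le_const2) auto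
      thus ?thesis unfolding g_def using modular_step[OF p c0] by simp
    qed
    obtain h where h: "h \<in> Lp_on p N" "(\<lambda>m. modular p (\<lambda>t. g m t - h t)) \<longlonglongrightarrow> 0"
      using Lp_on_complete[OF p gL bounded_martingale_Cauchy[OF p gL av mg]] by blast
    have "cell_integral h n k = c n k" for n k
    proof (rule LIMSEQ_unique[OF cell_integral_tendsto[OF p gL h]])
      show "(\<lambda>m. cell_integral (g m) n k) \<longlonglongrightarrow> c n k"
        by (intro tendsto_eventually eventually_sequentiallyI[of n] co)
    qed
    thus ?thesis using h(1) by (auto simp: c_def)
  qed
  then obtain g where g: "\<And>j N. j \<in> J \<Longrightarrow> g j N \<in> Lp_on p N"
    "\<And>j N n k. j \<in> J \<Longrightarrow> k < N * 2 ^ n \<Longrightarrow> cell_integral (g j N) n k = L j n k"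
    by metis
  \<comment> \<open>\<open>Suc (cell 0 t)\<close> is the least integer strictly above
    \<open>t\<close>. Limits built for different intervals agree only almost everywhere, so one
    representative is fixed on each unit interval.\<close>
  define f where "f j t = (if 0 \<le> t then g j (Suc (cell 0 t)) t else 0)" for j t
  have f_sum: "restr N (f j) t = (\<Sum>i<N. indicator (dyad 0 i) t * g j (Suc i) t)" for N j t
  proof (cases "t \<in> {0..<real N}")
    case True
    hence "(\<Sum>i<N. indicator (dyad 0 i) t * g j (Suc i) t) = (\<Sum>i<N. if i = cell 0 t then g j (Suc i) t else 0)"
      by (intro sum.cong) (auto simp: indicator_def mem_dyad)
    also have "\<dots> = f j t" using True cell_less[of t N 0] by (simp add: f_def)
    finally show ?thesis using True by (simp add: restr_inside)
  next
    case False
    have "indicator (dyad 0 i) t = (0::real)" if "i < N" for i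
      using dyad_subset[of i N 0] that False by (auto simp: indicator_def)
    thus ?thesis using False by (simp add: restr_outside)
  qed
  have gi: "(\<lambda>t. indicator (dyad 0 i) t * g j (Suc i) t) \<in> Lp_on p N" if "j \<in> J" "i < N" for i j N
  proof -
    note G = Lp_onD[OF g(1)[OF that(1), of "Suc i"]]
    have "integrable lebesgue (\<lambda>t. \<bar>indicator (dyad 0 i) t * g j (Suc i) t\<bar> powr p)"
      by (rule Bochner_Integration.integrable_bound[OF G(2)])
        (use G(1) p in \<open>auto simp: indicator_def intro!: AE_I2\<close>)
    moreover have "(\<lambda>t. indicator (dyad 0 i) t * g j (Suc i) t) \<in> borel_measurable lebesgue" using G(1) by measurable
    ultimately show ?thesis using dyad_subset[of i N 0] that by (auto simp: Lp_on_def indicator_def)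
  qed
  have rL: "restr N (f j) \<in> Lp_on p N" if "j \<in> J" for j N
  proof -
    have "restr N (f j) = (\<lambda>t. \<Sum>i<N. indicator (dyad 0 i) t * g j (Suc i) t)" using f_sum by blast
    thus ?thesis using Lp_on_sum[OF p, of "{..<N}" "\<lambda>i t. indicator (dyad 0 i) t * g j (Suc i) t" N] gi that by simp
  qed
  have fm: "f j \<in> borel_measurable lebesgue" if "j \<in> J" for j
  proof (rule borel_measurable_LIMSEQ_real)
    show "restr N (f j) \<in> borel_measurable lebesgue" for N by (rule Lp_onD(1)[OF rL[OF that]])
    fix t :: real
    obtain N0 :: nat where N0: "t < real N0" using reals_Archimedean2 by blast
    show "(\<lambda>N. restr N (f j) t) \<longlonglongrightarrow> f j t"
    proof (intro tendsto_eventually eventually_sequentiallyI[of N0])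
      fix N assume "N0 \<le> N"
      hence "t < real N" using N0 by linarith
      thus "restr N (f j) t = f j t" by (simp add: restr_def f_def indicator_def)
    qed
  qed
  show ?thesis
  proof (rule that[of s f])
    show "strict_mono s" by (rule s)
    fix j assume j: "j \<in> J"
    show "loc_Lp p (f j)" using rL[OF j] fm[OF j] by (simp add: loc_Lp_def)
    have "cell_integral (f j) n k = L j n k" for n k
    proof -
      define i where "i = k div 2 ^ n"
      have "cell_integral (f j) n k = cell_integral (g j (Suc i)) n k"
        unfolding cell_integral_def
        by (rule Bochner_Integration.integral_cong) (auto simp: indicator_def f_def i_def mem_dyad dyad_unit[unfolded mem_dyad])
      also have "\<dots> = L j n k"
      proof (rule g(2)[OF j])
        have "k = k div 2 ^ n * 2 ^ n + k mod 2 ^ n" by (rule div_mult_mod_eq[symmetric])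
        moreover have "k mod 2 ^ n < 2 ^ n" by simp
        ultimately show "k < Suc i * 2 ^ n" unfolding i_def by (metis add.commute add_less_cancel_right mult_Suc)
      qed
      finally show ?thesis .
    qed
    thus "wconv (\<lambda>m. X (s m) j) (f j)" using L[OF j] by (simp add: wconv_def)
  qed
qed

section \<open>Weak convergence and bounded functionals\<close>

lemma Lp_norm_modular: "Lp_norm p f = modular p f powr (1 / p)"
  by (simp add: Lp_norm_def modular_def)

lemma Lp_norm_nonneg [simp]: "0 \<le> Lp_norm p f"
  by (simp add: Lp_norm_def)

lemma Lp_norm_le_vec_norm: "finite J \<Longrightarrow> j \<in> J \<Longrightarrow> Lp_norm p (f j) \<le> vec_norm p J f"
  unfolding vec_norm_def by (intro Max_ge) auto

lemma Lp_on_Lp_space: "f \<in> Lp_on p N \<Longrightarrow> f \<in> Lp_space p"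
  by (simp add: Lp_on_def Lp_space_def)

lemma Lp_space_restr:
  assumes "0 < p" "f \<in> Lp_space p"
  shows "restr N f \<in> Lp_on p N" "modular p (restr N f) \<le> modular p f"
proof -
  have f: "f \<in> borel_measurable lebesgue" "integrable lebesgue (\<lambda>t. \<bar>f t\<bar> powr p)"
    using assms by (auto simp: Lp_space_def)
  have m: "restr N f \<in> borel_measurable lebesgue" unfolding restr_def using f by measurable
  have le: "\<bar>restr N f t\<bar> powr p \<le> \<bar>f t\<bar> powr p" for t using assms(1) by (auto simp: restr_def indicator_def)
  have "integrable lebesgue (\<lambda>t. \<bar>restr N f t\<bar> powr p)"
    by (rule Bochner_Integration.integrable_bound[OF f(2)]) (use m le in \<open>auto intro!: AE_I2\<close>)
  thus "restr N f \<in> Lp_on p N" "modular p (restr N f) \<le> modular p f"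
    using m le f by (auto simp: Lp_on_def restr_outside modular_def intro!: integral_mono)
qed

lemma Lp_space_loc_Lp: "0 < p \<Longrightarrow> f \<in> Lp_space p \<Longrightarrow> loc_Lp p f"
  using Lp_space_restr(1) by (auto simp: loc_Lp_def Lp_space_def)

lemma cell_integral_bounded_functional:
  assumes p: "1 < p" and "finite J" "j \<in> J"
  shows "bounded_functional p J (\<lambda>f. cell_integral (f j) n k)"
  unfolding bounded_functional_def
proof (intro conjI ballI allI)
  show "cell_integral (\<lambda>t. f j t + g j t) n k = cell_integral (f j) n k + cell_integral (g j) n k"
    if "f \<in> J \<rightarrow> Lp_space p" "g \<in> J \<rightarrow> Lp_space p" for f g
    using that p assms(3) by (intro cell_integral_add_loc[OF p] Lp_space_loc_Lp) auto
  show "cell_integral (\<lambda>t. c * f j t) n k = c * cell_integral (f j) n k" for c and f :: "'a \<Rightarrow> real \<Rightarrow> real"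
    by (rule cell_integral_scale)
  define N where "N = Suc k"
  have kN: "k < N * 2 ^ n" unfolding N_def by (rule less_Suc_mult)
  \<comment> \<open>This is the norm of the cell indicator in L^q for the conjugate exponent
    \<open>q\<close>, as in Hoelder's inequality; it comes out of Jensen's inequality on the
    cell.\<close>
  define K where "K = (2 ^ n) powr (1 / p) / 2 ^ n"
  have "\<bar>cell_integral (f j) n k\<bar> \<le> K * vec_norm p J f" if f: "f \<in> J \<rightarrow> Lp_space p" for f
  proof -
    have fj: "f j \<in> Lp_space p" using f assms(3) by auto
    have R: "restr N (f j) \<in> Lp_on p N" using Lp_space_restr(1)[OF _ fj] p by simp
    have ip: "integrable lebesgue (\<lambda>t. \<bar>restr N (f j) t\<bar> powr p)" by (rule Lp_onD[OF R])
    define a where "a = \<bar>2 ^ n * cell_integral (f j) n k\<bar>"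
    have "a powr p / 2 ^ n \<le> (LINT t|lebesgue. indicator (dyad n k) t * \<bar>restr N (f j) t\<bar> powr p)"
      unfolding a_def using cell_integral_powr_le[OF p R, of n k] cell_integral_restr[OF kN] by simp
    also have "\<dots> \<le> modular p (restr N (f j))"
      unfolding modular_def
      using ip integrable_mult_indicator[OF dyad_lebesgue ip] by (intro integral_mono) (auto simp: indicator_def)
    also have "\<dots> \<le> modular p (f j)" using Lp_space_restr(2)[OF _ fj] p by simp
    finally have "a powr p \<le> 2 ^ n * modular p (f j)" by (simp add: field_simps)
    hence "(a powr p) powr (1 / p) \<le> (2 ^ n * modular p (f j)) powr (1 / p)" using p by (intro powr_mono2) auto
    moreover have "(a powr p) powr (1 / p) = a" using p by (simp add: powr_powr a_def)
    moreover have "(2 ^ n * modular p (f j)) powr (1 / p) = (2 ^ n) powr (1 / p) * Lp_norm p (f j)"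
      by (simp add: powr_mult Lp_norm_modular)
    ultimately have "2 ^ n * \<bar>cell_integral (f j) n k\<bar> \<le> (2 ^ n) powr (1 / p) * Lp_norm p (f j)"
      by (simp add: a_def abs_mult)
    hence "\<bar>cell_integral (f j) n k\<bar> \<le> K * Lp_norm p (f j)" by (simp add: K_def field_simps)
    also have "\<dots> \<le> K * vec_norm p J f"
      using Lp_norm_le_vec_norm[OF assms(2,3), of p f] by (intro mult_left_mono) (auto simp: K_def)
    finally show ?thesis .
  qed
  thus "\<exists>K. \<forall>f\<in>J \<rightarrow> Lp_space p. \<bar>cell_integral (f j) n k\<bar> \<le> K * vec_norm p J f" by blast
qed

lemma weakly_converges_imp_wconv:
  assumes "1 < p" "finite J" "j \<in> J" "weakly_converges p J X f"
  shows "wconv (\<lambda>m. X m j) (f j)"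
  unfolding wconv_def
  using assms(4) cell_integral_bounded_functional[OF assms(1-3)] unfolding weakly_converges_def by blast

text \<open>On step functions a bounded functional is integration against a step function \<open>g k\<close>. Testing
  with \<open>\<bar>g k\<bar> powr (q - 1)\<close> shows that the martingale \<open>g\<close> is bounded in \<open>L\<^sup>q\<close>, hence Cauchy.\<close>

lemma bounded_functional_tendsto:
  fixes \<phi> :: "(real \<Rightarrow> real) \<Rightarrow> real"
  assumes p: "1 < p"
    and add: "\<And>f g. f \<in> Lp_space p \<Longrightarrow> g \<in> Lp_space p \<Longrightarrow> \<phi> (\<lambda>t. f t + g t) = \<phi> f + \<phi> g"
    and scale: "\<And>c f. f \<in> Lp_space p \<Longrightarrow> \<phi> (\<lambda>t. c * f t) = c * \<phi> f"
    and bd: "\<And>f. f \<in> Lp_space p \<Longrightarrow> \<bar>\<phi> f\<bar> \<le> K * Lp_norm p f"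
    and X: "\<And>m. X m \<in> Lp_on p N" "\<And>m. modular p (X m) \<le> B" and f: "f \<in> Lp_on p N"
    and w: "wconv X f"
  shows "(\<lambda>m. \<phi> (X m)) \<longlonglongrightarrow> \<phi> f"
proof -
  define q where "q = p / (p - 1)"
  have q: "1 < q" "1 / p + 1 / q = 1" "(q - 1) * p = q" using p by (auto simp: q_def field_simps)
  have K0: "K * Lp_norm p f \<le> \<bar>K\<bar> * Lp_norm p f" for f by (intro mult_right_mono) auto
  have bd': "\<bar>\<phi> h\<bar> \<le> \<bar>K\<bar> * modular p h powr (1 / p)" if "h \<in> Lp_space p" for h
    using order_trans[OF bd[OF that] K0] by (simp add: Lp_norm_modular)
  have diff: "\<phi> (\<lambda>t. f t - g t) = \<phi> f - \<phi> g" if "f \<in> Lp_on p N" "g \<in> Lp_on p N" for f g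
    using add[of f "\<lambda>t. -1 * g t"] scale[of g "-1"] that Lp_on_scale[OF that(2), of "-1"]
    by (auto dest!: Lp_on_Lp_space)
  have ind: "(indicator (dyad n k) :: real \<Rightarrow> real) \<in> Lp_on p N" if "k < N * 2 ^ n" for n k
    using dyad_subset[OF that] p by (intro Lp_on_bounded[of _ _ 1]) (auto simp: indicator_def)
  define c where "c n k = (if k < N * 2 ^ n then \<phi> (indicator (dyad n k)) else 0)" for n k
  define g where "g n = step n (c n)" for n
  have c0: "N * 2 ^ n \<le> k \<Longrightarrow> c n k = 0" for n k by (simp add: c_def)
  have gL: "g n \<in> Lp_on r N" if "1 < r" for n r unfolding g_def by (rule step_Lp_on[OF that c0])
  have sum: "\<phi> (\<lambda>t. \<Sum>k\<in>A. a k * indicator (dyad n k) t) = (\<Sum>k\<in>A. a k * c n k)"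
    if "finite A" "A \<subseteq> {..<N * 2 ^ n}" for A a n
    using that
  proof (induction A rule: finite_induct)
    case empty
    have "(\<lambda>t. 0) \<in> Lp_space p" by (simp add: Lp_space_def)
    from scale[OF this, of 0] show ?case by simp
  next
    case (insert x A)
    have 1: "indicator (dyad n x) \<in> Lp_on p N" using insert.prems by (intro ind) auto
    have 2: "(\<lambda>t. \<Sum>k\<in>A. a k * indicator (dyad n k) t) \<in> Lp_on p N"
      using insert.prems by (intro Lp_on_sum[OF p] Lp_on_scale ind) auto
    have "\<phi> (\<lambda>t. \<Sum>k\<in>insert x A. a k * indicator (dyad n k) t)
        = \<phi> (\<lambda>t. a x * indicator (dyad n x) t + (\<Sum>k\<in>A. a k * indicator (dyad n k) t))"
      by (simp only: sum.insert[OF insert.hyps])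
    also have "\<dots> = a x * \<phi> (indicator (dyad n x)) + \<phi> (\<lambda>t. \<Sum>k\<in>A. a k * indicator (dyad n k) t)"
      using add[OF Lp_on_Lp_space[OF Lp_on_scale[OF 1]] Lp_on_Lp_space[OF 2]] scale[OF Lp_on_Lp_space[OF 1]] by simp
    also have "\<phi> (indicator (dyad n x)) = c n x" using insert.prems by (simp add: c_def)
    finally show ?case using insert by simp
  qed
  have step: "\<phi> (step n a) = (\<Sum>k<N * 2 ^ n. 2 ^ n * a k * c n k)" if "\<And>k. N * 2 ^ n \<le> k \<Longrightarrow> a k = 0" for n a
  proof -
    have "step n a = (\<lambda>t. \<Sum>k<N * 2 ^ n. (2 ^ n * a k) * indicator (dyad n k) t)" using step_eq_sum[of N n a] that by blast
    thus ?thesis using sum[where A="{..<N * 2 ^ n}" and a="\<lambda>k. 2 ^ n * a k" and n=n] by (simp only: finite_lessThan subset_refl)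
  qed
  have split: "c n k = c (Suc n) (2 * k) + c (Suc n) (2 * k + 1)" for n k
  proof (cases "k < N * 2 ^ n")
    case True
    have "\<phi> (indicator (dyad n k)) = \<phi> (\<lambda>t. indicator (dyad (Suc n) (2 * k)) t + indicator (dyad (Suc n) (2 * k + 1)) t)"
      using dyad_split[of n k] by (intro arg_cong[where f=\<phi>]) auto
    also have "\<dots> = \<phi> (indicator (dyad (Suc n) (2 * k))) + \<phi> (indicator (dyad (Suc n) (2 * k + 1)))"
      using True by (intro add Lp_on_Lp_space[of _ p N] ind) auto
    finally show ?thesis using True by (simp add: c_def)
  qed (auto simp: c_def)
  have co: "cell_integral (g m) n k = c n k" if "n \<le> m" for n m k
    using that
  proof (induction n arbitrary: k rule: inc_induct)
    case base show ?case by (simp add: g_def)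
  next
    case (step n)
    thus ?case using cell_integral_split[OF p gL[OF p], of m n k] split[of n k] by simp
  qed
  have av: "avg n (g m) = g n" if "n \<le> m" for n m
  proof -
    have "cell_integral (g m) n = c n" using co[OF that] by blast
    thus ?thesis by (simp add: avg_def g_def)
  qed
  have mg: "modular q (g n) \<le> \<bar>K\<bar> powr q" for n
  proof -
    define A where "A = modular q (g n)"
    have A: "A = (\<Sum>k<N * 2 ^ n. \<bar>2 ^ n * c n k\<bar> powr q / 2 ^ n)"
      unfolding A_def g_def by (rule modular_step[OF q(1) c0])
    \<comment> \<open>The sign makes every term of the pairing nonnegative, and
      \<open>(q - 1) * p = q\<close> makes the \<open>p\<close>-modular of the test function equal
      to the \<open>q\<close>-modular \<open>A\<close> of \<open>g n\<close>. The bound on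
      \<open>\<phi>\<close> then reads \<open>A \<le> \<bar>K\<bar> * A powr (1 / p)\<close>, which
      bounds \<open>A\<close> itself.\<close>
    define a where "a k = sgn (c n k) * \<bar>2 ^ n * c n k\<bar> powr (q - 1) / 2 ^ n" for k
    have a0: "N * 2 ^ n \<le> k \<Longrightarrow> a k = 0" for k using c0 by (simp add: a_def)
    have "2 ^ n * a k * c n k = \<bar>2 ^ n * c n k\<bar> powr q / 2 ^ n" for k
    proof (cases "c n k = 0")
      case False
      have "\<bar>2 ^ n * c n k\<bar> powr q = \<bar>2 ^ n * c n k\<bar> powr (q - 1) * \<bar>2 ^ n * c n k\<bar>"
        using False powr_add[of "\<bar>2 ^ n * c n k\<bar>" "q - 1" 1] by simp
      thus ?thesis by (simp add: a_def abs_mult sgn_if)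
    qed (use q in simp)
    hence "\<phi> (step n a) = A" using step[where n=n and a=a] a0 unfolding A by simp
    moreover have "modular p (step n a) = A"
    proof -
      have "\<bar>2 ^ n * a k\<bar> powr p = \<bar>2 ^ n * c n k\<bar> powr q" for k
        using q by (cases "c n k = 0") (auto simp: a_def abs_mult powr_powr abs_sgn_eq)
      thus ?thesis unfolding A using modular_step[of p N n a] p a0 by simp
    qed
    moreover have "A \<ge> 0" by (simp add: A_def)
    ultimately have 1: "A \<le> \<bar>K\<bar> * A powr (1 / p)"
      using bd'[OF Lp_on_Lp_space[OF step_Lp_on[of p N n a]]] p a0 by simp
    show ?thesis
    proof (cases "A = 0")
      case False
      hence A0: "0 < A" using \<open>0 \<le> A\<close> by simp
      have "A = A powr (1 / p) * A powr (1 / q)" using A0 q by (simp flip: powr_add)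
      hence "A powr (1 / p) * A powr (1 / q) \<le> A powr (1 / p) * \<bar>K\<bar>" using 1 by (simp add: mult.commute)
      hence "A powr (1 / q) \<le> \<bar>K\<bar>" using A0 by simp
      hence "(A powr (1 / q)) powr q \<le> \<bar>K\<bar> powr q" using q by (intro powr_mono2) auto
      thus ?thesis using A0 q by (simp add: powr_powr A_def)
    qed (simp add: A_def)
  qed
  have int_step: "\<phi> (avg n h) = (LINT t|lebesgue. h t * g n t)" if h: "h \<in> Lp_on p N" for h n
  proof -
    have "N * 2 ^ n \<le> k \<Longrightarrow> cell_integral h n k = 0" for k by (rule cell_integral_outside[OF Lp_onD(3)[OF h]])
    hence "\<phi> (avg n h) = (\<Sum>k<N * 2 ^ n. 2 ^ n * cell_integral h n k * c n k)"
      unfolding avg_def by (intro step)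
    also have "\<dots> = (LINT t|lebesgue. h t * g n t)"
      using integral_times_step[of p h N n "c n", OF p h c0] by (simp add: g_def mult_ac)
    finally show ?thesis .
  qed
  \<comment> \<open>The pairing of \<open>h\<close> with \<open>g n\<close> equals
    \<open>\<phi> (avg n h)\<close>. The functional is continuous and the averages tend to
    \<open>h\<close> in L^p.\<close>
  have lim: "(\<lambda>n. LINT t|lebesgue. h t * g n t) \<longlonglongrightarrow> \<phi> h" if h: "h \<in> Lp_on p N" for h
  proof -
    have "(\<lambda>n. \<phi> (avg n h) - \<phi> h) \<longlonglongrightarrow> 0"
    proof (rule Lim_null_comparison)
      show "\<forall>\<^sub>F n in sequentially. norm (\<phi> (avg n h) - \<phi> h) \<le> \<bar>K\<bar> * modular p (\<lambda>t. avg n h t - h t) powr (1 / p)"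
        using bd'[OF Lp_on_Lp_space[OF Lp_on_diff[OF p avg_Lp_on[OF p h] h]]] diff[OF avg_Lp_on[OF p h] h]
        by (intro always_eventually) simp
      have "(\<lambda>n. \<bar>K\<bar> * modular p (\<lambda>t. avg n h t - h t) powr (1 / p)) \<longlonglongrightarrow> \<bar>K\<bar> * 0 powr (1 / p)"
        using p by (intro tendsto_mult tendsto_const tendsto_powr' avg_tendsto[OF p h]) auto
      thus "(\<lambda>n. \<bar>K\<bar> * modular p (\<lambda>t. avg n h t - h t) powr (1 / p)) \<longlonglongrightarrow> 0" using p by simp
    qed
    thus ?thesis unfolding int_step[OF h] by (simp add: LIM_zero_iff)
  qed
  define B' where "B' = max B (modular p f)"
  have B': "modular p (X m) \<le> B'" "modular p f \<le> B'" "0 \<le> B'" for m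
    using X(2)[of m] by (auto simp: B'_def le_max_iff_disj)
  have uniform: "\<exists>k. \<forall>h\<in>Lp_on p N. modular p h \<le> B' \<longrightarrow> \<bar>\<phi> h - (LINT t|lebesgue. h t * g k t)\<bar> \<le> e"
    if "0 < e" for e
  proof -
    \<comment> \<open>Young's inequality is applied to \<open>s * \<bar>h t\<bar>\<close> and
      \<open>\<bar>z t\<bar> / s\<close>. The weight \<open>s\<close> is so small that the share of
      \<open>h\<close> is at most \<open>e / 2\<close> for every \<open>h\<close> with modular at
      most \<open>B'\<close>; only then is \<open>k\<close> chosen, depending on
      \<open>s\<close>.\<close>
    define s where "s = (e / (2 * (B' + 1))) powr (1 / p)"
    have s: "0 < s" using \<open>0 < e\<close> B'(3) by (simp add: s_def)
    have sp: "s powr p * B' \<le> e / 2"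
    proof -
      have "s powr p = e / (2 * (B' + 1))" using \<open>0 < e\<close> B'(3) p by (simp add: s_def powr_powr)
      hence "s powr p * B' = e / 2 * (B' / (B' + 1))" by simp
      also have "\<dots> \<le> e / 2 * 1" using \<open>0 < e\<close> B'(3) by (intro mult_left_mono) (auto simp: divide_le_eq_1)
      finally show ?thesis by simp
    qed
    have "0 < s powr q * (e / 2)" using s \<open>0 < e\<close> by simp
    from bounded_martingale_Cauchy[OF q(1) gL[OF q(1)] av mg this]
    obtain k where k: "\<And>n. k \<le> n \<Longrightarrow> modular q (\<lambda>t. g n t - g k t) \<le> s powr q * (e / 2)" by blast
    show ?thesis
    proof (intro exI[of _ k] ballI impI)
      fix h assume h: "h \<in> Lp_on p N" "modular p h \<le> B'"
      have dL: "(\<lambda>t. g n t - g k t) \<in> Lp_on q N" for n by (intro Lp_on_diff q gL)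
      have gi: "integrable lebesgue (\<lambda>t. h t * g n t)" for n
      proof -
        have "g n \<in> Lp_on q N" by (rule gL[OF q(1)])
        have y: "\<bar>h t * g n t\<bar> \<le> \<bar>h t\<bar> powr p / p + \<bar>g n t\<bar> powr q / q" for t
          using Youngs_inequality[OF p q(1,2), of "\<bar>h t\<bar>" "\<bar>g n t\<bar>"] by (simp add: abs_mult)
        show ?thesis
          by (rule Bochner_Integration.integrable_bound[of _ "\<lambda>t. \<bar>h t\<bar> powr p / p + \<bar>g n t\<bar> powr q / q"])
            (use Lp_onD(1,2)[OF h(1)] Lp_onD(1,2)[OF \<open>g n \<in> Lp_on q N\<close>] y in \<open>auto intro!: AE_I2 order_trans[OF y abs_ge_self]\<close>)
      qed
      have bnd: "\<bar>(LINT t|lebesgue. h t * g n t) - (LINT t|lebesgue. h t * g k t)\<bar> \<le> e" if "k \<le> n" for n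
      proof -
        define z where "z = (\<lambda>t. g n t - g k t)"
        have zL: "z \<in> Lp_on q N" unfolding z_def by (rule dL)
        have y: "\<bar>h t * z t\<bar> \<le> s powr p * \<bar>h t\<bar> powr p + (1 / s powr q) * \<bar>z t\<bar> powr q" for t
        proof -
          have "\<bar>h t * z t\<bar> = (s * \<bar>h t\<bar>) * (\<bar>z t\<bar> / s)" using s by (simp add: abs_mult)
          also have "\<dots> \<le> (s * \<bar>h t\<bar>) powr p / p + (\<bar>z t\<bar> / s) powr q / q"
            using s by (intro Youngs_inequality[OF p q(1,2)]) auto
          also have "\<dots> \<le> (s * \<bar>h t\<bar>) powr p + (\<bar>z t\<bar> / s) powr q"
            using p q by (intro add_mono) (auto simp: divide_le_eq mult_le_cancel_left1)
          also have "\<dots> = s powr p * \<bar>h t\<bar> powr p + (1 / s powr q) * \<bar>z t\<bar> powr q"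
            using s by (simp add: powr_mult powr_divide)
          finally show ?thesis .
        qed
        have "(LINT t|lebesgue. h t * g n t) - (LINT t|lebesgue. h t * g k t) = (LINT t|lebesgue. h t * z t)"
          using gi by (simp add: z_def right_diff_distrib)
        also have "\<bar>\<dots>\<bar> \<le> (LINT t|lebesgue. \<bar>h t * z t\<bar>)" by (rule integral_abs_bound)
        also have "\<dots> \<le> (LINT t|lebesgue. s powr p * \<bar>h t\<bar> powr p + (1 / s powr q) * \<bar>z t\<bar> powr q)"
        proof (rule integral_mono)
          have "integrable lebesgue (\<lambda>t. h t * g n t - h t * g k t)" using gi by simp
          thus "integrable lebesgue (\<lambda>t. \<bar>h t * z t\<bar>)"
            by (intro integrable_abs) (simp only: z_def right_diff_distrib)
          show "integrable lebesgue (\<lambda>t. s powr p * \<bar>h t\<bar> powr p + (1 / s powr q) * \<bar>z t\<bar> powr q)"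
            using Lp_onD(2)[OF h(1)] Lp_onD(2)[OF zL] by simp
        qed (rule y)
        also have "\<dots> = s powr p * modular p h + modular q z / s powr q"
          using Lp_onD(2)[OF h(1)] Lp_onD(2)[OF zL] by (simp add: modular_def)
        also have "\<dots> \<le> e / 2 + e / 2"
        proof (intro add_mono)
          show "s powr p * modular p h \<le> e / 2"
            by (rule order_trans[OF mult_left_mono[OF h(2)] sp]) simp
          show "modular q z / s powr q \<le> e / 2" using k[OF that] s by (simp add: z_def divide_le_eq mult.commute)
        qed
        finally show ?thesis by simp
      qed
      have "(\<lambda>n. \<bar>(LINT t|lebesgue. h t * g n t) - (LINT t|lebesgue. h t * g k t)\<bar>)
          \<longlonglongrightarrow> \<bar>\<phi> h - (LINT t|lebesgue. h t * g k t)\<bar>"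
        by (intro tendsto_rabs tendsto_diff tendsto_const lim h)
      thus "\<bar>\<phi> h - (LINT t|lebesgue. h t * g k t)\<bar> \<le> e"
        by (rule LIMSEQ_le_const2) (use bnd in blast)
    qed
  qed
  show ?thesis
  proof (rule LIMSEQ_I)
    fix e :: real assume "0 < e"
    obtain k where k: "\<And>h. h \<in> Lp_on p N \<Longrightarrow> modular p h \<le> B' \<Longrightarrow> \<bar>\<phi> h - (LINT t|lebesgue. h t * g k t)\<bar> \<le> e / 3"
      using uniform[of "e / 3"] \<open>0 < e\<close> by auto
    have "(\<lambda>m. LINT t|lebesgue. X m t * g k t) \<longlonglongrightarrow> (LINT t|lebesgue. f t * g k t)"
    proof -
      have eq: "(LINT t|lebesgue. h t * g k t) = (\<Sum>j<N * 2 ^ k. 2 ^ k * c k j * cell_integral h k j)"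
        if "h \<in> Lp_on p N" for h
        unfolding g_def by (rule integral_times_step[OF p that c0])
      show ?thesis unfolding eq[OF X(1)] eq[OF f]
        using w by (intro tendsto_sum tendsto_mult tendsto_const) (auto simp: wconv_def)
    qed
    from LIMSEQ_D[OF this, of "e / 3"] obtain M where
      M: "\<And>m. M \<le> m \<Longrightarrow> \<bar>(LINT t|lebesgue. X m t * g k t) - (LINT t|lebesgue. f t * g k t)\<bar> < e / 3"
      using \<open>0 < e\<close> by auto
    have "\<bar>\<phi> (X m) - \<phi> f\<bar> < e" if "M \<le> m" for m
      using k[OF X(1) B'(1), of m] k[OF f B'(2)] M[OF that] by linarith
    thus "\<exists>M. \<forall>m\<ge>M. norm (\<phi> (X m) - \<phi> f) < e" by auto
  qed
qed

section \<open>Functionals on vectors of functions\<close>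

lemma vec_norm_nonneg: "finite J \<Longrightarrow> 0 \<le> vec_norm p J f"
  unfolding vec_norm_def by (intro Max_ge) auto

lemma vec_norm_le: "finite J \<Longrightarrow> 0 \<le> b \<Longrightarrow> (\<And>j. j \<in> J \<Longrightarrow> Lp_norm p (f j) \<le> b) \<Longrightarrow> vec_norm p J f \<le> b"
  unfolding vec_norm_def by (intro Max.boundedI) auto

lemma Lp_norm_cong_AE:
  assumes "AE t in lebesgue. f t = g t" "f \<in> borel_measurable lebesgue" "g \<in> borel_measurable lebesgue"
  shows "Lp_norm p f = Lp_norm p g"
proof -
  have "(LINT t|lebesgue. \<bar>f t\<bar> powr p) = (LINT t|lebesgue. \<bar>g t\<bar> powr p)"
  proof (rule integral_cong_AE)
    show "AE t in lebesgue. \<bar>f t\<bar> powr p = \<bar>g t\<bar> powr p" using assms(1) by eventually_elim simp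
  qed (use assms in measurable)
  thus ?thesis by (simp add: Lp_norm_def)
qed

lemma Lp_space_add: "1 < p \<Longrightarrow> f \<in> Lp_space p \<Longrightarrow> g \<in> Lp_space p \<Longrightarrow> (\<lambda>t. f t + g t) \<in> Lp_space p"
proof -
  assume p: "1 < p" and f: "f \<in> Lp_space p" "g \<in> Lp_space p"
  have "integrable lebesgue (\<lambda>t. \<bar>f t + g t\<bar> powr p)"
    by (rule Bochner_Integration.integrable_bound
        [where f="\<lambda>t. 2 powr p * (\<bar>f t\<bar> powr p + \<bar>g t\<bar> powr p)"])
      (use f powr_add_le[OF p] in \<open>auto simp: Lp_space_def\<close>)
  thus ?thesis using f by (auto simp: Lp_space_def)
qed

lemma Lp_space_scale: "f \<in> Lp_space p \<Longrightarrow> (\<lambda>t. c * f t) \<in> Lp_space p"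
  by (auto simp: Lp_space_def abs_mult powr_mult)

lemma Lp_space_0: "(\<lambda>t. 0) \<in> Lp_space p"
  by (simp add: Lp_space_def)

lemma bounded_functional_add:
  assumes "bounded_functional p J \<phi>" "f \<in> J \<rightarrow> Lp_space p" "g \<in> J \<rightarrow> Lp_space p"
  shows "\<phi> (\<lambda>j t. f j t + g j t) = \<phi> f + \<phi> g"
  by (rule bspec[OF bspec[OF conjunct1[OF assms(1)[unfolded bounded_functional_def]] assms(2)] assms(3)])

lemma bounded_functional_scale:
  assumes "bounded_functional p J \<phi>" "f \<in> J \<rightarrow> Lp_space p"
  shows "\<phi> (\<lambda>j t. c * f j t) = c * \<phi> f"
  by (rule bspec[OF spec[OF conjunct1[OF conjunct2[OF assms(1)[unfolded bounded_functional_def]]]] assms(2)])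

text \<open>The difference of the two vectors has norm 0, so the bound forces the functional to
  vanish on it. This permits resetting functions that vanish outside a bounded interval only almost
  everywhere.\<close>

lemma bounded_functional_cong_AE:
  assumes p: "1 < p" and J: "finite J" and \<phi>: "bounded_functional p J \<phi>"
    and fg: "f \<in> J \<rightarrow> Lp_space p" "g \<in> J \<rightarrow> Lp_space p" and ae: "\<And>j. j \<in> J \<Longrightarrow> AE t in lebesgue. f j t = g j t"
  shows "\<phi> f = \<phi> g"
proof -
  note b = \<phi>[unfolded bounded_functional_def]
  obtain K where K: "\<And>f. f \<in> J \<rightarrow> Lp_space p \<Longrightarrow> \<bar>\<phi> f\<bar> \<le> K * vec_norm p J f" using b by blast
  have ng: "(\<lambda>j t. -1 * g j t) \<in> J \<rightarrow> Lp_space p" using fg(2) by (intro Pi_I Lp_space_scale) auto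
  define h where "h = (\<lambda>j t. f j t + -1 * g j t)"
  have h: "h \<in> J \<rightarrow> Lp_space p" unfolding h_def using fg by (intro Pi_I Lp_space_add[OF p] Lp_space_scale) auto
  have "\<phi> h = \<phi> f + \<phi> (\<lambda>j t. -1 * g j t)" unfolding h_def by (rule bounded_functional_add[OF \<phi> fg(1) ng])
  also have "\<phi> (\<lambda>j t. -1 * g j t) = -1 * \<phi> g" by (rule bounded_functional_scale[OF \<phi> fg(2)])
  finally have eq: "\<phi> h = \<phi> f - \<phi> g" by simp
  have "Lp_norm p (h j) = 0" if "j \<in> J" for j
  proof -
    have "AE t in lebesgue. h j t = 0" using ae[OF that] by eventually_elim (simp add: h_def)
    moreover have "h j \<in> borel_measurable lebesgue" using h that by (auto simp: Lp_space_def)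
    ultimately have "Lp_norm p (h j) = Lp_norm p (\<lambda>t. 0)" by (intro Lp_norm_cong_AE) auto
    thus ?thesis by (simp add: Lp_norm_def)
  qed
  hence "vec_norm p J h = 0" using vec_norm_le[OF J, of 0 p h] vec_norm_nonneg[OF J, of p h] by simp
  thus ?thesis using K[OF h] eq by simp
qed

text \<open>By linearity a functional on vectors is the sum of its restrictions to the coordinate
  axes \<open>E j\<close>, and for the maximum norm each of these is a bounded functional on scalar
  functions.\<close>

lemma wconv_imp_weakly_converges:
  fixes X :: "nat \<Rightarrow> 'j \<Rightarrow> real \<Rightarrow> real"
  assumes p: "1 < p" and J: "finite J"
    and X: "\<And>j m. j \<in> J \<Longrightarrow> X m j \<in> Lp_space p" "\<And>j m. j \<in> J \<Longrightarrow> AE t in lebesgue. t \<notin> {0..<real N} \<longrightarrow> X m j t = 0"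
      "\<And>j. j \<in> J \<Longrightarrow> loc_bounded p (\<lambda>m. X m j)"
    and f: "\<And>j. j \<in> J \<Longrightarrow> f j \<in> Lp_space p" "\<And>j. j \<in> J \<Longrightarrow> AE t in lebesgue. t \<notin> {0..<real N} \<longrightarrow> f j t = 0"
    and w: "\<And>j. j \<in> J \<Longrightarrow> wconv (\<lambda>m. X m j) (f j)"
  shows "weakly_converges p J X f"
  unfolding weakly_converges_def
proof (intro allI impI)
  fix \<phi> assume \<phi>: "bounded_functional p J (\<phi> :: ('j \<Rightarrow> real \<Rightarrow> real) \<Rightarrow> real)"
  note b = \<phi>[unfolded bounded_functional_def]
  obtain K where K: "\<And>f. f \<in> J \<rightarrow> Lp_space p \<Longrightarrow> \<bar>\<phi> f\<bar> \<le> K * vec_norm p J f" using b by blast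
  define E where "E j h = (\<lambda>i t. if i = j then h t else 0)" for j :: 'j and h :: "real \<Rightarrow> real"
  have E: "E j h \<in> J \<rightarrow> Lp_space p" if "h \<in> Lp_space p" for j h
  proof (rule Pi_I)
    show "E j h i \<in> Lp_space p" for i by (cases "i = j") (auto simp: E_def that Lp_space_0)
  qed
  have sum: "\<phi> (\<lambda>i t. if i \<in> A then F i t else 0) = (\<Sum>j\<in>A. \<phi> (E j (F j)))"
    if "finite A" "A \<subseteq> J" "\<And>j. j \<in> J \<Longrightarrow> F j \<in> Lp_space p" for A F
    using that(1,2)
  proof (induction A rule: finite_induct)
    case empty
    have "(\<lambda>i t. 0) \<in> J \<rightarrow> Lp_space p" using Lp_space_0 by auto
    from bounded_functional_scale[OF \<phi> this, of 0] show ?case by simp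
  next
    case (insert x A)
    have FA: "(\<lambda>i t. if i \<in> A then F i t else 0) \<in> J \<rightarrow> Lp_space p"
    proof (rule Pi_I)
      show "(\<lambda>t. if i \<in> A then F i t else 0) \<in> Lp_space p" if "i \<in> J" for i
        by (cases "i \<in> A") (auto simp: \<open>\<And>j. j \<in> J \<Longrightarrow> F j \<in> Lp_space p\<close> that Lp_space_0)
    qed
    have Ex: "E x (F x) \<in> J \<rightarrow> Lp_space p" using insert.prems that(3) by (intro E) auto
    have "(\<lambda>i t. if i \<in> insert x A then F i t else 0) = (\<lambda>i t. E x (F x) i t + (if i \<in> A then F i t else 0))"
      using insert.hyps by (auto simp: E_def fun_eq_iff)
    hence "\<phi> (\<lambda>i t. if i \<in> insert x A then F i t else 0) = \<phi> (E x (F x)) + \<phi> (\<lambda>i t. if i \<in> A then F i t else 0)"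
      using bounded_functional_add[OF \<phi> Ex FA] by simp
    thus ?case using insert by simp
  qed
  have dec: "\<phi> F = (\<Sum>j\<in>J. \<phi> (E j (restr N (F j))))"
    if F: "\<And>j. j \<in> J \<Longrightarrow> F j \<in> Lp_space p" "\<And>j. j \<in> J \<Longrightarrow> AE t in lebesgue. t \<notin> {0..<real N} \<longrightarrow> F j t = 0" for F
  proof -
    have R: "restr N (F j) \<in> Lp_space p" if "j \<in> J" for j
      using Lp_on_Lp_space[OF Lp_space_restr(1)[OF _ F(1)[OF that]]] p by simp
    have "\<phi> F = \<phi> (\<lambda>i t. if i \<in> J then restr N (F i) t else 0)"
    proof (rule bounded_functional_cong_AE[OF p J \<phi>])
      fix j assume "j \<in> J"
      show "AE t in lebesgue. F j t = (if j \<in> J then restr N (F j) t else 0)"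
        using F(2)[OF \<open>j \<in> J\<close>] by eventually_elim (use \<open>j \<in> J\<close> in \<open>auto simp: restr_def indicator_def\<close>)
    qed (use F(1) R in auto)
    also have "\<dots> = (\<Sum>j\<in>J. \<phi> (E j (restr N (F j))))" using sum[OF J subset_refl, of "\<lambda>j. restr N (F j)"] R by simp
    finally show ?thesis .
  qed
  have "(\<lambda>m. \<phi> (E j (restr N (X m j)))) \<longlonglongrightarrow> \<phi> (E j (restr N (f j)))" if j: "j \<in> J" for j
  proof -
    obtain B where B: "\<And>m. modular p (restr N (X m j)) \<le> B" using X(3)[OF j] unfolding loc_bounded_def by blast
    show ?thesis
    proof (rule bounded_functional_tendsto[where \<phi>="\<lambda>h. \<phi> (E j h)", OF p])
      fix h1 h2 assume h: "h1 \<in> Lp_space p" "h2 \<in> Lp_space p"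
      have "E j (\<lambda>t. h1 t + h2 t) = (\<lambda>i t. E j h1 i t + E j h2 i t)" by (auto simp: E_def fun_eq_iff)
      thus "\<phi> (E j (\<lambda>t. h1 t + h2 t)) = \<phi> (E j h1) + \<phi> (E j h2)"
        using bounded_functional_add[OF \<phi> E[OF h(1)] E[OF h(2)]] by simp
    next
      fix c h assume h: "h \<in> Lp_space p"
      have "E j (\<lambda>t. c * h t) = (\<lambda>i t. c * E j h i t)" by (auto simp: E_def fun_eq_iff)
      thus "\<phi> (E j (\<lambda>t. c * h t)) = c * \<phi> (E j h)" using bounded_functional_scale[OF \<phi> E[OF h]] by simp
    next
      fix h assume h: "h \<in> Lp_space p"
      have "\<bar>\<phi> (E j h)\<bar> \<le> K * vec_norm p J (E j h)" by (rule K[OF E[OF h]])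
      also have "vec_norm p J (E j h) = Lp_norm p h"
      proof (rule antisym)
        show "vec_norm p J (E j h) \<le> Lp_norm p h"
        proof (rule vec_norm_le[OF J])
          show "Lp_norm p (E j h i) \<le> Lp_norm p h" for i
            by (cases "i = j") (auto simp: E_def Lp_norm_def)
        qed simp
        show "Lp_norm p h \<le> vec_norm p J (E j h)"
          using Lp_norm_le_vec_norm[OF J j, of p "E j h"] by (simp add: E_def)
      qed
      finally show "\<bar>\<phi> (E j h)\<bar> \<le> K * Lp_norm p h" .
    qed (use B f(1)[OF j] X(1)[OF j] p wconv_restr[OF w[OF j], of N] in \<open>auto intro!: Lp_space_restr(1)\<close>)
  qed
  hence "(\<lambda>m. \<Sum>j\<in>J. \<phi> (E j (restr N (X m j)))) \<longlonglongrightarrow> (\<Sum>j\<in>J. \<phi> (E j (restr N (f j))))"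
    by (intro tendsto_sum) auto
  thus "(\<lambda>m. \<phi> (X m)) \<longlonglongrightarrow> \<phi> f" using dec[of f, OF f] dec[of "X m" for m, OF X(1,2)] by simp
qed

section \<open>Brouwer's theorem on a cube\<close>

text \<open>The cube is indexed by the first \<open>n\<close> naturals, so that the dimension may be
  a number computed inside a proof. Kuhn's lemma on a grid of width \<open>1 / p\<close> provides,
  for each coordinate, two corners of one small cube at which \<open>F - id\<close> is nonnegative
  and nonpositive. As the grid is refined, the corners meet in a fixed point.\<close>

lemma brouwer_cube:
  fixes F :: "(nat \<Rightarrow> real) \<Rightarrow> nat \<Rightarrow> real"
  assumes maps: "\<And>x i. (\<And>j. j < n \<Longrightarrow> x j \<in> {0..1}) \<Longrightarrow> i < n \<Longrightarrow> F x i \<in> {0..1}"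
    and cont: "\<And>X x i. (\<And>m j. j < n \<Longrightarrow> X m j \<in> {0..1}) \<Longrightarrow> (\<And>j. j < n \<Longrightarrow> (\<lambda>m. X m j) \<longlonglongrightarrow> x j) \<Longrightarrow>
      i < n \<Longrightarrow> (\<lambda>m. F (X m) i) \<longlonglongrightarrow> F x i"
  obtains x where "\<And>j. j < n \<Longrightarrow> x j \<in> {0..1}" "\<And>j. j < n \<Longrightarrow> F x j = x j"
proof -
  define R where "R p q i r s \<longleftrightarrow> (\<forall>j<n. q j \<le> r j \<and> r j \<le> q j + 1) \<and> (\<forall>j<n. q j \<le> s j \<and> s j \<le> q j + 1) \<and>
      real (r i) / real p \<le> F (\<lambda>j. real (r j) / real p) i \<and> F (\<lambda>j. real (s j) / real p) i \<le> real (s i) / real p"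
    for p :: nat and q :: "nat \<Rightarrow> nat" and i and r s :: "nat \<Rightarrow> nat"
  have ex: "\<exists>q. (\<forall>i<n. q i < p) \<and> (\<forall>i<n. \<exists>r s. R p q i r s)"
    if p: "0 < p" for p :: nat
  proof -
    \<comment> \<open>Label 0 means that coordinate \<open>i\<close> of \<open>F\<close> is at least
      that of the grid point. On the upper face the label is forced to be 1, which keeps the
      inequality for label 1 valid because \<open>F\<close> does not exceed 1.\<close>
    define label where "label z i = (if real (z i) / real p \<le> F (\<lambda>j. real (z j) / real p) i \<and> z i \<noteq> p then 0 else 1 :: nat)"
      for z i
    have bd: "F (\<lambda>j. real (z j) / real p) i \<in> {0..1}" if "\<forall>i<n. z i \<le> p" "i < n" for z i
      by (rule maps) (use that p in \<open>auto simp: divide_le_eq_1\<close>)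
    obtain q where q: "\<forall>i<n. q i < p" "\<forall>i<n. \<exists>r s. (\<forall>j<n. q j \<le> r j \<and> r j \<le> q j + 1) \<and>
        (\<forall>j<n. q j \<le> s j \<and> s j \<le> q j + 1) \<and> label r i \<noteq> label s i"
    proof (rule kuhn_lemma[OF p, of n label])
      show "\<forall>x. (\<forall>i<n. x i \<le> p) \<longrightarrow> (\<forall>i<n. label x i = 0 \<or> label x i = 1)" by (simp add: label_def)
      show "\<forall>x. (\<forall>i<n. x i \<le> p) \<longrightarrow> (\<forall>i<n. x i = 0 \<longrightarrow> label x i = 0)"
        using bd p by (auto simp: label_def)
      show "\<forall>x. (\<forall>i<n. x i \<le> p) \<longrightarrow> (\<forall>i<n. x i = p \<longrightarrow> label x i = 1)" by (simp add: label_def)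
    qed blast
    have up: "F (\<lambda>j. real (z j) / real p) i \<le> real (z i) / real p" if "label z i = 1" "\<forall>i<n. z i \<le> p" "i < n" for z i
      using that bd[OF that(2,3)] p by (auto simp: label_def split: if_splits)
    have lo: "real (z i) / real p \<le> F (\<lambda>j. real (z j) / real p) i" if "label z i = 0" for z i
      using that by (auto simp: label_def split: if_splits)
    show ?thesis
    proof (rule exI[of _ q], rule conjI[OF q(1)], intro allI impI)
      fix i assume i: "i < n"
      obtain r s where rs: "\<forall>j<n. q j \<le> r j \<and> r j \<le> q j + 1" "\<forall>j<n. q j \<le> s j \<and> s j \<le> q j + 1" "label r i \<noteq> label s i"
        using q(2) i by blast
      have le: "\<forall>i<n. r i \<le> p" "\<forall>i<n. s i \<le> p" using rs(1,2) q(1) by fastforce+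
      have "label r i = 0 \<and> label s i = 1 \<or> label s i = 0 \<and> label r i = 1"
        using rs(3) by (auto simp: label_def split: if_splits)
      thus "\<exists>r s. R p q i r s"
      proof
        assume "label r i = 0 \<and> label s i = 1"
        thus ?thesis unfolding R_def using rs(1,2) lo[of r i] up[of s i] le i by blast
      next
        assume "label s i = 0 \<and> label r i = 1"
        thus ?thesis unfolding R_def using rs(1,2) lo[of s i] up[of r i] le i by blast
      qed
    qed
  qed
  have "\<forall>m. \<exists>q. (\<forall>i<n. q i < Suc m) \<and> (\<forall>i<n. \<exists>r s. R (Suc m) q i r s)" using ex by simp
  from choice[OF this] obtain q where q': "\<And>m. (\<forall>i<n. q m i < Suc m) \<and> (\<forall>i<n. \<exists>r s. R (Suc m) (q m) i r s)" by blast
  have q: "\<And>m i. i < n \<Longrightarrow> q m i < Suc m" using q' by blast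
  have "\<forall>x. \<exists>y. snd x < n \<longrightarrow> R (Suc (fst x)) (q (fst x)) (snd x) (fst y) (snd y)" using q' by fastforce
  from choice[OF this] obtain y where y: "\<And>m i. i < n \<Longrightarrow> R (Suc m) (q m) i (fst (y (m, i))) (snd (y (m, i)))"
    by fastforce
  define r s where "r m i = fst (y (m, i))" and "s m i = snd (y (m, i))" for m i
  have rs: "R (Suc m) (q m) i (r m i) (s m i)" if "i < n" for m i using y[OF that] by (simp add: r_def s_def)
  have r: "q m j \<le> r m i j \<and> r m i j \<le> q m j + 1" if "i < n" "j < n" for m i j
    using rs[OF that(1), of m] that(2) unfolding R_def by blast
  have s: "q m j \<le> s m i j \<and> s m i j \<le> q m j + 1" if "i < n" "j < n" for m i j
    using rs[OF that(1), of m] that(2) unfolding R_def by blast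
  have rF: "real (r m i i) / real (Suc m) \<le> F (\<lambda>j. real (r m i j) / real (Suc m)) i" if "i < n" for m i
    using rs[OF that, of m] unfolding R_def by blast
  have sF: "F (\<lambda>j. real (s m i j) / real (Suc m)) i \<le> real (s m i i) / real (Suc m)" if "i < n" for m i
    using rs[OF that, of m] unfolding R_def by blast
  obtain k :: "nat \<Rightarrow> nat" where k: "strict_mono k"
    "\<And>i. i \<in> {..<n} \<Longrightarrow> \<exists>l. (\<lambda>m. real (q (k m) i) / real (Suc (k m))) \<longlonglongrightarrow> l"
  proof (rule function_convergent_subsequence[of "{..<n}" "\<lambda>m i. real (q m i) / real (Suc m)" 1])
    show "norm (real (q m i) / real (Suc m)) \<le> 1" if "i \<in> {..<n}" for m i
      using q[of i m] that by (auto simp: divide_le_eq_1)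
  qed auto
  define x where "x i = lim (\<lambda>m. real (q (k m) i) / real (Suc (k m)))" for i
  have x: "(\<lambda>m. real (q (k m) i) / real (Suc (k m))) \<longlonglongrightarrow> x i" if "i < n" for i
    using k(2)[of i] that by (auto simp: x_def limI)
  \<comment> \<open>A corner differs from the base point \<open>q\<close> by at most one grid step
    in each coordinate, so all corners share its limit.\<close>
  have close: "(\<lambda>m. real (w (k m) j) / real (Suc (k m))) \<longlonglongrightarrow> x j"
    if "\<And>m. q m j \<le> w m j \<and> w m j \<le> q m j + 1" "j < n" for w :: "nat \<Rightarrow> nat \<Rightarrow> nat" and j
  proof (rule tendsto_sandwich[OF _ _ x[OF that(2)]])
    show "\<forall>\<^sub>F m in sequentially. real (q (k m) j) / real (Suc (k m)) \<le> real (w (k m) j) / real (Suc (k m))"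
      using that(1) by (intro always_eventually allI divide_right_mono) auto
    show "\<forall>\<^sub>F m in sequentially. real (w (k m) j) / real (Suc (k m)) \<le> real (q (k m) j) / real (Suc (k m)) + inverse (real (Suc (k m)))"
    proof (intro always_eventually allI)
      fix m
      have "real (w (k m) j) \<le> real (q (k m) j) + 1" using that(1)[of "k m"] by linarith
      hence "real (w (k m) j) / real (Suc (k m)) \<le> (real (q (k m) j) + 1) / real (Suc (k m))" by (intro divide_right_mono) auto
      thus "real (w (k m) j) / real (Suc (k m)) \<le> real (q (k m) j) / real (Suc (k m)) + inverse (real (Suc (k m)))"
        by (simp add: add_divide_distrib inverse_eq_divide)
    qed
    have "(\<lambda>m. inverse (real (Suc (k m)))) \<longlonglongrightarrow> 0"
      using LIMSEQ_subseq_LIMSEQ[OF LIMSEQ_inverse_real_of_nat k(1)] by (simp add: o_def)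
    thus "(\<lambda>m. real (q (k m) j) / real (Suc (k m)) + inverse (real (Suc (k m)))) \<longlonglongrightarrow> x j"
      using tendsto_add[OF x[OF that(2)]] by fastforce
  qed
  have box: "real (w j) / real (Suc m) \<in> {0..1}" if "q m j \<le> w j \<and> w j \<le> q m j + 1" "j < n" for w :: "nat \<Rightarrow> nat" and m j
    using that q[OF that(2), of m] by (auto simp: divide_le_eq_1)
  show ?thesis
  proof (rule that[of x])
    fix i assume i: "i < n"
    show "x i \<in> {0..1}"
    proof -
      have "0 \<le> x i" by (rule LIMSEQ_le_const[OF x[OF i]]) auto
      moreover have "x i \<le> 1"
      proof (rule LIMSEQ_le_const2[OF x[OF i]])
        have "real (q (k m) i) / real (Suc (k m)) \<le> 1" for m using q[OF i, of "k m"] by (simp add: divide_le_eq_1)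
        thus "\<exists>N. \<forall>m\<ge>N. real (q (k m) i) / real (Suc (k m)) \<le> 1" by blast
      qed
      ultimately show ?thesis by simp
    qed
    have "(\<lambda>m. F (\<lambda>j. real (r (k m) i j) / real (Suc (k m))) i) \<longlonglongrightarrow> F x i"
      by (rule cont[OF _ _ i]) (use box r close[of _ "\<lambda>m. r m i"] i in blast)+
    moreover have "(\<lambda>m. real (r (k m) i i) / real (Suc (k m))) \<longlonglongrightarrow> x i" using close[of i "\<lambda>m. r m i"] r i by blast
    ultimately have 1: "x i \<le> F x i" using rF[OF i] by (intro LIMSEQ_le[of _ "x i"]) auto
    have "(\<lambda>m. F (\<lambda>j. real (s (k m) i j) / real (Suc (k m))) i) \<longlonglongrightarrow> F x i"
      by (rule cont[OF _ _ i]) (use box s close[of _ "\<lambda>m. s m i"] i in blast)+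
    moreover have "(\<lambda>m. real (s (k m) i i) / real (Suc (k m))) \<longlonglongrightarrow> x i" using close[of i "\<lambda>m. s m i"] s i by blast
    ultimately have 2: "F x i \<le> x i" using sF[OF i] by (intro LIMSEQ_le[of _ "F x i" _ "x i"]) auto
    show "F x i = x i" using 1 2 by simp
  qed
qed

section \<open>Rates\<close>

lemma ratesD:
  assumes "f \<in> rates p"
  shows "f \<in> borel_measurable lebesgue" "AE t in lebesgue. 0 \<le> f t" "AE t in lebesgue. t < 0 \<longrightarrow> f t = 0"
  using assms by (auto simp: rates_def)

lemma rates_loc_Lp:
  assumes "f \<in> rates p" "0 < p"
  shows "loc_Lp p f"
  unfolding loc_Lp_def
proof (intro conjI allI)
  show m: "f \<in> borel_measurable lebesgue" by (rule ratesD[OF assms(1)])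
  fix N
  have rm: "restr N f \<in> borel_measurable lebesgue" unfolding restr_def using m by measurable
  have "set_integrable lebesgue {0..real N} (\<lambda>t. \<bar>f t\<bar> powr p)" using assms by (auto simp: rates_def)
  hence "integrable lebesgue (\<lambda>t. \<bar>restr N f t\<bar> powr p)"
    unfolding set_integrable_def
    by (rule Bochner_Integration.integrable_bound) (use rm assms in \<open>auto simp: restr_def indicator_def intro!: AE_I2\<close>)
  thus "restr N f \<in> Lp_on p N" using rm by (auto simp: Lp_on_def restr_outside)
qed

lemma rates_if_loc_Lp:
  assumes "0 < p" "loc_Lp p f" "AE t in lebesgue. 0 \<le> t \<longrightarrow> 0 \<le> f t" "AE t in lebesgue. t < 0 \<longrightarrow> f t = 0"
  shows "f \<in> rates p"
proof -
  have m: "f \<in> borel_measurable lebesgue" by (rule loc_LpD[OF assms(2)])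
  have "set_integrable lebesgue {a..b} (\<lambda>t. \<bar>f t\<bar> powr p)" for a b
  proof -
    obtain N :: nat where N: "b < real N" using reals_Archimedean2 by blast
    show ?thesis unfolding set_integrable_def
    proof (rule Bochner_Integration.integrable_bound[OF Lp_onD(2)[OF loc_LpD(1)[OF assms(2), of N]]])
      show "AE t in lebesgue. norm (indicator {a..b} t *\<^sub>R \<bar>f t\<bar> powr p) \<le> norm (\<bar>restr N f t\<bar> powr p)"
        using assms(4) by eventually_elim (use N assms(1) in \<open>auto simp: restr_def indicator_def\<close>)
    qed (use m in measurable)
  qed
  moreover have "AE t in lebesgue. 0 \<le> f t" using assms(3,4) by eventually_elim force
  ultimately show ?thesis using m assms(4) by (simp add: rates_def)
qed

lemma rates_untilD:
  assumes "f \<in> rates_until p T"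
  shows "f \<in> rates p" "AE t in lebesgue. t \<notin> before T \<longrightarrow> f t = 0"
  using assms by (auto simp: rates_until_def)

lemma rates_until_Lp_space:
  assumes "f \<in> rates_until p (ereal T)" "0 < p" "T \<le> real N"
  shows "f \<in> Lp_space p" "AE t in lebesgue. t \<notin> {0..<real N} \<longrightarrow> f t = 0"
proof -
  show ae: "AE t in lebesgue. t \<notin> {0..<real N} \<longrightarrow> f t = 0"
    using rates_untilD(2)[OF assms(1)] by eventually_elim (use assms(3) in \<open>auto simp: before_def\<close>)
  have L: "restr N f \<in> Lp_on p N" using rates_loc_Lp[OF rates_untilD(1)[OF assms(1)] assms(2)] by (simp add: loc_Lp_def)
  have m: "f \<in> borel_measurable lebesgue" by (rule ratesD[OF rates_untilD(1)[OF assms(1)]])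
  have "integrable lebesgue (\<lambda>t. \<bar>f t\<bar> powr p)"
  proof (rule integrable_cong_AE_imp[OF Lp_onD(2)[OF L]])
    show "AE t in lebesgue. \<bar>restr N f t\<bar> powr p = \<bar>f t\<bar> powr p"
      using ae by eventually_elim (auto simp: restr_def indicator_def)
  qed (use m in measurable)
  thus "f \<in> Lp_space p" using m by (simp add: Lp_space_def)
qed

lemma sigma_finite_lebesgue: "sigma_finite_measure (lebesgue :: real measure)"
proof (unfold_locales, intro exI conjI)
  show "countable (range (\<lambda>n::nat. {- real n..real n}))" by simp
  show "\<Union> (range (\<lambda>n::nat. {- real n..real n})) = space lebesgue"
  proof -
    have "\<exists>n::nat. x \<in> {- real n..real n}" for x
    proof -
      obtain n :: nat where "\<bar>x\<bar> \<le> real n" using real_arch_simple by blast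
      thus ?thesis by (intro exI[of _ n]) auto
    qed
    thus ?thesis by auto
  qed
qed auto

text \<open>Hypotheses hold for almost every predictor at almost every time, but expectations are
  taken at a fixed time. Fubini's theorem exchanges the two exceptional sets, for which the property
  has to be jointly measurable.\<close>

lemma AE_swap_lebesgue:
  assumes "prob_space \<mu>" and "Measurable.pred (\<mu> \<Otimes>\<^sub>M lebesgue) (\<lambda>x. P (fst x) (snd x))"
    and "AE C in \<mu>. AE t in lebesgue. P C t"
  shows "AE t in lebesgue. AE C in \<mu>. P C (t :: real)"
proof -
  interpret prob_space \<mu> by fact
  interpret pair_sigma_finite \<mu> "lebesgue :: real measure"
    by (intro pair_sigma_finite.intro sigma_finite_measure_axioms sigma_finite_lebesgue)
  show ?thesis using AE_commute[of P] assms(2,3) by (simp add: pred_def)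
qed

section \<open>Parametrized measures\<close>

lemma measurable_sections:
  fixes W :: "'c \<Rightarrow> real \<Rightarrow> 'd"
  assumes W: "(\<lambda>x. W (fst x) (snd x)) \<in> measurable (\<mu> \<Otimes>\<^sub>M lebesgue) N"
  shows "(\<lambda>C. W C t) \<in> measurable \<mu> N"
  using measurable_compose[OF measurable_Pair2' W, of t] by simp

lemma pred_sections:
  fixes P :: "'c \<Rightarrow> real \<Rightarrow> bool"
  assumes "Measurable.pred (\<mu> \<Otimes>\<^sub>M lebesgue) (\<lambda>x. P (fst x) (snd x))"
  shows "{C \<in> space \<mu>. P C t} \<in> sets \<mu>"
  using measurable_sections[OF assms, of t] by (simp add: pred_def)

lemma measurable_measure_sections:
  assumes "prob_space \<mu>" and P: "Measurable.pred (\<mu> \<Otimes>\<^sub>M lebesgue) (\<lambda>x. P (fst x) (snd x))"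
  shows "(\<lambda>t :: real. measure \<mu> {C \<in> space \<mu>. P C t}) \<in> borel_measurable lebesgue"
proof -
  interpret prob_space \<mu> by fact
  interpret pair_sigma_finite \<mu> "lebesgue :: real measure"
    by (intro pair_sigma_finite.intro sigma_finite_measure_axioms sigma_finite_lebesgue)
  define Q where "Q = {x \<in> space (\<mu> \<Otimes>\<^sub>M (lebesgue :: real measure)). P (fst x) (snd x)}"
  have Q: "Q \<in> sets (\<mu> \<Otimes>\<^sub>M lebesgue)" using P by (simp add: Q_def pred_def)
  have "(\<lambda>t. emeasure \<mu> ((\<lambda>C. (C, t)) -` Q)) \<in> borel_measurable lebesgue"
    by (rule measurable_emeasure_Pair2[OF Q])
  moreover have "(\<lambda>C. (C, t)) -` Q = {C \<in> space \<mu>. P C t}" for t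
    by (auto simp: Q_def space_pair_measure)
  ultimately show ?thesis unfolding measure_def by simp
qed

lemma measurable_expectation_sections:
  assumes "prob_space \<mu>" and W: "(\<lambda>x. W (fst x) (snd x)) \<in> borel_measurable (\<mu> \<Otimes>\<^sub>M lebesgue)"
  shows "(\<lambda>t :: real. LINT C|\<mu>. W C t :: real) \<in> borel_measurable lebesgue"
proof -
  interpret prob_space \<mu> by fact
  have "(\<lambda>x. W (snd x) (fst x)) \<in> borel_measurable (lebesgue \<Otimes>\<^sub>M \<mu>)"
    using measurable_compose[OF measurable_pair_swap' W] by (simp add: case_prod_beta)
  hence "case_prod (\<lambda>t C. W C t) \<in> borel_measurable (lebesgue \<Otimes>\<^sub>M \<mu>)" by (simp add: case_prod_beta)
  thus ?thesis by (rule borel_measurable_lebesgue_integral)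
qed

section \<open>The network\<close>

definition join :: "('e \<times> 'i) vec \<Rightarrow> ('e \<times> 'i) vec \<Rightarrow> ('e \<times> 'i \<times> sign) vec" where
  "join x y = (\<lambda>(e, i, s). case s of Plus \<Rightarrow> x (e, i) | Minus \<Rightarrow> y (e, i))"

lemma edge_inflow_join [simp]: "edge_inflow (join x y) = x"
  and edge_outflow_join [simp]: "edge_outflow (join x y) = y"
  and join_eta: "join (edge_inflow f) (edge_outflow f) = f"
  by (auto simp: edge_inflow_def edge_outflow_def join_def fun_eq_iff split: sign.split)

lemma UNIV_sign: "UNIV = {Plus, Minus}"
  by (auto intro: sign.exhaust)

lemma join_flows: "join x y \<in> flows p G I \<longleftrightarrow> x \<in> arcs G \<times> I \<rightarrow> rates p \<and> y \<in> arcs G \<times> I \<rightarrow> rates p"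
  by (fastforce simp: flows_def flow_index_def join_def Pi_iff UNIV_sign split: sign.split)

lemma join_flows_until: "join x y \<in> flows_until p G I T \<longleftrightarrow>
    x \<in> arcs G \<times> I \<rightarrow> rates_until p T \<and> y \<in> arcs G \<times> I \<rightarrow> rates_until p T"
  by (fastforce simp: flows_until_def flow_index_def join_def Pi_iff UNIV_sign split: sign.split)

locale network =
  fixes p :: real
    and G :: "('v, 'e) pre_digraph"
    and I :: "'i set"
    and d :: "'i \<Rightarrow> 'v"
    and u :: "('v \<times> 'i) vec"
    and \<Phi> :: "('e \<times> 'i) vec \<Rightarrow> ('e \<times> 'i) vec"
    and \<mu> :: "'i \<Rightarrow> ('e, 'i) predictor measure"
  assumes p: "1 < p"
    and fin_digraph: "fin_digraph G"
    and I: "finite I"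
    and d: "\<And>i. i \<in> I \<Longrightarrow> d i \<in> verts G"
    and reachable: "\<And>i v. i \<in> I \<Longrightarrow> v \<in> verts G \<Longrightarrow> v \<rightarrow>\<^sup>*\<^bsub>G\<^esub> d i"
    and u: "u \<in> verts G \<times> I \<rightarrow> rates p"
    and \<Phi>: "edge_loading_operator p G I \<Phi>"
    and \<Phi>_bounded: "locally_bounded_loading p G I \<Phi>"
    and \<mu>: "\<And>i. i \<in> I \<Longrightarrow> predictor_distribution p G I (\<mu> i)"
begin

sublocale fin_digraph G by (rule fin_digraph)

abbreviation "A \<equiv> arcs G \<times> I"

abbreviation paths :: "'v \<Rightarrow> 'i \<Rightarrow> 'e list set" where
  "paths v i \<equiv> simple_paths_between G v (d i)"

lemma finite_A: "finite A" and finite_out: "finite (out_arcs G v)" and finite_in: "finite (in_arcs G v)"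
  using I by auto

lemma finite_flow_index: "finite (flow_index G I)"
  using I by (simp add: flow_index_def UNIV_sign)

lemma finite_paths: "finite (paths v i)"
  by (rule finite_subset[OF _ apaths_finite[of v "d i"]]) (auto simp: simple_paths_between_def)

lemma paths_nonempty: "v \<in> verts G \<Longrightarrow> i \<in> I \<Longrightarrow> v \<noteq> d i \<Longrightarrow> paths v i \<noteq> {}"
proof -
  assume v: "v \<in> verts G" "i \<in> I" "v \<noteq> d i"
  then obtain q where q: "apath v q (d i)" using reachable[of i v] unfolding reachable_apath by blast
  hence "q \<noteq> []" using v(3) by (auto simp: apath_Nil_iff)
  thus ?thesis using q by (auto simp: simple_paths_between_def)
qed

lemma hd_path: "q \<in> paths v i \<Longrightarrow> hd q \<in> out_arcs G v"
  by (cases q) (auto simp: simple_paths_between_def apath_Cons_iff)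

lemma path_simple: "q \<in> paths v i \<Longrightarrow> v \<in> verts G \<Longrightarrow> i \<in> I \<Longrightarrow> q \<in> simple_paths G"
  using d by (auto simp: simple_paths_def)

lemma finite_simple_paths: "finite (simple_paths G)"
  unfolding simple_paths_def using apaths_finite
  by (auto simp: simple_paths_between_def intro!: finite_UN_I finite_verts intro: finite_subset[OF _ apaths_finite])

text \<open>The cost vector \<open>c\<close> is detached from predictor, time and flow, so that
  limits and perturbations of costs become questions about finitely many numbers.\<close>

definition best :: "'v \<Rightarrow> 'i \<Rightarrow> ('e list \<Rightarrow> real) \<Rightarrow> 'e set" where
  "best v i c = {e \<in> out_arcs G v. \<exists>q\<in>paths v i. hd q = e \<and> (\<forall>q'\<in>paths v i. c q \<le> c q')}"

lemma optimal_edges_best: "optimal_edges G d i \<theta> f C \<inter> out_arcs G v = best v i (C \<theta> f)"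
proof (intro set_eqI iffI)
  fix e assume "e \<in> optimal_edges G d i \<theta> f C \<inter> out_arcs G v"
  thus "e \<in> best v i (C \<theta> f)"
    by (auto simp: optimal_edges_def best_def is_arg_min_def not_less intro!: bexI[of _ "e # _"])
next
  fix e assume "e \<in> best v i (C \<theta> f)"
  then obtain q where e: "e \<in> out_arcs G v" and q: "q \<in> paths v i" "hd q = e" "\<forall>q'\<in>paths v i. C \<theta> f q \<le> C \<theta> f q'"
    by (auto simp: best_def)
  have "q \<noteq> []" using q(1) by (simp add: simple_paths_between_def)
  hence "q = e # tl q" using q(2) by (cases q) auto
  hence "is_arg_min (C \<theta> f) (\<lambda>q'. q' \<in> paths v i) (e # tl q)" using q by (auto simp: is_arg_min_def not_less)
  thus "e \<in> optimal_edges G d i \<theta> f C \<inter> out_arcs G v" using e by (auto simp: optimal_edges_def)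
qed

lemma choice_prob_best: "choice_prob G d \<mu> v M i \<theta> f = measure (\<mu> i) {C \<in> space (\<mu> i). best v i (C \<theta> f) = M}"
  unfolding choice_prob_def optimal_edges_best by (simp add: eq_commute)

lemma best_nonempty:
  assumes "v \<in> verts G" "i \<in> I" "v \<noteq> d i"
  shows "best v i c \<noteq> {}"
proof -
  obtain q where "is_arg_min c (\<lambda>q. q \<in> paths v i) q"
    using ex_is_arg_min_if_finite[OF finite_paths paths_nonempty[OF assms]] by blast
  hence "hd q \<in> best v i c" using hd_path[of q v i] by (auto simp: best_def is_arg_min_def not_less)
  thus ?thesis by blast
qed

lemma best_subset: "best v i c \<subseteq> out_arcs G v"
  by (auto simp: best_def)

text \<open>The Gibbs distribution on paths at inverse temperature \<open>n\<close>, pushed forward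
  to the first edge. Unlike the set of optimal edges it is continuous in the costs. Without any path
  the quotient is \<open>0 / 0 = 0\<close>.\<close>

definition softmax :: "'v \<Rightarrow> 'i \<Rightarrow> 'e \<Rightarrow> nat \<Rightarrow> ('e list \<Rightarrow> real) \<Rightarrow> real" where
  "softmax v i e n c = (\<Sum>q | q \<in> paths v i \<and> hd q = e. exp (- real n * c q)) / (\<Sum>q\<in>paths v i. exp (- real n * c q))"

lemma softmax_bounds: "0 \<le> softmax v i e n c" "softmax v i e n c \<le> 1"
proof -
  have 1: "(\<Sum>q | q \<in> paths v i \<and> hd q = e. exp (- real n * c q)) \<le> (\<Sum>q\<in>paths v i. exp (- real n * c q))"
    using finite_paths by (intro sum_mono2) auto
  show "0 \<le> softmax v i e n c" unfolding softmax_def by (intro divide_nonneg_nonneg sum_nonneg) auto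
  have "0 \<le> (\<Sum>q\<in>paths v i. exp (- real n * c q))" by (intro sum_nonneg) auto
  thus "softmax v i e n c \<le> 1" unfolding softmax_def using 1 by (auto simp: divide_le_eq_1)
qed

lemma sum_exp_pos: "paths v i \<noteq> {} \<Longrightarrow> 0 < (\<Sum>q\<in>paths v i. exp (- real n * c q))"
  using finite_paths by (intro sum_pos) auto

lemma sum_softmax:
  assumes "paths v i \<noteq> {}"
  shows "(\<Sum>e\<in>out_arcs G v. softmax v i e n c) = 1"
proof -
  have "(\<Sum>e\<in>out_arcs G v. \<Sum>q | q \<in> paths v i \<and> hd q = e. exp (- real n * c q)) = (\<Sum>q\<in>paths v i. exp (- real n * c q))"
    by (rule sum.group[OF finite_paths finite_out]) (auto intro: hd_path)
  thus ?thesis using sum_exp_pos[OF assms, of n c] by (simp add: softmax_def sum_divide_distrib[symmetric])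
qed

lemma softmax_tendsto:
  assumes "\<And>q. q \<in> paths v i \<Longrightarrow> (\<lambda>m. c m q) \<longlonglongrightarrow> c' q"
  shows "(\<lambda>m. softmax v i e n (c m)) \<longlonglongrightarrow> softmax v i e n c'"
proof (cases "paths v i = {}")
  case True
  thus ?thesis by (simp add: softmax_def)
next
  case False
  show ?thesis unfolding softmax_def
    using sum_exp_pos[OF False, of n c'] assms by (intro tendsto_divide tendsto_sum tendsto_exp tendsto_mult tendsto_const) auto
qed

text \<open>Once the cost of \<open>q\<close> stays above that of an optimal path by \<open>\<delta>\<close>, its softmax weight
  decays like \<open>exp (- m \<delta>)\<close>.\<close>

lemma softmax_tendsto_0:
  assumes c: "\<And>q. q \<in> paths v i \<Longrightarrow> (\<lambda>m. c m q) \<longlonglongrightarrow> c' q" and e: "e \<notin> best v i c'"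
    and s: "\<And>m. m \<le> s m"
  shows "(\<lambda>m. softmax v i e (s m) (c m)) \<longlonglongrightarrow> 0"
proof (cases "paths v i = {}")
  case True
  thus ?thesis by (simp add: softmax_def)
next
  case False
  obtain r where r: "is_arg_min c' (\<lambda>q. q \<in> paths v i) r"
    using ex_is_arg_min_if_finite[OF finite_paths False] by blast
  have rp: "r \<in> paths v i" "\<And>q. q \<in> paths v i \<Longrightarrow> c' r \<le> c' q" using r by (auto simp: is_arg_min_def not_less)
  have less: "c' r < c' q" if q: "q \<in> paths v i" "hd q = e" for q
  proof (rule ccontr)
    assume "\<not> c' r < c' q"
    hence "\<forall>q'\<in>paths v i. c' q \<le> c' q'" using rp(2) by (force intro: order_trans)
    hence "e \<in> best v i c'" using q hd_path[OF q(1)] by (auto simp: best_def)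
    thus False using e by simp
  qed
  have zero: "(\<lambda>m. exp (- real (s m) * (c m q - c m r))) \<longlonglongrightarrow> 0" if q: "q \<in> paths v i" "hd q = e" for q
  proof -
    define \<delta> where "\<delta> = (c' q - c' r) / 2"
    have \<delta>: "0 < \<delta>" using less[OF q] by (simp add: \<delta>_def)
    have "(\<lambda>m. c m q - c m r) \<longlonglongrightarrow> c' q - c' r" by (intro tendsto_diff c q rp)
    moreover have "\<delta> < c' q - c' r" using less[OF q] by (simp add: \<delta>_def)
    ultimately have ev: "\<forall>\<^sub>F m in sequentially. \<delta> < c m q - c m r" by (rule order_tendstoD(1))
    have "(\<lambda>m. exp (- \<delta>) ^ m) \<longlonglongrightarrow> 0" using \<delta> by (intro LIMSEQ_realpow_zero) auto
    thus ?thesis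
    proof (rule Lim_null_comparison[rotated])
      show "\<forall>\<^sub>F m in sequentially. norm (exp (- real (s m) * (c m q - c m r))) \<le> exp (- \<delta>) ^ m"
        using ev
      proof eventually_elim
        fix m assume *: "\<delta> < c m q - c m r"
        have "real m * \<delta> \<le> real (s m) * (c m q - c m r)"
          using s[of m] * \<delta> by (intro mult_mono) auto
        thus "norm (exp (- real (s m) * (c m q - c m r))) \<le> exp (- \<delta>) ^ m"
          by (simp add: exp_of_nat_mult[symmetric])
      qed
    qed
  qed
  have fin: "finite {q \<in> paths v i. hd q = e}" using finite_paths by simp
  show ?thesis
  proof (rule Lim_null_comparison)
    show "(\<lambda>m. \<Sum>q | q \<in> paths v i \<and> hd q = e. exp (- real (s m) * (c m q - c m r))) \<longlonglongrightarrow> 0"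
      using tendsto_sum[of "{q \<in> paths v i. hd q = e}" "\<lambda>q m. exp (- real (s m) * (c m q - c m r))" "\<lambda>q. 0"] zero by simp
    show "\<forall>\<^sub>F m in sequentially. norm (softmax v i e (s m) (c m)) \<le> (\<Sum>q | q \<in> paths v i \<and> hd q = e. exp (- real (s m) * (c m q - c m r)))"
    proof (intro always_eventually allI)
      fix m
      \<comment> \<open>The weight of the single path \<open>r\<close>, optimal for the limiting
        costs, bounds the denominator from below; dividing by it leaves cost differences in the
        exponents.\<close>
      have "exp (- real (s m) * c m r) \<le> (\<Sum>q\<in>paths v i. exp (- real (s m) * c m q))"
        using rp(1) finite_paths by (intro member_le_sum) auto
      hence "softmax v i e (s m) (c m) \<le> (\<Sum>q | q \<in> paths v i \<and> hd q = e. exp (- real (s m) * c m q)) / exp (- real (s m) * c m r)"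
        unfolding softmax_def by (intro divide_left_mono sum_nonneg mult_pos_pos sum_exp_pos False) auto
      also have "\<dots> = (\<Sum>q | q \<in> paths v i \<and> hd q = e. exp (- real (s m) * (c m q - c m r)))"
        unfolding sum_divide_distrib by (intro sum.cong refl) (simp add: exp_diff[symmetric] algebra_simps)
      finally show "norm (softmax v i e (s m) (c m)) \<le> (\<Sum>q | q \<in> paths v i \<and> hd q = e. exp (- real (s m) * (c m q - c m r)))"
        using softmax_bounds(1)[of v i e "s m" "c m"] by simp
    qed
  qed
qed

section \<open>Measurability of costs and choice probabilities\<close>

lemma prob_space_\<mu>: "i \<in> I \<Longrightarrow> prob_space (\<mu> i)"
  using \<mu> by (simp add: predictor_distribution_def)

lemma cost_measurable:
  assumes "i \<in> I" "f \<in> flows p G I" "q \<in> simple_paths G"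
  shows "(\<lambda>x. fst x (snd x) f q) \<in> borel_measurable (\<mu> i \<Otimes>\<^sub>M lebesgue)"
proof -
  have "(\<lambda>(C, \<theta>). C \<theta> f q) \<in> borel_measurable (\<mu> i \<Otimes>\<^sub>M lebesgue)"
    using \<mu>[OF assms(1)] assms(2,3) unfolding predictor_distribution_def by blast
  thus ?thesis by (simp add: case_prod_beta)
qed

lemma cost_cong_AE:
  assumes "i \<in> I" "C \<in> space (\<mu> i)" "f \<in> flows p G I" "g \<in> flows p G I" "ae_equal (flow_index G I) f g" "q \<in> simple_paths G"
  shows "C \<theta> f q = C \<theta> g q"
  using \<mu>[OF assms(1)] assms(2-) by (auto simp: predictor_distribution_def cost_predictor_def)

lemma best_measurable:
  assumes i: "i \<in> I" and v: "v \<in> verts G" and f: "f \<in> flows p G I"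
  shows "Measurable.pred (\<mu> i \<Otimes>\<^sub>M lebesgue) (\<lambda>x. best v i (fst x (snd x) f) = M)"
proof -
  have c: "(\<lambda>x. fst x (snd x) f q) \<in> borel_measurable (\<mu> i \<Otimes>\<^sub>M lebesgue)" if "q \<in> paths v i" for q
    using cost_measurable[OF i f path_simple[OF that v i]] .
  have le: "Measurable.pred (\<mu> i \<Otimes>\<^sub>M lebesgue) (\<lambda>x. \<forall>q'\<in>paths v i. fst x (snd x) f q \<le> fst x (snd x) f q')"
    if "q \<in> paths v i" for q
  proof (intro pred_intros_finite finite_paths)
    fix q' assume "q' \<in> paths v i"
    thus "Measurable.pred (\<mu> i \<Otimes>\<^sub>M lebesgue) (\<lambda>x. fst x (snd x) f q \<le> fst x (snd x) f q')"
      unfolding pred_def by (intro borel_measurable_le c that)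
  qed
  have mem: "Measurable.pred (\<mu> i \<Otimes>\<^sub>M lebesgue) (\<lambda>x. e \<in> best v i (fst x (snd x) f))" if "e \<in> out_arcs G v" for e
  proof -
    have eq: "(\<lambda>x. e \<in> best v i (fst x (snd x) f))
        = (\<lambda>x. \<exists>q\<in>{q\<in>paths v i. hd q = e}. \<forall>q'\<in>paths v i. fst x (snd x) f q \<le> fst x (snd x) f q')"
      using that by (auto simp: best_def fun_eq_iff)
    show ?thesis unfolding eq
      by (intro pred_intros_finite le) (use finite_paths in auto)
  qed
  have eq: "(\<lambda>x. best v i (fst x (snd x) f) = M)
      = (\<lambda>x. M \<subseteq> out_arcs G v \<and> (\<forall>e\<in>out_arcs G v. e \<in> best v i (fst x (snd x) f) \<longleftrightarrow> e \<in> M))"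
    using best_subset by (fastforce simp: fun_eq_iff)
  show ?thesis unfolding eq
    by (intro pred_intros_logic pred_intros_finite finite_out mem) auto
qed

lemma softmax_measurable:
  assumes i: "i \<in> I" and v: "v \<in> verts G" and f: "f \<in> flows p G I"
  shows "(\<lambda>x. softmax v i e n (fst x (snd x) f)) \<in> borel_measurable (\<mu> i \<Otimes>\<^sub>M lebesgue)"
  unfolding softmax_def
  by (intro borel_measurable_divide borel_measurable_sum measurable_compose[OF _ borel_measurable_exp]
      borel_measurable_times borel_measurable_const cost_measurable[OF i f] path_simple[OF _ v i]; blast)

lemma choice_prob_measurable:
  assumes "i \<in> I" "v \<in> verts G" "f \<in> flows p G I"
  shows "(\<lambda>\<theta>. choice_prob G d \<mu> v M i \<theta> f) \<in> borel_measurable lebesgue"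
  unfolding choice_prob_best
  by (rule measurable_measure_sections[OF prob_space_\<mu>[OF assms(1)] best_measurable[OF assms]])

lemma choice_prob_bounds: "i \<in> I \<Longrightarrow> 0 \<le> choice_prob G d \<mu> v M i \<theta> f \<and> choice_prob G d \<mu> v M i \<theta> f \<le> 1"
  unfolding choice_prob_def using prob_space.prob_le_1[OF prob_space_\<mu>] by simp

definition inflow :: "('e \<times> 'i) vec \<Rightarrow> ('v \<times> 'i) vec" where
  "inflow y = (\<lambda>(v, i) \<theta>. of_bool (v \<noteq> d i) * (u (v, i) \<theta> + (\<Sum>e\<in>in_arcs G v. y (e, i) \<theta>)))"

lemma \<Phi>_rates: "x \<in> A \<rightarrow> rates p \<Longrightarrow> \<Phi> x \<in> A \<rightarrow> rates p"
  using \<Phi> by (auto simp: edge_loading_operator_def)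

lemma inflow_loc_Lp:
  assumes "v \<in> verts G" "i \<in> I" "\<And>j. j \<in> A \<Longrightarrow> loc_Lp p (y j)"
  shows "loc_Lp p (inflow y (v, i))"
proof -
  have "loc_Lp p (\<lambda>\<theta>. u (v, i) \<theta> + (\<Sum>e\<in>in_arcs G v. y (e, i) \<theta>))"
  proof (intro loc_Lp_add[OF p] loc_Lp_sum[OF p])
    show "loc_Lp p (u (v, i))" using u assms(1,2) p by (intro rates_loc_Lp) auto
    show "loc_Lp p (y (e, i))" if "e \<in> in_arcs G v" for e using that assms(2) by (intro assms(3)) auto
  qed
  thus ?thesis using loc_Lp_0 by (cases "v = d i") (auto simp: inflow_def)
qed

lemma inflow_nonneg:
  assumes "v \<in> verts G" "i \<in> I" "\<And>j. j \<in> A \<Longrightarrow> AE \<theta> in lebesgue. 0 \<le> y j \<theta>"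
  shows "AE \<theta> in lebesgue. 0 \<le> inflow y (v, i) \<theta>"
proof -
  have 1: "AE \<theta> in lebesgue. 0 \<le> u (v, i) \<theta>" using u assms(1,2) ratesD(2) by blast
  have "AE \<theta> in lebesgue. \<forall>e\<in>in_arcs G v. 0 \<le> y (e, i) \<theta>"
    using assms(2,3) by (intro AE_finite_allI finite_in) auto
  with 1 show ?thesis by eventually_elim (auto simp: inflow_def intro!: mult_nonneg_nonneg add_nonneg_nonneg sum_nonneg)
qed

lemma choice_pairs_iff: "(M, e) \<in> choice_pairs G \<longleftrightarrow> e \<in> arcs G \<and> M \<subseteq> out_arcs G (tail G e) \<and> e \<in> M"
proof
  assume "(M, e) \<in> choice_pairs G"
  then obtain v where v: "v \<in> verts G" "M \<subseteq> out_arcs G v" "e \<in> M" by (auto simp: choice_pairs_def)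
  hence "e \<in> out_arcs G v" by blast
  thus "e \<in> arcs G \<and> M \<subseteq> out_arcs G (tail G e) \<and> e \<in> M" using v by auto
qed (auto simp: choice_pairs_def)

lemma choice_pairsI: "M \<subseteq> out_arcs G v \<Longrightarrow> e \<in> M \<Longrightarrow> (M, e) \<in> choice_pairs G"
proof -
  assume M: "M \<subseteq> out_arcs G v" "e \<in> M"
  hence "e \<in> out_arcs G v" by blast
  thus ?thesis using M by (auto simp: choice_pairs_iff)
qed

end

context network
begin

text \<open>The splitting rate \<open>\<rho> (M, e, i)\<close> is the share of the flow of class \<open>(M, i)\<close> that enters \<open>e\<close>.
  Where nothing arrives it is arbitrary.\<close>

lemma prediction_equilibriumI:
  assumes x: "x \<in> A \<rightarrow> rates p" and y: "y \<in> A \<rightarrow> rates p"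
    and H: "\<And>M e i. (M, e) \<in> choice_pairs G \<Longrightarrow> i \<in> I \<Longrightarrow> H (M, e, i) \<in> borel_measurable lebesgue"
    and loading: "\<And>j. j \<in> A \<Longrightarrow> AE \<theta> in lebesgue. ereal \<theta> < T \<longrightarrow> y j \<theta> = \<Phi> x j \<theta>"
    and balance: "\<And>v i. v \<in> verts G \<Longrightarrow> i \<in> I \<Longrightarrow>
      AE \<theta> in lebesgue. ereal \<theta> < T \<longrightarrow> (\<Sum>e\<in>out_arcs G v. x (e, i) \<theta>) = inflow y (v, i) \<theta>"
    and shares: "\<And>e i. e \<in> arcs G \<Longrightarrow> i \<in> I \<Longrightarrow>
      AE \<theta> in lebesgue. ereal \<theta> < T \<longrightarrow> x (e, i) \<theta> = (\<Sum>M | (M, e) \<in> choice_pairs G. H (M, e, i) \<theta>)"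
    and H_nonneg: "\<And>M e i. (M, e) \<in> choice_pairs G \<Longrightarrow> i \<in> I \<Longrightarrow> AE \<theta> in lebesgue. ereal \<theta> < T \<longrightarrow> 0 \<le> H (M, e, i) \<theta>"
    and H_sum: "\<And>v M i. v \<in> verts G \<Longrightarrow> M \<noteq> {} \<Longrightarrow> M \<subseteq> out_arcs G v \<Longrightarrow> i \<in> I \<Longrightarrow>
      AE \<theta> in lebesgue. ereal \<theta> < T \<longrightarrow>
        (\<Sum>e\<in>M. H (M, e, i) \<theta>) = choice_prob G d \<mu> v M i \<theta> (join x y) * inflow y (v, i) \<theta>"
  shows "prediction_equilibrium p G I d u \<Phi> \<mu> T (join x y)"
proof -
  define f where "f = join x y"
  have f: "f \<in> flows p G I" using x y by (simp add: f_def join_flows)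
  define X where "X e i \<theta> = inflow y (tail G e, i) \<theta>" for e i \<theta>
  \<comment> \<open>Beyond \<open>T\<close> and where nothing arrives, the choice probability is
    split evenly over \<open>M\<close>: membership in \<open>routing\<close> demands the prescribed
    sums at almost all times, not only where flow is present.\<close>
  define \<rho> where "\<rho> = (\<lambda>(M, e, i) \<theta>. if ereal \<theta> < T \<and> 0 < X e i \<theta> then H (M, e, i) \<theta> / X e i \<theta>
     else choice_prob G d \<mu> (tail G e) M i \<theta> f / real (card M))"
  define r where "r = (\<lambda>(e, i) \<theta>. \<Sum>M | (M, e) \<in> choice_pairs G. \<rho> (M, e, i) \<theta>)"
  have fM: "finite M" if "M \<subseteq> out_arcs G v" for M v using that finite_out finite_subset by blast
  have Xm: "X e i \<in> borel_measurable lebesgue" if "e \<in> arcs G" "i \<in> I" for e i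
    unfolding X_def using y p that by (intro loc_LpD(2)[OF inflow_loc_Lp] rates_loc_Lp) auto
  have \<rho>m: "\<rho> (M, e, i) \<in> borel_measurable lebesgue" if "(M, e) \<in> choice_pairs G" "i \<in> I" for M e i
  proof -
    have e: "e \<in> arcs G" using that by (simp add: choice_pairs_iff)
    note [measurable] = H[OF that] Xm[OF e that(2)] choice_prob_measurable[OF that(2) tail_in_verts[OF e] f]
    have T: "{\<theta>. ereal \<theta> < T} \<in> sets lebesgue"
      by (cases T) (auto simp: lessThan_def[symmetric])
    have "{\<theta> \<in> space lebesgue. ereal \<theta> < T \<and> 0 < X e i \<theta>} = {\<theta>. ereal \<theta> < T} \<inter> {\<theta> \<in> space lebesgue. 0 < X e i \<theta>}"
      by auto
    also have "\<dots> \<in> sets lebesgue" using T by measurable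
    finally show ?thesis unfolding \<rho>_def prod.case by (intro measurable_If) measurable
  qed
  have \<rho>_sum: "AE \<theta> in lebesgue. (\<Sum>e\<in>M. \<rho> (M, e, i) \<theta>) = choice_prob G d \<mu> v M i \<theta> f"
    if M: "v \<in> verts G" "M \<noteq> {}" "M \<subseteq> out_arcs G v" "i \<in> I" for v M i
    using H_sum[OF M]
  proof eventually_elim
    fix \<theta> assume h: "ereal \<theta> < T \<longrightarrow> (\<Sum>e\<in>M. H (M, e, i) \<theta>) = choice_prob G d \<mu> v M i \<theta> (join x y) * inflow y (v, i) \<theta>"
    have t: "tail G e = v" if "e \<in> M" for e using that M(3) by auto
    have c: "0 < card M" using M fM card_gt_0_iff by blast
    show "(\<Sum>e\<in>M. \<rho> (M, e, i) \<theta>) = choice_prob G d \<mu> v M i \<theta> f"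
    proof (cases "ereal \<theta> < T \<and> 0 < inflow y (v, i) \<theta>")
      case True
      hence "(\<Sum>e\<in>M. \<rho> (M, e, i) \<theta>) = (\<Sum>e\<in>M. H (M, e, i) \<theta> / inflow y (v, i) \<theta>)"
        using t by (intro sum.cong) (auto simp: \<rho>_def X_def)
      also have "\<dots> = (\<Sum>e\<in>M. H (M, e, i) \<theta>) / inflow y (v, i) \<theta>" by (simp add: sum_divide_distrib)
      finally show ?thesis using True h by (simp add: f_def)
    next
      case False
      hence "(\<Sum>e\<in>M. \<rho> (M, e, i) \<theta>) = (\<Sum>e\<in>M. choice_prob G d \<mu> v M i \<theta> f / real (card M))"
        using t by (intro sum.cong) (auto simp: \<rho>_def X_def)
      thus ?thesis using c by simp
    qed
  qed
  have \<rho>0: "AE \<theta> in lebesgue. 0 \<le> \<rho> (M, e, i) \<theta>" if "(M, e) \<in> choice_pairs G" "i \<in> I" for M e i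
    using H_nonneg[OF that] by eventually_elim (use choice_prob_bounds[OF that(2)] in \<open>auto simp: \<rho>_def\<close>)
  have \<rho>1: "AE \<theta> in lebesgue. \<rho> (M, e, i) \<theta> \<le> 1" if Me: "(M, e) \<in> choice_pairs G" and i: "i \<in> I" for M e i
  proof -
    define v where "v = tail G e"
    have M: "M \<subseteq> out_arcs G v" "e \<in> M" "e \<in> arcs G" using Me by (auto simp: choice_pairs_iff v_def)
    have v: "v \<in> verts G" using M(3) by (simp add: v_def)
    have "AE \<theta> in lebesgue. \<forall>e'\<in>M. 0 \<le> \<rho> (M, e', i) \<theta>"
      by (intro AE_finite_allI[OF fM[OF M(1)]] \<rho>0 choice_pairsI[OF M(1)] i)
    moreover have "AE \<theta> in lebesgue. (\<Sum>e\<in>M. \<rho> (M, e, i) \<theta>) = choice_prob G d \<mu> v M i \<theta> f"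
      using M by (intro \<rho>_sum v i) auto
    ultimately show ?thesis
    proof eventually_elim
      fix \<theta> assume *: "\<forall>e'\<in>M. 0 \<le> \<rho> (M, e', i) \<theta>" "(\<Sum>e\<in>M. \<rho> (M, e, i) \<theta>) = choice_prob G d \<mu> v M i \<theta> f"
      have "\<rho> (M, e, i) \<theta> \<le> (\<Sum>e\<in>M. \<rho> (M, e, i) \<theta>)" using * M fM by (intro member_le_sum) auto
      thus "\<rho> (M, e, i) \<theta> \<le> 1" using * choice_prob_bounds[OF i, of v M \<theta> f] by linarith
    qed
  qed
  have "r \<in> routing G I d \<mu> f"
    unfolding routing_def
  proof (intro CollectI exI[of _ \<rho>] conjI ballI allI impI)
    fix z assume "z \<in> choice_pairs G"
    show "case z of (M, e) \<Rightarrow> \<forall>i\<in>I. \<rho> (M, e, i) \<in> splits"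
    proof (cases z)
      case (Pair M e)
      hence Me: "(M, e) \<in> choice_pairs G" using \<open>z \<in> choice_pairs G\<close> by simp
      have "\<rho> (M, e, i) \<in> splits" if "i \<in> I" for i
      proof -
        have "AE \<theta> in lebesgue. \<rho> (M, e, i) \<theta> \<in> {0..1}"
          using \<rho>0[OF Me that] \<rho>1[OF Me that] by eventually_elim simp
        thus ?thesis using \<rho>m[OF Me that] by (simp add: splits_def)
      qed
      thus ?thesis using Pair by simp
    qed
  next
    show "ae_equal A r (\<lambda>(e, i) \<theta>. \<Sum>M | (M, e) \<in> choice_pairs G. \<rho> (M, e, i) \<theta>)"
      by (simp add: ae_equal_def r_def)
  qed (use \<rho>_sum in auto)
  moreover have "AE \<theta> in lebesgue. ereal \<theta> < T \<longrightarrow> (\<forall>i\<in>I.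
        (\<forall>e \<in> arcs G. y (e, i) \<theta> = \<Phi> x (e, i) \<theta>) \<and>
        (\<forall>v \<in> verts G. (\<Sum>e\<in>out_arcs G v. x (e, i) \<theta>) = inflow y (v, i) \<theta>) \<and>
        (\<forall>e \<in> arcs G. x (e, i) \<theta> = r (e, i) \<theta> * (\<Sum>e'\<in>out_arcs G (tail G e). x (e', i) \<theta>)))"
  proof -
    have 1: "AE \<theta> in lebesgue. \<forall>j\<in>A. ereal \<theta> < T \<longrightarrow> y j \<theta> = \<Phi> x j \<theta>"
      by (intro AE_finite_allI finite_A loading)
    have 2: "AE \<theta> in lebesgue. \<forall>j\<in>verts G \<times> I. ereal \<theta> < T \<longrightarrow> (\<Sum>e\<in>out_arcs G (fst j). x (e, snd j) \<theta>) = inflow y j \<theta>"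
    proof (intro AE_finite_allI)
      fix j assume "j \<in> verts G \<times> I"
      thus "AE \<theta> in lebesgue. ereal \<theta> < T \<longrightarrow> (\<Sum>e\<in>out_arcs G (fst j). x (e, snd j) \<theta>) = inflow y j \<theta>"
        using balance[of "fst j" "snd j"] by auto
    qed (use I in auto)
    have 3: "AE \<theta> in lebesgue. \<forall>j\<in>A. ereal \<theta> < T \<longrightarrow> x j \<theta> = (\<Sum>M | (M, fst j) \<in> choice_pairs G. H (M, fst j, snd j) \<theta>)"
    proof (intro AE_finite_allI finite_A)
      fix j assume "j \<in> A"
      thus "AE \<theta> in lebesgue. ereal \<theta> < T \<longrightarrow> x j \<theta> = (\<Sum>M | (M, fst j) \<in> choice_pairs G. H (M, fst j, snd j) \<theta>)"
        using shares[of "fst j" "snd j"] by auto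
    qed
    have 4: "AE \<theta> in lebesgue. \<forall>j\<in>A. 0 \<le> x j \<theta>"
      using x by (intro AE_finite_allI finite_A ratesD(2)) auto
    from 1 2 3 4 show ?thesis
    proof eventually_elim
      fix \<theta>
      assume *: "\<forall>j\<in>A. ereal \<theta> < T \<longrightarrow> y j \<theta> = \<Phi> x j \<theta>"
        "\<forall>j\<in>verts G \<times> I. ereal \<theta> < T \<longrightarrow> (\<Sum>e\<in>out_arcs G (fst j). x (e, snd j) \<theta>) = inflow y j \<theta>"
        "\<forall>j\<in>A. ereal \<theta> < T \<longrightarrow> x j \<theta> = (\<Sum>M | (M, fst j) \<in> choice_pairs G. H (M, fst j, snd j) \<theta>)"
        "\<forall>j\<in>A. 0 \<le> x j \<theta>"
      show "ereal \<theta> < T \<longrightarrow> (\<forall>i\<in>I.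
        (\<forall>e \<in> arcs G. y (e, i) \<theta> = \<Phi> x (e, i) \<theta>) \<and>
        (\<forall>v \<in> verts G. (\<Sum>e\<in>out_arcs G v. x (e, i) \<theta>) = inflow y (v, i) \<theta>) \<and>
        (\<forall>e \<in> arcs G. x (e, i) \<theta> = r (e, i) \<theta> * (\<Sum>e'\<in>out_arcs G (tail G e). x (e', i) \<theta>)))"
      proof (intro impI ballI conjI)
        fix i e assume T: "ereal \<theta> < T" and i: "i \<in> I" and e: "e \<in> arcs G"
        have s: "(\<Sum>e'\<in>out_arcs G (tail G e). x (e', i) \<theta>) = X e i \<theta>"
          using *(2) T i e tail_in_verts[OF e] by (auto simp: X_def)
        have xH: "x (e, i) \<theta> = (\<Sum>M | (M, e) \<in> choice_pairs G. H (M, e, i) \<theta>)" using *(3) T i e by auto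
        show "x (e, i) \<theta> = r (e, i) \<theta> * (\<Sum>e'\<in>out_arcs G (tail G e). x (e', i) \<theta>)"
        proof (cases "0 < X e i \<theta>")
          case True
          thus ?thesis unfolding s xH r_def prod.case sum_distrib_right using T
            by (intro sum.cong) (auto simp: \<rho>_def)
        next
          case False
          \<comment> \<open>Without inflow the edge rates are nonnegative with sum at most 0, so
            they vanish and any value of \<open>r\<close> satisfies the equation.\<close>
          have le: "x (e, i) \<theta> \<le> (\<Sum>e'\<in>out_arcs G (tail G e). x (e', i) \<theta>)"
            using e i *(4) finite_out by (intro member_le_sum) auto
          have "0 \<le> x (e, i) \<theta>" using *(4) e i by auto
          hence "x (e, i) \<theta> = 0" "X e i \<theta> = 0" using le False s by auto
          thus ?thesis using s by simp
        qed
      next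
        fix i e assume "ereal \<theta> < T" "i \<in> I" "e \<in> arcs G"
        thus "y (e, i) \<theta> = \<Phi> x (e, i) \<theta>" using *(1) by blast
      next
        fix i v assume "ereal \<theta> < T" "i \<in> I" "v \<in> verts G"
        thus "(\<Sum>e\<in>out_arcs G v. x (e, i) \<theta>) = inflow y (v, i) \<theta>" using bspec[OF *(2), of "(v, i)"] by simp
      qed
    qed
  qed
  ultimately show ?thesis
    using f unfolding prediction_equilibrium_def f_def edge_inflow_join edge_outflow_join inflow_def prod.case
    by (intro conjI bexI[of _ r])
qed

end

section \<open>Approximate equilibria\<close>

lemma cell_integral_bound:
  assumes "1 < p" "loc_bounded p X"
  obtains D where "\<And>m. \<bar>cell_integral (X m) n k\<bar> \<le> D"
proof -
  define N where "N = Suc k"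
  have kN: "k < N * 2 ^ n" unfolding N_def by (rule less_Suc_mult)
  have L: "restr N (X m) \<in> Lp_on p N" for m using assms(2) by (auto simp: loc_bounded_def loc_LpD)
  obtain B where B: "\<And>m. modular p (restr N (X m)) \<le> B"
    using assms(2) unfolding loc_bounded_def by blast
  have "\<bar>cell_integral (X m) n k\<bar> \<le> 1 / 2 ^ n + B" for m
  proof -
    have "\<bar>cell_integral (X m) n k\<bar> = \<bar>LINT t|lebesgue. restr N (X m) t * indicator (dyad n k) t\<bar>"
      using cell_integral_restr[OF kN, of "X m"] by (simp add: cell_integral_def mult.commute)
    also have "\<dots> \<le> 1 * (LINT t|lebesgue. \<bar>indicator (dyad n k) t :: real\<bar>) + 1 * 1 powr (1 - p) * B"
      by (rule integral_mult_modular_bound[OF assms(1) _ L B]) (auto intro!: AE_I2 split: split_indicator)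
    finally show ?thesis by (simp add: measure_dyad)
  qed
  thus ?thesis using that by blast
qed

lemma rates_mult:
  assumes "1 < p" "f \<in> rates p" "a \<in> borel_measurable lebesgue" "AE t in lebesgue. 0 \<le> a t \<and> a t \<le> c"
  shows "(\<lambda>t. a t * f t) \<in> rates p"
proof (rule rates_if_loc_Lp)
  have "AE t in lebesgue. \<bar>a t\<bar> \<le> c" using assms(4) by eventually_elim auto
  thus "loc_Lp p (\<lambda>t. a t * f t)" using assms(1) by (intro loc_Lp_mult(1) rates_loc_Lp assms(2,3)) auto
  show "AE t in lebesgue. 0 \<le> t \<longrightarrow> 0 \<le> a t * f t" using ratesD(2)[OF assms(2)] assms(4) by eventually_elim auto
  show "AE t in lebesgue. t < 0 \<longrightarrow> a t * f t = 0" using ratesD(3)[OF assms(2)] by eventually_elim auto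
qed (use assms in auto)

lemma before_lebesgue [measurable]: "before T \<in> sets lebesgue"
proof -
  have "before T = {0..} \<inter> {t. ereal t < T}" by (auto simp: before_def)
  moreover have "{t. ereal t < T} \<in> sets lebesgue" by (cases T) (auto simp: lessThan_def[symmetric])
  ultimately show ?thesis by auto
qed

lemma rates_cut: "1 < p \<Longrightarrow> S \<in> sets lebesgue \<Longrightarrow> f \<in> rates p \<Longrightarrow> (\<lambda>t. indicator S t * f t) \<in> rates p"
  by (rule rates_mult[of p f _ 1]) (auto simp: indicator_def)

lemma rates_until_cut: "1 < p \<Longrightarrow> f \<in> rates p \<Longrightarrow> (\<lambda>t. indicator (before T) t * f t) \<in> rates_until p T"
  using rates_cut[OF _ before_lebesgue] by (auto simp: rates_until_def indicator_def intro!: AE_I2)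

lemma AE_lebesgue_neq: "AE t in lebesgue. t \<noteq> (c :: real)"
  using AE_lborel_singleton[of c] by (rule AE_completion)

text \<open>The loading is cut to a closed interval, whereas \<open>before\<close> is half-open; the
  difference is the null set consisting of the point \<open>T\<close>.\<close>

lemma rates_until_cut_closed:
  assumes "1 < p" "f \<in> rates p"
  shows "(\<lambda>t. indicator {0..T} t * f t) \<in> rates_until p (ereal T)"
proof -
  have "AE t in lebesgue. t \<notin> before (ereal T) \<longrightarrow> indicator {0..T} t * f t = 0"
    using AE_lebesgue_neq[of T] by eventually_elim (auto simp: before_def indicator_def)
  thus ?thesis using rates_cut[OF assms(1) _ assms(2), of "{0..T}"] by (simp add: rates_until_def)
qed

lemma modular_cong_AE:
  assumes "AE t in lebesgue. f t = g t" "f \<in> borel_measurable lebesgue" "g \<in> borel_measurable lebesgue"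
  shows "modular p f = modular p g"
  unfolding modular_def
proof (rule integral_cong_AE)
  show "AE t in lebesgue. \<bar>f t\<bar> powr p = \<bar>g t\<bar> powr p" using assms(1) by eventually_elim simp
qed (use assms in measurable)

lemma loc_bounded_dominated:
  assumes p: "1 < p" and "loc_bounded p Y" "\<And>m. X m \<in> borel_measurable lebesgue"
    "\<And>m. AE t in lebesgue. 0 \<le> t \<longrightarrow> \<bar>X m t\<bar> \<le> \<bar>Y m t\<bar>"
  shows "loc_bounded p X"
proof -
  have rm: "restr N (X m) \<in> borel_measurable lebesgue" for N m unfolding restr_def using assms(3) by measurable
  have L: "restr N (Y m) \<in> Lp_on p N" for N m using assms(2) by (auto simp: loc_bounded_def loc_LpD)
  have ae: "AE t in lebesgue. \<bar>restr N (X m) t\<bar> \<le> \<bar>restr N (Y m) t\<bar>" for N m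
    using assms(4)[of m] by eventually_elim (auto simp: restr_def indicator_def)
  have "restr N (X m) \<in> Lp_on p N" for N m
  proof -
    have "integrable lebesgue (\<lambda>t. \<bar>restr N (X m) t\<bar> powr p)"
    proof (rule Bochner_Integration.integrable_bound[OF Lp_onD(2)[OF L]])
      show "AE t in lebesgue. norm (\<bar>restr N (X m) t\<bar> powr p) \<le> norm (\<bar>restr N (Y m) t\<bar> powr p)"
        using ae[of N m] by eventually_elim (use p in \<open>auto intro!: powr_mono2\<close>)
    qed (use rm in measurable)
    thus ?thesis using rm by (auto simp: Lp_on_def restr_outside)
  qed
  moreover have "\<exists>B. \<forall>m. modular p (restr N (X m)) \<le> B" for N
  proof -
    obtain B where B: "\<And>m. modular p (restr N (Y m)) \<le> B" using assms(2) unfolding loc_bounded_def by blast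
    have "modular p (restr N (X m)) \<le> B" for m
      by (rule order_trans[OF modular_mono[OF ae p L rm] B])
    thus ?thesis by blast
  qed
  ultimately show ?thesis using assms(3) by (simp add: loc_bounded_def loc_Lp_def)
qed

text \<open>No cell of any level straddles the integer \<open>N\<close>.\<close>

lemma restr_avg: "restr N (avg n f) = avg n (restr N f)"
proof
  fix t
  show "restr N (avg n f) t = avg n (restr N f) t"
    using cell_less[of t N n] cell_integral_restr[of "cell n t" N n f] cell_integral_restr_outside[of "cell n t" N n f]
    by (auto simp: restr_def avg_def step_def indicator_def)
qed

lemma loc_bounded_avg:
  assumes p: "1 < p" and "loc_bounded p Y"
  shows "loc_bounded p (\<lambda>m. avg (s m) (Y m))"
proof -
  have L: "restr N (Y m) \<in> Lp_on p N" for N m using assms(2) by (auto simp: loc_bounded_def loc_LpD)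
  have "\<exists>B. \<forall>m. modular p (avg (s m) (restr N (Y m))) \<le> B" for N
  proof -
    obtain B where B: "\<And>m. modular p (restr N (Y m)) \<le> B" using assms(2) unfolding loc_bounded_def by blast
    have "modular p (avg (s m) (restr N (Y m))) \<le> B" for m by (rule order_trans[OF modular_avg_le[OF p L] B])
    thus ?thesis by blast
  qed
  thus ?thesis using avg_Lp_on[OF p L] by (simp add: loc_bounded_def loc_Lp_def restr_avg borel_measurable_lebesgue)
qed

text \<open>With countable quantifiers, convergence becomes a countable combination of measurable
  events, as the exchange of null sets requires.\<close>

lemma tendsto_iff_Suc:
  fixes a :: "nat \<Rightarrow> real"
  shows "a \<longlonglongrightarrow> l \<longleftrightarrow> (\<forall>k. \<exists>M. \<forall>m. M \<le> m \<longrightarrow> \<bar>a m - l\<bar> < inverse (real (Suc k)))"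
proof
  assume "a \<longlonglongrightarrow> l"
  thus "\<forall>k. \<exists>M. \<forall>m. M \<le> m \<longrightarrow> \<bar>a m - l\<bar> < inverse (real (Suc k))"
    using LIMSEQ_D[of a l] by (metis inverse_positive_iff_positive of_nat_0_less_iff real_norm_def zero_less_Suc)
next
  assume *: "\<forall>k. \<exists>M. \<forall>m. M \<le> m \<longrightarrow> \<bar>a m - l\<bar> < inverse (real (Suc k))"
  show "a \<longlonglongrightarrow> l"
  proof (rule LIMSEQ_I)
    fix r :: real assume "0 < r"
    then obtain k where k: "inverse (real (Suc k)) < r" using reals_Archimedean by blast
    obtain M where "\<forall>m. M \<le> m \<longrightarrow> \<bar>a m - l\<bar> < inverse (real (Suc k))" using * by blast
    hence "\<forall>m\<ge>M. norm (a m - l) < r" using k by (auto intro: less_trans)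
    thus "\<exists>M. \<forall>m\<ge>M. norm (a m - l) < r" by blast
  qed
qed

lemma pred_tendsto:
  fixes a :: "nat \<Rightarrow> 'c \<Rightarrow> real"
  assumes "\<And>m. a m \<in> borel_measurable M" "b \<in> borel_measurable M"
  shows "Measurable.pred M (\<lambda>x. (\<lambda>m. a m x) \<longlonglongrightarrow> b x)"
  unfolding tendsto_iff_Suc
proof (intro pred_intros_countable pred_intros_logic)
  fix k m
  show "Measurable.pred M (\<lambda>x. \<bar>a m x - b x\<bar> < inverse (real (Suc k)))"
    unfolding pred_def using assms by (intro borel_measurable_less) auto
qed simp

context network
begin

section \<open>Bounds and limits of loading, costs and routing\<close>

lemma A_rates_loc_Lp: "x \<in> A \<rightarrow> rates p \<Longrightarrow> j \<in> A \<Longrightarrow> loc_Lp p (x j)"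
  using p by (intro rates_loc_Lp) auto

lemma A_rates_until: "x \<in> A \<rightarrow> rates_until p T \<Longrightarrow> x \<in> A \<rightarrow> rates p"
  using rates_untilD(1) by blast

lemma loading_modular_bound:
  assumes "0 \<le> T"
  obtains B where "\<And>x j. x \<in> A \<rightarrow> rates p \<Longrightarrow> j \<in> A \<Longrightarrow> modular p (cut {0..T} (\<Phi> x) j) \<le> B"
proof -
  obtain B where B: "\<And>x. x \<in> A \<rightarrow> rates p \<Longrightarrow> vec_norm p A (cut {0..T} (\<Phi> x)) \<le> B" "0 \<le> B"
    using \<Phi>_bounded assms unfolding locally_bounded_loading_def by blast
  have "modular p (cut {0..T} (\<Phi> x) j) \<le> B powr p" if "x \<in> A \<rightarrow> rates p" "j \<in> A" for x j
  proof -
    have "modular p (cut {0..T} (\<Phi> x) j) powr (1 / p) \<le> B"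
      using order_trans[OF Lp_norm_le_vec_norm[OF finite_A that(2)] B(1)[OF that(1)]] by (simp only: Lp_norm_modular)
    hence "(modular p (cut {0..T} (\<Phi> x) j) powr (1 / p)) powr p \<le> B powr p" using p by (intro powr_mono2) auto
    thus ?thesis using p by (simp add: powr_powr)
  qed
  thus ?thesis using that by blast
qed

text \<open>The bound on the loading is uniform over all inflows, so outflow rates of arbitrary
  sequences are locally bounded. No a priori bound on the inflow rates enters; theirs follows
  afterwards from the node balance.\<close>

lemma loading_loc_bounded:
  assumes x: "\<And>m. x m \<in> A \<rightarrow> rates p" and j: "j \<in> A" and S: "\<And>m. S m \<in> sets lebesgue"
  shows "loc_bounded p (\<lambda>m. cut (S m) (\<Phi> (x m)) j)"
proof (rule loc_bounded_dominated[OF p, of "\<lambda>m. \<Phi> (x m) j"])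
  have r: "\<Phi> (x m) j \<in> rates p" for m using \<Phi>_rates[OF x] j by auto
  have "\<exists>B. \<forall>m. modular p (restr N (\<Phi> (x m) j)) \<le> B" for N
  proof -
    obtain B where B: "\<And>x j. x \<in> A \<rightarrow> rates p \<Longrightarrow> j \<in> A \<Longrightarrow> modular p (cut {0..real N} (\<Phi> x) j) \<le> B"
      using loading_modular_bound[of "real N"] by auto
    have "modular p (restr N (\<Phi> (x m) j)) \<le> B" for m
    proof -
      have L: "(\<lambda>t. indicator {0..real N} t * \<Phi> (x m) j t) \<in> rates p" by (intro rates_cut p r) simp
      have "modular p (restr N (\<Phi> (x m) j)) = modular p (cut {0..real N} (\<Phi> (x m)) j)"
      proof (rule modular_cong_AE)
        show "AE t in lebesgue. restr N (\<Phi> (x m) j) t = cut {0..real N} (\<Phi> (x m)) j t"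
          using AE_lebesgue_neq[of "real N"] by eventually_elim (auto simp: restr_def cut_def indicator_def)
        show "restr N (\<Phi> (x m) j) \<in> borel_measurable lebesgue" unfolding restr_def using ratesD(1)[OF r] by measurable
        show "cut {0..real N} (\<Phi> (x m)) j \<in> borel_measurable lebesgue" unfolding cut_def by (rule ratesD(1)[OF L])
      qed
      also have "\<dots> \<le> B" by (rule B[OF x j])
      finally show ?thesis .
    qed
    thus ?thesis by blast
  qed
  thus "loc_bounded p (\<lambda>m. \<Phi> (x m) j)" using rates_loc_Lp[OF r] p by (simp add: loc_bounded_def)
  show "cut (S m) (\<Phi> (x m)) j \<in> borel_measurable lebesgue" for m
    unfolding cut_def using S[of m] ratesD(1)[OF r[of m]] by measurable
qed (auto simp: cut_def indicator_def)

text \<open>Passes from dyadic testing to all bounded functionals, where continuity of the loading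
  is assumed, and back.\<close>

lemma loading_wconv:
  assumes T: "0 \<le> T" and cont: "continuity_until p G I \<Phi> \<mu> T"
    and X: "\<And>m. X m \<in> A \<rightarrow> rates_until p (ereal T)" "x \<in> A \<rightarrow> rates_until p (ereal T)"
    and w: "\<And>j. j \<in> A \<Longrightarrow> loc_bounded p (\<lambda>m. X m j)" "\<And>j. j \<in> A \<Longrightarrow> wconv (\<lambda>m. X m j) (x j)" and j: "j \<in> A"
  shows "wconv (\<lambda>m. cut {0..T} (\<Phi> (X m)) j) (cut {0..T} (\<Phi> x) j)"
proof -
  obtain N :: nat where N: "T \<le> real N" using real_arch_simple by blast
  have "weakly_converges p A X x"
    using X p N rates_until_Lp_space[of _ p T N]
    by (intro wconv_imp_weakly_converges[OF p finite_A, where N=N] w) (auto simp: Pi_iff)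
  hence "weakly_converges p A (\<lambda>m. cut {0..T} (\<Phi> (X m))) (cut {0..T} (\<Phi> x))"
    using cont X unfolding continuity_until_def weak_weak_continuous_on_def by (auto simp: image_subset_iff)
  thus ?thesis using weakly_converges_imp_wconv[OF p finite_A j] by blast
qed

text \<open>Continuity is assumed for almost every predictor and then almost every time, whereas
  routing at a fixed time averages over predictors. For a fixed sequence the event of convergence is
  measurable, so the order can be exchanged.\<close>

lemma costs_tendsto:
  assumes T: "0 \<le> T" and cont: "continuity_until p G I \<Phi> \<mu> T" and i: "i \<in> I"
    and F: "\<And>m. F m \<in> flows_until p G I (ereal T)" "f \<in> flows_until p G I (ereal T)"
    and w: "\<And>j. j \<in> flow_index G I \<Longrightarrow> loc_bounded p (\<lambda>m. F m j)" "\<And>j. j \<in> flow_index G I \<Longrightarrow> wconv (\<lambda>m. F m j) (f j)"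
  shows "AE \<theta> in lebesgue. \<theta> < T \<longrightarrow> (AE C in \<mu> i. \<forall>q\<in>simple_paths G. (\<lambda>m. C \<theta> (F m) q) \<longlonglongrightarrow> C \<theta> f q)"
proof -
  obtain N :: nat where N: "T \<le> real N" using real_arch_simple by blast
  have "F m j \<in> rates_until p (ereal T)" "f j \<in> rates_until p (ereal T)" if "j \<in> flow_index G I" for m j
    using F that by (auto simp: flows_until_def)
  note L = rates_until_Lp_space[OF this(1) _ N] rates_until_Lp_space[OF this(2) _ N]
  have weak: "weakly_converges p (flow_index G I) F f"
    using p by (intro wconv_imp_weakly_converges[OF p finite_flow_index, where N=N] w L) auto
  have flows: "F m \<in> flows p G I" "f \<in> flows p G I" for m
    using F rates_untilD(1) unfolding flows_until_def flows_def by blast+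
  have "AE \<theta> in lebesgue. AE C in \<mu> i. \<theta> < T \<longrightarrow> (\<forall>q\<in>simple_paths G. (\<lambda>m. C \<theta> (F m) q) \<longlonglongrightarrow> C \<theta> f q)"
  proof (rule AE_swap_lebesgue[OF prob_space_\<mu>[OF i]])
    have "AE C in \<mu> i. AE \<theta> in lebesgue. \<theta> < T \<longrightarrow> (\<forall>q \<in> simple_paths G.
        weak_strong_continuous_on p (flow_index G I) (flows_until p G I T) (\<lambda>f. C \<theta> f q))"
      using cont i unfolding continuity_until_def by blast
    thus "AE C in \<mu> i. AE \<theta> in lebesgue. \<theta> < T \<longrightarrow> (\<forall>q\<in>simple_paths G. (\<lambda>m. C \<theta> (F m) q) \<longlonglongrightarrow> C \<theta> f q)"
    proof eventually_elim
      fix C assume "AE \<theta> in lebesgue. \<theta> < T \<longrightarrow> (\<forall>q \<in> simple_paths G.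
        weak_strong_continuous_on p (flow_index G I) (flows_until p G I T) (\<lambda>f. C \<theta> f q))"
      thus "AE \<theta> in lebesgue. \<theta> < T \<longrightarrow> (\<forall>q\<in>simple_paths G. (\<lambda>m. C \<theta> (F m) q) \<longlonglongrightarrow> C \<theta> f q)"
      proof eventually_elim
        fix \<theta> assume "\<theta> < T \<longrightarrow> (\<forall>q \<in> simple_paths G.
          weak_strong_continuous_on p (flow_index G I) (flows_until p G I T) (\<lambda>f. C \<theta> f q))"
        thus "\<theta> < T \<longrightarrow> (\<forall>q\<in>simple_paths G. (\<lambda>m. C \<theta> (F m) q) \<longlonglongrightarrow> C \<theta> f q)"
          using weak F unfolding weak_strong_continuous_on_def by (simp add: image_subset_iff)
      qed
    qed
    show "Measurable.pred (\<mu> i \<Otimes>\<^sub>M lebesgue)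
        (\<lambda>x. snd x < T \<longrightarrow> (\<forall>q\<in>simple_paths G. (\<lambda>m. fst x (snd x) (F m) q) \<longlonglongrightarrow> fst x (snd x) f q))"
    proof (intro pred_intros_logic pred_intros_finite finite_simple_paths pred_tendsto cost_measurable[OF i] flows)
      have "(snd :: _ \<times> real \<Rightarrow> real) \<in> borel_measurable (\<mu> i \<Otimes>\<^sub>M lebesgue)"
      proof -
        have "(\<lambda>\<theta>::real. \<theta>) \<in> borel_measurable lebesgue" by (intro borel_measurable_lebesgue) simp
        from measurable_compose[OF measurable_snd[of "\<mu> i" lebesgue] this] show ?thesis by simp
      qed
      thus "Measurable.pred (\<mu> i \<Otimes>\<^sub>M lebesgue) (\<lambda>x. snd x < T)"
        unfolding pred_def by (intro borel_measurable_less) auto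
    qed
  qed
  thus ?thesis by eventually_elim auto
qed

text \<open>Each alternative is uniform in \<open>x\<close> and \<open>y\<close>, so a single case
  distinction treats a whole sequence of flows together with its limit.\<close>

lemma join_index_cases:
  assumes "h \<in> flow_index G I"
  obtains j where "j \<in> A" "\<And>x y. join x y h = x j" | j where "j \<in> A" "\<And>x y. join x y h = y j"
proof -
  obtain e i s where h: "h = (e, i, s)" "(e, i) \<in> A" using assms by (auto simp: flow_index_def)
  show ?thesis
  proof (cases s)
    case Plus
    show ?thesis by (rule that(1)[OF h(2)]) (simp add: h(1) Plus join_def)
  next
    case Minus
    show ?thesis by (rule that(2)[OF h(2)]) (simp add: h(1) Minus join_def)
  qed
qed

definition route :: "nat \<Rightarrow> ('e \<times> 'i \<times> sign) vec \<Rightarrow> ('e \<times> 'i) vec" where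
  "route n f = (\<lambda>(e, i) \<theta>. LINT C|\<mu> i. softmax (tail G e) i e n (C \<theta> f))"

lemma route_measurable: "f \<in> flows p G I \<Longrightarrow> j \<in> A \<Longrightarrow> route n f j \<in> borel_measurable lebesgue"
proof -
  assume f: "f \<in> flows p G I" and "j \<in> A"
  then obtain e i where j: "j = (e, i)" "e \<in> arcs G" "i \<in> I" by auto
  show ?thesis unfolding j(1) route_def prod.case
    using measurable_expectation_sections[OF prob_space_\<mu>[OF j(3)] softmax_measurable[OF j(3) tail_in_verts[OF j(2)] f]] .
qed

lemma softmax_section_integrable:
  assumes "f \<in> flows p G I" "e \<in> arcs G" "i \<in> I"
  shows "integrable (\<mu> i) (\<lambda>C. softmax (tail G e) i e n (C \<theta> f))"
proof -
  interpret prob_space "\<mu> i" by (rule prob_space_\<mu>[OF assms(3)])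
  show ?thesis
    using measurable_sections[OF softmax_measurable[OF assms(3) tail_in_verts[OF assms(2)] assms(1)]] softmax_bounds
    by (intro integrable_const_bound[where B=1]) auto
qed

lemma route_bounds: "f \<in> flows p G I \<Longrightarrow> j \<in> A \<Longrightarrow> 0 \<le> route n f j \<theta> \<and> route n f j \<theta> \<le> 1"
proof -
  assume f: "f \<in> flows p G I" and "j \<in> A"
  then obtain e i where j: "j = (e, i)" "e \<in> arcs G" "i \<in> I" by auto
  interpret prob_space "\<mu> i" by (rule prob_space_\<mu>[OF j(3)])
  have "(LINT C|\<mu> i. softmax (tail G e) i e n (C \<theta> f)) \<le> (LINT C|\<mu> i. 1)"
    using softmax_section_integrable[OF f j(2,3)] softmax_bounds by (intro integral_mono) auto
  thus ?thesis using softmax_bounds by (auto simp: j(1) route_def prob_space)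
qed

lemma inflow_loc_bounded:
  assumes "v \<in> verts G" "i \<in> I" "\<And>j. j \<in> A \<Longrightarrow> loc_bounded p (\<lambda>m. y m j)"
  shows "loc_bounded p (\<lambda>m. inflow (y m) (v, i))"
proof -
  have "loc_bounded p (\<lambda>m \<theta>. u (v, i) \<theta> + (\<Sum>e\<in>in_arcs G v. y m (e, i) \<theta>))"
  proof (intro loc_bounded_add[OF p] loc_bounded_sum[OF p] loc_bounded_const)
    show "loc_Lp p (u (v, i))" using u assms(1,2) p by (intro rates_loc_Lp) auto
    show "loc_bounded p (\<lambda>m. y m (e, i))" if "e \<in> in_arcs G v" for e using that assms(2) by (intro assms(3)) auto
  qed
  from loc_bounded_mult[OF p this, of "\<lambda>m \<theta>. of_bool (v \<noteq> d i)" 1] show ?thesis by (simp add: inflow_def)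
qed

lemma inflow_wconv:
  assumes v: "v \<in> verts G" and i: "i \<in> I"
    and y: "\<And>j m. j \<in> A \<Longrightarrow> loc_Lp p (y m j)" "\<And>j. j \<in> A \<Longrightarrow> loc_Lp p (y' j)" "\<And>j. j \<in> A \<Longrightarrow> wconv (\<lambda>m. y m j) (y' j)"
  shows "wconv (\<lambda>m. inflow (y m) (v, i)) (inflow y' (v, i))"
proof -
  have L: "loc_Lp p (u (v, i))" using u v i p by (intro rates_loc_Lp) auto
  have in_A: "(e, i) \<in> A" if "e \<in> in_arcs G v" for e using that i by auto
  have "wconv (\<lambda>m \<theta>. u (v, i) \<theta> + (\<Sum>e\<in>in_arcs G v. y m (e, i) \<theta>)) (\<lambda>\<theta>. u (v, i) \<theta> + (\<Sum>e\<in>in_arcs G v. y' (e, i) \<theta>))"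
    by (intro wconv_add[OF p] wconv_sum[OF p] loc_Lp_sum[OF p] L wconv_const y in_A)
  thus ?thesis by (cases "v = d i") (auto simp: inflow_def wconv_const)
qed

text \<open>The parentheses separate the bounded routing factor, for which pointwise convergence is
  available, from the node inflow, which converges only weakly.\<close>

definition routed :: "real \<Rightarrow> nat \<Rightarrow> ('e \<times> 'i) vec \<Rightarrow> ('e \<times> 'i) vec \<Rightarrow> ('e \<times> 'i) vec" where
  "routed T n x y = (\<lambda>(e, i) \<theta>. (indicator {0..<T} \<theta> * route n (join x y) (e, i) \<theta>) * inflow y (tail G e, i) \<theta>)"

lemma routed_loc_bounded:
  assumes x: "\<And>m. x m \<in> A \<rightarrow> rates p" "\<And>m. y m \<in> A \<rightarrow> rates p" and y: "\<And>j. j \<in> A \<Longrightarrow> loc_bounded p (\<lambda>m. y m j)" and j: "j \<in> A"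
  shows "loc_bounded p (\<lambda>m. routed (T m) (s m) (x m) (y m) j)"
proof -
  obtain e i where ei: "j = (e, i)" "e \<in> arcs G" "i \<in> I" using j by auto
  have F: "join (x m) (y m) \<in> flows p G I" for m using x by (simp add: join_flows)
  have eiA: "(e, i) \<in> A" using ei by simp
  show ?thesis unfolding ei(1) routed_def prod.case
  proof (rule loc_bounded_mult[where c=1, OF p inflow_loc_bounded[OF tail_in_verts[OF ei(2)] ei(3) y]])
    show "(\<lambda>\<theta>. indicator {0..<T m} \<theta> * route (s m) (join (x m) (y m)) (e, i) \<theta>) \<in> borel_measurable lebesgue" for m
      using route_measurable[OF F[of m] eiA, of "s m"] by measurable
    show "AE \<theta> in lebesgue. \<bar>indicator {0..<T m} \<theta> * route (s m) (join (x m) (y m)) (e, i) \<theta>\<bar> \<le> 1" for m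
      using route_bounds[OF F[of m] eiA] by (intro AE_I2) (auto simp: indicator_def)
  qed
qed

lemma route_tendsto:
  assumes F: "\<And>m. F m \<in> flows p G I" "f \<in> flows p G I" and e: "e \<in> arcs G" and i: "i \<in> I"
    and c: "AE C in \<mu> i. \<forall>q\<in>simple_paths G. (\<lambda>m. C \<theta> (F m) q) \<longlonglongrightarrow> C \<theta> f q"
  shows "(\<lambda>m. route n (F m) (e, i) \<theta>) \<longlonglongrightarrow> route n f (e, i) \<theta>"
proof -
  interpret prob_space "\<mu> i" by (rule prob_space_\<mu>[OF i])
  show ?thesis unfolding route_def prod.case
  proof (rule integral_dominated_convergence[where w="\<lambda>_. 1"])
    show "AE C in \<mu> i. (\<lambda>m. softmax (tail G e) i e n (C \<theta> (F m))) \<longlonglongrightarrow> softmax (tail G e) i e n (C \<theta> f)"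
      using c by eventually_elim (intro softmax_tendsto, use path_simple[OF _ tail_in_verts[OF e] i] in blast)
  qed (use softmax_section_integrable[OF F(1) e i] softmax_section_integrable[OF F(2) e i] softmax_bounds in auto)
qed

end

context network
begin

lemma routed_nonneg:
  assumes "x \<in> A \<rightarrow> rates p" "y \<in> A \<rightarrow> rates p" "j \<in> A"
  shows "AE \<theta> in lebesgue. 0 \<le> routed T n x y j \<theta>"
proof -
  obtain e i where j: "j = (e, i)" "e \<in> arcs G" "i \<in> I" using assms(3) by auto
  have "AE \<theta> in lebesgue. 0 \<le> inflow y (tail G e, i) \<theta>"
    using assms(2) j by (intro inflow_nonneg ratesD(2)) auto
  thus ?thesis
    by eventually_elim (use route_bounds[of "join x y" "(e, i)" n] assms j in \<open>auto simp: routed_def join_flows\<close>)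
qed

text \<open>A family without a common bound would contain a sequence of unbounded cell integrals,
  but the routed flows of any sequence are locally bounded. The bound determines the size of the
  cube for Brouwer's theorem.\<close>

lemma routed_cell_bounded:
  assumes "j \<in> A"
  obtains D where "\<And>x T. x \<in> A \<rightarrow> rates p \<Longrightarrow> \<bar>cell_integral (routed T s x (cut {0..T} (\<Phi> x)) j) n k\<bar> \<le> D"
proof -
  have "\<exists>D. \<forall>x T. x \<in> A \<rightarrow> rates p \<longrightarrow> \<bar>cell_integral (routed T s x (cut {0..T} (\<Phi> x)) j) n k\<bar> \<le> D"
  proof (rule ccontr)
    assume *: "\<not> ?thesis"
    have "\<exists>x T. x \<in> A \<rightarrow> rates p \<and> real m < \<bar>cell_integral (routed T s x (cut {0..T} (\<Phi> x)) j) n k\<bar>" for m :: nat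
    proof (rule ccontr)
      assume "\<not> ?thesis"
      hence "\<forall>x T. x \<in> A \<rightarrow> rates p \<longrightarrow> \<bar>cell_integral (routed T s x (cut {0..T} (\<Phi> x)) j) n k\<bar> \<le> real m"
        by (simp only: not_ex de_Morgan_conj not_less) blast
      thus False using * by blast
    qed
    then obtain x T where xT: "\<And>m. x m \<in> A \<rightarrow> rates p"
      "\<And>m. real m < \<bar>cell_integral (routed (T m) s (x m) (cut {0..T m} (\<Phi> (x m))) j) n k\<bar>" by metis
    have y: "cut {0..T m} (\<Phi> (x m)) \<in> A \<rightarrow> rates p" for m
      using \<Phi>_rates[OF xT(1)[of m]] unfolding cut_def by (intro Pi_I rates_cut[OF p]) auto
    have "loc_bounded p (\<lambda>m. routed (T m) s (x m) (cut {0..T m} (\<Phi> (x m))) j)"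
      by (rule routed_loc_bounded[OF xT(1) y loading_loc_bounded[OF xT(1)] assms]) auto
    then obtain D where "\<And>m. \<bar>cell_integral (routed (T m) s (x m) (cut {0..T m} (\<Phi> (x m))) j) n k\<bar> \<le> D"
      using cell_integral_bound[OF p] by blast
    moreover obtain m :: nat where "D \<le> real m" using real_arch_simple by blast
    ultimately show False using xT(2)[of m] by (meson leD order_trans)
  qed
  thus ?thesis using that by blast
qed

text \<open>The cell averages of the edge inflow rates range over a cube, and Brouwer's theorem applies to
  the map that routes the resulting flow by the softmax rule and averages again.\<close>

lemma approximate_equilibrium_exists:
  assumes T: "0 \<le> T" and cont: "continuity_until p G I \<Phi> \<mu> T"
  obtains x where "x \<in> A \<rightarrow> rates_until p (ereal T)"
    "\<And>j \<theta>. j \<in> A \<Longrightarrow> x j \<theta> = indicator (before (ereal T)) \<theta> * avg n (routed T n x (cut {0..T} (\<Phi> x)) j) \<theta>"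
proof -
  obtain N :: nat where N: "T \<le> real N" using real_arch_simple by blast
  define K where "K = N * 2 ^ n"
  have "\<forall>z. \<exists>D. fst z \<in> A \<longrightarrow> (\<forall>x T. x \<in> A \<rightarrow> rates p \<longrightarrow> \<bar>cell_integral (routed T n x (cut {0..T} (\<Phi> x)) (fst z)) n (snd z)\<bar> \<le> D)"
    using routed_cell_bounded by meson
  then obtain D where D: "\<And>j k x. j \<in> A \<Longrightarrow> x \<in> A \<rightarrow> rates p \<Longrightarrow>
      \<bar>cell_integral (routed T n x (cut {0..T} (\<Phi> x)) j) n k\<bar> \<le> D (j, k)" by (metis fst_conv snd_conv)
  define B where "B = 1 + (\<Sum>z\<in>A \<times> {..<K}. \<bar>D z\<bar>)"
  have B0: "0 < B" unfolding B_def by (intro add_pos_nonneg sum_nonneg) auto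
  have B: "\<bar>cell_integral (routed T n x (cut {0..T} (\<Phi> x)) j) n k\<bar> \<le> B" if "j \<in> A" "k < K" "x \<in> A \<rightarrow> rates p" for j k x
  proof -
    have "\<bar>D (j, k)\<bar> \<le> (\<Sum>z\<in>A \<times> {..<K}. \<bar>D z\<bar>)" using that finite_A by (intro member_le_sum) auto
    thus ?thesis using D[OF that(1,3), of k] by (simp add: B_def)
  qed
  \<comment> \<open>Brouwer's theorem speaks about initial segments of the naturals. The bijection
    \<open>b\<close> numbers the pairs of an edge-commodity index and a cell, and \<open>c\<close>
    undoes the numbering.\<close>
  obtain b where b: "bij_betw b (A \<times> {..<K}) {..<card (A \<times> {..<K})}"
    using ex_bij_betw_finite_nat[of "A \<times> {..<K}"] finite_A by (auto simp: atLeast0LessThan)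
  define M where "M = card (A \<times> {..<K})"
  define c where "c = the_inv_into (A \<times> {..<K}) b"
  have bM: "b z < M" if "z \<in> A \<times> {..<K}" for z using b that by (auto simp: bij_betw_def M_def)
  have cb: "c (b z) = z" if "z \<in> A \<times> {..<K}" for z
    using b that by (auto simp: c_def bij_betw_def the_inv_into_f_f)
  have cA: "c l \<in> A \<times> {..<K}" if "l < M" for l
  proof -
    have "l \<in> b ` (A \<times> {..<K})" using b that by (simp add: bij_betw_def M_def)
    thus ?thesis using cb by auto
  qed
  define S where "S = before (ereal T)"
  have S: "S \<in> sets lebesgue" "S = {0..<T}" by (auto simp: S_def before_def)
  define \<beta> where "\<beta> k \<theta> = indicator S \<theta> * (B * 2 ^ n * indicator (dyad n k) \<theta>)" for k and \<theta> :: real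
  define X where "X z = (\<lambda>j \<theta>. \<Sum>k<K. z (b (j, k)) * \<beta> k \<theta>)" for z
  define Y where "Y z = cut {0..T} (\<Phi> (X z))" for z
  define R where "R z = routed T n (X z) (Y z)" for z
  have \<beta>L: "loc_Lp p (\<beta> k)" for k
  proof -
    have L: "(indicator (dyad n k) :: real \<Rightarrow> real) \<in> Lp_on p (Suc k)"
      using dyad_subset[OF less_Suc_mult[of k n]] p by (intro Lp_on_bounded[of _ _ 1]) (auto simp: indicator_def)
    have "loc_Lp p (indicator (dyad n k) :: real \<Rightarrow> real)"
      by (rule Lp_space_loc_Lp[OF _ Lp_on_Lp_space[OF L]]) (use p in simp)
    from loc_Lp_mult(1)[OF p this, of "\<lambda>\<theta>. indicator S \<theta> * (B * 2 ^ n)" "B * 2 ^ n"] show ?thesis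
      using S(1) B0 by (simp add: \<beta>_def[abs_def] mult.assoc indicator_def)
  qed
  have \<beta>0: "0 \<le> \<beta> k \<theta>" for k \<theta> using B0 by (simp add: \<beta>_def)
  have XL: "loc_Lp p (X z j)" for z j
    unfolding X_def
  proof (intro loc_Lp_sum[OF p])
    show "loc_Lp p (\<lambda>\<theta>. z (b (j, k)) * \<beta> k \<theta>)" for k
      by (rule loc_Lp_mult(1)[OF p \<beta>L, of _ "\<bar>z (b (j, k))\<bar>"]) auto
  qed
  have X0: "X z j \<theta> = 0" if "\<theta> \<notin> S" for z j \<theta> using that by (simp add: X_def \<beta>_def)
  have Xr: "X z \<in> A \<rightarrow> rates_until p (ereal T)" if z: "\<And>l. l < M \<Longrightarrow> z l \<in> {0..1}" for z
  proof (rule Pi_I)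
    fix j assume j: "j \<in> A"
    have nn: "0 \<le> X z j \<theta>" for \<theta>
      unfolding X_def
    proof (intro sum_nonneg mult_nonneg_nonneg \<beta>0)
      fix k assume "k \<in> {..<K}"
      thus "0 \<le> z (b (j, k))" using z[OF bM, of "(j, k)"] j by auto
    qed
    have "X z j \<in> rates p"
      by (rule rates_if_loc_Lp[OF _ XL]) (use p nn X0 S in auto)
    thus "X z j \<in> rates_until p (ereal T)" using X0 by (auto simp: rates_until_def S_def)
  qed
  have Yr: "Y z \<in> A \<rightarrow> rates_until p (ereal T)" if z: "\<And>l. l < M \<Longrightarrow> z l \<in> {0..1}" for z
  proof -
    have "X z \<in> A \<rightarrow> rates_until p (ereal T)" using Xr z by blast
    from \<Phi>_rates[OF A_rates_until[OF this]] show ?thesis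
      unfolding Y_def cut_def by (intro Pi_I rates_until_cut_closed[OF p]) auto
  qed
  define F where "F z l = cell_integral (R z (fst (c l))) n (snd (c l)) / B" for z l
  obtain z where z: "\<And>l. l < M \<Longrightarrow> z l \<in> {0..1}" "\<And>l. l < M \<Longrightarrow> F z l = z l"
  proof (rule brouwer_cube[of M F])
    fix z :: "nat \<Rightarrow> real" and l :: nat
    assume z: "\<And>l. l < M \<Longrightarrow> z l \<in> {0..1}" and l: "l < M"
    have j: "fst (c l) \<in> A" and k: "snd (c l) < K" using cA[OF l] by auto
    have x: "X z \<in> A \<rightarrow> rates p" and y: "Y z \<in> A \<rightarrow> rates p" using A_rates_until Xr Yr z by blast+
    have "0 \<le> cell_integral (R z (fst (c l))) n (snd (c l))"
      unfolding cell_integral_def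
    proof (rule integral_nonneg_AE)
      show "AE t in lebesgue. 0 \<le> indicator (dyad n (snd (c l))) t * R z (fst (c l)) t"
        using routed_nonneg[OF x y j, of T n] by eventually_elim (simp add: R_def)
    qed
    moreover have "cell_integral (R z (fst (c l))) n (snd (c l)) \<le> B" using B[OF j k x] by (simp add: R_def Y_def)
    ultimately show "F z l \<in> {0..1}" using B0 by (simp add: F_def divide_le_eq_1)
  next
    fix Z :: "nat \<Rightarrow> nat \<Rightarrow> real" and z :: "nat \<Rightarrow> real" and l :: nat
    assume Z: "\<And>m l. l < M \<Longrightarrow> Z m l \<in> {0..1}" and lim: "\<And>l. l < M \<Longrightarrow> (\<lambda>m. Z m l) \<longlonglongrightarrow> z l" and l: "l < M"
    have z: "z l \<in> {0..1}" if "l < M" for l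
    proof -
      have "0 \<le> z l" by (rule LIMSEQ_le_const[OF lim[OF that]]) (use Z[OF that] in auto)
      moreover have "z l \<le> 1" by (rule LIMSEQ_le_const2[OF lim[OF that]]) (use Z[OF that] in auto)
      ultimately show ?thesis by simp
    qed
    have j: "fst (c l) \<in> A" using cA[OF l] by auto
    have Xb: "loc_bounded p (\<lambda>m. X (Z m) j)" if "j \<in> A" for j
      unfolding X_def
    proof (intro loc_bounded_sum[OF p])
      fix k assume "k \<in> {..<K}"
      hence "b (j, k) < M" using bM that by auto
      thus "loc_bounded p (\<lambda>m \<theta>. Z m (b (j, k)) * \<beta> k \<theta>)"
        using Z[of "b (j, k)"] by (intro loc_bounded_mult[where c=1, OF p loc_bounded_const[OF \<beta>L]]) auto
    qed
    have Xw: "wconv (\<lambda>m. X (Z m) j) (X z j)" if "j \<in> A" for j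
      unfolding X_def
    proof (intro wconv_sum[OF p])
      fix k assume "k \<in> {..<K}"
      hence "b (j, k) < M" using bM that by auto
      thus "wconv (\<lambda>m \<theta>. Z m (b (j, k)) * \<beta> k \<theta>) (\<lambda>\<theta>. z (b (j, k)) * \<beta> k \<theta>)"
        using lim unfolding wconv_def cell_integral_scale by (intro allI tendsto_mult tendsto_const) auto
      show "loc_Lp p (\<lambda>\<theta>. Z m (b (j, k)) * \<beta> k \<theta>)" for m
        by (rule loc_Lp_mult(1)[OF p \<beta>L, of _ "\<bar>Z m (b (j, k))\<bar>"]) auto
      show "loc_Lp p (\<lambda>\<theta>. z (b (j, k)) * \<beta> k \<theta>)"
        by (rule loc_Lp_mult(1)[OF p \<beta>L, of _ "\<bar>z (b (j, k))\<bar>"]) auto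
    qed
    have xm: "X (Z m) \<in> A \<rightarrow> rates_until p (ereal T)" "Y (Z m) \<in> A \<rightarrow> rates_until p (ereal T)" for m
      using Xr Yr Z by blast+
    have x: "X z \<in> A \<rightarrow> rates_until p (ereal T)" "Y z \<in> A \<rightarrow> rates_until p (ereal T)"
      using Xr Yr z by blast+
    have Yw: "wconv (\<lambda>m. Y (Z m) j) (Y z j)" if "j \<in> A" for j
      unfolding Y_def by (rule loading_wconv[OF T cont xm(1) x(1) Xb Xw that])
    have Yb: "loc_bounded p (\<lambda>m. Y (Z m) j)" if "j \<in> A" for j
      unfolding Y_def by (rule loading_loc_bounded[OF A_rates_until[OF xm(1)] that]) simp
    define Fl where "Fl z = join (X z) (Y z)" for z
    have Flm: "Fl (Z m) \<in> flows p G I" "Fl (Z m) \<in> flows_until p G I (ereal T)" for m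
      using xm A_rates_until[OF xm(1)] A_rates_until[OF xm(2)] by (auto simp: Fl_def join_flows join_flows_until)
    have Fl: "Fl z \<in> flows p G I" "Fl z \<in> flows_until p G I (ereal T)"
      using x A_rates_until[OF x(1)] A_rates_until[OF x(2)] by (auto simp: Fl_def join_flows join_flows_until)
    have Flw: "loc_bounded p (\<lambda>m. Fl (Z m) h)" "wconv (\<lambda>m. Fl (Z m) h) (Fl z h)" if "h \<in> flow_index G I" for h
      by (rule join_index_cases[OF that]; simp add: Fl_def Xb Yb Xw Yw)+
    have ct: "AE \<theta> in lebesgue. \<theta> < T \<longrightarrow> (AE C in \<mu> i. \<forall>q\<in>simple_paths G. (\<lambda>m. C \<theta> (Fl (Z m)) q) \<longlonglongrightarrow> C \<theta> (Fl z) q)"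
      if "i \<in> I" for i
      by (rule costs_tendsto[OF T cont that Flm(2) Fl(2) Flw])
    obtain e i where ei: "fst (c l) = (e, i)" "e \<in> arcs G" "i \<in> I" using j by auto
    have eiA: "(e, i) \<in> A" using ei by simp
    have "wconv (\<lambda>m. R (Z m) (e, i)) (R z (e, i))"
      unfolding R_def routed_def prod.case
    proof (rule wconv_mult[where c=1, OF p])
      show "loc_bounded p (\<lambda>m. inflow (Y (Z m)) (tail G e, i))"
        by (rule inflow_loc_bounded[OF tail_in_verts[OF ei(2)] ei(3) Yb])
      show "loc_Lp p (inflow (Y z) (tail G e, i))"
        by (rule inflow_loc_Lp[OF tail_in_verts[OF ei(2)] ei(3) A_rates_loc_Lp[OF A_rates_until[OF x(2)]]])
      show "wconv (\<lambda>m. inflow (Y (Z m)) (tail G e, i)) (inflow (Y z) (tail G e, i))"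
        by (rule inflow_wconv[OF tail_in_verts[OF ei(2)] ei(3) A_rates_loc_Lp[OF A_rates_until[OF xm(2)]]
              A_rates_loc_Lp[OF A_rates_until[OF x(2)]] Yw])
      show "(\<lambda>\<theta>. indicator {0..<T} \<theta> * route n (join (X (Z m)) (Y (Z m))) (e, i) \<theta>) \<in> borel_measurable lebesgue" for m
        using route_measurable[OF Flm(1)[of m] eiA, of n] unfolding Fl_def by measurable
      show "(\<lambda>\<theta>. indicator {0..<T} \<theta> * route n (join (X z) (Y z)) (e, i) \<theta>) \<in> borel_measurable lebesgue"
        using route_measurable[OF Fl(1) eiA, of n] unfolding Fl_def by measurable
      show "AE \<theta> in lebesgue. \<bar>indicator {0..<T} \<theta> * route n (join (X (Z m)) (Y (Z m))) (e, i) \<theta>\<bar> \<le> 1" for m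
        using route_bounds[OF Flm(1)[of m] eiA] by (intro AE_I2) (auto simp: Fl_def indicator_def)
      show "\<bar>indicator {0..<T} \<theta> * route n (join (X z) (Y z)) (e, i) \<theta>\<bar> \<le> 1" for \<theta>
        using route_bounds[OF Fl(1) eiA] by (auto simp: Fl_def indicator_def)
      show "AE \<theta> in lebesgue. 0 \<le> \<theta> \<longrightarrow> (\<lambda>m. indicator {0..<T} \<theta> * route n (join (X (Z m)) (Y (Z m))) (e, i) \<theta>)
          \<longlonglongrightarrow> indicator {0..<T} \<theta> * route n (join (X z) (Y z)) (e, i) \<theta>"
        using ct[OF ei(3)]
      proof eventually_elim
        fix \<theta> assume *: "\<theta> < T \<longrightarrow> (AE C in \<mu> i. \<forall>q\<in>simple_paths G. (\<lambda>m. C \<theta> (Fl (Z m)) q) \<longlonglongrightarrow> C \<theta> (Fl z) q)"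
        show "0 \<le> \<theta> \<longrightarrow> (\<lambda>m. indicator {0..<T} \<theta> * route n (join (X (Z m)) (Y (Z m))) (e, i) \<theta>)
          \<longlonglongrightarrow> indicator {0..<T} \<theta> * route n (join (X z) (Y z)) (e, i) \<theta>"
        proof (cases "\<theta> < T")
          case True
          have "(\<lambda>m. route n (Fl (Z m)) (e, i) \<theta>) \<longlonglongrightarrow> route n (Fl z) (e, i) \<theta>"
            by (rule route_tendsto[OF Flm(1) Fl(1) ei(2,3)]) (use * True in blast)
          thus ?thesis unfolding Fl_def by (intro impI tendsto_mult tendsto_const)
        qed simp
      qed
    qed
    thus "(\<lambda>m. F (Z m) l) \<longlonglongrightarrow> F z l"
      unfolding F_def ei(1) wconv_def using B0 by (intro tendsto_divide tendsto_const) auto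
  qed blast
  show ?thesis
  proof (rule that[of "X z"])
    show "X z \<in> A \<rightarrow> rates_until p (ereal T)" by (rule Xr[OF z(1)])
    fix j \<theta> assume j: "j \<in> A"
    have r: "cell_integral (R z j) n k = B * z (b (j, k))" if "k < K" for k
    proof -
      have "F z (b (j, k)) = z (b (j, k))" using z(2) bM j that by auto
      thus ?thesis using B0 cb[of "(j, k)"] j that by (simp add: F_def field_simps)
    qed
    have "X z j \<theta> = indicator S \<theta> * avg n (R z j) \<theta>"
    proof (cases "\<theta> \<in> S")
      case True
      hence t: "0 \<le> \<theta>" "\<theta> < real N" using N by (auto simp: S)
      have k: "cell n \<theta> < K" using cell_less[of \<theta> N n] t by (simp add: K_def)
      have "X z j \<theta> = (\<Sum>k<K. if k = cell n \<theta> then z (b (j, k)) * (B * 2 ^ n) else 0)"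
        unfolding X_def \<beta>_def using True t by (intro sum.cong) (auto simp: indicator_def mem_dyad)
      also have "\<dots> = avg n (R z j) \<theta>" using k r[OF k] t by (simp add: avg_def step_def)
      finally show ?thesis using True by simp
    qed (simp add: X0)
    thus "X z j \<theta> = indicator (before (ereal T)) \<theta> * avg n (routed T n (X z) (cut {0..T} (\<Phi> (X z))) j) \<theta>"
      by (simp add: R_def Y_def S_def)
  qed
qed

end

section \<open>Limits of approximate equilibria\<close>

lemma avg_diff:
  assumes "1 < p" "f \<in> Lp_on p N" "g \<in> Lp_on p N"
  shows "avg n (\<lambda>t. f t - g t) t = avg n f t - avg n g t"
  using cell_integral_diff[OF assms] by (simp add: avg_def step_def right_diff_distrib)

text \<open>Averaging is a contraction, so \<open>w m\<close> may be replaced by its limit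
  \<open>z\<close> inside the average, and averages of a fixed function converge to it. The sets
  \<open>S m\<close> vary because the horizons of the approximate problems may vary.\<close>

lemma avg_indicator_tendsto_L1:
  fixes p :: real
  assumes p: "1 < p" and s: "\<And>m. m \<le> s m" and S: "\<And>m. S m \<in> sets lebesgue" "S' \<in> sets lebesgue"
    and D: "D \<in> sets lebesgue" "D \<subseteq> {0..<real N}"
    and l: "AE t in lebesgue. 0 \<le> t \<longrightarrow> (\<lambda>m. indicator (S m) t :: real) \<longlonglongrightarrow> indicator S' t"
  shows "(\<lambda>m. LINT t|lebesgue. \<bar>indicator (S m) t * avg (s m) (\<lambda>t. indicator D t * indicator (S m) t) t
      - indicator D t * indicator S' t\<bar>) \<longlonglongrightarrow> 0"
proof -
  note [measurable] = S D(1)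
  define w where "w m t = indicator D t * (indicator (S m) t :: real)" for m and t :: real
  define z where "z t = indicator D t * (indicator S' t :: real)" for t :: real
  have wm [measurable]: "w m \<in> borel_measurable lebesgue" for m unfolding w_def by measurable
  have zm [measurable]: "z \<in> borel_measurable lebesgue" unfolding z_def by measurable
  have out: "w m t = 0" "z t = 0" if "t \<notin> {0..<real N}" for m t using that D(2) by (auto simp: w_def z_def indicator_def)
  have b1: "\<bar>w m t\<bar> \<le> 1" "\<bar>z t\<bar> \<le> 1" for m t by (auto simp: w_def z_def indicator_def)
  have wL: "w m \<in> Lp_on p N" for m using p by (intro Lp_on_bounded[of _ _ 1] wm out b1) auto
  have zL: "z \<in> Lp_on p N" using p by (intro Lp_on_bounded[of _ _ 1] zm out b1) auto
  have wz: "AE t in lebesgue. (\<lambda>m. w m t) \<longlonglongrightarrow> z t"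
    using l
  proof eventually_elim
    fix t assume *: "0 \<le> t \<longrightarrow> (\<lambda>m. indicator (S m) t :: real) \<longlonglongrightarrow> indicator S' t"
    show "(\<lambda>m. w m t) \<longlonglongrightarrow> z t"
    proof (cases "0 \<le> t")
      case True
      thus ?thesis using * unfolding w_def z_def by (intro tendsto_mult tendsto_const) auto
    qed (use out[of t] in simp)
  qed
  have L1: "(\<lambda>m. LINT t|lebesgue. \<bar>w m t - z t\<bar>) \<longlonglongrightarrow> 0"
  proof (rule L1_tendsto_0_if_bounded_AE[where c=1 and N=N])
    show "AE t in lebesgue. (\<lambda>m. w m t - z t) \<longlonglongrightarrow> 0"
      using wz by eventually_elim (rule LIM_zero)
  qed (auto simp: w_def z_def indicator_def out[unfolded w_def z_def indicator_def])
  \<comment> \<open>The difference of two indicators takes only the values -1, 0 and 1, so its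
    modular is its L^1 norm.\<close>
  have "\<bar>w m t - z t\<bar> powr p = \<bar>w m t - z t\<bar>" for m t
    by (auto simp: w_def z_def indicator_def)
  hence "(\<lambda>m. modular p (\<lambda>t. w m t - z t)) \<longlonglongrightarrow> 0" using L1 by (simp add: modular_def)
  hence "(\<lambda>m. modular p (avg (s m) (\<lambda>t. w m t - z t))) \<longlonglongrightarrow> 0"
    by (rule Lim_null_comparison[rotated]) (use modular_avg_le[OF p Lp_on_diff[OF p wL zL]] in auto)
  from modular_tendsto_0_imp_L1[OF p avg_Lp_on[OF p Lp_on_diff[OF p wL zL]] this]
  have A1: "(\<lambda>m. LINT t|lebesgue. \<bar>avg (s m) (w m) t - avg (s m) z t\<bar>) \<longlonglongrightarrow> 0" by (simp add: avg_diff[OF p wL zL])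
  have s': "filterlim s at_top sequentially" by (rule filterlim_at_top_mono[OF filterlim_ident]) (use s in auto)
  have "(\<lambda>m. modular p (\<lambda>t. avg (s m) z t - z t)) \<longlonglongrightarrow> 0"
    by (rule filterlim_compose[OF avg_tendsto[OF p zL] s'])
  from modular_tendsto_0_imp_L1[OF p Lp_on_diff[OF p avg_Lp_on[OF p zL] zL] this]
  have A2: "(\<lambda>m. LINT t|lebesgue. \<bar>avg (s m) z t - z t\<bar>) \<longlonglongrightarrow> 0" .
  have A3: "(\<lambda>m. LINT t|lebesgue. \<bar>indicator (S m) t * z t - z t\<bar>) \<longlonglongrightarrow> 0"
  proof (rule L1_tendsto_0_if_bounded_AE[where c=1 and N=N])
    show "AE t in lebesgue. (\<lambda>m. indicator (S m) t * z t - z t) \<longlonglongrightarrow> 0"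
      using l
    proof eventually_elim
      fix t assume *: "0 \<le> t \<longrightarrow> (\<lambda>m. indicator (S m) t :: real) \<longlonglongrightarrow> indicator S' t"
      show "(\<lambda>m. indicator (S m) t * z t - z t) \<longlonglongrightarrow> 0"
      proof (cases "0 \<le> t")
        case True
        have "(\<lambda>m. indicator (S m) t * z t - z t) \<longlonglongrightarrow> indicator S' t * z t - z t"
          using * True by (intro tendsto_diff tendsto_mult tendsto_const) auto
        moreover have "indicator S' t * z t = z t" by (auto simp: z_def indicator_def)
        ultimately show ?thesis by simp
      qed (use out(2)[of t] in simp)
    qed
  qed (auto simp: z_def indicator_def out(2)[unfolded z_def indicator_def])
  note i = Lp_on_integrable[OF p avg_Lp_on[OF p wL]] Lp_on_integrable[OF p avg_Lp_on[OF p zL]] Lp_on_integrable[OF p zL]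
  have iS: "integrable lebesgue (\<lambda>t. indicator (S m) t * f t)" if "integrable lebesgue f" for m and f :: "real \<Rightarrow> real"
    using integrable_mult_indicator[OF S(1) that, of m] by simp
  have "(LINT t|lebesgue. \<bar>indicator (S m) t * avg (s m) (w m) t - z t\<bar>) \<le>
      (LINT t|lebesgue. \<bar>avg (s m) (w m) t - avg (s m) z t\<bar>) + (LINT t|lebesgue. \<bar>avg (s m) z t - z t\<bar>)
      + (LINT t|lebesgue. \<bar>indicator (S m) t * z t - z t\<bar>)" for m
  proof -
    have "(LINT t|lebesgue. \<bar>indicator (S m) t * avg (s m) (w m) t - z t\<bar>) \<le>
      (LINT t|lebesgue. \<bar>avg (s m) (w m) t - avg (s m) z t\<bar> + \<bar>avg (s m) z t - z t\<bar> + \<bar>indicator (S m) t * z t - z t\<bar>)"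
      using i iS by (intro integral_mono) (auto simp: indicator_def)
    thus ?thesis using i iS by simp
  qed
  hence "(\<lambda>m. LINT t|lebesgue. \<bar>indicator (S m) t * avg (s m) (w m) t - z t\<bar>) \<longlonglongrightarrow> 0"
    using tendsto_add_zero[OF tendsto_add_zero[OF A1 A2] A3]
    by (intro Lim_null_comparison[of "\<lambda>m. LINT t|lebesgue. \<bar>indicator (S m) t * avg (s m) (w m) t - z t\<bar>" _ sequentially])
      (auto intro!: always_eventually)
  thus ?thesis by (simp add: w_def[abs_def] z_def[abs_def])
qed

text \<open>By self-adjointness, testing the averaged sequence on a cell is testing the sequence
  itself with an averaged indicator, which converges in L^1. The inner cut belongs to the flow that
  is averaged; the outer one removes what averaging spreads beyond the horizon.\<close>

lemma wconv_avg:
  assumes p: "1 < p" and s: "\<And>m. m \<le> s m" and S: "\<And>m. S m \<in> sets lebesgue" "S' \<in> sets lebesgue"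
    and l: "AE t in lebesgue. 0 \<le> t \<longrightarrow> (\<lambda>m. indicator (S m) t :: real) \<longlonglongrightarrow> indicator S' t"
    and g: "loc_bounded p g" "loc_Lp p h" "wconv g h"
  shows "wconv (\<lambda>m t. indicator (S m) t * avg (s m) (\<lambda>t. indicator (S m) t * g m t) t) (\<lambda>t. indicator S' t * h t)"
  unfolding wconv_def
proof (intro allI)
  fix n k
  define N where "N = Suc k"
  have sub: "dyad n k \<subseteq> {0..<real N}" unfolding N_def by (rule dyad_subset[OF less_Suc_mult])
  note [measurable] = S
  define w where "w m t = indicator (dyad n k) t * (indicator (S m) t :: real)" for m and t :: real
  have wm [measurable]: "w m \<in> borel_measurable lebesgue" for m unfolding w_def by measurable
  have wL: "w m \<in> Lp_on p N" for m
    using p sub by (intro Lp_on_bounded[of _ _ 1] wm) (auto simp: w_def indicator_def)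
  have wavg: "\<bar>avg (s m) (w m) t\<bar> \<le> 1" for m t
    by (rule abs_avg_le[OF p wL]) (auto simp: w_def indicator_def)
  have Sg: "loc_Lp p (\<lambda>t. indicator (S m) t * g m t)" for m
    by (rule loc_Lp_mult(1)[OF p loc_boundedD[OF g(1)], of _ 1]) (auto simp: indicator_def)
  have eq: "cell_integral (\<lambda>t. indicator (S m) t * avg (s m) (\<lambda>t. indicator (S m) t * g m t) t) n k
      = (LINT t|lebesgue. g m t * (indicator (S m) t * avg (s m) (w m) t))" for m
  proof -
    define G where "G = restr N (\<lambda>t. indicator (S m) t * g m t)"
    have GL: "G \<in> Lp_on p N" unfolding G_def by (rule loc_LpD[OF Sg])
    have "indicator (dyad n k) t * (indicator (S m) t * avg (s m) (\<lambda>t. indicator (S m) t * g m t) t) = avg (s m) G t * w m t" for t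
    proof (cases "t \<in> dyad n k")
      case True
      hence "avg (s m) (\<lambda>t. indicator (S m) t * g m t) t = avg (s m) G t"
        using sub fun_cong[OF restr_avg[of N "s m" "\<lambda>t. indicator (S m) t * g m t"], of t]
        by (simp add: G_def restr_inside subset_iff)
      thus ?thesis by (simp add: w_def)
    qed (simp add: w_def)
    hence "cell_integral (\<lambda>t. indicator (S m) t * avg (s m) (\<lambda>t. indicator (S m) t * g m t) t) n k
        = (LINT t|lebesgue. avg (s m) G t * w m t)" unfolding cell_integral_def by simp
    also have "\<dots> = (LINT t|lebesgue. G t * avg (s m) (w m) t)" by (rule integral_avg_swap[OF p GL wL])
    also have "\<dots> = (LINT t|lebesgue. g m t * (indicator (S m) t * avg (s m) (w m) t))"
      using Lp_onD(3)[OF avg_Lp_on[OF p wL]]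
      by (intro Bochner_Integration.integral_cong refl) (auto simp: G_def restr_def indicator_def)
    finally show ?thesis .
  qed
  have eq': "cell_integral (\<lambda>t. indicator S' t * h t) n k = (LINT t|lebesgue. h t * (indicator (dyad n k) t * indicator S' t))"
    unfolding cell_integral_def by (simp add: ac_simps)
  show "(\<lambda>m. cell_integral (\<lambda>t. indicator (S m) t * avg (s m) (\<lambda>t. indicator (S m) t * g m t) t) n k)
      \<longlonglongrightarrow> cell_integral (\<lambda>t. indicator S' t * h t) n k"
    unfolding eq eq'
  proof (rule weak_test[OF p g, where c=1 and N=N])
    show "(\<lambda>m. LINT t|lebesgue. \<bar>indicator (S m) t * avg (s m) (w m) t - indicator (dyad n k) t * indicator S' t\<bar>) \<longlonglongrightarrow> 0"
      using avg_indicator_tendsto_L1[OF p s S dyad_lebesgue sub l] by (simp add: w_def[abs_def])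
    show "AE t in lebesgue. \<bar>indicator (S m) t * avg (s m) (w m) t\<bar> \<le> 1" for m
      using wavg by (intro AE_I2) (auto simp: indicator_def)
    show "indicator (S m) t * avg (s m) (w m) t = 0" if "t \<notin> {0..<real N}" for m t
      using Lp_onD(3)[OF avg_Lp_on[OF p wL] that] by simp
    show "(\<lambda>t. indicator (S m) t * avg (s m) (w m) t) \<in> borel_measurable lebesgue" for m
      using borel_measurable_lebesgue[OF avg_measurable[of "s m" "w m"]] by measurable
  qed (use sub in \<open>auto simp: indicator_def\<close>)
qed

context network
begin

lemma sum_choice_prob:
  assumes i: "i \<in> I" and v: "v \<in> verts G" and f: "f \<in> flows p G I"
  shows "(\<Sum>M\<in>Pow (out_arcs G v). choice_prob G d \<mu> v M i \<theta> f) = 1"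
proof -
  interpret prob_space "\<mu> i" by (rule prob_space_\<mu>[OF i])
  define Q where "Q M = {C \<in> space (\<mu> i). best v i (C \<theta> f) = M}" for M
  have Q: "Q M \<in> sets (\<mu> i)" for M unfolding Q_def by (rule pred_sections[OF best_measurable[OF i v f]])
  have "measure (\<mu> i) (\<Union>M\<in>Pow (out_arcs G v). Q M) = (\<Sum>M\<in>Pow (out_arcs G v). measure (\<mu> i) (Q M))"
    using Q finite_out by (intro finite_measure_finite_Union) (auto simp: disjoint_family_on_def Q_def)
  moreover have "(\<Union>M\<in>Pow (out_arcs G v). Q M) = space (\<mu> i)" using best_subset by (auto simp: Q_def)
  ultimately show ?thesis using prob_space by (simp add: choice_prob_best Q_def)
qed

lemma inflow_before_0:
  assumes "v \<in> verts G" "i \<in> I" "y \<in> A \<rightarrow> rates p"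
  shows "AE \<theta> in lebesgue. \<theta> < 0 \<longrightarrow> inflow y (v, i) \<theta> = 0"
proof -
  have 1: "AE \<theta> in lebesgue. \<theta> < 0 \<longrightarrow> u (v, i) \<theta> = 0" using u assms(1,2) ratesD(3) by blast
  have "AE \<theta> in lebesgue. \<forall>e\<in>in_arcs G v. \<theta> < 0 \<longrightarrow> y (e, i) \<theta> = 0"
    using assms(2,3) by (intro AE_finite_allI finite_in ratesD(3)) auto
  with 1 show ?thesis by eventually_elim (simp add: inflow_def)
qed

text \<open>Here \<open>f\<close> is the approximate flow, which determines the softmax weights, and
  \<open>g\<close> is the limiting flow, which determines the class \<open>M\<close>. Under ties a
  single share need not converge. What is controlled are the sum over all edges, which is the
  probability of the class, and the shares of edges outside \<open>M\<close>, which tend to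
  0.\<close>

definition class_share :: "nat \<Rightarrow> ('e \<times> 'i \<times> sign) vec \<Rightarrow> ('e \<times> 'i \<times> sign) vec \<Rightarrow> ('e set \<times> 'e \<times> 'i) vec" where
  "class_share n f g = (\<lambda>(M, e, i) \<theta>. LINT C|\<mu> i.
     of_bool (best (tail G e) i (C \<theta> g) = M) * softmax (tail G e) i e n (C \<theta> f))"

context
  fixes f g e i
  assumes f: "f \<in> flows p G I" and g: "g \<in> flows p G I" and e: "e \<in> arcs G" and i: "i \<in> I"
begin

lemma class_share_integrand_measurable:
  "(\<lambda>x. of_bool (best (tail G e) i (fst x (snd x) g) = M) * softmax (tail G e) i e n (fst x (snd x) f))
     \<in> borel_measurable (\<mu> i \<Otimes>\<^sub>M lebesgue)"
proof -
  have "(\<lambda>x. of_bool (best (tail G e) i (fst x (snd x) g) = M) :: real) \<in> borel_measurable (\<mu> i \<Otimes>\<^sub>M lebesgue)"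
    using best_measurable[OF i tail_in_verts[OF e] g] unfolding of_bool_def by (intro measurable_If) (auto simp: pred_def)
  thus ?thesis by (intro borel_measurable_times softmax_measurable[OF i tail_in_verts[OF e] f])
qed

lemma class_share_integrable:
  "integrable (\<mu> i) (\<lambda>C. of_bool (best (tail G e) i (C \<theta> g) = M) * softmax (tail G e) i e n (C \<theta> f))"
proof -
  interpret prob_space "\<mu> i" by (rule prob_space_\<mu>[OF i])
  show ?thesis
    using measurable_sections[OF class_share_integrand_measurable] softmax_bounds
    by (intro integrable_const_bound[where B=1]) (auto simp: of_bool_def)
qed

lemma class_share_measurable: "class_share n f g (M, e, i) \<in> borel_measurable lebesgue"
  unfolding class_share_def prod.case
  by (rule measurable_expectation_sections[OF prob_space_\<mu>[OF i] class_share_integrand_measurable])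

lemma class_share_bounds: "0 \<le> class_share n f g (M, e, i) \<theta>" "class_share n f g (M, e, i) \<theta> \<le> 1"
proof -
  interpret prob_space "\<mu> i" by (rule prob_space_\<mu>[OF i])
  show "0 \<le> class_share n f g (M, e, i) \<theta>" using softmax_bounds by (simp add: class_share_def)
  have "class_share n f g (M, e, i) \<theta> \<le> (LINT C|\<mu> i. 1)"
    unfolding class_share_def prod.case
    using class_share_integrable softmax_bounds by (intro integral_mono) (auto simp: of_bool_def)
  thus "class_share n f g (M, e, i) \<theta> \<le> 1" by (simp add: prob_space)
qed

lemma sum_class_share: "(\<Sum>M\<in>Pow (out_arcs G (tail G e)). class_share n f g (M, e, i) \<theta>) = route n f (e, i) \<theta>"
proof -
  have "(\<Sum>M\<in>Pow (out_arcs G (tail G e)). class_share n f g (M, e, i) \<theta>)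
      = (LINT C|\<mu> i. (\<Sum>M\<in>Pow (out_arcs G (tail G e)). of_bool (best (tail G e) i (C \<theta> g) = M) * softmax (tail G e) i e n (C \<theta> f)))"
    unfolding class_share_def prod.case by (intro Bochner_Integration.integral_sum[symmetric] class_share_integrable)
  also have "\<dots> = (LINT C|\<mu> i. softmax (tail G e) i e n (C \<theta> f))"
  proof (intro Bochner_Integration.integral_cong refl)
    fix C
    have "(\<Sum>M\<in>Pow (out_arcs G (tail G e)). of_bool (best (tail G e) i (C \<theta> g) = M) * softmax (tail G e) i e n (C \<theta> f))
       = (\<Sum>M\<in>Pow (out_arcs G (tail G e)). if best (tail G e) i (C \<theta> g) = M then softmax (tail G e) i e n (C \<theta> f) else 0)"
      by (intro sum.cong) auto
    also have "\<dots> = softmax (tail G e) i e n (C \<theta> f)"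
      using best_subset finite_out by (subst sum.delta') auto
    finally show "(\<Sum>M\<in>Pow (out_arcs G (tail G e)). of_bool (best (tail G e) i (C \<theta> g) = M) * softmax (tail G e) i e n (C \<theta> f))
       = softmax (tail G e) i e n (C \<theta> f)" .
  qed
  finally show ?thesis by (simp add: route_def)
qed

end

text \<open>For a fixed predictor the softmax weights of the edges leaving \<open>v\<close> add up
  to 1, so class \<open>M\<close> receives exactly its probability under \<open>g\<close>, whatever
  \<open>n\<close> and \<open>f\<close> are. The destination, where a path is not guaranteed, is
  excluded; its node inflow is 0 anyway.\<close>

lemma sum_class_share_out:
  assumes f: "f \<in> flows p G I" and g: "g \<in> flows p G I" and v: "v \<in> verts G" "v \<noteq> d i" and i: "i \<in> I"
  shows "(\<Sum>e\<in>out_arcs G v. class_share n f g (M, e, i) \<theta>) = choice_prob G d \<mu> v M i \<theta> g"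
proof -
  interpret prob_space "\<mu> i" by (rule prob_space_\<mu>[OF i])
  have int: "integrable (\<mu> i) (\<lambda>C. of_bool (best v i (C \<theta> g) = M) * softmax v i e n (C \<theta> f))"
    if "e \<in> out_arcs G v" for e
    using class_share_integrable[OF f g _ i, of e \<theta> M n] that by auto
  have "(\<Sum>e\<in>out_arcs G v. class_share n f g (M, e, i) \<theta>)
      = (\<Sum>e\<in>out_arcs G v. LINT C|\<mu> i. of_bool (best v i (C \<theta> g) = M) * softmax v i e n (C \<theta> f))"
    by (intro sum.cong) (auto simp: class_share_def)
  also have "\<dots> = (LINT C|\<mu> i. (\<Sum>e\<in>out_arcs G v. of_bool (best v i (C \<theta> g) = M) * softmax v i e n (C \<theta> f)))"
    by (rule Bochner_Integration.integral_sum[symmetric]) (rule int)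
  also have "\<dots> = (LINT C|\<mu> i. indicator {C \<in> space (\<mu> i). best v i (C \<theta> g) = M} C)"
    using sum_softmax[OF paths_nonempty[OF v(1) i v(2)]]
    by (intro Bochner_Integration.integral_cong refl) (auto simp: sum_distrib_left[symmetric] indicator_def)
  also have "\<dots> = choice_prob G d \<mu> v M i \<theta> g"
    using pred_sections[OF best_measurable[OF i v(1) g]] by (simp add: choice_prob_best)
  finally show ?thesis .
qed

text \<open>On the event that \<open>M\<close> is optimal for \<open>g\<close>, an edge outside
  \<open>M\<close> starts no optimal path and its softmax weight decays. The weights are at most 1,
  which dominates the expectation.\<close>

lemma class_share_tendsto_0:
  assumes F: "\<And>m. F m \<in> flows p G I" "g \<in> flows p G I" and e: "e \<in> arcs G" "e \<notin> M" and i: "i \<in> I" and s: "\<And>m. m \<le> s m"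
    and c: "AE C in \<mu> i. \<forall>q\<in>simple_paths G. (\<lambda>m. C \<theta> (F m) q) \<longlonglongrightarrow> C \<theta> g q"
  shows "(\<lambda>m. class_share (s m) (F m) g (M, e, i) \<theta>) \<longlonglongrightarrow> 0"
proof -
  interpret prob_space "\<mu> i" by (rule prob_space_\<mu>[OF i])
  have "(\<lambda>m. class_share (s m) (F m) g (M, e, i) \<theta>) \<longlonglongrightarrow> (LINT C|\<mu> i. 0)"
    unfolding class_share_def prod.case
  proof (rule integral_dominated_convergence[where w="\<lambda>_. 1"])
    show "AE C in \<mu> i. (\<lambda>m. of_bool (best (tail G e) i (C \<theta> g) = M) * softmax (tail G e) i e (s m) (C \<theta> (F m))) \<longlonglongrightarrow> 0"
      using c
    proof eventually_elim
      fix C :: "('e, 'i) predictor" assume *: "\<forall>q\<in>simple_paths G. (\<lambda>m. C \<theta> (F m) q) \<longlonglongrightarrow> C \<theta> g q"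
      show "(\<lambda>m. of_bool (best (tail G e) i (C \<theta> g) = M) * softmax (tail G e) i e (s m) (C \<theta> (F m))) \<longlonglongrightarrow> 0"
      proof (cases "best (tail G e) i (C \<theta> g) = M")
        case True
        have "(\<lambda>m. softmax (tail G e) i e (s m) (C \<theta> (F m))) \<longlonglongrightarrow> 0"
        proof (rule softmax_tendsto_0[OF _ _ s])
          show "(\<lambda>m. C \<theta> (F m) q) \<longlonglongrightarrow> C \<theta> g q" if "q \<in> paths (tail G e) i" for q
            using * path_simple[OF that tail_in_verts[OF e(1)] i] by blast
        qed (use True e(2) in simp)
        thus ?thesis using True by simp
      qed simp
    qed
    show "AE C in \<mu> i. norm (of_bool (best (tail G e) i (C \<theta> g) = M) * softmax (tail G e) i e (s m) (C \<theta> (F m))) \<le> 1" for m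
      using softmax_bounds by (intro AE_I2) (auto simp: of_bool_def)
  qed (use class_share_integrable[OF F(1) F(2) e(1) i] in auto)
  thus ?thesis by simp
qed

end

context network
begin

text \<open>The class flows \<open>H\<close>, shares times node inflow, are locally bounded and have
  weak limits \<open>h\<close> along a subsequence, although the shares may have none.
  Nonnegativity, vanishing outside \<open>M\<close>, the total per class and node, and the total per
  edge are all preserved by weak limits, and these are the data from which an equilibrium is
  assembled.\<close>

lemma equilibrium_limit:
  assumes s: "\<And>m. m \<le> s m"
    and x: "\<And>m. x m \<in> A \<rightarrow> rates p" and y: "\<And>m. y m \<in> A \<rightarrow> rates p"
    and x': "x' \<in> A \<rightarrow> rates p" and y': "y' \<in> A \<rightarrow> rates p"
    and yb: "\<And>j. j \<in> A \<Longrightarrow> loc_bounded p (\<lambda>m. y m j)"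
    and xw: "\<And>j. j \<in> A \<Longrightarrow> wconv (\<lambda>m. x m j) (x' j)" and yw: "\<And>j. j \<in> A \<Longrightarrow> wconv (\<lambda>m. y m j) (y' j)"
    and eq: "\<And>m j \<theta>. j \<in> A \<Longrightarrow> x m j \<theta> = indicator (before (ereal (\<tau> m))) \<theta> * avg (s m) (routed (\<tau> m) (s m) (x m) (y m) j) \<theta>"
    and \<tau>: "AE \<theta> in lebesgue. 0 \<le> \<theta> \<longrightarrow> (\<lambda>m. indicator (before (ereal (\<tau> m))) \<theta> :: real) \<longlonglongrightarrow> indicator (before T) \<theta>"
    and costs: "\<And>i. i \<in> I \<Longrightarrow> AE \<theta> in lebesgue. 0 \<le> \<theta> \<longrightarrow> ereal \<theta> < T \<longrightarrow>
      (AE C in \<mu> i. \<forall>q\<in>simple_paths G. (\<lambda>m. C \<theta> (join (x m) (y m)) q) \<longlonglongrightarrow> C \<theta> (join x' y') q)"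
    and loading: "\<And>j. j \<in> A \<Longrightarrow> AE \<theta> in lebesgue. ereal \<theta> < T \<longrightarrow> y' j \<theta> = \<Phi> x' j \<theta>"
  shows "prediction_equilibrium p G I d u \<Phi> \<mu> T (join x' y')"
proof -
  define F where "F m = join (x m) (y m)" for m
  define f where "f = join x' y'"
  have F: "F m \<in> flows p G I" for m using x y by (simp add: F_def join_flows)
  have f: "f \<in> flows p G I" using x' y' by (simp add: f_def join_flows)
  define X where "X m = inflow (y m)" for m
  define X' where "X' = inflow y'"
  define a where "a m = class_share (s m) (F m) f" for m
  define H where "H m = (\<lambda>(M, e, i) \<theta>. a m (M, e, i) \<theta> * X m (tail G e, i) \<theta>)" for m
  \<comment> \<open>Pairs with \<open>e \<notin> M\<close> are included: the softmax rule may send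
    flow of class \<open>M\<close> there as well, and only the limit is shown to vanish.\<close>
  define K where "K = {(M, e, i). e \<in> arcs G \<and> M \<subseteq> out_arcs G (tail G e) \<and> i \<in> I}"
  have finK: "finite K"
    by (rule finite_subset[of _ "Pow (arcs G) \<times> arcs G \<times> I"]) (use I in \<open>auto simp: K_def\<close>)
  have Kcases: "\<exists>M e i. k = (M, e, i) \<and> e \<in> arcs G \<and> M \<subseteq> out_arcs G (tail G e) \<and> i \<in> I" if "k \<in> K" for k
    using that by (auto simp: K_def)
  have yL: "loc_Lp p (y m j)" "loc_Lp p (y' j)" if "j \<in> A" for m j
    using A_rates_loc_Lp[OF y that] A_rates_loc_Lp[OF y' that] .
  have Xb: "loc_bounded p (\<lambda>m. X m (v, i))" and X'L: "loc_Lp p (X' (v, i))" and Xw: "wconv (\<lambda>m. X m (v, i)) (X' (v, i))"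
    if "v \<in> verts G" "i \<in> I" for v i
    unfolding X_def X'_def
  proof -
    show "loc_bounded p (\<lambda>m. inflow (y m) (v, i))" by (rule inflow_loc_bounded[OF that yb])
    show "loc_Lp p (inflow y' (v, i))" by (rule inflow_loc_Lp[OF that yL(2)])
    show "wconv (\<lambda>m. inflow (y m) (v, i)) (inflow y' (v, i))" by (rule inflow_wconv[OF that yL yw])
  qed
  have am: "a m (M, e, i) \<in> borel_measurable lebesgue" and ab: "\<bar>a m (M, e, i) \<theta>\<bar> \<le> 1" "0 \<le> a m (M, e, i) \<theta>"
    if "e \<in> arcs G" "i \<in> I" for m M e i \<theta>
    using class_share_measurable[OF F f that] class_share_bounds[OF F f that] by (auto simp: a_def)
  have Hb: "loc_bounded p (\<lambda>m. H m k)" if "k \<in> K" for k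
    using Kcases[OF that] am ab
    by (auto simp: H_def intro!: loc_bounded_mult[where c=1, OF p Xb])
  obtain \<sigma> :: "nat \<Rightarrow> nat" and h where \<sigma>: "strict_mono \<sigma>" and hL: "\<And>k. k \<in> K \<Longrightarrow> loc_Lp p (h k)"
    and hw: "\<And>k. k \<in> K \<Longrightarrow> wconv (\<lambda>m. H (\<sigma> m) k) (h k)"
  proof (rule wconv_subseq_exists[OF p finK, where X=H])
    show "loc_bounded p (\<lambda>m. H m k)" if "k \<in> K" for k by (rule Hb[OF that])
  qed (rule that)
  define iT where "iT \<theta> = (indicator (before T) \<theta> :: real)" for \<theta>
  have iTm [measurable]: "iT \<in> borel_measurable lebesgue" unfolding iT_def[abs_def] by measurable
  have iTb: "\<bar>iT \<theta>\<bar> \<le> 1" for \<theta> by (simp add: iT_def indicator_def)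
  have iT1: "iT \<theta> = 1" if "0 \<le> \<theta>" "ereal \<theta> < T" for \<theta> using that by (simp add: iT_def before_def)
  have in_K: "(M, e, i) \<in> K" if "e \<in> out_arcs G v" "M \<subseteq> out_arcs G v" "i \<in> I" for M e i v
    using that by (auto simp: K_def)
  have h_nonneg: "AE \<theta> in lebesgue. 0 \<le> \<theta> \<longrightarrow> 0 \<le> h k \<theta>" if k: "k \<in> K" for k
  proof (rule wconv_nonneg[OF p loc_bounded_subseq[OF Hb[OF k]] hL[OF k] hw[OF k]])
    fix m
    obtain M e i where k': "k = (M, e, i)" "e \<in> arcs G" "i \<in> I" using Kcases[OF k] by blast
    have "AE \<theta> in lebesgue. 0 \<le> X (\<sigma> m) (tail G e, i) \<theta>"
      unfolding X_def using y k' by (intro inflow_nonneg ratesD(2)[of _ p]) auto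
    thus "AE \<theta> in lebesgue. 0 \<le> H (\<sigma> m) k \<theta>"
      by eventually_elim (use ab(2)[OF k'(2,3)] in \<open>simp add: H_def k'(1)\<close>)
  qed
  \<comment> \<open>Before \<open>T\<close> the share of an edge outside \<open>M\<close> tends to 0
    pointwise, so the class flow tends weakly to 0 there. Uniqueness of weak limits transfers this
    to \<open>h\<close>.\<close>
  have vanish: "AE \<theta> in lebesgue. 0 \<le> \<theta> \<longrightarrow> ereal \<theta> < T \<longrightarrow> h (M, e, i) \<theta> = 0"
    if e: "e \<in> out_arcs G v" "e \<notin> M" and M: "M \<subseteq> out_arcs G v" and i: "i \<in> I" for M e i v
  proof -
    have k: "(M, e, i) \<in> K" by (rule in_K[OF e(1) M i])
    have ea: "e \<in> arcs G" using e(1) by simp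
    have "wconv (\<lambda>m \<theta>. (iT \<theta> * a (\<sigma> m) (M, e, i) \<theta>) * X (\<sigma> m) (tail G e, i) \<theta>) (\<lambda>\<theta>. 0 * X' (tail G e, i) \<theta>)"
    proof (rule wconv_mult[where c=1, OF p loc_bounded_subseq[OF Xb] X'L wconv_subseq[OF Xw \<sigma>]])
      show "AE \<theta> in lebesgue. 0 \<le> \<theta> \<longrightarrow> (\<lambda>m. iT \<theta> * a (\<sigma> m) (M, e, i) \<theta>) \<longlonglongrightarrow> 0"
        using costs[OF i]
      proof eventually_elim
        fix \<theta> assume *: "0 \<le> \<theta> \<longrightarrow> ereal \<theta> < T \<longrightarrow>
          (AE C in \<mu> i. \<forall>q\<in>simple_paths G. (\<lambda>m. C \<theta> (join (x m) (y m)) q) \<longlonglongrightarrow> C \<theta> (join x' y') q)"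
        show "0 \<le> \<theta> \<longrightarrow> (\<lambda>m. iT \<theta> * a (\<sigma> m) (M, e, i) \<theta>) \<longlonglongrightarrow> 0"
        proof (intro impI, cases "ereal \<theta> < T")
          case True
          assume "0 \<le> \<theta>"
          hence "(\<lambda>m. a m (M, e, i) \<theta>) \<longlonglongrightarrow> 0" unfolding a_def
            using * True by (intro class_share_tendsto_0[OF F f ea e(2) i s]) (auto simp: F_def f_def)
          from LIMSEQ_subseq_LIMSEQ[OF this \<sigma>] show "(\<lambda>m. iT \<theta> * a (\<sigma> m) (M, e, i) \<theta>) \<longlonglongrightarrow> 0"
            by (simp add: o_def tendsto_mult_right_zero)
        qed (simp add: iT_def before_def)
      qed
      show "(\<lambda>\<theta>. iT \<theta> * a (\<sigma> m) (M, e, i) \<theta>) \<in> borel_measurable lebesgue" for m using am[OF ea i] by measurable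
      show "AE \<theta> in lebesgue. \<bar>iT \<theta> * a (\<sigma> m) (M, e, i) \<theta>\<bar> \<le> 1" for m
        using ab(1)[OF ea i] by (intro AE_I2) (auto simp: iT_def indicator_def)
    qed (use ea i in auto)
    moreover have "wconv (\<lambda>m \<theta>. iT \<theta> * H (\<sigma> m) (M, e, i) \<theta>) (\<lambda>\<theta>. iT \<theta> * h (M, e, i) \<theta>)"
      by (rule wconv_mult[where c=1, OF p loc_bounded_subseq[OF Hb[OF k]] hL[OF k] hw[OF k]]) (use iTb in auto)
    ultimately have "AE \<theta> in lebesgue. 0 \<le> \<theta> \<longrightarrow> iT \<theta> * h (M, e, i) \<theta> = 0"
      using loc_Lp_mult(1)[OF p hL[OF k] iTm, of 1] iTb loc_Lp_0
      by (intro wconv_unique[OF p, where X="\<lambda>m \<theta>. iT \<theta> * H (\<sigma> m) (M, e, i) \<theta>"]) (auto simp: H_def mult.assoc)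
    thus ?thesis by eventually_elim (use iT1 in auto)
  qed
  \<comment> \<open>The shares of all edges leaving \<open>v\<close> add up to a factor that does
    not depend on the index, so two weak limits of the same sequence are compared.\<close>
  have node_sum: "AE \<theta> in lebesgue. 0 \<le> \<theta> \<longrightarrow> (\<Sum>e\<in>out_arcs G v. h (M, e, i) \<theta>) = choice_prob G d \<mu> v M i \<theta> f * X' (v, i) \<theta>"
    if v: "v \<in> verts G" and M: "M \<subseteq> out_arcs G v" and i: "i \<in> I" for v M i
  proof -
    have pm: "(\<lambda>\<theta>. choice_prob G d \<mu> v M i \<theta> f) \<in> borel_measurable lebesgue" by (rule choice_prob_measurable[OF i v f])
    have pb: "\<bar>choice_prob G d \<mu> v M i \<theta> f\<bar> \<le> 1" for \<theta> using choice_prob_bounds[OF i, of v M \<theta> f] by auto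
    have "wconv (\<lambda>m \<theta>. \<Sum>e\<in>out_arcs G v. H (\<sigma> m) (M, e, i) \<theta>) (\<lambda>\<theta>. \<Sum>e\<in>out_arcs G v. h (M, e, i) \<theta>)"
      using in_K[OF _ M i] hw hL loc_boundedD[OF Hb] by (intro wconv_sum[OF p]) auto
    moreover have "(\<Sum>e\<in>out_arcs G v. H m (M, e, i) \<theta>) = choice_prob G d \<mu> v M i \<theta> f * X m (v, i) \<theta>" for m \<theta>
    proof -
      have "(\<Sum>e\<in>out_arcs G v. H m (M, e, i) \<theta>) = (\<Sum>e\<in>out_arcs G v. a m (M, e, i) \<theta>) * X m (v, i) \<theta>"
        unfolding sum_distrib_right by (intro sum.cong) (auto simp: H_def)
      thus ?thesis using sum_class_share_out[OF F f v _ i] by (cases "v = d i") (auto simp: X_def inflow_def a_def)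
    qed
    ultimately have "wconv (\<lambda>m \<theta>. choice_prob G d \<mu> v M i \<theta> f * X (\<sigma> m) (v, i) \<theta>) (\<lambda>\<theta>. \<Sum>e\<in>out_arcs G v. h (M, e, i) \<theta>)" by simp
    moreover have "wconv (\<lambda>m \<theta>. choice_prob G d \<mu> v M i \<theta> f * X (\<sigma> m) (v, i) \<theta>) (\<lambda>\<theta>. choice_prob G d \<mu> v M i \<theta> f * X' (v, i) \<theta>)"
      by (rule wconv_mult[where c=1, OF p loc_bounded_subseq[OF Xb[OF v i]] X'L[OF v i] wconv_subseq[OF Xw[OF v i] \<sigma>]])
        (use pm pb in auto)
    ultimately show ?thesis
      using in_K[OF _ M i] hL loc_Lp_mult(1)[OF p X'L[OF v i] pm, of 1] pb
      by (intro wconv_unique[OF p]) (auto intro!: loc_Lp_sum[OF p])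
  qed
  \<comment> \<open>Summing over classes recovers the flow routed by softmax, whose cut average is
    \<open>x m\<close>. The averaging disappears in the weak limit.\<close>
  have edge_sum: "AE \<theta> in lebesgue. 0 \<le> \<theta> \<longrightarrow> x' (e, i) \<theta> = iT \<theta> * (\<Sum>M\<in>Pow (out_arcs G (tail G e)). h (M, e, i) \<theta>)"
    if e: "e \<in> arcs G" and i: "i \<in> I" for e i
  proof -
    define v where "v = tail G e"
    have ev: "e \<in> out_arcs G v" using e by (simp add: v_def)
    have kK: "(M, e, i) \<in> K" if "M \<in> Pow (out_arcs G v)" for M using in_K[OF ev _ i] that by auto
    define g where "g m \<theta> = route (s m) (F m) (e, i) \<theta> * X m (v, i) \<theta>" for m \<theta>
    have gH: "g m = (\<lambda>\<theta>. \<Sum>M\<in>Pow (out_arcs G v). H m (M, e, i) \<theta>)" for m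
      unfolding g_def sum_class_share[OF F f e i, symmetric] sum_distrib_right by (simp add: H_def a_def v_def)
    have gb: "loc_bounded p g" unfolding gH using Hb kK by (intro loc_bounded_sum[OF p]) auto
    have hs: "loc_Lp p (\<lambda>\<theta>. \<Sum>M\<in>Pow (out_arcs G v). h (M, e, i) \<theta>)" using hL kK by (intro loc_Lp_sum[OF p]) auto
    have gw: "wconv (\<lambda>m. g (\<sigma> m)) (\<lambda>\<theta>. \<Sum>M\<in>Pow (out_arcs G v). h (M, e, i) \<theta>)"
      unfolding gH using hw hL kK loc_boundedD[OF Hb] by (intro wconv_sum[OF p]) auto
    have w: "wconv (\<lambda>m \<theta>. indicator (before (ereal (\<tau> (\<sigma> m)))) \<theta> * avg (s (\<sigma> m)) (\<lambda>\<theta>. indicator (before (ereal (\<tau> (\<sigma> m)))) \<theta> * g (\<sigma> m) \<theta>) \<theta>)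
        (\<lambda>\<theta>. indicator (before T) \<theta> * (\<Sum>M\<in>Pow (out_arcs G v). h (M, e, i) \<theta>))"
    proof (rule wconv_avg[OF p _ before_lebesgue before_lebesgue _ loc_bounded_subseq[OF gb] hs gw])
      show "m \<le> s (\<sigma> m)" for m using s[of "\<sigma> m"] strict_mono_imp_increasing[OF \<sigma>, of m] by simp
      show "AE \<theta> in lebesgue. 0 \<le> \<theta> \<longrightarrow> (\<lambda>m. indicator (before (ereal (\<tau> (\<sigma> m)))) \<theta> :: real) \<longlonglongrightarrow> indicator (before T) \<theta>"
        using \<tau>
      proof eventually_elim
        fix \<theta> assume "0 \<le> \<theta> \<longrightarrow> (\<lambda>m. indicator (before (ereal (\<tau> m))) \<theta> :: real) \<longlonglongrightarrow> indicator (before T) \<theta>"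
        thus "0 \<le> \<theta> \<longrightarrow> (\<lambda>m. indicator (before (ereal (\<tau> (\<sigma> m)))) \<theta> :: real) \<longlonglongrightarrow> indicator (before T) \<theta>"
          using LIMSEQ_subseq_LIMSEQ[OF _ \<sigma>] by (auto simp: o_def)
      qed
    qed
    have "before (ereal (\<tau> m)) = {0..<\<tau> m}" for m by (auto simp: before_def)
    hence r: "routed (\<tau> m) (s m) (x m) (y m) (e, i) = (\<lambda>\<theta>. indicator (before (ereal (\<tau> m))) \<theta> * g m \<theta>)" for m
      by (simp add: routed_def g_def F_def X_def v_def mult.assoc fun_eq_iff)
    have "x m (e, i) = (\<lambda>\<theta>. indicator (before (ereal (\<tau> m))) \<theta> * avg (s m) (\<lambda>\<theta>. indicator (before (ereal (\<tau> m))) \<theta> * g m \<theta>) \<theta>)" for m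
      using eq[of "(e, i)" m] e i unfolding r by auto
    hence w': "wconv (\<lambda>m. x (\<sigma> m) (e, i)) (\<lambda>\<theta>. iT \<theta> * (\<Sum>M\<in>Pow (out_arcs G v). h (M, e, i) \<theta>))"
      using w by (simp add: iT_def)
    have "(e, i) \<in> A" using e i by simp
    from wconv_unique[OF p A_rates_loc_Lp[OF x' this] loc_Lp_mult(1)[OF p hs iTm, of 1] wconv_subseq[OF xw[OF this] \<sigma>] w']
    show ?thesis using iTb by (simp add: v_def)
  qed
  define h' where "h' k \<theta> = indicator {0..} \<theta> * h k \<theta>" for k \<theta>
  have outfin: "finite (Pow (out_arcs G v))" for v using finite_out by simp
  show ?thesis
  proof (rule prediction_equilibriumI[OF x' y', where H=h'])
    fix M e i assume Me: "(M, e) \<in> choice_pairs G" and i: "i \<in> I"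
    hence k: "(M, e, i) \<in> K" by (auto simp: choice_pairs_iff K_def)
    show "h' (M, e, i) \<in> borel_measurable lebesgue"
      unfolding h'_def[abs_def] using loc_LpD(2)[OF hL[OF k]] by measurable
    show "AE \<theta> in lebesgue. ereal \<theta> < T \<longrightarrow> 0 \<le> h' (M, e, i) \<theta>"
      using h_nonneg[OF k] by eventually_elim (auto simp: h'_def indicator_def)
  next
    fix j assume "j \<in> A"
    thus "AE \<theta> in lebesgue. ereal \<theta> < T \<longrightarrow> y' j \<theta> = \<Phi> x' j \<theta>" by (rule loading)
  next
    fix v i assume v: "v \<in> verts G" and i: "i \<in> I"
    have 1: "AE \<theta> in lebesgue. \<forall>M\<in>Pow (out_arcs G v). 0 \<le> \<theta> \<longrightarrow>
        (\<Sum>e\<in>out_arcs G v. h (M, e, i) \<theta>) = choice_prob G d \<mu> v M i \<theta> f * X' (v, i) \<theta>"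
      by (intro AE_finite_allI outfin node_sum v i) auto
    have 2: "AE \<theta> in lebesgue. \<forall>e\<in>out_arcs G v. 0 \<le> \<theta> \<longrightarrow> x' (e, i) \<theta> = iT \<theta> * (\<Sum>M\<in>Pow (out_arcs G v). h (M, e, i) \<theta>)"
    proof (intro AE_finite_allI finite_out)
      fix e assume "e \<in> out_arcs G v"
      thus "AE \<theta> in lebesgue. 0 \<le> \<theta> \<longrightarrow> x' (e, i) \<theta> = iT \<theta> * (\<Sum>M\<in>Pow (out_arcs G v). h (M, e, i) \<theta>)"
        using edge_sum[of e i] i by simp
    qed
    have 3: "AE \<theta> in lebesgue. \<forall>e\<in>out_arcs G v. \<theta> < 0 \<longrightarrow> x' (e, i) \<theta> = 0"
      using x' i by (intro AE_finite_allI finite_out ratesD(3)) auto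
    show "AE \<theta> in lebesgue. ereal \<theta> < T \<longrightarrow> (\<Sum>e\<in>out_arcs G v. x' (e, i) \<theta>) = inflow y' (v, i) \<theta>"
      using 1 2 3 inflow_before_0[OF v i y']
    proof eventually_elim
      fix \<theta>
      assume *: "\<forall>M\<in>Pow (out_arcs G v). 0 \<le> \<theta> \<longrightarrow>
        (\<Sum>e\<in>out_arcs G v. h (M, e, i) \<theta>) = choice_prob G d \<mu> v M i \<theta> f * X' (v, i) \<theta>"
        "\<forall>e\<in>out_arcs G v. 0 \<le> \<theta> \<longrightarrow> x' (e, i) \<theta> = iT \<theta> * (\<Sum>M\<in>Pow (out_arcs G v). h (M, e, i) \<theta>)"
        "\<forall>e\<in>out_arcs G v. \<theta> < 0 \<longrightarrow> x' (e, i) \<theta> = 0" "\<theta> < 0 \<longrightarrow> inflow y' (v, i) \<theta> = 0"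
      show "ereal \<theta> < T \<longrightarrow> (\<Sum>e\<in>out_arcs G v. x' (e, i) \<theta>) = inflow y' (v, i) \<theta>"
      proof (cases "0 \<le> \<theta>")
        case True
        show ?thesis
        proof
          assume T: "ereal \<theta> < T"
          have "(\<Sum>e\<in>out_arcs G v. x' (e, i) \<theta>) = (\<Sum>e\<in>out_arcs G v. \<Sum>M\<in>Pow (out_arcs G v). h (M, e, i) \<theta>)"
            using *(2) True iT1[OF True T] by (intro sum.cong) auto
          also have "\<dots> = (\<Sum>M\<in>Pow (out_arcs G v). \<Sum>e\<in>out_arcs G v. h (M, e, i) \<theta>)" by (rule sum.swap)
          also have "\<dots> = (\<Sum>M\<in>Pow (out_arcs G v). choice_prob G d \<mu> v M i \<theta> f * X' (v, i) \<theta>)"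
            using *(1) True by (intro sum.cong) auto
          also have "\<dots> = X' (v, i) \<theta>" using sum_choice_prob[OF i v f, of \<theta>] by (simp add: sum_distrib_right[symmetric])
          finally show "(\<Sum>e\<in>out_arcs G v. x' (e, i) \<theta>) = inflow y' (v, i) \<theta>" by (simp add: X'_def)
        qed
      next
        case False
        have "(\<Sum>e\<in>out_arcs G v. x' (e, i) \<theta>) = 0" using *(3) False by (intro sum.neutral) auto
        thus ?thesis using *(4) False by simp
      qed
    qed
  next
    fix e i assume e: "e \<in> arcs G" and i: "i \<in> I"
    define v where "v = tail G e"
    have ev: "e \<in> out_arcs G v" using e by (simp add: v_def)
    have pairs: "{M. (M, e) \<in> choice_pairs G} = {M \<in> Pow (out_arcs G v). e \<in> M}" using e by (auto simp: choice_pairs_iff v_def)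
    have 1: "AE \<theta> in lebesgue. \<forall>M\<in>Pow (out_arcs G v). e \<notin> M \<longrightarrow> 0 \<le> \<theta> \<longrightarrow> ereal \<theta> < T \<longrightarrow> h (M, e, i) \<theta> = 0"
    proof (intro AE_finite_allI outfin)
      fix M assume M: "M \<in> Pow (out_arcs G v)"
      show "AE \<theta> in lebesgue. e \<notin> M \<longrightarrow> 0 \<le> \<theta> \<longrightarrow> ereal \<theta> < T \<longrightarrow> h (M, e, i) \<theta> = 0"
        using vanish[OF ev _ _ i, of M] M by (cases "e \<in> M") auto
    qed
    have 2: "AE \<theta> in lebesgue. \<theta> < 0 \<longrightarrow> x' (e, i) \<theta> = 0" using x' e i by (intro ratesD(3)) auto
    show "AE \<theta> in lebesgue. ereal \<theta> < T \<longrightarrow> x' (e, i) \<theta> = (\<Sum>M | (M, e) \<in> choice_pairs G. h' (M, e, i) \<theta>)"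
      using edge_sum[OF e i] 1 2
    proof eventually_elim
      fix \<theta>
      assume *: "0 \<le> \<theta> \<longrightarrow> x' (e, i) \<theta> = iT \<theta> * (\<Sum>M\<in>Pow (out_arcs G (tail G e)). h (M, e, i) \<theta>)"
        "\<forall>M\<in>Pow (out_arcs G v). e \<notin> M \<longrightarrow> 0 \<le> \<theta> \<longrightarrow> ereal \<theta> < T \<longrightarrow> h (M, e, i) \<theta> = 0"
        "\<theta> < 0 \<longrightarrow> x' (e, i) \<theta> = 0"
      show "ereal \<theta> < T \<longrightarrow> x' (e, i) \<theta> = (\<Sum>M | (M, e) \<in> choice_pairs G. h' (M, e, i) \<theta>)"
      proof (cases "0 \<le> \<theta>")
        case True
        show ?thesis
        proof
          assume T: "ereal \<theta> < T"
          have "x' (e, i) \<theta> = (\<Sum>M\<in>Pow (out_arcs G v). h (M, e, i) \<theta>)" using *(1) True iT1[OF True T] by (simp add: v_def)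
          also have "\<dots> = (\<Sum>M | (M, e) \<in> choice_pairs G. h (M, e, i) \<theta>)"
            unfolding pairs using *(2) True T outfin by (intro sum.mono_neutral_right) auto
          finally show "x' (e, i) \<theta> = (\<Sum>M | (M, e) \<in> choice_pairs G. h' (M, e, i) \<theta>)" using True by (simp add: h'_def)
        qed
      qed (use *(3) in \<open>simp add: h'_def\<close>)
    qed
  next
    fix v M i assume v: "v \<in> verts G" and M: "M \<noteq> {}" "M \<subseteq> out_arcs G v" and i: "i \<in> I"
    have 1: "AE \<theta> in lebesgue. \<forall>e\<in>out_arcs G v. e \<notin> M \<longrightarrow> 0 \<le> \<theta> \<longrightarrow> ereal \<theta> < T \<longrightarrow> h (M, e, i) \<theta> = 0"
    proof (intro AE_finite_allI finite_out)
      fix e assume "e \<in> out_arcs G v"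
      thus "AE \<theta> in lebesgue. e \<notin> M \<longrightarrow> 0 \<le> \<theta> \<longrightarrow> ereal \<theta> < T \<longrightarrow> h (M, e, i) \<theta> = 0"
        using vanish[OF _ _ M(2) i, of e] by (cases "e \<in> M") auto
    qed
    show "AE \<theta> in lebesgue. ereal \<theta> < T \<longrightarrow> (\<Sum>e\<in>M. h' (M, e, i) \<theta>) = choice_prob G d \<mu> v M i \<theta> (join x' y') * inflow y' (v, i) \<theta>"
      using node_sum[OF v M(2) i] 1 inflow_before_0[OF v i y']
    proof eventually_elim
      fix \<theta>
      assume *: "0 \<le> \<theta> \<longrightarrow> (\<Sum>e\<in>out_arcs G v. h (M, e, i) \<theta>) = choice_prob G d \<mu> v M i \<theta> f * X' (v, i) \<theta>"
        "\<forall>e\<in>out_arcs G v. e \<notin> M \<longrightarrow> 0 \<le> \<theta> \<longrightarrow> ereal \<theta> < T \<longrightarrow> h (M, e, i) \<theta> = 0" "\<theta> < 0 \<longrightarrow> inflow y' (v, i) \<theta> = 0"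
      show "ereal \<theta> < T \<longrightarrow> (\<Sum>e\<in>M. h' (M, e, i) \<theta>) = choice_prob G d \<mu> v M i \<theta> (join x' y') * inflow y' (v, i) \<theta>"
      proof (cases "0 \<le> \<theta>")
        case True
        show ?thesis
        proof
          assume T: "ereal \<theta> < T"
          have "(\<Sum>e\<in>M. h (M, e, i) \<theta>) = (\<Sum>e\<in>out_arcs G v. h (M, e, i) \<theta>)"
            using *(2) True T M(2) finite_out by (intro sum.mono_neutral_left) auto
          thus "(\<Sum>e\<in>M. h' (M, e, i) \<theta>) = choice_prob G d \<mu> v M i \<theta> (join x' y') * inflow y' (v, i) \<theta>"
            using *(1) True by (simp add: h'_def f_def X'_def)
        qed
      qed (use *(3) in \<open>simp add: h'_def\<close>)
    qed
  qed
qed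

end

section \<open>Existence under weak continuity\<close>

lemma coincide_until_iff: "coincide_until J T f g \<longleftrightarrow> (\<forall>j\<in>J. AE t in lebesgue. 0 \<le> t \<longrightarrow> ereal t < T \<longrightarrow> f j t = g j t)"
  unfolding coincide_until_def ae_equal_def cut_def
  by (intro ball_cong refl arg_cong[where f="\<lambda>P. eventually P _"] ext) (auto simp: before_def indicator_def)

context network
begin

text \<open>The common core of the finite and the infinite horizon, with \<open>\<tau>\<close>
  constant or tending to infinity. What differs, the passage to the limit in the loading and in the
  costs, enters as the hypotheses \<open>loads\<close> and \<open>costs\<close>. The index
  \<open>m\<close> serves as partition level and as inverse temperature.\<close>

lemma equilibrium_exists_if_limits:
  assumes \<tau>0: "\<And>m. 0 \<le> \<tau> m" and \<tau>T: "\<And>m. ereal (\<tau> m) \<le> T" and cont: "\<And>m. continuity_until p G I \<Phi> \<mu> (\<tau> m)"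
    and \<tau>l: "AE \<theta> in lebesgue. 0 \<le> \<theta> \<longrightarrow> (\<lambda>m. indicator (before (ereal (\<tau> m))) \<theta> :: real) \<longlonglongrightarrow> indicator (before T) \<theta>"
    and loads: "\<And>\<sigma> x x' j. strict_mono \<sigma> \<Longrightarrow> (\<And>m. x m \<in> A \<rightarrow> rates_until p (ereal (\<tau> (\<sigma> m)))) \<Longrightarrow> x' \<in> A \<rightarrow> rates_until p T \<Longrightarrow>
      (\<And>j. j \<in> A \<Longrightarrow> loc_bounded p (\<lambda>m. x m j)) \<Longrightarrow> (\<And>j. j \<in> A \<Longrightarrow> wconv (\<lambda>m. x m j) (x' j)) \<Longrightarrow> j \<in> A \<Longrightarrow>
      wconv (\<lambda>m. cut {0..\<tau> (\<sigma> m)} (\<Phi> (x m)) j) (cut (before T) (\<Phi> x') j)"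
    and costs: "\<And>\<sigma> F f i. strict_mono \<sigma> \<Longrightarrow> (\<And>m. F m \<in> flows_until p G I (ereal (\<tau> (\<sigma> m)))) \<Longrightarrow> f \<in> flows_until p G I T \<Longrightarrow>
      (\<And>j. j \<in> flow_index G I \<Longrightarrow> loc_bounded p (\<lambda>m. F m j)) \<Longrightarrow> (\<And>j. j \<in> flow_index G I \<Longrightarrow> wconv (\<lambda>m. F m j) (f j)) \<Longrightarrow> i \<in> I \<Longrightarrow>
      AE \<theta> in lebesgue. 0 \<le> \<theta> \<longrightarrow> ereal \<theta> < T \<longrightarrow> (AE C in \<mu> i. \<forall>q\<in>simple_paths G. (\<lambda>m. C \<theta> (F m) q) \<longlonglongrightarrow> C \<theta> f q)"
  shows "\<exists>f. prediction_equilibrium p G I d u \<Phi> \<mu> T f"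
proof -
  have "\<forall>m. \<exists>x. x \<in> A \<rightarrow> rates_until p (ereal (\<tau> m)) \<and> (\<forall>j\<in>A. \<forall>\<theta>. x j \<theta> = indicator (before (ereal (\<tau> m))) \<theta> *
      avg m (routed (\<tau> m) m x (cut {0..\<tau> m} (\<Phi> x)) j) \<theta>)"
  proof
    fix m
    obtain x where "x \<in> A \<rightarrow> rates_until p (ereal (\<tau> m))"
      "\<And>j \<theta>. j \<in> A \<Longrightarrow> x j \<theta> = indicator (before (ereal (\<tau> m))) \<theta> * avg m (routed (\<tau> m) m x (cut {0..\<tau> m} (\<Phi> x)) j) \<theta>"
      by (rule approximate_equilibrium_exists[OF \<tau>0[of m] cont[of m], where n=m]) (rule that)
    thus "\<exists>x. x \<in> A \<rightarrow> rates_until p (ereal (\<tau> m)) \<and> (\<forall>j\<in>A. \<forall>\<theta>. x j \<theta> = indicator (before (ereal (\<tau> m))) \<theta> *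
      avg m (routed (\<tau> m) m x (cut {0..\<tau> m} (\<Phi> x)) j) \<theta>)" by (intro exI[of _ x] conjI ballI allI)
  qed
  from choice[OF this] obtain X where X': "\<forall>m. X m \<in> A \<rightarrow> rates_until p (ereal (\<tau> m)) \<and>
    (\<forall>j\<in>A. \<forall>\<theta>. X m j \<theta> = indicator (before (ereal (\<tau> m))) \<theta> * avg m (routed (\<tau> m) m (X m) (cut {0..\<tau> m} (\<Phi> (X m))) j) \<theta>)" by blast
  have X: "X m \<in> A \<rightarrow> rates_until p (ereal (\<tau> m))" for m using X' by blast
  have Xeq: "X m j \<theta> = indicator (before (ereal (\<tau> m))) \<theta> * avg m (routed (\<tau> m) m (X m) (cut {0..\<tau> m} (\<Phi> (X m))) j) \<theta>"
    if "j \<in> A" for m j \<theta> using X' that by blast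
  have Xr: "X m \<in> A \<rightarrow> rates p" for m by (rule A_rates_until[OF X])
  have Y: "cut {0..\<tau> m} (\<Phi> (X m)) \<in> A \<rightarrow> rates_until p (ereal (\<tau> m))" for m
    using \<Phi>_rates[OF Xr[of m]] unfolding cut_def by (intro Pi_I rates_until_cut_closed[OF p]) auto
  have Yb: "loc_bounded p (\<lambda>m. cut {0..\<tau> m} (\<Phi> (X m)) j)" if "j \<in> A" for j
    by (rule loading_loc_bounded[OF Xr that]) simp
  have Xb: "loc_bounded p (\<lambda>m. X m j)" if j: "j \<in> A" for j
  proof -
    have "loc_bounded p (\<lambda>m \<theta>. indicator (before (ereal (\<tau> m))) \<theta> * avg m (routed (\<tau> m) m (X m) (cut {0..\<tau> m} (\<Phi> (X m))) j) \<theta>)"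
      by (rule loc_bounded_mult[where c=1, OF p loc_bounded_avg[OF p routed_loc_bounded[OF Xr A_rates_until[OF Y] Yb j]]])
        (auto simp: indicator_def)
    moreover have "(\<lambda>m. X m j) = (\<lambda>m \<theta>. indicator (before (ereal (\<tau> m))) \<theta> * avg m (routed (\<tau> m) m (X m) (cut {0..\<tau> m} (\<Phi> (X m))) j) \<theta>)"
      using Xeq[OF j] by (intro ext)
    ultimately show ?thesis by (simp only:)
  qed
  obtain \<sigma> :: "nat \<Rightarrow> nat" and z where \<sigma>: "strict_mono \<sigma>" and zL: "\<And>j. j \<in> A \<Longrightarrow> loc_Lp p (z j)"
    and zw: "\<And>j. j \<in> A \<Longrightarrow> wconv (\<lambda>m. X (\<sigma> m) j) (z j)"
  proof (rule wconv_subseq_exists[OF p finite_A, where X=X])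
    show "loc_bounded p (\<lambda>m. X m j)" if "j \<in> A" for j by (rule Xb[OF that])
  qed (rule that)
  define x' where "x' j \<theta> = indicator (before T) \<theta> * z j \<theta>" for j \<theta>
  have x'L: "loc_Lp p (x' j)" if "j \<in> A" for j
    unfolding x'_def[abs_def] by (rule loc_Lp_mult(1)[OF p zL[OF that], of _ 1]) (auto simp: indicator_def)
  have x'w: "wconv (\<lambda>m. X (\<sigma> m) j) (x' j)" if j: "j \<in> A" for j
  proof (rule wconv_cong_AE)
    show "wconv (\<lambda>m \<theta>. indicator (before T) \<theta> * X (\<sigma> m) j \<theta>) (\<lambda>\<theta>. indicator (before T) \<theta> * z j \<theta>)"
      by (rule wconv_mult[where c=1, OF p loc_bounded_subseq[OF Xb[OF j]] zL[OF j] zw[OF j]]) (auto simp: indicator_def)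
    show "AE \<theta> in lebesgue. 0 \<le> \<theta> \<longrightarrow> indicator (before T) \<theta> * X (\<sigma> m) j \<theta> = X (\<sigma> m) j \<theta>" for m
    proof (intro AE_I2 impI)
      fix \<theta> :: real
      have "\<theta> \<in> before (ereal (\<tau> (\<sigma> m))) \<Longrightarrow> \<theta> \<in> before T"
        using less_le_trans[OF _ \<tau>T[of "\<sigma> m"], of "ereal \<theta>"] by (auto simp: before_def)
      thus "indicator (before T) \<theta> * X (\<sigma> m) j \<theta> = X (\<sigma> m) j \<theta>"
        unfolding Xeq[OF j, of "\<sigma> m" \<theta>] by (auto simp: indicator_def)
    qed
    show Xm: "X (\<sigma> m) j \<in> borel_measurable lebesgue" for m by (rule ratesD(1)[OF funcset_mem[OF Xr j]])
    show "(\<lambda>\<theta>. indicator (before T) \<theta> * X (\<sigma> m) j \<theta>) \<in> borel_measurable lebesgue" for m using Xm by measurable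
    show "x' j \<in> borel_measurable lebesgue" by (rule loc_LpD(2)[OF x'L[OF j]])
    thus "(\<lambda>\<theta>. indicator (before T) \<theta> * z j \<theta>) \<in> borel_measurable lebesgue" by (simp add: x'_def[abs_def])
  qed (simp add: x'_def)
  have x'r: "x' \<in> A \<rightarrow> rates_until p T"
  proof
    fix j assume j: "j \<in> A"
    have "AE \<theta> in lebesgue. 0 \<le> \<theta> \<longrightarrow> 0 \<le> x' j \<theta>"
      by (rule wconv_nonneg[OF p loc_bounded_subseq[OF Xb[OF j]] x'L[OF j] x'w[OF j]]) (rule ratesD(2)[OF funcset_mem[OF Xr j]])
    hence "x' j \<in> rates p"
      using p by (intro rates_if_loc_Lp x'L j) (auto simp: x'_def before_def)
    thus "x' j \<in> rates_until p T" by (simp add: rates_until_def x'_def indicator_def)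
  qed
  \<comment> \<open>Defined through the loading of \<open>x'\<close>, so that the loading equation
    is built in; that it is also the weak limit of the approximate outflow rates is the content of
    \<open>loads\<close>.\<close>
  define y' where "y' = cut (before T) (\<Phi> x')"
  have y'r: "y' \<in> A \<rightarrow> rates_until p T"
    using \<Phi>_rates[OF A_rates_until[OF x'r]] unfolding y'_def cut_def by (intro Pi_I rates_until_cut[OF p]) auto
  have y'w: "wconv (\<lambda>m. cut {0..\<tau> (\<sigma> m)} (\<Phi> (X (\<sigma> m))) j) (y' j)" if "j \<in> A" for j
    unfolding y'_def by (rule loads[OF \<sigma> X x'r loc_bounded_subseq[OF Xb] x'w that])
  have "prediction_equilibrium p G I d u \<Phi> \<mu> T (join x' y')"
  proof (rule equilibrium_limit[where s=\<sigma> and x="\<lambda>m. X (\<sigma> m)" and y="\<lambda>m. cut {0..\<tau> (\<sigma> m)} (\<Phi> (X (\<sigma> m)))" and \<tau>="\<lambda>m. \<tau> (\<sigma> m)"])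
    show "m \<le> \<sigma> m" for m by (rule strict_mono_imp_increasing[OF \<sigma>])
    show "AE \<theta> in lebesgue. 0 \<le> \<theta> \<longrightarrow> (\<lambda>m. indicator (before (ereal (\<tau> (\<sigma> m)))) \<theta> :: real) \<longlonglongrightarrow> indicator (before T) \<theta>"
      using \<tau>l
    proof eventually_elim
      fix \<theta> assume "0 \<le> \<theta> \<longrightarrow> (\<lambda>m. indicator (before (ereal (\<tau> m))) \<theta> :: real) \<longlonglongrightarrow> indicator (before T) \<theta>"
      thus "0 \<le> \<theta> \<longrightarrow> (\<lambda>m. indicator (before (ereal (\<tau> (\<sigma> m)))) \<theta> :: real) \<longlonglongrightarrow> indicator (before T) \<theta>"
        using LIMSEQ_subseq_LIMSEQ[OF _ \<sigma>] by (auto simp: o_def)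
    qed
    show "AE \<theta> in lebesgue. 0 \<le> \<theta> \<longrightarrow> ereal \<theta> < T \<longrightarrow> (AE C in \<mu> i. \<forall>q\<in>simple_paths G.
        (\<lambda>m. C \<theta> (join (X (\<sigma> m)) (cut {0..\<tau> (\<sigma> m)} (\<Phi> (X (\<sigma> m))))) q) \<longlonglongrightarrow> C \<theta> (join x' y') q)" if "i \<in> I" for i
    proof (rule costs[OF \<sigma> _ _ _ _ that])
      show "join (X (\<sigma> m)) (cut {0..\<tau> (\<sigma> m)} (\<Phi> (X (\<sigma> m)))) \<in> flows_until p G I (ereal (\<tau> (\<sigma> m)))" for m
        using X Y by (simp add: join_flows_until)
      show "join x' y' \<in> flows_until p G I T" using x'r y'r by (simp add: join_flows_until)
      fix h assume h: "h \<in> flow_index G I"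
      show "loc_bounded p (\<lambda>m. join (X (\<sigma> m)) (cut {0..\<tau> (\<sigma> m)} (\<Phi> (X (\<sigma> m)))) h)"
        by (rule join_index_cases[OF h]) (simp_all add: loc_bounded_subseq[OF Xb] loc_bounded_subseq[OF Yb])
      show "wconv (\<lambda>m. join (X (\<sigma> m)) (cut {0..\<tau> (\<sigma> m)} (\<Phi> (X (\<sigma> m)))) h) (join x' y' h)"
        by (rule join_index_cases[OF h]) (simp_all add: x'w y'w)
    qed
    show "AE \<theta> in lebesgue. ereal \<theta> < T \<longrightarrow> y' j \<theta> = \<Phi> x' j \<theta>" if j: "j \<in> A" for j
    proof -
      have "AE \<theta> in lebesgue. \<theta> < 0 \<longrightarrow> \<Phi> x' j \<theta> = 0"
        using \<Phi>_rates[OF A_rates_until[OF x'r]] j by (intro ratesD(3)[of _ p]) auto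
      thus ?thesis by eventually_elim (auto simp: y'_def cut_def before_def indicator_def)
    qed
  
    show "X (\<sigma> m) \<in> A \<rightarrow> rates p" "cut {0..\<tau> (\<sigma> m)} (\<Phi> (X (\<sigma> m))) \<in> A \<rightarrow> rates p" for m
      by (rule Xr, rule A_rates_until[OF Y])
    show "x' \<in> A \<rightarrow> rates p" "y' \<in> A \<rightarrow> rates p" by (rule A_rates_until[OF x'r], rule A_rates_until[OF y'r])
    fix j assume j: "j \<in> A"
    show "loc_bounded p (\<lambda>m. cut {0..\<tau> (\<sigma> m)} (\<Phi> (X (\<sigma> m))) j)" by (rule loc_bounded_subseq[OF Yb[OF j]])
    show "wconv (\<lambda>m. X (\<sigma> m) j) (x' j)" by (rule x'w[OF j])
    show "wconv (\<lambda>m. cut {0..\<tau> (\<sigma> m)} (\<Phi> (X (\<sigma> m))) j) (y' j)" by (rule y'w[OF j])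
    show "X (\<sigma> m) j \<theta> = indicator (before (ereal (\<tau> (\<sigma> m)))) \<theta> *
        avg (\<sigma> m) (routed (\<tau> (\<sigma> m)) (\<sigma> m) (X (\<sigma> m)) (cut {0..\<tau> (\<sigma> m)} (\<Phi> (X (\<sigma> m)))) j) \<theta>" for m \<theta>
      by (rule Xeq[OF j])
  qed
  thus ?thesis by blast
qed

theorem equilibrium_exists_until:
  assumes T: "0 \<le> T" and cont: "continuity_until p G I \<Phi> \<mu> T"
  shows "\<exists>f. prediction_equilibrium p G I d u \<Phi> \<mu> (ereal T) f"
proof (rule equilibrium_exists_if_limits[where \<tau>="\<lambda>_. T"])
  fix \<sigma> :: "nat \<Rightarrow> nat" and x x' j
  assume x: "\<And>m. x m \<in> A \<rightarrow> rates_until p (ereal T)" "x' \<in> A \<rightarrow> rates_until p (ereal T)"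
    and xw: "\<And>j. j \<in> A \<Longrightarrow> loc_bounded p (\<lambda>m. x m j)" "\<And>j. j \<in> A \<Longrightarrow> wconv (\<lambda>m. x m j) (x' j)" and j: "j \<in> A"
  show "wconv (\<lambda>m. cut {0..T} (\<Phi> (x m)) j) (cut (before (ereal T)) (\<Phi> x') j)"
  proof (rule wconv_cong_AE[OF loading_wconv[OF T cont x xw j]])
    show "AE \<theta> in lebesgue. 0 \<le> \<theta> \<longrightarrow> cut {0..T} (\<Phi> x') j \<theta> = cut (before (ereal T)) (\<Phi> x') j \<theta>"
      using AE_lebesgue_neq[of T] by eventually_elim (auto simp: cut_def before_def indicator_def)
    have [measurable]: "\<Phi> (x m) j \<in> borel_measurable lebesgue" "\<Phi> x' j \<in> borel_measurable lebesgue" for m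
      by (rule ratesD(1)[OF funcset_mem[OF \<Phi>_rates[OF A_rates_until[OF x(1)]] j]],
          rule ratesD(1)[OF funcset_mem[OF \<Phi>_rates[OF A_rates_until[OF x(2)]] j]])
    show "cut {0..T} (\<Phi> (x m)) j \<in> borel_measurable lebesgue" "cut {0..T} (\<Phi> (x m)) j \<in> borel_measurable lebesgue"
      "cut {0..T} (\<Phi> x') j \<in> borel_measurable lebesgue" "cut (before (ereal T)) (\<Phi> x') j \<in> borel_measurable lebesgue" for m
      unfolding cut_def by measurable
    show "AE \<theta> in lebesgue. 0 \<le> \<theta> \<longrightarrow> cut {0..T} (\<Phi> (x m)) j \<theta> = cut {0..T} (\<Phi> (x m)) j \<theta>" for m by (rule AE_I2) simp
  qed
next
  fix \<sigma> :: "nat \<Rightarrow> nat" and F f i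
  assume "strict_mono \<sigma>" and "\<And>m. F m \<in> flows_until p G I (ereal T)" "f \<in> flows_until p G I (ereal T)"
    "\<And>j. j \<in> flow_index G I \<Longrightarrow> loc_bounded p (\<lambda>m. F m j)" "\<And>j. j \<in> flow_index G I \<Longrightarrow> wconv (\<lambda>m. F m j) (f j)" "i \<in> I"
  hence "AE \<theta> in lebesgue. \<theta> < T \<longrightarrow> (AE C in \<mu> i. \<forall>q\<in>simple_paths G. (\<lambda>m. C \<theta> (F m) q) \<longlonglongrightarrow> C \<theta> f q)"
    by (intro costs_tendsto[OF T cont])
  thus "AE \<theta> in lebesgue. 0 \<le> \<theta> \<longrightarrow> ereal \<theta> < ereal T \<longrightarrow> (AE C in \<mu> i. \<forall>q\<in>simple_paths G. (\<lambda>m. C \<theta> (F m) q) \<longlonglongrightarrow> C \<theta> f q)"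
    by eventually_elim simp
qed (simp_all add: T cont)

text \<open>Serves causality, with \<open>\<eta> = 0\<close>, as well as the Lipschitz
  estimate.\<close>

lemma AE_costs_swap:
  assumes i: "i \<in> I" and f: "f \<in> flows p G I" and g: "g \<in> flows p G I"
    and "AE C in \<mu> i. AE \<theta> in lebesgue. 0 \<le> \<theta> \<longrightarrow> \<theta> < T \<longrightarrow> (\<forall>q\<in>simple_paths G. \<bar>C \<theta> f q - C \<theta> g q\<bar> \<le> \<eta>)"
  shows "AE \<theta> in lebesgue. 0 \<le> \<theta> \<longrightarrow> \<theta> < T \<longrightarrow> (AE C in \<mu> i. \<forall>q\<in>simple_paths G. \<bar>C \<theta> f q - C \<theta> g q\<bar> \<le> \<eta>)"
proof -
  have "AE \<theta> in lebesgue. AE C in \<mu> i. 0 \<le> \<theta> \<longrightarrow> \<theta> < T \<longrightarrow> (\<forall>q\<in>simple_paths G. \<bar>C \<theta> f q - C \<theta> g q\<bar> \<le> \<eta>)"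
  proof (rule AE_swap_lebesgue[OF prob_space_\<mu>[OF i] _ assms(4)])
    have s: "(snd :: _ \<times> real \<Rightarrow> real) \<in> borel_measurable (\<mu> i \<Otimes>\<^sub>M lebesgue)"
    proof -
      have "(\<lambda>\<theta>::real. \<theta>) \<in> borel_measurable lebesgue" by (intro borel_measurable_lebesgue) simp
      from measurable_compose[OF measurable_snd[of "\<mu> i" lebesgue] this] show ?thesis by simp
    qed
    show "Measurable.pred (\<mu> i \<Otimes>\<^sub>M lebesgue)
        (\<lambda>x. 0 \<le> snd x \<longrightarrow> snd x < T \<longrightarrow> (\<forall>q\<in>simple_paths G. \<bar>fst x (snd x) f q - fst x (snd x) g q\<bar> \<le> \<eta>))"
    proof (intro pred_intros_logic pred_intros_finite finite_simple_paths)
      show "Measurable.pred (\<mu> i \<Otimes>\<^sub>M lebesgue) (\<lambda>x :: ('e,'i) predictor \<times> real. 0 \<le> snd x)"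
        unfolding pred_def using borel_measurable_le[OF borel_measurable_const s, of 0] .
      show "Measurable.pred (\<mu> i \<Otimes>\<^sub>M lebesgue) (\<lambda>x :: ('e,'i) predictor \<times> real. snd x < T)"
        unfolding pred_def using borel_measurable_less[OF s borel_measurable_const, of T] .
      show "Measurable.pred (\<mu> i \<Otimes>\<^sub>M lebesgue) (\<lambda>x. \<bar>fst x (snd x) f q - fst x (snd x) g q\<bar> \<le> \<eta>)" if "q \<in> simple_paths G" for q
        unfolding pred_def
        by (intro borel_measurable_le borel_measurable_abs borel_measurable_diff borel_measurable_const cost_measurable i f g that)
    qed
  qed
  thus ?thesis by eventually_elim simp
qed

lemma causal_costs_eq:
  assumes caus: "AE C in \<mu> i. causal_predictor p G I C" and i: "i \<in> I" and T: "0 \<le> T"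
    and f: "f \<in> flows p G I" and g: "g \<in> flows p G I" and co: "coincide_until (flow_index G I) (ereal T) f g"
  shows "AE \<theta> in lebesgue. 0 \<le> \<theta> \<longrightarrow> \<theta> < T \<longrightarrow> (AE C in \<mu> i. \<forall>q\<in>simple_paths G. C \<theta> f q = C \<theta> g q)"
proof -
  have "AE C in \<mu> i. AE \<theta> in lebesgue. 0 \<le> \<theta> \<longrightarrow> \<theta> < T \<longrightarrow> (\<forall>q\<in>simple_paths G. \<bar>C \<theta> f q - C \<theta> g q\<bar> \<le> 0)"
    using caus
  proof eventually_elim
    fix C assume "causal_predictor p G I C"
    hence "coincide_until (simple_paths G) (ereal T) (\<lambda>q \<theta>. C \<theta> f q) (\<lambda>q \<theta>. C \<theta> g q)"
      using T f g co unfolding causal_predictor_def by simp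
    hence "AE \<theta> in lebesgue. \<forall>q\<in>simple_paths G. 0 \<le> \<theta> \<longrightarrow> ereal \<theta> < ereal T \<longrightarrow> C \<theta> f q = C \<theta> g q"
      unfolding coincide_until_iff by (intro AE_finite_allI finite_simple_paths) auto
    thus "AE \<theta> in lebesgue. 0 \<le> \<theta> \<longrightarrow> \<theta> < T \<longrightarrow> (\<forall>q\<in>simple_paths G. \<bar>C \<theta> f q - C \<theta> g q\<bar> \<le> 0)"
      by eventually_elim simp
  qed
  from AE_costs_swap[OF i f g this] show ?thesis by simp
qed

text \<open>The approximate problems have horizon \<open>m\<close>. A dyadic cell lies before some
  integer \<open>N\<close>, and by causality the loading and the costs before \<open>N\<close>
  depend only on the flow before \<open>N\<close>, where continuity for the fixed horizon
  \<open>N\<close> applies.\<close>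

theorem equilibrium_exists_causal:
  assumes cont: "\<And>T. 0 \<le> T \<Longrightarrow> continuity_until p G I \<Phi> \<mu> T" and \<Phi>_causal: "causal_loading p G I \<Phi>"
    and C_causal: "\<And>i. i \<in> I \<Longrightarrow> AE C in \<mu> i. causal_predictor p G I C"
  shows "\<exists>f. prediction_equilibrium p G I d u \<Phi> \<mu> \<infinity> f"
proof (rule equilibrium_exists_if_limits[where \<tau>=real])
  define R where "R N x = (\<lambda>j \<theta>. indicator (before (ereal (real N))) \<theta> * x j \<theta>)" for N and x :: "'j \<Rightarrow> real \<Rightarrow> real"
  \<comment> \<open>Cutting at \<open>N\<close> turns a sequence with growing horizons into one with
    a fixed horizon; multiplication by a fixed indicator preserves weak convergence.\<close>
  define RA where "RA N x = (\<lambda>j \<theta>. indicator (before (ereal (real N))) \<theta> * x j \<theta>)" for N and x :: "'e \<times> 'i \<Rightarrow> real \<Rightarrow> real"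
  have RA_w: "wconv (\<lambda>m. RA N (x m) j) (RA N x' j)" if "loc_bounded p (\<lambda>m. x m j)" "wconv (\<lambda>m. x m j) (x' j)" "loc_Lp p (x' j)" for N x x' j
    unfolding RA_def by (rule wconv_mult[where c=1, OF p that(1,3,2)]) (auto simp: indicator_def)
  have RA_b: "loc_bounded p (\<lambda>m. RA N (x m) j)" if "loc_bounded p (\<lambda>m. x m j)" for N x j
    unfolding RA_def by (rule loc_bounded_mult[where c=1, OF p that]) (auto simp: indicator_def)
  have RA_r: "RA N x \<in> A \<rightarrow> rates_until p (ereal (real N))" if "x \<in> A \<rightarrow> rates p" for N x
    using that unfolding RA_def by (intro Pi_I rates_until_cut[OF p]) auto
  have \<Phi>R: "AE \<theta> in lebesgue. 0 \<le> \<theta> \<longrightarrow> \<theta> < real N \<longrightarrow> \<Phi> x j \<theta> = \<Phi> (RA N x) j \<theta>"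
    if x: "x \<in> A \<rightarrow> rates p" and j: "j \<in> A" for N x j
  proof -
    have "coincide_until A (ereal (real N)) x (RA N x)"
      unfolding coincide_until_iff by (auto simp: RA_def before_def intro!: AE_I2)
    then obtain \<alpha> where "0 \<le> \<alpha>" "coincide_until A (ereal (real N) + ereal \<alpha>) (\<Phi> x) (\<Phi> (RA N x))"
      using \<Phi>_causal x A_rates_until[OF RA_r[OF x]] unfolding causal_loading_def by (metis ereal_less_eq(5) of_nat_0_le_iff)
    hence "AE \<theta> in lebesgue. 0 \<le> \<theta> \<longrightarrow> ereal \<theta> < ereal (real N) + ereal \<alpha> \<longrightarrow> \<Phi> x j \<theta> = \<Phi> (RA N x) j \<theta>"
      using j unfolding coincide_until_iff by blast
    thus ?thesis by eventually_elim (use \<open>0 \<le> \<alpha>\<close> in auto)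
  qed
  show "wconv (\<lambda>m. cut {0..real (\<sigma> m)} (\<Phi> (x m)) j) (cut (before \<infinity>) (\<Phi> x') j)"
    if \<sigma>: "strict_mono \<sigma>" and x: "\<And>m. x m \<in> A \<rightarrow> rates_until p (ereal (real (\<sigma> m)))" "x' \<in> A \<rightarrow> rates_until p \<infinity>"
      and xw: "\<And>j. j \<in> A \<Longrightarrow> loc_bounded p (\<lambda>m. x m j)" "\<And>j. j \<in> A \<Longrightarrow> wconv (\<lambda>m. x m j) (x' j)" and j: "j \<in> A" for \<sigma> x x' j
    unfolding wconv_def
  proof (intro allI)
    fix n k
    define N where "N = Suc k"
    have sub: "dyad n k \<subseteq> {0..<real N}" unfolding N_def by (rule dyad_subset[OF less_Suc_mult])
    have xr: "x m \<in> A \<rightarrow> rates p" "x' \<in> A \<rightarrow> rates p" for m using A_rates_until[OF x(1)] A_rates_until[OF x(2)] .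
    have w: "wconv (\<lambda>m. cut {0..real N} (\<Phi> (RA N (x m))) j) (cut {0..real N} (\<Phi> (RA N x')) j)"
      by (rule loading_wconv[OF _ cont RA_r[OF xr(1)] RA_r[OF xr(2)] RA_b[OF xw(1)] RA_w[OF xw A_rates_loc_Lp[OF xr(2)]] j]) auto
    have \<Phi>m: "\<Phi> z j \<in> borel_measurable lebesgue" if "z \<in> A \<rightarrow> rates p" for z
      by (rule ratesD(1)[OF funcset_mem[OF \<Phi>_rates[OF that] j]])
    have eq: "cell_integral (cut S (\<Phi> z) j) n k = cell_integral (cut {0..real N} (\<Phi> (RA N z)) j) n k"
      if "z \<in> A \<rightarrow> rates p" "{0..real N} \<subseteq> S" "S \<in> sets lebesgue" for z S
    proof -
      have "cell_integral (cut S (\<Phi> z) j) n k = cell_integral (restr N (\<Phi> (RA N z) j)) n k"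
        unfolding cell_integral_def
      proof (rule integral_cong_AE)
        note [measurable] = \<Phi>m[OF that(1)] \<Phi>m[OF A_rates_until[OF RA_r[OF that(1)]], of N] that(3)
        show "(\<lambda>t. indicator (dyad n k) t * cut S (\<Phi> z) j t) \<in> borel_measurable lebesgue" unfolding cut_def by measurable
        show "(\<lambda>t. indicator (dyad n k) t * restr N (\<Phi> (RA N z) j) t) \<in> borel_measurable lebesgue" unfolding restr_def by measurable
        show "AE t in lebesgue. indicator (dyad n k) t * cut S (\<Phi> z) j t = indicator (dyad n k) t * restr N (\<Phi> (RA N z) j) t"
          using \<Phi>R[OF that(1) j, of N]
        proof eventually_elim
          fix t assume *: "0 \<le> t \<longrightarrow> t < real N \<longrightarrow> \<Phi> z j t = \<Phi> (RA N z) j t"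
          show "indicator (dyad n k) t * cut S (\<Phi> z) j t = indicator (dyad n k) t * restr N (\<Phi> (RA N z) j) t"
          proof (cases "t \<in> dyad n k")
            case True
            hence "0 \<le> t" "t < real N" "t \<in> S" using sub that(2) by (auto simp: subset_iff)
            thus ?thesis using * by (simp add: cut_def restr_def)
          qed simp
        qed
      qed
      also have "\<dots> = cell_integral (cut {0..real N} (\<Phi> (RA N z)) j) n k"
        unfolding cell_integral_def using sub
        by (intro Bochner_Integration.integral_cong refl) (auto simp: restr_def cut_def indicator_def subset_iff)
      finally show ?thesis .
    qed
    have "(\<lambda>m. cell_integral (cut {0..real N} (\<Phi> (RA N (x m))) j) n k) \<longlonglongrightarrow> cell_integral (cut (before \<infinity>) (\<Phi> x') j) n k"
    proof -
      have "cell_integral (cut (before \<infinity>) (\<Phi> x') j) n k = cell_integral (cut {0..real N} (\<Phi> (RA N x')) j) n k"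
        by (rule eq[OF xr(2)]) (auto simp: before_def)
      thus ?thesis using w unfolding wconv_def by simp
    qed
    \<comment> \<open>Once \<open>\<sigma> m\<close> exceeds \<open>N\<close>, cutting the loading
      at \<open>\<sigma> m\<close> does not affect the cell, and causality allows the inflow to be
      cut at \<open>N\<close>.\<close>
    moreover have "\<forall>\<^sub>F m in sequentially. cell_integral (cut {0..real N} (\<Phi> (RA N (x m))) j) n k = cell_integral (cut {0..real (\<sigma> m)} (\<Phi> (x m)) j) n k"
    proof (rule eventually_sequentiallyI[of N])
      fix m assume "N \<le> m"
      hence "N \<le> \<sigma> m" using strict_mono_imp_increasing[OF \<sigma>, of m] by simp
      thus "cell_integral (cut {0..real N} (\<Phi> (RA N (x m))) j) n k = cell_integral (cut {0..real (\<sigma> m)} (\<Phi> (x m)) j) n k"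
        by (intro eq[symmetric] xr) auto
    qed
    ultimately show "(\<lambda>m. cell_integral (cut {0..real (\<sigma> m)} (\<Phi> (x m)) j) n k) \<longlonglongrightarrow> cell_integral (cut (before \<infinity>) (\<Phi> x') j) n k"
      by (rule Lim_transform_eventually)
  qed
  show "AE \<theta> in lebesgue. 0 \<le> \<theta> \<longrightarrow> ereal \<theta> < \<infinity> \<longrightarrow> (AE C in \<mu> i. \<forall>q\<in>simple_paths G. (\<lambda>m. C \<theta> (F m) q) \<longlonglongrightarrow> C \<theta> f q)"
    if F: "\<And>m. F m \<in> flows_until p G I (ereal (real (\<sigma> m)))" "f \<in> flows_until p G I \<infinity>"
      and Fw: "\<And>j. j \<in> flow_index G I \<Longrightarrow> loc_bounded p (\<lambda>m. F m j)" "\<And>j. j \<in> flow_index G I \<Longrightarrow> wconv (\<lambda>m. F m j) (f j)"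
      and i: "i \<in> I" for \<sigma> F f i
  proof -
    define RF where "RF N h = (\<lambda>j \<theta>. indicator (before (ereal (real N))) \<theta> * h j \<theta>)" for N and h :: "('e \<times> 'i \<times> sign) vec"
    have Fr: "F m \<in> flows p G I" "f \<in> flows p G I" for m
      using F rates_untilD(1) unfolding flows_until_def flows_def by blast+
    have fL: "loc_Lp p (f j)" if "j \<in> flow_index G I" for j using Fr(2) that p by (intro rates_loc_Lp) (auto simp: flows_def)
    have RF_r: "RF N h \<in> flows_until p G I (ereal (real N))" if "h \<in> flows p G I" for N h
      using that unfolding RF_def flows_until_def flows_def by (intro Pi_I rates_until_cut[OF p]) auto
    have RF_f: "RF N h \<in> flows p G I" if "h \<in> flows p G I" for N h
      using RF_r[OF that, of N] rates_untilD(1) unfolding flows_until_def flows_def by blast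
    have RF_c: "coincide_until (flow_index G I) (ereal (real N)) h (RF N h)" for N h
      unfolding coincide_until_iff by (auto simp: RF_def before_def intro!: AE_I2)
    have "AE \<theta> in lebesgue. 0 \<le> \<theta> \<longrightarrow> \<theta> < real N \<longrightarrow> (AE C in \<mu> i. \<forall>q\<in>simple_paths G. (\<lambda>m. C \<theta> (F m) q) \<longlonglongrightarrow> C \<theta> f q)" for N
    proof -
      have "AE \<theta> in lebesgue. \<theta> < real N \<longrightarrow> (AE C in \<mu> i. \<forall>q\<in>simple_paths G. (\<lambda>m. C \<theta> (RF N (F m)) q) \<longlonglongrightarrow> C \<theta> (RF N f) q)"
      proof (rule costs_tendsto[OF _ cont i RF_r[OF Fr(1)] RF_r[OF Fr(2)]])
        fix j assume j: "j \<in> flow_index G I"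
        show "loc_bounded p (\<lambda>m. RF N (F m) j)"
          unfolding RF_def by (rule loc_bounded_mult[where c=1, OF p Fw(1)[OF j]]) (auto simp: indicator_def)
        show "wconv (\<lambda>m. RF N (F m) j) (RF N f j)"
          unfolding RF_def by (rule wconv_mult[where c=1, OF p Fw(1)[OF j] fL[OF j] Fw(2)[OF j]]) (auto simp: indicator_def)
      qed auto
      moreover have "AE \<theta> in lebesgue. \<forall>m. 0 \<le> \<theta> \<longrightarrow> \<theta> < real N \<longrightarrow> (AE C in \<mu> i. \<forall>q\<in>simple_paths G. C \<theta> (F m) q = C \<theta> (RF N (F m)) q)"
        unfolding AE_all_countable
        by (intro allI causal_costs_eq[OF C_causal[OF i] i _ Fr(1) RF_f[OF Fr(1)] RF_c]) simp
      moreover have "AE \<theta> in lebesgue. 0 \<le> \<theta> \<longrightarrow> \<theta> < real N \<longrightarrow> (AE C in \<mu> i. \<forall>q\<in>simple_paths G. C \<theta> f q = C \<theta> (RF N f) q)"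
        by (intro causal_costs_eq[OF C_causal[OF i] i _ Fr(2) RF_f[OF Fr(2)] RF_c]) simp
      ultimately show ?thesis
      proof eventually_elim
        fix \<theta>
        assume *: "\<theta> < real N \<longrightarrow> (AE C in \<mu> i. \<forall>q\<in>simple_paths G. (\<lambda>m. C \<theta> (RF N (F m)) q) \<longlonglongrightarrow> C \<theta> (RF N f) q)"
          "\<forall>m. 0 \<le> \<theta> \<longrightarrow> \<theta> < real N \<longrightarrow> (AE C in \<mu> i. \<forall>q\<in>simple_paths G. C \<theta> (F m) q = C \<theta> (RF N (F m)) q)"
          "0 \<le> \<theta> \<longrightarrow> \<theta> < real N \<longrightarrow> (AE C in \<mu> i. \<forall>q\<in>simple_paths G. C \<theta> f q = C \<theta> (RF N f) q)"
        show "0 \<le> \<theta> \<longrightarrow> \<theta> < real N \<longrightarrow> (AE C in \<mu> i. \<forall>q\<in>simple_paths G. (\<lambda>m. C \<theta> (F m) q) \<longlonglongrightarrow> C \<theta> f q)"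
        proof (intro impI)
          assume t: "0 \<le> \<theta>" "\<theta> < real N"
          have 1: "AE C in \<mu> i. \<forall>q\<in>simple_paths G. (\<lambda>m. C \<theta> (RF N (F m)) q) \<longlonglongrightarrow> C \<theta> (RF N f) q" using *(1) t by blast
          have 2: "AE C in \<mu> i. \<forall>m. \<forall>q\<in>simple_paths G. C \<theta> (F m) q = C \<theta> (RF N (F m)) q"
            unfolding AE_all_countable using *(2) t by blast
          have 3: "AE C in \<mu> i. \<forall>q\<in>simple_paths G. C \<theta> f q = C \<theta> (RF N f) q" using *(3) t by blast
          from 1 2 3 show "AE C in \<mu> i. \<forall>q\<in>simple_paths G. (\<lambda>m. C \<theta> (F m) q) \<longlonglongrightarrow> C \<theta> f q"
            by eventually_elim simp
        qed
      qed
    qed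
    hence "AE \<theta> in lebesgue. \<forall>N. 0 \<le> \<theta> \<longrightarrow> \<theta> < real N \<longrightarrow> (AE C in \<mu> i. \<forall>q\<in>simple_paths G. (\<lambda>m. C \<theta> (F m) q) \<longlonglongrightarrow> C \<theta> f q)"
      unfolding AE_all_countable by blast
    thus ?thesis
    proof eventually_elim
      fix \<theta> assume *: "\<forall>N. 0 \<le> \<theta> \<longrightarrow> \<theta> < real N \<longrightarrow> (AE C in \<mu> i. \<forall>q\<in>simple_paths G. (\<lambda>m. C \<theta> (F m) q) \<longlonglongrightarrow> C \<theta> f q)"
      obtain N :: nat where "\<theta> < real N" using reals_Archimedean2 by blast
      thus "0 \<le> \<theta> \<longrightarrow> ereal \<theta> < \<infinity> \<longrightarrow> (AE C in \<mu> i. \<forall>q\<in>simple_paths G. (\<lambda>m. C \<theta> (F m) q) \<longlonglongrightarrow> C \<theta> f q)"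
        using * by blast
    qed
  qed
  show "AE \<theta> in lebesgue. 0 \<le> \<theta> \<longrightarrow> (\<lambda>m. indicator (before (ereal (real m))) \<theta> :: real) \<longlonglongrightarrow> indicator (before \<infinity>) \<theta>"
  proof (intro AE_I2 impI)
    fix \<theta> :: real assume t: "0 \<le> \<theta>"
    obtain N :: nat where N: "\<theta> < real N" using reals_Archimedean2 by blast
    show "(\<lambda>m. indicator (before (ereal (real m))) \<theta> :: real) \<longlonglongrightarrow> indicator (before \<infinity>) \<theta>"
    proof (intro tendsto_eventually eventually_sequentiallyI[of N])
      fix m assume "N \<le> m"
      hence "\<theta> < real m" using N by linarith
      thus "indicator (before (ereal (real m))) \<theta> = (indicator (before \<infinity>) \<theta> :: real)" using t by (simp add: before_def)
    qed
  qed
qed (simp_all add: cont)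

end

section \<open>Unique equilibria\<close>

text \<open>Supremum distance at most \<open>\<delta>\<close> on \<open>[0, T)\<close>, phrased as a
  bound almost everywhere so that unbounded functions require no infinite norms. The case
  \<open>\<delta> = 0\<close> is coincidence until \<open>T\<close>.\<close>

definition close_until :: "'j set \<Rightarrow> real \<Rightarrow> real \<Rightarrow> 'j vec \<Rightarrow> 'j vec \<Rightarrow> bool" where
  "close_until J T \<delta> f g \<longleftrightarrow> (\<forall>j\<in>J. AE t in lebesgue. 0 \<le> t \<longrightarrow> t < T \<longrightarrow> \<bar>f j t - g j t\<bar> \<le> \<delta>)"

lemma close_until_iff_coincide: "close_until J T 0 f g \<longleftrightarrow> coincide_until J (ereal T) f g"
  unfolding close_until_def coincide_until_iff by (intro ball_cong refl AE_cong) auto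

lemma rates_until_mono: "f \<in> rates_until p S \<Longrightarrow> S \<le> T \<Longrightarrow> f \<in> rates_until p T"
  by (auto simp: rates_until_def before_def)

section \<open>Stability of optimal edges under cost perturbations\<close>

lemma prob_abs_le:
  assumes "prob_space M" "distributed M lborel Z h" "\<And>x. h x \<le> ennreal B" "0 \<le> B" "0 \<le> r"
  shows "measure M {C \<in> space M. \<bar>Z C\<bar> \<le> r} \<le> 2 * r * B"
proof -
  interpret prob_space M by fact
  have "{C \<in> space M. \<bar>Z C\<bar> \<le> r} = Z -` {-r..r} \<inter> space M" by (auto simp: abs_le_iff)
  hence "emeasure M {C \<in> space M. \<bar>Z C\<bar> \<le> r} = (\<integral>\<^sup>+x. h x * indicator {-r..r} x \<partial>lborel)"
    using distributed_emeasure[OF assms(2), of "{-r..r}"] by simp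
  also have "\<dots> \<le> (\<integral>\<^sup>+x. ennreal B * indicator {-r..r} x \<partial>lborel)"
    by (intro nn_integral_mono mult_right_mono assms(3)) simp
  also have "\<dots> = ennreal (2 * r * B)"
    using assms(4,5) by (simp add: nn_integral_cmult_indicator ennreal_mult[symmetric] mult.commute)
  finally show ?thesis using assms(4,5) by (simp add: emeasure_eq_measure)
qed

context network
begin

text \<open>Each cost moves by at most \<open>\<eta>\<close>, so gaps above
  \<open>2 * \<eta>\<close> keep their sign and the order of the paths by cost is unchanged.\<close>

lemma best_cong_if_separated:
  assumes close: "\<And>q. q \<in> paths v i \<Longrightarrow> \<bar>c q - c' q\<bar> \<le> \<eta>"
    and sep: "\<And>q q'. q \<in> paths v i \<Longrightarrow> q' \<in> paths v i \<Longrightarrow> q \<noteq> q' \<Longrightarrow> 2 * \<eta> < \<bar>c q - c q'\<bar>"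
  shows "best v i c = best v i c'"
proof -
  have le: "c' q \<le> c' q' \<longleftrightarrow> c q \<le> c q'" if "q \<in> paths v i" "q' \<in> paths v i" for q q'
  proof (cases "q = q'")
    case False
    thus ?thesis using close[OF that(1)] close[OF that(2)] sep[OF that False] by linarith
  qed simp
  show ?thesis unfolding best_def using le by blast
qed

lemma best_singleton_if_separated:
  assumes "\<And>q q'. q \<in> paths v i \<Longrightarrow> q' \<in> paths v i \<Longrightarrow> q \<noteq> q' \<Longrightarrow> c q \<noteq> c q'"
  shows "card (best v i c) \<le> 1"
proof -
  have "e = e'" if "e \<in> best v i c" "e' \<in> best v i c" for e e'
    using that assms unfolding best_def by (auto, metis order_antisym)
  moreover have "finite (best v i c)" by (rule finite_subset[OF best_subset finite_out])
  ultimately show ?thesis by (subst One_nat_def, subst card_le_Suc0_iff_eq) blast+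
qed

text \<open>The two events agree outside \<open>E\<close> up to a null set, so each is contained in
  the union of the other with \<open>E\<close> up to a null set.\<close>

lemma choice_prob_diff_le:
  assumes i: "i \<in> I" and v: "v \<in> verts G" and f: "f \<in> flows p G I" and g: "g \<in> flows p G I"
    and E: "E \<in> sets (\<mu> i)" "AE C in \<mu> i. C \<notin> E \<longrightarrow> best v i (C \<theta> f) = best v i (C \<theta> g)"
  shows "\<bar>choice_prob G d \<mu> v M i \<theta> f - choice_prob G d \<mu> v M i \<theta> g\<bar> \<le> measure (\<mu> i) E"
proof -
  interpret prob_space "\<mu> i" by (rule prob_space_\<mu>[OF i])
  define Q where "Q h = {C \<in> space (\<mu> i). best v i (C \<theta> h) = M}" for h
  have Q: "Q h \<in> sets (\<mu> i)" if "h \<in> flows p G I" for h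
    unfolding Q_def by (rule pred_sections[OF best_measurable[OF i v that]])
  have le: "measure (\<mu> i) (Q h) \<le> measure (\<mu> i) (Q k) + measure (\<mu> i) E"
    if "h \<in> flows p G I" "k \<in> flows p G I" "AE C in \<mu> i. C \<notin> E \<longrightarrow> best v i (C \<theta> h) = best v i (C \<theta> k)" for h k
  proof -
    have "AE C in \<mu> i. C \<in> Q h \<longrightarrow> C \<in> Q k \<union> E" using that(3) by eventually_elim (auto simp: Q_def)
    hence "measure (\<mu> i) (Q h) \<le> measure (\<mu> i) (Q k \<union> E)"
      by (intro finite_measure_mono_AE sets.Un Q that E(1))
    also have "\<dots> \<le> measure (\<mu> i) (Q k) + measure (\<mu> i) E" by (intro measure_Un_le Q that E(1))
    finally show ?thesis .
  qed
  have "AE C in \<mu> i. C \<notin> E \<longrightarrow> best v i (C \<theta> g) = best v i (C \<theta> f)" using E(2) by eventually_elim simp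
  from le[OF f g E(2)] le[OF g f this] show ?thesis unfolding choice_prob_best Q_def by linarith
qed

definition single_prob :: "('e \<times> 'i \<times> sign) vec \<Rightarrow> ('e \<times> 'i) vec" where
  "single_prob f = (\<lambda>(e, i) \<theta>. choice_prob G d \<mu> (tail G e) {e} i \<theta> f)"

lemma single_prob_measurable: "f \<in> flows p G I \<Longrightarrow> j \<in> A \<Longrightarrow> single_prob f j \<in> borel_measurable lebesgue"
  unfolding single_prob_def by (auto simp: case_prod_beta intro!: choice_prob_measurable)

lemma single_prob_bounds: "j \<in> A \<Longrightarrow> 0 \<le> single_prob f j \<theta> \<and> single_prob f j \<theta> \<le> 1"
  unfolding single_prob_def using choice_prob_bounds by (auto simp: case_prod_beta)

text \<open>With no ties, equilibria are determined by their edge inflow rates, which are the fixed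
  points of this operator.\<close>

definition rerouted :: "('e \<times> 'i) vec \<Rightarrow> ('e \<times> 'i) vec" where
  "rerouted x = (\<lambda>(e, i) \<theta>. single_prob (join x (\<Phi> x)) (e, i) \<theta> * inflow (\<Phi> x) (tail G e, i) \<theta>)"

lemma inflow_rates:
  assumes "v \<in> verts G" "i \<in> I" "y \<in> A \<rightarrow> rates p"
  shows "inflow y (v, i) \<in> rates p"
proof (rule rates_if_loc_Lp)
  show "0 < p" using p by simp
  show "loc_Lp p (inflow y (v, i))" by (rule inflow_loc_Lp[OF assms(1,2) A_rates_loc_Lp[OF assms(3)]])
  have "AE \<theta> in lebesgue. 0 \<le> inflow y (v, i) \<theta>"
    by (rule inflow_nonneg[OF assms(1,2) ratesD(2)[OF funcset_mem[OF assms(3)]]])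
  thus "AE \<theta> in lebesgue. 0 \<le> \<theta> \<longrightarrow> 0 \<le> inflow y (v, i) \<theta>" by eventually_elim simp
  show "AE \<theta> in lebesgue. \<theta> < 0 \<longrightarrow> inflow y (v, i) \<theta> = 0" by (rule inflow_before_0[OF assms])
qed

lemma join_loading_flows: "x \<in> A \<rightarrow> rates p \<Longrightarrow> join x (\<Phi> x) \<in> flows p G I"
  using \<Phi>_rates by (simp add: join_flows)

lemma rerouted_rates:
  assumes x: "x \<in> A \<rightarrow> rates p"
  shows "rerouted x \<in> A \<rightarrow> rates p"
proof
  fix j assume j: "j \<in> A"
  obtain e i where ei: "j = (e, i)" "e \<in> arcs G" "i \<in> I" using j by auto
  have "(\<lambda>\<theta>. single_prob (join x (\<Phi> x)) (e, i) \<theta> * inflow (\<Phi> x) (tail G e, i) \<theta>) \<in> rates p"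
    using single_prob_bounds j ei
    by (intro rates_mult[where c=1, OF p] inflow_rates tail_in_verts \<Phi>_rates x single_prob_measurable join_loading_flows) auto
  thus "rerouted x j \<in> rates p" by (simp add: rerouted_def ei)
qed

lemma close_join:
  "close_until A T \<delta> x x' \<Longrightarrow> close_until A T \<delta> y y' \<Longrightarrow> close_until (flow_index G I) T \<delta> (join x y) (join x' y')"
  unfolding close_until_def flow_index_def join_def by (fastforce simp: UNIV_sign)

definition cost_gap :: "'i \<Rightarrow> ('e \<times> 'i \<times> sign) vec \<Rightarrow> 'e list \<Rightarrow> 'e list \<Rightarrow> real \<Rightarrow> real \<Rightarrow> ('e, 'i) predictor set" where
  "cost_gap i f q q' \<theta> r = {C \<in> space (\<mu> i). \<bar>C \<theta> f q - C \<theta> f q'\<bar> \<le> r}"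

end

locale regular_network = network p G I d u \<Phi> \<mu>
  for p :: real
    and G :: "('v, 'e) pre_digraph"
    and I :: "'i set"
    and d :: "'i \<Rightarrow> 'v"
    and u :: "('v \<times> 'i) vec"
    and \<Phi> :: "('e \<times> 'i) vec \<Rightarrow> ('e \<times> 'i) vec"
    and \<mu> :: "'i \<Rightarrow> ('e, 'i) predictor measure" +
  assumes strictly_causal: "uniformly_strictly_causal_loading p G I \<Phi>"
    and ess_bounded: "essentially_bounded_loading p G I \<Phi>"
    and u_bounded: "\<And>j. j \<in> verts G \<times> I \<Longrightarrow> locally_essentially_bounded (u j)"
    and causal: "\<And>i. i \<in> I \<Longrightarrow> AE C in \<mu> i. causal_predictor p G I C"
    and densities: "bounded_cost_densities p G I \<mu>"
    and Lipschitz: "locally_Lipschitz_predictors p G I \<mu>"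
begin

text \<open>The threshold \<open>r\<close> is quantified inside \<open>AE\<close>: the exceptional
  times stem from the density alone, so one null set serves all thresholds.\<close>

lemma cost_gap_prob:
  "\<exists>B>0. \<forall>f\<in>flows p G I. \<forall>q\<in>simple_paths G. \<forall>q'\<in>simple_paths G. \<forall>i\<in>I. q \<noteq> q' \<longrightarrow>
    (AE \<theta> in lebesgue. \<forall>r\<ge>0. cost_gap i f q q' \<theta> r \<in> sets (\<mu> i) \<and>
      measure (\<mu> i) (cost_gap i f q q' \<theta> r) \<le> 2 * r * B)"
proof -
  obtain B where B: "0 < B" and dens: "\<And>q q' f. q \<in> simple_paths G \<Longrightarrow> q' \<in> simple_paths G \<Longrightarrow> q \<noteq> q' \<Longrightarrow> f \<in> flows p G I \<Longrightarrow>
      AE \<theta> in lebesgue. \<forall>i\<in>I. \<exists>h. distributed (\<mu> i) lborel (\<lambda>C. C \<theta> f q - C \<theta> f q') h \<and> (\<forall>x. h x \<le> ennreal B)"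
    using densities unfolding bounded_cost_densities_def by blast
  show ?thesis
  proof (intro exI[of _ B] conjI B ballI impI)
    fix f q q' i assume *: "f \<in> flows p G I" "q \<in> simple_paths G" "q' \<in> simple_paths G" and i: "i \<in> I" and ne: "q \<noteq> q'"
    show "AE \<theta> in lebesgue. \<forall>r\<ge>0. cost_gap i f q q' \<theta> r \<in> sets (\<mu> i) \<and>
        measure (\<mu> i) (cost_gap i f q q' \<theta> r) \<le> 2 * r * B"
      using dens[OF *(2,3) ne *(1)]
    proof eventually_elim
      fix \<theta> assume "\<forall>i\<in>I. \<exists>h. distributed (\<mu> i) lborel (\<lambda>C. C \<theta> f q - C \<theta> f q') h \<and> (\<forall>x. h x \<le> ennreal B)"
      then obtain h where h: "distributed (\<mu> i) lborel (\<lambda>C. C \<theta> f q - C \<theta> f q') h" "\<And>x. h x \<le> ennreal B" using i by blast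
      have [measurable]: "(\<lambda>C. C \<theta> f q - C \<theta> f q') \<in> borel_measurable (\<mu> i)"
        using distributed_measurable[OF h(1)] by simp
      show "\<forall>r\<ge>0. cost_gap i f q q' \<theta> r \<in> sets (\<mu> i) \<and>
          measure (\<mu> i) (cost_gap i f q q' \<theta> r) \<le> 2 * r * B"
        unfolding cost_gap_def using prob_abs_le[OF prob_space_\<mu>[OF i] h] B by auto
    qed
  qed
qed

text \<open>At \<open>r = 0\<close> the density bound gives probability 0 to equal costs of two
  distinct paths. There are finitely many pairs of paths, and with distinct costs at most one edge
  starts an optimal path.\<close>

lemma ties_null:
  assumes f: "f \<in> flows p G I" and i: "i \<in> I" and v: "v \<in> verts G"
  shows "AE \<theta> in lebesgue. AE C in \<mu> i. card (best v i (C \<theta> f)) \<le> 1"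
proof -
  interpret prob_space "\<mu> i" by (rule prob_space_\<mu>[OF i])
  obtain B where B: "0 < B" "\<forall>f\<in>flows p G I. \<forall>q\<in>simple_paths G. \<forall>q'\<in>simple_paths G. \<forall>i\<in>I. q \<noteq> q' \<longrightarrow>
    (AE \<theta> in lebesgue. \<forall>r\<ge>0. cost_gap i f q q' \<theta> r \<in> sets (\<mu> i) \<and>
      measure (\<mu> i) (cost_gap i f q q' \<theta> r) \<le> 2 * r * B)"
    using cost_gap_prob by (elim exE conjE)
  define D where "D = {(q, q'). q \<in> paths v i \<and> q' \<in> paths v i \<and> q \<noteq> q'}"
  have D: "finite D" by (rule finite_subset[of _ "paths v i \<times> paths v i"]) (auto simp: D_def finite_paths)
  have "AE \<theta> in lebesgue. \<forall>z\<in>D. \<forall>r\<ge>0. cost_gap i f (fst z) (snd z) \<theta> r \<in> sets (\<mu> i) \<and>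
      measure (\<mu> i) (cost_gap i f (fst z) (snd z) \<theta> r) \<le> 2 * r * B"
    by (intro AE_finite_allI[OF D] B(2)[rule_format, OF f _ _ i]) (auto simp: D_def path_simple v i)
  thus ?thesis
  proof eventually_elim
    fix \<theta> :: real assume *: "\<forall>z\<in>D. \<forall>r\<ge>0. cost_gap i f (fst z) (snd z) \<theta> r \<in> sets (\<mu> i) \<and>
      measure (\<mu> i) (cost_gap i f (fst z) (snd z) \<theta> r) \<le> 2 * r * B"
    have "AE C in \<mu> i. \<forall>z\<in>D. C \<theta> f (fst z) \<noteq> C \<theta> f (snd z)"
    proof (intro AE_finite_allI[OF D])
      fix z assume "z \<in> D"
      hence "cost_gap i f (fst z) (snd z) \<theta> 0 \<in> null_sets (\<mu> i)"
        using bspec[OF *, rule_format, of z 0] by (simp add: null_sets_def emeasure_eq_measure measure_le_0_iff)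
      hence "AE C in \<mu> i. C \<notin> cost_gap i f (fst z) (snd z) \<theta> 0" by (rule AE_not_in)
      thus "AE C in \<mu> i. C \<theta> f (fst z) \<noteq> C \<theta> f (snd z)" using AE_space by eventually_elim (auto simp: cost_gap_def)
    qed
    thus "AE C in \<mu> i. card (best v i (C \<theta> f)) \<le> 1"
    proof eventually_elim
      fix C :: "('e, 'i) predictor" assume "\<forall>z\<in>D. C \<theta> f (fst z) \<noteq> C \<theta> f (snd z)"
      thus "card (best v i (C \<theta> f)) \<le> 1" by (intro best_singleton_if_separated) (auto simp: D_def)
    qed
  qed
qed

text \<open>A set with several edges is a tie, and the empty set is impossible away from the
  destination. The side condition spares the empty set at the destination, where it may carry
  probability.\<close>

lemma choice_prob_0:
  assumes f: "f \<in> flows p G I" and i: "i \<in> I" and v: "v \<in> verts G"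
  shows "AE \<theta> in lebesgue. \<forall>M. card M \<noteq> 1 \<longrightarrow> v \<noteq> d i \<or> M \<noteq> {} \<longrightarrow> choice_prob G d \<mu> v M i \<theta> f = 0"
  using ties_null[OF assms]
proof eventually_elim
  fix \<theta> assume *: "AE C in \<mu> i. card (best v i (C \<theta> f)) \<le> 1"
  interpret prob_space "\<mu> i" by (rule prob_space_\<mu>[OF i])
  show "\<forall>M. card M \<noteq> 1 \<longrightarrow> v \<noteq> d i \<or> M \<noteq> {} \<longrightarrow> choice_prob G d \<mu> v M i \<theta> f = 0"
  proof (intro allI impI)
    fix M :: "'e set" assume M: "card M \<noteq> 1" "v \<noteq> d i \<or> M \<noteq> {}"
    have ne: "best v i (C \<theta> f) \<noteq> M" if c: "card (best v i (C \<theta> f)) \<le> 1" for C :: "('e, 'i) predictor"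
    proof
      assume eq: "best v i (C \<theta> f) = M"
      have fin: "finite M" using eq finite_subset[OF best_subset finite_out] by blast
      have "card M = 0" using M(1) c eq by simp
      hence "M = {}" using fin by simp
      thus False using M(2) best_nonempty[OF v i] eq by blast
    qed
    have "AE C in \<mu> i. C \<in> {C \<in> space (\<mu> i). best v i (C \<theta> f) = M} \<longrightarrow> C \<in> {}"
      using * by eventually_elim (use ne in blast)
    hence "measure (\<mu> i) {C \<in> space (\<mu> i). best v i (C \<theta> f) = M} \<le> measure (\<mu> i) {}"
      by (intro finite_measure_mono_AE) auto
    thus "choice_prob G d \<mu> v M i \<theta> f = 0" unfolding choice_prob_best by (simp add: measure_le_0_iff)
  qed
qed

lemma sum_single_prob:
  assumes f: "f \<in> flows p G I" and i: "i \<in> I" and v: "v \<in> verts G" "v \<noteq> d i"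
  shows "AE \<theta> in lebesgue. (\<Sum>e\<in>out_arcs G v. single_prob f (e, i) \<theta>) = 1"
proof (rule eventually_mono[OF choice_prob_0[OF f i v(1)]])
  fix \<theta> :: real assume *: "\<forall>M. card M \<noteq> 1 \<longrightarrow> v \<noteq> d i \<or> M \<noteq> {} \<longrightarrow> choice_prob G d \<mu> v M i \<theta> f = 0"
  have 1: "(\<Sum>e\<in>out_arcs G v. single_prob f (e, i) \<theta>) = (\<Sum>e\<in>out_arcs G v. choice_prob G d \<mu> v {e} i \<theta> f)"
    by (intro sum.cong refl) (auto simp: single_prob_def)
  have 2: "(\<Sum>e\<in>out_arcs G v. choice_prob G d \<mu> v {e} i \<theta> f) = (\<Sum>M\<in>(\<lambda>e. {e}) ` out_arcs G v. choice_prob G d \<mu> v M i \<theta> f)"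
    by (subst sum.reindex) (auto simp: inj_on_def)
  \<comment> \<open>Away from the destination only singletons carry probability, so the sum over all
    subsets reduces to them.\<close>
  have 3: "(\<Sum>M\<in>(\<lambda>e. {e}) ` out_arcs G v. choice_prob G d \<mu> v M i \<theta> f) = (\<Sum>M\<in>Pow (out_arcs G v). choice_prob G d \<mu> v M i \<theta> f)"
  proof (intro sum.mono_neutral_left ballI)
    show "finite (Pow (out_arcs G v))" by (rule finite_Pow_iff[THEN iffD2, OF finite_out])
    show "(\<lambda>e. {e}) ` out_arcs G v \<subseteq> Pow (out_arcs G v)" by (rule image_subsetI) simp
    fix M assume "M \<in> Pow (out_arcs G v) - (\<lambda>e. {e}) ` out_arcs G v"
    hence ne: "M \<noteq> {e}" for e by (auto simp del: in_out_arcs_conv)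
    have "card M \<noteq> 1"
    proof
      assume "card M = 1"
      then obtain e where "M = {e}" by (rule card_1_singletonE)
      thus False using ne by contradiction
    qed
    thus "choice_prob G d \<mu> v M i \<theta> f = 0" by (intro *[rule_format] disjI1 v(2))
  qed
  show "(\<Sum>e\<in>out_arcs G v. single_prob f (e, i) \<theta>) = 1"
    by (rule trans[OF 1 trans[OF 2 trans[OF 3 sum_choice_prob[OF i v(1) f]]]])
qed

end

section \<open>Uniform bounds and the contraction estimate\<close>

lemma close_untilD: "close_until J T \<delta> f g \<Longrightarrow> j \<in> J \<Longrightarrow> AE t in lebesgue. 0 \<le> t \<longrightarrow> t < T \<longrightarrow> \<bar>f j t - g j t\<bar> \<le> \<delta>"
  by (simp add: close_until_def)

lemma coincide_untilD: "coincide_until J T f g \<Longrightarrow> j \<in> J \<Longrightarrow> AE t in lebesgue. 0 \<le> t \<longrightarrow> ereal t < T \<longrightarrow> f j t = g j t"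
  by (simp add: coincide_until_iff)

lemma Linf_norm_le_AE:
  assumes "Linf_norm f \<le> ereal K"
  shows "AE t in lebesgue. \<bar>f t\<bar> \<le> K"
proof -
  have "AE t in lebesgue. ereal \<bar>f t\<bar> \<le> Linf_norm f" unfolding Linf_norm_def by (rule esssup_AE)
  thus ?thesis by eventually_elim (use assms order_trans in fastforce)
qed

text \<open>The difference lives on an interval of length \<open>\<beta>\<close> and is bounded by
  \<open>\<delta>\<close> there. This is the origin of the small factor \<open>\<beta>\<close> in
  the contraction, and the reason why the Lipschitz condition is posed in the L^1 norm.\<close>

lemma vec_norm_1_cut_le:
  assumes J: "finite J" and f: "f \<in> J \<rightarrow> rates p" and g: "g \<in> J \<rightarrow> rates p" and "0 \<le> T" "0 \<le> \<beta>" "0 \<le> \<delta>"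
    and eq: "close_until J T 0 f g" and close: "close_until J (T + \<beta>) \<delta> f g"
  shows "vec_norm 1 J (\<lambda>j t. indicator (before (ereal (T + \<beta>))) t * f j t - indicator (before (ereal (T + \<beta>))) t * g j t) \<le> \<beta> * \<delta>"
proof (rule vec_norm_le[OF J])
  fix j assume j: "j \<in> J"
  define h where "h t = indicator (before (ereal (T + \<beta>))) t * f j t - indicator (before (ereal (T + \<beta>))) t * g j t" for t
  have [measurable]: "f j \<in> borel_measurable lebesgue" "g j \<in> borel_measurable lebesgue"
    by (rule ratesD(1)[OF funcset_mem[OF f j]], rule ratesD(1)[OF funcset_mem[OF g j]])
  have hm: "h \<in> borel_measurable lebesgue" unfolding h_def by measurable
  have "AE t in lebesgue. \<bar>h t\<bar> \<le> \<delta> * indicator {T..T + \<beta>} t"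
    using close_untilD[OF eq j] close_untilD[OF close j]
    by eventually_elim (use assms(6) in \<open>auto simp: h_def before_def indicator_def\<close>)
  hence "(LINT t|lebesgue. \<bar>h t\<bar>) \<le> (LINT t|lebesgue. \<delta> * indicator {T..T + \<beta>} t)"
    using hm by (intro integral_mono_AE' integrable_mult_right integrable_real_indicator) (auto simp: emeasure_lborel_Icc_eq assms(5))
  also have "\<dots> = \<beta> * \<delta>" using assms(5) by simp
  finally have "(LINT t|lebesgue. \<bar>h t\<bar>) \<le> \<beta> * \<delta>" .
  moreover have "0 \<le> (LINT t|lebesgue. \<bar>h t\<bar>)" by simp
  ultimately have "Lp_norm 1 h \<le> \<beta> * \<delta>" by (simp add: Lp_norm_def)
  thus "Lp_norm 1 (\<lambda>t. indicator (before (ereal (T + \<beta>))) t * f j t - indicator (before (ereal (T + \<beta>))) t * g j t) \<le> \<beta> * \<delta>"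
    unfolding h_def .
qed (simp add: assms)

context regular_network
begin

lemma loading_ess_bound:
  assumes "0 \<le> N"
  obtains K where "0 \<le> K" "\<And>x j. x \<in> A \<rightarrow> rates p \<Longrightarrow> j \<in> A \<Longrightarrow>
    AE \<theta> in lebesgue. 0 \<le> \<theta> \<longrightarrow> \<theta> \<le> N \<longrightarrow> \<bar>\<Phi> x j \<theta>\<bar> \<le> K"
proof -
  define S where "S = (SUP f \<in> A \<rightarrow> rates p. SUP j \<in> A. Linf_norm (cut {0..N} (\<Phi> f) j))"
  have "S < \<infinity>" using ess_bounded assms unfolding essentially_bounded_loading_def S_def by blast
  then obtain n :: nat where n: "S < ereal (real n)" using less_PInf_Ex_of_nat[of S] by auto
  show ?thesis
  proof (rule that[of "real n"])
    fix x j assume x: "x \<in> A \<rightarrow> rates p" and j: "j \<in> A"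
    have "Linf_norm (cut {0..N} (\<Phi> x) j) \<le> S" unfolding S_def
      by (rule SUP_upper2[OF x]) (rule SUP_upper[OF j])
    hence "AE \<theta> in lebesgue. \<bar>cut {0..N} (\<Phi> x) j \<theta>\<bar> \<le> real n" using n by (intro Linf_norm_le_AE) simp
    thus "AE \<theta> in lebesgue. 0 \<le> \<theta> \<longrightarrow> \<theta> \<le> N \<longrightarrow> \<bar>\<Phi> x j \<theta>\<bar> \<le> real n"
      by eventually_elim (auto simp: cut_def)
  qed simp
qed

lemma network_inflow_ess_bound:
  obtains K where "0 \<le> K" "\<And>j. j \<in> verts G \<times> I \<Longrightarrow> AE \<theta> in lebesgue. 0 \<le> \<theta> \<longrightarrow> \<theta> \<le> N \<longrightarrow> \<bar>u j \<theta>\<bar> \<le> K"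
proof -
  have "\<exists>k::nat. AE \<theta> in lebesgue. 0 \<le> \<theta> \<longrightarrow> \<theta> \<le> N \<longrightarrow> \<bar>u j \<theta>\<bar> \<le> real k" if j: "j \<in> verts G \<times> I" for j
  proof -
    have "Linf_norm (\<lambda>t. indicator {0..N} t * u j t) < \<infinity>"
      using u_bounded[OF j] unfolding locally_essentially_bounded_def by blast
    then obtain n :: nat where n: "Linf_norm (\<lambda>t. indicator {0..N} t * u j t) < ereal (real n)"
      using less_PInf_Ex_of_nat[of "Linf_norm (\<lambda>t. indicator {0..N} t * u j t)"] by auto
    have "AE \<theta> in lebesgue. \<bar>indicator {0..N} \<theta> * u j \<theta>\<bar> \<le> real n" using n by (intro Linf_norm_le_AE) simp
    hence "AE \<theta> in lebesgue. 0 \<le> \<theta> \<longrightarrow> \<theta> \<le> N \<longrightarrow> \<bar>u j \<theta>\<bar> \<le> real n" by eventually_elim auto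
    thus ?thesis by blast
  qed
  then obtain k where k: "\<And>j. j \<in> verts G \<times> I \<Longrightarrow> AE \<theta> in lebesgue. 0 \<le> \<theta> \<longrightarrow> \<theta> \<le> N \<longrightarrow> \<bar>u j \<theta>\<bar> \<le> real (k j)" by metis
  show ?thesis
  proof (rule that[of "\<Sum>j\<in>verts G \<times> I. real (k j)"])
    fix j assume j: "j \<in> verts G \<times> I"
    have le: "real (k j) \<le> (\<Sum>j\<in>verts G \<times> I. real (k j))" using I by (intro member_le_sum[OF j]) auto
    from k[OF j] show "AE \<theta> in lebesgue. 0 \<le> \<theta> \<longrightarrow> \<theta> \<le> N \<longrightarrow> \<bar>u j \<theta>\<bar> \<le> (\<Sum>j\<in>verts G \<times> I. real (k j))"
      by eventually_elim (use le in linarith)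
  qed (simp add: sum_nonneg)
qed

lemma inflow_ess_bound:
  assumes "0 \<le> N"
  obtains K where "0 \<le> K" "\<And>x v i. x \<in> A \<rightarrow> rates p \<Longrightarrow> v \<in> verts G \<Longrightarrow> i \<in> I \<Longrightarrow>
    AE \<theta> in lebesgue. 0 \<le> \<theta> \<longrightarrow> \<theta> \<le> N \<longrightarrow> \<bar>inflow (\<Phi> x) (v, i) \<theta>\<bar> \<le> K"
proof -
  obtain L where L: "0 \<le> L" "\<And>x j. x \<in> A \<rightarrow> rates p \<Longrightarrow> j \<in> A \<Longrightarrow>
    AE \<theta> in lebesgue. 0 \<le> \<theta> \<longrightarrow> \<theta> \<le> N \<longrightarrow> \<bar>\<Phi> x j \<theta>\<bar> \<le> L" using assms by (rule loading_ess_bound) blast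
  obtain U where U: "0 \<le> U" "\<And>j. j \<in> verts G \<times> I \<Longrightarrow> AE \<theta> in lebesgue. 0 \<le> \<theta> \<longrightarrow> \<theta> \<le> N \<longrightarrow> \<bar>u j \<theta>\<bar> \<le> U"
    by (rule network_inflow_ess_bound[of N]) blast
  show ?thesis
  proof (rule that[of "U + real (card (arcs G)) * L"])
    fix x v i assume x: "x \<in> A \<rightarrow> rates p" and v: "v \<in> verts G" and i: "i \<in> I"
    have "AE \<theta> in lebesgue. \<forall>e\<in>in_arcs G v. 0 \<le> \<theta> \<longrightarrow> \<theta> \<le> N \<longrightarrow> \<bar>\<Phi> x (e, i) \<theta>\<bar> \<le> L"
      by (intro AE_finite_allI finite_in L(2)[OF x]) (use i in auto)
    moreover have "AE \<theta> in lebesgue. 0 \<le> \<theta> \<longrightarrow> \<theta> \<le> N \<longrightarrow> \<bar>u (v, i) \<theta>\<bar> \<le> U" using v i by (intro U(2)) simp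
    ultimately show "AE \<theta> in lebesgue. 0 \<le> \<theta> \<longrightarrow> \<theta> \<le> N \<longrightarrow> \<bar>inflow (\<Phi> x) (v, i) \<theta>\<bar> \<le> U + real (card (arcs G)) * L"
    proof eventually_elim
      fix \<theta> :: real
      assume *: "\<forall>e\<in>in_arcs G v. 0 \<le> \<theta> \<longrightarrow> \<theta> \<le> N \<longrightarrow> \<bar>\<Phi> x (e, i) \<theta>\<bar> \<le> L" "0 \<le> \<theta> \<longrightarrow> \<theta> \<le> N \<longrightarrow> \<bar>u (v, i) \<theta>\<bar> \<le> U"
      show "0 \<le> \<theta> \<longrightarrow> \<theta> \<le> N \<longrightarrow> \<bar>inflow (\<Phi> x) (v, i) \<theta>\<bar> \<le> U + real (card (arcs G)) * L"
      proof (intro impI)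
        assume t: "0 \<le> \<theta>" "\<theta> \<le> N"
        have "\<bar>\<Sum>e\<in>in_arcs G v. \<Phi> x (e, i) \<theta>\<bar> \<le> (\<Sum>e\<in>in_arcs G v. \<bar>\<Phi> x (e, i) \<theta>\<bar>)" by (rule sum_abs)
        also have "\<dots> \<le> real (card (in_arcs G v)) * L" using * t by (intro sum_bounded_above) blast
        also have "\<dots> \<le> real (card (arcs G)) * L"
          using L(1) by (intro mult_right_mono of_nat_mono card_mono finite_arcs) auto
        finally have "\<bar>u (v, i) \<theta> + (\<Sum>e\<in>in_arcs G v. \<Phi> x (e, i) \<theta>)\<bar> \<le> U + real (card (arcs G)) * L"
          using * t by linarith
        thus "\<bar>inflow (\<Phi> x) (v, i) \<theta>\<bar> \<le> U + real (card (arcs G)) * L"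
          using U(1) L(1) by (cases "v = d i") (simp_all add: inflow_def)
      qed
    qed
  qed (use U L in simp)
qed

text \<open>The bound does not depend on \<open>x\<close>: the loading is essentially bounded over
  all inflows and probabilities are at most 1. One application of \<open>rerouted\<close> thus turns
  rates that are merely in L^p locally into locally bounded ones.\<close>

lemma rerouted_ess_bound:
  assumes "0 \<le> N"
  obtains K where "0 \<le> K" "\<And>x j. x \<in> A \<rightarrow> rates p \<Longrightarrow> j \<in> A \<Longrightarrow>
    AE \<theta> in lebesgue. 0 \<le> \<theta> \<longrightarrow> \<theta> \<le> N \<longrightarrow> \<bar>rerouted x j \<theta>\<bar> \<le> K"
proof -
  obtain K where K: "0 \<le> K" "\<And>x v i. x \<in> A \<rightarrow> rates p \<Longrightarrow> v \<in> verts G \<Longrightarrow> i \<in> I \<Longrightarrow>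
    AE \<theta> in lebesgue. 0 \<le> \<theta> \<longrightarrow> \<theta> \<le> N \<longrightarrow> \<bar>inflow (\<Phi> x) (v, i) \<theta>\<bar> \<le> K" using assms by (rule inflow_ess_bound) blast
  show ?thesis
  proof (rule that[OF K(1)])
    fix x j assume x: "x \<in> A \<rightarrow> rates p" and j: "j \<in> A"
    obtain e i where ei: "j = (e, i)" "e \<in> arcs G" "i \<in> I" using j by auto
    from K(2)[OF x tail_in_verts[OF ei(2)] ei(3)]
    show "AE \<theta> in lebesgue. 0 \<le> \<theta> \<longrightarrow> \<theta> \<le> N \<longrightarrow> \<bar>rerouted x j \<theta>\<bar> \<le> K"
    proof eventually_elim
      fix \<theta> :: real assume *: "0 \<le> \<theta> \<longrightarrow> \<theta> \<le> N \<longrightarrow> \<bar>inflow (\<Phi> x) (tail G e, i) \<theta>\<bar> \<le> K"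
      have s: "\<bar>single_prob (join x (\<Phi> x)) j \<theta>\<bar> \<le> 1" using single_prob_bounds[OF j] by simp
      show "0 \<le> \<theta> \<longrightarrow> \<theta> \<le> N \<longrightarrow> \<bar>rerouted x j \<theta>\<bar> \<le> K"
      proof (intro impI)
        assume "0 \<le> \<theta>" "\<theta> \<le> N"
        hence "\<bar>single_prob (join x (\<Phi> x)) j \<theta>\<bar> * \<bar>inflow (\<Phi> x) (tail G e, i) \<theta>\<bar> \<le> 1 * K"
          using * s by (intro mult_mono) auto
        thus "\<bar>rerouted x j \<theta>\<bar> \<le> K" by (simp add: rerouted_def ei abs_mult)
      qed
    qed
  qed
qed

text \<open>The costs of distinct paths are within \<open>2 \<eta>\<close> of each other only with a probability of order \<open>\<eta>\<close>, and
  otherwise a perturbation of all costs by \<open>\<eta>\<close> leaves the optimal edges unchanged.\<close>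

lemma single_prob_contraction:
  assumes "0 \<le> N"
  obtains c where "0 \<le> c"
    "\<And>f g T \<beta> \<delta> j. f \<in> flows p G I \<Longrightarrow> g \<in> flows p G I \<Longrightarrow> 0 \<le> T \<Longrightarrow> 0 \<le> \<beta> \<Longrightarrow> T + \<beta> \<le> N \<Longrightarrow> 0 \<le> \<delta> \<Longrightarrow>
      close_until (flow_index G I) T 0 f g \<Longrightarrow> close_until (flow_index G I) (T + \<beta>) \<delta> f g \<Longrightarrow>
      close_until A (T + \<beta>) (c * \<beta> * \<delta>) (single_prob f) (single_prob g)"
proof -
  obtain L where L: "0 < L" and Lip: "\<And>i. i \<in> I \<Longrightarrow> AE C in \<mu> i. AE \<theta> in lebesgue. \<theta> \<in> {0..N} \<longrightarrow>
        (\<forall>f \<in> flows_until p G I (ereal N). \<forall>g \<in> flows_until p G I (ereal N). \<forall>q \<in> simple_paths G.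
           \<bar>indicator {0..N} \<theta> * C \<theta> f q - indicator {0..N} \<theta> * C \<theta> g q\<bar>
             \<le> L * vec_norm 1 (flow_index G I) (\<lambda>j t. f j t - g j t))"
    using Lipschitz assms unfolding locally_Lipschitz_predictors_def by blast
  obtain B where B: "0 < B" "\<forall>f\<in>flows p G I. \<forall>q\<in>simple_paths G. \<forall>q'\<in>simple_paths G. \<forall>i\<in>I. q \<noteq> q' \<longrightarrow>
    (AE \<theta> in lebesgue. \<forall>r\<ge>0. cost_gap i f q q' \<theta> r \<in> sets (\<mu> i) \<and>
      measure (\<mu> i) (cost_gap i f q q' \<theta> r) \<le> 2 * r * B)"
    using cost_gap_prob by (elim exE conjE)
  define P where "P = {(q, q'). q \<in> simple_paths G \<and> q' \<in> simple_paths G \<and> q \<noteq> q'}"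
  have P: "finite P" by (rule finite_subset[of _ "simple_paths G \<times> simple_paths G"]) (auto simp: P_def finite_simple_paths)
  \<comment> \<open>Each pair of paths costs a probability of at most
    \<open>2 * (2 * \<eta>) * B\<close>, with
    \<open>\<eta> = L * (\<beta> * \<delta>)\<close>.\<close>
  define c where "c = real (card P) * (4 * L * B)"
  have c: "0 \<le> c" using L B(1) by (simp add: c_def)
  show ?thesis
  proof (rule that[OF c])
    fix f g T \<beta> \<delta>
    assume f: "f \<in> flows p G I" and g: "g \<in> flows p G I" and T: "0 \<le> T" "0 \<le> \<beta>" "T + \<beta> \<le> N" and \<delta>: "0 \<le> \<delta>"
      and close: "close_until (flow_index G I) T 0 f g" "close_until (flow_index G I) (T + \<beta>) \<delta> f g"
    define R where "R h = (\<lambda>j \<theta>. indicator (before (ereal (T + \<beta>))) \<theta> * h j \<theta>)" for h :: "('e \<times> 'i \<times> sign) vec"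
    have R_u: "R h \<in> flows_until p G I (ereal (T + \<beta>))" if "h \<in> flows p G I" for h
      using that unfolding R_def flows_until_def flows_def by (intro Pi_I rates_until_cut[OF p]) auto
    have R_N: "R h \<in> flows_until p G I (ereal N)" if "h \<in> flows p G I" for h
      using R_u[OF that] T rates_until_mono unfolding flows_until_def by fastforce
    have R_f: "R h \<in> flows p G I" if "h \<in> flows p G I" for h
      using R_u[OF that] rates_untilD(1) unfolding flows_until_def flows_def by blast
    have R_c: "coincide_until (flow_index G I) (ereal (T + \<beta>)) h (R h)" for h
      unfolding coincide_until_iff by (auto simp: R_def before_def intro!: AE_I2)
    define \<eta> where "\<eta> = L * (\<beta> * \<delta>)"
    have \<eta>: "0 \<le> \<eta>" using L T \<delta> by (simp add: \<eta>_def)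
    have "vec_norm 1 (flow_index G I) (\<lambda>j t. R f j t - R g j t) \<le> \<beta> * \<delta>"
      unfolding R_def using f g T \<delta> close by (intro vec_norm_1_cut_le finite_flow_index) (auto simp: flows_def)
    hence nrm: "L * vec_norm 1 (flow_index G I) (\<lambda>j t. R f j t - R g j t) \<le> \<eta>" unfolding \<eta>_def using L by (intro mult_left_mono) auto
    have diff: "AE \<theta> in lebesgue. 0 \<le> \<theta> \<longrightarrow> \<theta> < T + \<beta> \<longrightarrow> (AE C in \<mu> i. \<forall>q\<in>simple_paths G. \<bar>C \<theta> (R f) q - C \<theta> (R g) q\<bar> \<le> \<eta>)"
      if i: "i \<in> I" for i
    proof (rule AE_costs_swap[OF i R_f[OF f] R_f[OF g]])
      show "AE C in \<mu> i. AE \<theta> in lebesgue. 0 \<le> \<theta> \<longrightarrow> \<theta> < T + \<beta> \<longrightarrow> (\<forall>q\<in>simple_paths G. \<bar>C \<theta> (R f) q - C \<theta> (R g) q\<bar> \<le> \<eta>)"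
        using Lip[OF i]
      proof eventually_elim
        fix C :: "('e, 'i) predictor"
        assume "AE \<theta> in lebesgue. \<theta> \<in> {0..N} \<longrightarrow>
          (\<forall>f \<in> flows_until p G I (ereal N). \<forall>g \<in> flows_until p G I (ereal N). \<forall>q \<in> simple_paths G.
           \<bar>indicator {0..N} \<theta> * C \<theta> f q - indicator {0..N} \<theta> * C \<theta> g q\<bar>
             \<le> L * vec_norm 1 (flow_index G I) (\<lambda>j t. f j t - g j t))"
        thus "AE \<theta> in lebesgue. 0 \<le> \<theta> \<longrightarrow> \<theta> < T + \<beta> \<longrightarrow> (\<forall>q\<in>simple_paths G. \<bar>C \<theta> (R f) q - C \<theta> (R g) q\<bar> \<le> \<eta>)"
        proof eventually_elim
          fix \<theta> :: real
          assume *: "\<theta> \<in> {0..N} \<longrightarrow>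
          (\<forall>f \<in> flows_until p G I (ereal N). \<forall>g \<in> flows_until p G I (ereal N). \<forall>q \<in> simple_paths G.
           \<bar>indicator {0..N} \<theta> * C \<theta> f q - indicator {0..N} \<theta> * C \<theta> g q\<bar>
             \<le> L * vec_norm 1 (flow_index G I) (\<lambda>j t. f j t - g j t))"
          show "0 \<le> \<theta> \<longrightarrow> \<theta> < T + \<beta> \<longrightarrow> (\<forall>q\<in>simple_paths G. \<bar>C \<theta> (R f) q - C \<theta> (R g) q\<bar> \<le> \<eta>)"
          proof (intro impI ballI)
            fix q assume t: "0 \<le> \<theta>" "\<theta> < T + \<beta>" and q: "q \<in> simple_paths G"
            have tN: "\<theta> \<in> {0..N}" using t T by simp
            have "\<bar>indicator {0..N} \<theta> * C \<theta> (R f) q - indicator {0..N} \<theta> * C \<theta> (R g) q\<bar>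
                \<le> L * vec_norm 1 (flow_index G I) (\<lambda>j t. R f j t - R g j t)"
              using *[rule_format, OF tN R_N[OF f] R_N[OF g] q] .
            thus "\<bar>C \<theta> (R f) q - C \<theta> (R g) q\<bar> \<le> \<eta>" using tN nrm by simp
          qed
        qed
      qed
    qed
    have causal_eq: "AE \<theta> in lebesgue. 0 \<le> \<theta> \<longrightarrow> \<theta> < T + \<beta> \<longrightarrow> (AE C in \<mu> i. \<forall>q\<in>simple_paths G. C \<theta> h q = C \<theta> (R h) q)"
      if "i \<in> I" "h \<in> flows p G I" for i h
      by (rule causal_costs_eq[OF causal[OF that(1)] that(1) _ that(2) R_f[OF that(2)] R_c]) (use T in simp)
    show "close_until A (T + \<beta>) (c * \<beta> * \<delta>) (single_prob f) (single_prob g)"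
      unfolding close_until_def
    proof
      fix j assume "j \<in> A"
      then obtain e i where j: "j = (e, i)" and e: "e \<in> arcs G" and i: "i \<in> I" by auto
      define v where "v = tail G e"
      have v: "v \<in> verts G" unfolding v_def by (rule tail_in_verts[OF e])
      interpret prob_space "\<mu> i" by (rule prob_space_\<mu>[OF i])
      have gap: "AE \<theta> in lebesgue. \<forall>z\<in>P. \<forall>r\<ge>0. cost_gap i f (fst z) (snd z) \<theta> r \<in> sets (\<mu> i) \<and>
          measure (\<mu> i) (cost_gap i f (fst z) (snd z) \<theta> r) \<le> 2 * r * B"
        by (intro AE_finite_allI[OF P] B(2)[rule_format, OF f _ _ i]) (auto simp: P_def)
      from gap diff[OF i] causal_eq[OF i f] causal_eq[OF i g]
      show "AE \<theta> in lebesgue. 0 \<le> \<theta> \<longrightarrow> \<theta> < T + \<beta> \<longrightarrow> \<bar>single_prob f j \<theta> - single_prob g j \<theta>\<bar> \<le> c * \<beta> * \<delta>"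
      proof eventually_elim
        fix \<theta> :: real
        assume gap: "\<forall>z\<in>P. \<forall>r\<ge>0. cost_gap i f (fst z) (snd z) \<theta> r \<in> sets (\<mu> i) \<and>
            measure (\<mu> i) (cost_gap i f (fst z) (snd z) \<theta> r) \<le> 2 * r * B"
          and d1: "0 \<le> \<theta> \<longrightarrow> \<theta> < T + \<beta> \<longrightarrow> (AE C in \<mu> i. \<forall>q\<in>simple_paths G. \<bar>C \<theta> (R f) q - C \<theta> (R g) q\<bar> \<le> \<eta>)"
          and d2: "0 \<le> \<theta> \<longrightarrow> \<theta> < T + \<beta> \<longrightarrow> (AE C in \<mu> i. \<forall>q\<in>simple_paths G. C \<theta> f q = C \<theta> (R f) q)"
          and d3: "0 \<le> \<theta> \<longrightarrow> \<theta> < T + \<beta> \<longrightarrow> (AE C in \<mu> i. \<forall>q\<in>simple_paths G. C \<theta> g q = C \<theta> (R g) q)"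
        show "0 \<le> \<theta> \<longrightarrow> \<theta> < T + \<beta> \<longrightarrow> \<bar>single_prob f j \<theta> - single_prob g j \<theta>\<bar> \<le> c * \<beta> * \<delta>"
        proof (intro impI)
          assume t: "0 \<le> \<theta>" "\<theta> < T + \<beta>"
          define Z where "Z z = cost_gap i f (fst z) (snd z) \<theta> (2 * \<eta>)" for z
          have Z: "Z z \<in> sets (\<mu> i)" "measure (\<mu> i) (Z z) \<le> 4 * \<eta> * B" if "z \<in> P" for z
            using bspec[OF gap that, rule_format, of "2 * \<eta>"] \<eta> by (simp_all add: Z_def)
          have "\<bar>choice_prob G d \<mu> v {e} i \<theta> f - choice_prob G d \<mu> v {e} i \<theta> g\<bar> \<le> measure (\<mu> i) (\<Union>z\<in>P. Z z)"
          proof (rule choice_prob_diff_le[OF i v f g])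
            show "(\<Union>z\<in>P. Z z) \<in> sets (\<mu> i)" using Z(1) by (intro sets.finite_UN P)
            from d1[rule_format, OF t] d2[rule_format, OF t] d3[rule_format, OF t] AE_space
            show "AE C in \<mu> i. C \<notin> (\<Union>z\<in>P. Z z) \<longrightarrow> best v i (C \<theta> f) = best v i (C \<theta> g)"
            proof eventually_elim
              fix C :: "('e, 'i) predictor"
              assume a: "\<forall>q\<in>simple_paths G. \<bar>C \<theta> (R f) q - C \<theta> (R g) q\<bar> \<le> \<eta>"
                "\<forall>q\<in>simple_paths G. C \<theta> f q = C \<theta> (R f) q" "\<forall>q\<in>simple_paths G. C \<theta> g q = C \<theta> (R g) q" "C \<in> space (\<mu> i)"
              show "C \<notin> (\<Union>z\<in>P. Z z) \<longrightarrow> best v i (C \<theta> f) = best v i (C \<theta> g)"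
              proof
                assume n: "C \<notin> (\<Union>z\<in>P. Z z)"
                show "best v i (C \<theta> f) = best v i (C \<theta> g)"
                proof (rule best_cong_if_separated[where \<eta>=\<eta>])
                  fix q assume "q \<in> paths v i"
                  hence "q \<in> simple_paths G" by (rule path_simple[OF _ v i])
                  thus "\<bar>C \<theta> f q - C \<theta> g q\<bar> \<le> \<eta>" using a by simp
                next
                  fix q q' assume "q \<in> paths v i" "q' \<in> paths v i" "q \<noteq> q'"
                  hence "(q, q') \<in> P" unfolding P_def using path_simple[OF _ v i] by simp
                  hence "C \<notin> Z (q, q')" using n by blast
                  thus "2 * \<eta> < \<bar>C \<theta> f q - C \<theta> f q'\<bar>" using a(4) by (simp add: Z_def cost_gap_def)
                qed
              qed
            qed
          qed
          also have "\<dots> \<le> (\<Sum>z\<in>P. measure (\<mu> i) (Z z))" by (rule measure_UNION_le[OF P Z(1)])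
          also have "\<dots> \<le> real (card P) * (4 * \<eta> * B)" by (rule sum_bounded_above[OF Z(2)])
          also have "\<dots> = c * \<beta> * \<delta>" by (simp add: c_def \<eta>_def)
          finally show "\<bar>single_prob f j \<theta> - single_prob g j \<theta>\<bar> \<le> c * \<beta> * \<delta>" by (simp add: single_prob_def j v_def)
        qed
      qed
    qed
  qed
qed

text \<open>As the loadings coincide until \<open>T + \<beta>\<close>, both flows have the same node
  inflow there and only the routing probabilities differ. The node inflow enters through its uniform
  bound \<open>K\<close>.\<close>

lemma rerouted_contraction:
  assumes "0 \<le> N"
  obtains c where "0 \<le> c"
    "\<And>x x' T \<beta> \<delta>. x \<in> A \<rightarrow> rates p \<Longrightarrow> x' \<in> A \<rightarrow> rates p \<Longrightarrow> 0 \<le> T \<Longrightarrow> 0 \<le> \<beta> \<Longrightarrow> T + \<beta> \<le> N \<Longrightarrow> 0 \<le> \<delta> \<Longrightarrow>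
      close_until A T 0 x x' \<Longrightarrow> close_until A (T + \<beta>) 0 (\<Phi> x) (\<Phi> x') \<Longrightarrow> close_until A (T + \<beta>) \<delta> x x' \<Longrightarrow>
      close_until A (T + \<beta>) (c * \<beta> * \<delta>) (rerouted x) (rerouted x')"
proof -
  obtain c where c: "0 \<le> c" "\<And>f g T \<beta> \<delta> j. f \<in> flows p G I \<Longrightarrow> g \<in> flows p G I \<Longrightarrow> 0 \<le> T \<Longrightarrow> 0 \<le> \<beta> \<Longrightarrow> T + \<beta> \<le> N \<Longrightarrow> 0 \<le> \<delta> \<Longrightarrow>
      close_until (flow_index G I) T 0 f g \<Longrightarrow> close_until (flow_index G I) (T + \<beta>) \<delta> f g \<Longrightarrow>
      close_until A (T + \<beta>) (c * \<beta> * \<delta>) (single_prob f) (single_prob g)"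
    using assms by (rule single_prob_contraction) blast
  obtain K where K: "0 \<le> K" "\<And>x v i. x \<in> A \<rightarrow> rates p \<Longrightarrow> v \<in> verts G \<Longrightarrow> i \<in> I \<Longrightarrow>
    AE \<theta> in lebesgue. 0 \<le> \<theta> \<longrightarrow> \<theta> \<le> N \<longrightarrow> \<bar>inflow (\<Phi> x) (v, i) \<theta>\<bar> \<le> K" using assms by (rule inflow_ess_bound) blast
  show ?thesis
  proof (rule that[of "c * K"])
    fix x x' T \<beta> \<delta>
    assume x: "x \<in> A \<rightarrow> rates p" and x': "x' \<in> A \<rightarrow> rates p" and T: "0 \<le> T" "0 \<le> \<beta>" "T + \<beta> \<le> N" and \<delta>: "0 \<le> \<delta>"
      and close: "close_until A T 0 x x'" "close_until A (T + \<beta>) \<delta> x x'" and \<Phi>_eq: "close_until A (T + \<beta>) 0 (\<Phi> x) (\<Phi> x')"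
    have \<Phi>_T: "close_until A T 0 (\<Phi> x) (\<Phi> x')"
      unfolding close_until_def
    proof
      fix j assume "j \<in> A"
      from close_untilD[OF \<Phi>_eq this] show "AE t in lebesgue. 0 \<le> t \<longrightarrow> t < T \<longrightarrow> \<bar>\<Phi> x j t - \<Phi> x' j t\<bar> \<le> 0"
        by eventually_elim (use T in auto)
    qed
    have \<Phi>_\<delta>: "close_until A (T + \<beta>) \<delta> (\<Phi> x) (\<Phi> x')"
      unfolding close_until_def
    proof
      fix j assume "j \<in> A"
      from close_untilD[OF \<Phi>_eq this] show "AE t in lebesgue. 0 \<le> t \<longrightarrow> t < T + \<beta> \<longrightarrow> \<bar>\<Phi> x j t - \<Phi> x' j t\<bar> \<le> \<delta>"
        by eventually_elim (use \<delta> in auto)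
    qed
    have sp: "close_until A (T + \<beta>) (c * \<beta> * \<delta>) (single_prob (join x (\<Phi> x))) (single_prob (join x' (\<Phi> x')))"
      by (intro c(2) join_loading_flows x x' T \<delta> close_join close \<Phi>_T \<Phi>_\<delta>)
    show "close_until A (T + \<beta>) (c * K * \<beta> * \<delta>) (rerouted x) (rerouted x')"
      unfolding close_until_def
    proof
      fix j assume jA: "j \<in> A"
      then obtain e i where j: "j = (e, i)" and e: "e \<in> arcs G" and i: "i \<in> I" by auto
      have "AE \<theta> in lebesgue. \<forall>k\<in>A. 0 \<le> \<theta> \<longrightarrow> \<theta> < T + \<beta> \<longrightarrow> \<bar>\<Phi> x k \<theta> - \<Phi> x' k \<theta>\<bar> \<le> 0"
        by (intro AE_finite_allI finite_A close_untilD[OF \<Phi>_eq])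
      from this close_untilD[OF sp jA] K(2)[OF x tail_in_verts[OF e] i]
      show "AE \<theta> in lebesgue. 0 \<le> \<theta> \<longrightarrow> \<theta> < T + \<beta> \<longrightarrow> \<bar>rerouted x j \<theta> - rerouted x' j \<theta>\<bar> \<le> c * K * \<beta> * \<delta>"
      proof eventually_elim
        fix \<theta> :: real
        assume *: "\<forall>k\<in>A. 0 \<le> \<theta> \<longrightarrow> \<theta> < T + \<beta> \<longrightarrow> \<bar>\<Phi> x k \<theta> - \<Phi> x' k \<theta>\<bar> \<le> 0"
          "0 \<le> \<theta> \<longrightarrow> \<theta> < T + \<beta> \<longrightarrow> \<bar>single_prob (join x (\<Phi> x)) j \<theta> - single_prob (join x' (\<Phi> x')) j \<theta>\<bar> \<le> c * \<beta> * \<delta>"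
          "0 \<le> \<theta> \<longrightarrow> \<theta> \<le> N \<longrightarrow> \<bar>inflow (\<Phi> x) (tail G e, i) \<theta>\<bar> \<le> K"
        show "0 \<le> \<theta> \<longrightarrow> \<theta> < T + \<beta> \<longrightarrow> \<bar>rerouted x j \<theta> - rerouted x' j \<theta>\<bar> \<le> c * K * \<beta> * \<delta>"
        proof (intro impI)
          assume t: "0 \<le> \<theta>" "\<theta> < T + \<beta>"
          have "(\<Sum>e\<in>in_arcs G (tail G e). \<Phi> x (e, i) \<theta>) = (\<Sum>e\<in>in_arcs G (tail G e). \<Phi> x' (e, i) \<theta>)"
            using *(1) t i by (intro sum.cong refl) auto
          hence inf: "inflow (\<Phi> x') (tail G e, i) \<theta> = inflow (\<Phi> x) (tail G e, i) \<theta>" by (simp add: inflow_def)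
          have "\<bar>rerouted x j \<theta> - rerouted x' j \<theta>\<bar> =
              \<bar>single_prob (join x (\<Phi> x)) j \<theta> - single_prob (join x' (\<Phi> x')) j \<theta>\<bar> * \<bar>inflow (\<Phi> x) (tail G e, i) \<theta>\<bar>"
            by (simp add: rerouted_def j inf left_diff_distrib[symmetric] abs_mult)
          also have "\<dots> \<le> (c * \<beta> * \<delta>) * K" using * t T c(1) \<delta> by (intro mult_mono) auto
          finally show "\<bar>rerouted x j \<theta> - rerouted x' j \<theta>\<bar> \<le> c * K * \<beta> * \<delta>" by (simp add: mult_ac)
        qed
      qed
    qed
  qed (use c K in simp)
qed

end

section \<open>Distances until a time and their limits\<close>

lemma close_until_mono: "close_until J T \<delta> f g \<Longrightarrow> T' \<le> T \<Longrightarrow> \<delta> \<le> \<delta>' \<Longrightarrow> close_until J T' \<delta>' f g"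
  unfolding close_until_def by (intro ballI, drule (1) bspec, erule eventually_mono) auto

lemma close_until_sym: "close_until J T \<delta> f g \<Longrightarrow> close_until J T \<delta> g f"
  unfolding close_until_def by (simp add: abs_minus_commute)

lemma close_until_trans:
  assumes "close_until J T \<delta> f g" "close_until J T \<delta>' g h"
  shows "close_until J T (\<delta> + \<delta>') f h"
  unfolding close_until_def
proof
  fix j assume "j \<in> J"
  from close_untilD[OF assms(1) this] close_untilD[OF assms(2) this]
  show "AE t in lebesgue. 0 \<le> t \<longrightarrow> t < T \<longrightarrow> \<bar>f j t - h j t\<bar> \<le> \<delta> + \<delta>'" by eventually_elim linarith
qed

lemma close_until_refl: "close_until J T 0 f f"
  by (simp add: close_until_def)

lemma nonpos_if_le_geometric:
  fixes a C :: real
  assumes "\<And>n. a \<le> C / 2 ^ n"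
  shows "a \<le> 0"
proof (rule LIMSEQ_le_const[of "\<lambda>n. C / 2 ^ n"])
  have "(\<lambda>n. C * (1/2) ^ n) \<longlonglongrightarrow> C * 0" by (intro tendsto_mult tendsto_const LIMSEQ_power_zero) simp
  thus "(\<lambda>n. C / 2 ^ n) \<longlonglongrightarrow> 0" by (simp add: power_divide)
qed (use assms in blast)

lemma close_until_0I:
  assumes "\<And>n. close_until J T (C / 2 ^ n) f g"
  shows "close_until J T 0 f g"
  unfolding close_until_def
proof
  fix j assume j: "j \<in> J"
  have "AE t in lebesgue. \<forall>n. 0 \<le> t \<longrightarrow> t < T \<longrightarrow> \<bar>f j t - g j t\<bar> \<le> C / 2 ^ n"
    unfolding AE_all_countable by (intro allI close_untilD[OF assms j])
  thus "AE t in lebesgue. 0 \<le> t \<longrightarrow> t < T \<longrightarrow> \<bar>f j t - g j t\<bar> \<le> 0"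
    by eventually_elim (blast intro: nonpos_if_le_geometric)
qed

lemma coincide_until_SUP:
  fixes \<tau> :: "nat \<Rightarrow> ereal"
  assumes "\<And>n. coincide_until J (\<tau> n) f g"
  shows "coincide_until J (SUP n. \<tau> n) f g"
  unfolding coincide_until_iff
proof
  fix j assume j: "j \<in> J"
  have "AE t in lebesgue. \<forall>n. 0 \<le> t \<longrightarrow> ereal t < \<tau> n \<longrightarrow> f j t = g j t"
    unfolding AE_all_countable by (intro allI coincide_untilD[OF assms j])
  thus "AE t in lebesgue. 0 \<le> t \<longrightarrow> ereal t < (SUP n. \<tau> n) \<longrightarrow> f j t = g j t"
    by eventually_elim (auto simp: less_SUP_iff)
qed

lemma geometric_limit:
  fixes s :: "nat \<Rightarrow> real"
  assumes s: "\<And>n. \<bar>s n - s (Suc n)\<bar> \<le> C / 2 ^ n"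
  shows "s \<longlonglongrightarrow> lim s" and "\<bar>lim s - s n\<bar> \<le> 2 * C / 2 ^ n"
proof -
  have d: "\<bar>s (n + k) - s n\<bar> \<le> 2 * C / 2 ^ n - 2 * C / 2 ^ (n + k)" for n k
  proof (induction k)
    case (Suc k)
    have "C / 2 ^ (n + k) = 2 * C / 2 ^ (n + k) - 2 * C / 2 ^ (n + Suc k)" by (simp add: field_simps)
    thus ?case using Suc s[of "n + k"] by simp
  qed simp
  have C: "0 \<le> C" using s[of 0] by simp
  have d': "\<bar>s (n + k) - s n\<bar> \<le> 2 * C / 2 ^ n" for n k
  proof -
    have "0 \<le> 2 * C / 2 ^ (n + k)" using C by simp
    thus ?thesis using d[of n k] by linarith
  qed
  have "summable (\<lambda>n. s (Suc n) - s n)"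
  proof (rule summable_comparison_test')
    show "summable (\<lambda>n. C * (1/2) ^ n)" by (intro summable_mult summable_geometric) simp
    show "norm (s (Suc n) - s n) \<le> C * (1/2) ^ n" if "0 \<le> n" for n
      using s[of n] by (simp add: abs_minus_commute power_divide)
  qed
  hence "convergent (\<lambda>n. \<Sum>k<n. s (Suc k) - s k)" by (simp add: summable_iff_convergent)
  hence "convergent (\<lambda>n. s n - s 0)" by (simp add: sum_lessThan_telescope)
  hence "convergent (\<lambda>n. (s n - s 0) + s 0)" by (intro convergent_add convergent_const)
  thus l: "s \<longlonglongrightarrow> lim s" by (simp add: convergent_LIMSEQ_iff)
  have "(\<lambda>k. \<bar>s (n + k) - s n\<bar>) \<longlonglongrightarrow> \<bar>lim s - s n\<bar>"
    using LIMSEQ_ignore_initial_segment[OF l, of n] by (intro tendsto_rabs tendsto_diff tendsto_const) (simp add: add.commute)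
  thus "\<bar>lim s - s n\<bar> \<le> 2 * C / 2 ^ n" by (rule LIMSEQ_le_const2) (use d' in blast)
qed

lemma rates_if_loc_ess_bounded:
  assumes p: "0 < p" and [measurable]: "f \<in> borel_measurable lebesgue"
    and f: "AE t in lebesgue. 0 \<le> f t" "AE t in lebesgue. t < 0 \<longrightarrow> f t = 0"
    and b: "\<And>N. \<exists>K. AE t in lebesgue. 0 \<le> t \<longrightarrow> t \<le> N \<longrightarrow> \<bar>f t\<bar> \<le> K"
  shows "f \<in> rates p"
proof -
  have "set_integrable lebesgue {a..b} (\<lambda>t. \<bar>f t\<bar> powr p)" for a b
  proof -
    obtain K where K: "AE t in lebesgue. 0 \<le> t \<longrightarrow> t \<le> b \<longrightarrow> \<bar>f t\<bar> \<le> K" using b by blast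
    show ?thesis unfolding set_integrable_def
    proof (rule Bochner_Integration.integrable_bound)
      show "integrable lebesgue (\<lambda>t. \<bar>K\<bar> powr p * indicator {a..b} t)"
        by (intro integrable_mult_right integrable_real_indicator) (auto simp: emeasure_lborel_Icc_eq)
      show "AE t in lebesgue. norm (indicator {a..b} t *\<^sub>R \<bar>f t\<bar> powr p) \<le> norm (\<bar>K\<bar> powr p * indicator {a..b} t)"
        using K f(2)
      proof eventually_elim
        fix t assume *: "0 \<le> t \<longrightarrow> t \<le> b \<longrightarrow> \<bar>f t\<bar> \<le> K" "t < 0 \<longrightarrow> f t = 0"
        show "norm (indicator {a..b} t *\<^sub>R \<bar>f t\<bar> powr p) \<le> norm (\<bar>K\<bar> powr p * indicator {a..b} t)"
        proof (cases "t \<in> {a..b}")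
          case True
          hence "\<bar>f t\<bar> \<le> \<bar>K\<bar>" using * by (cases "t < 0") auto
          thus ?thesis using True p by (simp add: powr_mono2)
        qed simp
      qed
    qed measurable
  qed
  thus ?thesis using f by (simp add: rates_def)
qed

lemma coincide_rates_AE:
  assumes "coincide_until J \<infinity> f g" "f \<in> J \<rightarrow> rates p" "g \<in> J \<rightarrow> rates p" "j \<in> J"
  shows "AE t in lebesgue. f j t = g j t"
  using coincide_untilD[OF assms(1,4)] ratesD(3)[OF funcset_mem[OF assms(2,4)]] ratesD(3)[OF funcset_mem[OF assms(3,4)]]
proof eventually_elim
  fix t assume "0 \<le> t \<longrightarrow> ereal t < \<infinity> \<longrightarrow> f j t = g j t" "t < 0 \<longrightarrow> f j t = 0" "t < 0 \<longrightarrow> g j t = 0"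
  thus "f j t = g j t" by (cases "t < 0") auto
qed

section \<open>Fixed points of rerouting: local contraction, uniqueness and existence\<close>

context regular_network
begin

text \<open>Strict causality gives a delay \<open>\<alpha>\<close> that depends on \<open>x\<close>
  and \<open>T\<close> but not on the flow compared with \<open>x\<close>. Hence one
  \<open>\<beta>\<close> serves all pairs that agree with \<open>x\<close> until \<open>T\<close>,
  and all their loadings coincide until \<open>T + \<beta>\<close>.\<close>

lemma local_contraction:
  assumes x: "x \<in> A \<rightarrow> rates p" and T: "0 \<le> T"
  obtains \<beta> where "0 < \<beta>" "\<And>a b \<gamma> \<delta>. a \<in> A \<rightarrow> rates p \<Longrightarrow> b \<in> A \<rightarrow> rates p \<Longrightarrow>
      close_until A T 0 x a \<Longrightarrow> close_until A T 0 x b \<Longrightarrow> 0 \<le> \<gamma> \<Longrightarrow> \<gamma> \<le> \<beta> \<Longrightarrow> 0 \<le> \<delta> \<Longrightarrow>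
      close_until A (T + \<gamma>) \<delta> a b \<Longrightarrow> close_until A (T + \<gamma>) (\<delta> / 2) (rerouted a) (rerouted b)"
proof -
  obtain \<alpha> where \<alpha>: "0 < \<alpha>" "\<forall>g\<in>A \<rightarrow> rates p. coincide_until A (ereal T) x g \<longrightarrow> coincide_until A (ereal T + ereal \<alpha>) (\<Phi> x) (\<Phi> g)"
    using strictly_causal x T unfolding uniformly_strictly_causal_loading_def by (metis ereal_less_eq(5))
  have N: "0 \<le> T + 1" using T by simp
  obtain c where c: "0 \<le> c"
    "\<And>x x' T' \<beta> \<delta>. x \<in> A \<rightarrow> rates p \<Longrightarrow> x' \<in> A \<rightarrow> rates p \<Longrightarrow> 0 \<le> T' \<Longrightarrow> 0 \<le> \<beta> \<Longrightarrow> T' + \<beta> \<le> T + 1 \<Longrightarrow> 0 \<le> \<delta> \<Longrightarrow>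
      close_until A T' 0 x x' \<Longrightarrow> close_until A (T' + \<beta>) 0 (\<Phi> x) (\<Phi> x') \<Longrightarrow> close_until A (T' + \<beta>) \<delta> x x' \<Longrightarrow>
      close_until A (T' + \<beta>) (c * \<beta> * \<delta>) (rerouted x) (rerouted x')"
    by (rule rerouted_contraction[OF N]) blast
  \<comment> \<open>The three bounds keep within the delay, within the horizon \<open>T + 1\<close>
    for which \<open>c\<close> was obtained, and below the length that makes the contraction factor
    at most one half.\<close>
  define \<beta> where "\<beta> = min \<alpha> (min 1 (1 / (2 * (c + 1))))"
  have \<beta>: "0 < \<beta>" "\<beta> \<le> \<alpha>" "\<beta> \<le> 1" "\<beta> \<le> 1 / (2 * (c + 1))" 
    unfolding \<beta>_def using \<alpha>(1) c(1) by (auto intro: min.coboundedI1 min.coboundedI2)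
  show ?thesis
  proof (rule that[OF \<beta>(1)])
    fix a b \<gamma> \<delta>
    assume a: "a \<in> A \<rightarrow> rates p" "close_until A T 0 x a" and b: "b \<in> A \<rightarrow> rates p" "close_until A T 0 x b"
      and \<gamma>: "0 \<le> \<gamma>" "\<gamma> \<le> \<beta>" and \<delta>: "0 \<le> \<delta>" and close: "close_until A (T + \<gamma>) \<delta> a b"
    have \<Phi>g: "close_until A (T + \<gamma>) 0 (\<Phi> x) (\<Phi> g)" if "g \<in> A \<rightarrow> rates p" "close_until A T 0 x g" for g
    proof (rule close_until_mono)
      show "close_until A (T + \<alpha>) 0 (\<Phi> x) (\<Phi> g)" using \<alpha>(2) that by (simp add: close_until_iff_coincide)
    qed (use \<gamma> \<beta> in auto)
    have ab: "close_until A T 0 a b" using close_until_trans[OF close_until_sym[OF a(2)] b(2)] by simp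
    have \<Phi>ab: "close_until A (T + \<gamma>) 0 (\<Phi> a) (\<Phi> b)"
      using close_until_trans[OF close_until_sym[OF \<Phi>g[OF a]] \<Phi>g[OF b]] by simp
    have "close_until A (T + \<gamma>) (c * \<gamma> * \<delta>) (rerouted a) (rerouted b)"
      by (rule c(2)[OF a(1) b(1) T \<gamma>(1) _ \<delta> ab \<Phi>ab close]) (use \<gamma> \<beta> in simp)
    moreover have "c * \<gamma> * \<delta> \<le> \<delta> / 2"
    proof -
      have "c * \<gamma> \<le> (c + 1) * (1 / (2 * (c + 1)))" using \<gamma> \<beta> c(1) by (intro mult_mono) auto
      also have "\<dots> = 1 / 2" using c(1) by simp
      finally show ?thesis using mult_right_mono[OF _ \<delta>] by fastforce
    qed
    ultimately show "close_until A (T + \<gamma>) (\<delta> / 2) (rerouted a) (rerouted b)" by (rule close_until_mono[OF _ order_refl])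
  qed
qed

text \<open>The local contraction estimate with \<open>\<gamma> = 0\<close> and
  \<open>\<delta> = 0\<close>.\<close>

lemma rerouted_causal:
  assumes "a \<in> A \<rightarrow> rates p" "b \<in> A \<rightarrow> rates p" "0 \<le> T" "close_until A T 0 a b"
  shows "close_until A T 0 (rerouted a) (rerouted b)"
proof -
  obtain \<beta> where \<beta>: "0 < \<beta>" "\<And>x b \<gamma> \<delta>. x \<in> A \<rightarrow> rates p \<Longrightarrow> b \<in> A \<rightarrow> rates p \<Longrightarrow>
      close_until A T 0 a x \<Longrightarrow> close_until A T 0 a b \<Longrightarrow> 0 \<le> \<gamma> \<Longrightarrow> \<gamma> \<le> \<beta> \<Longrightarrow> 0 \<le> \<delta> \<Longrightarrow>
      close_until A (T + \<gamma>) \<delta> x b \<Longrightarrow> close_until A (T + \<gamma>) (\<delta> / 2) (rerouted x) (rerouted b)"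
    by (rule local_contraction[OF assms(1,3)]) blast
  have "close_until A (T + 0) (0 / 2) (rerouted a) (rerouted b)"
    by (rule \<beta>(2)[OF assms(1,2) close_until_refl assms(4)]) (use \<beta>(1) assms(4) in auto)
  thus ?thesis by simp
qed

text \<open>If the supremum of the times of coincidence were below \<open>T\<close>, the contraction
  on a short interval after it would carry coincidence further. A supremum replaces a stepwise
  argument because the intervals of contraction may shrink.\<close>

lemma rerouted_fixed_point_unique:
  assumes a: "a \<in> A \<rightarrow> rates p" "coincide_until A T a (rerouted a)"
    and b: "b \<in> A \<rightarrow> rates p" "coincide_until A T b (rerouted b)" and T: "0 \<le> T"
  shows "coincide_until A T a b"
proof -
  define S where "S = {t. 0 \<le> t \<and> t \<le> T \<and> coincide_until A t a b}"
  have 0: "0 \<in> S" using T by (simp add: S_def coincide_until_iff zero_ereal_def)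
  \<comment> \<open>The supremum is approached along a sequence, so only countably many null sets
    are involved.\<close>
  obtain \<tau> :: "nat \<Rightarrow> ereal" where \<tau>: "range \<tau> \<subseteq> S" "Sup S = (SUP n. \<tau> n)"
    using Sup_countable_SUP[of S] 0 by blast
  have sup: "coincide_until A (Sup S) a b" unfolding \<tau>(2)
    by (rule coincide_until_SUP) (use \<tau>(1) in \<open>auto simp: S_def\<close>)
  have "Sup S \<le> T" by (rule Sup_least) (simp add: S_def)
  moreover have "\<not> Sup S < T"
  proof
    assume less: "Sup S < T"
    have "0 \<le> Sup S" by (rule Sup_upper[OF 0])
    then obtain t where t: "Sup S = ereal t" "0 \<le> t" using less by (cases "Sup S") auto
    obtain \<beta> where \<beta>: "0 < \<beta>" "\<And>x b \<gamma> \<delta>. x \<in> A \<rightarrow> rates p \<Longrightarrow> b \<in> A \<rightarrow> rates p \<Longrightarrow>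
        close_until A t 0 a x \<Longrightarrow> close_until A t 0 a b \<Longrightarrow> 0 \<le> \<gamma> \<Longrightarrow> \<gamma> \<le> \<beta> \<Longrightarrow> 0 \<le> \<delta> \<Longrightarrow>
        close_until A (t + \<gamma>) \<delta> x b \<Longrightarrow> close_until A (t + \<gamma>) (\<delta> / 2) (rerouted x) (rerouted b)"
      by (rule local_contraction[OF a(1) t(2)]) blast
    obtain s where s: "ereal t < ereal s" "ereal s < T" using ereal_dense2[of "ereal t" T] less t(1) by auto
    \<comment> \<open>Shortened so that \<open>t + \<gamma>\<close> stays before \<open>T\<close>,
      where both fixed point equations hold.\<close>
    define \<gamma> where "\<gamma> = min \<beta> (s - t)"
    have \<gamma>: "0 < \<gamma>" "\<gamma> \<le> \<beta>" "t + \<gamma> \<le> s" using \<beta>(1) s(1) by (auto simp: \<gamma>_def)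
    have \<gamma>T: "ereal (t + \<gamma>) \<le> T"
    proof -
      have "ereal (t + \<gamma>) \<le> ereal s" using \<gamma>(3) by simp
      thus ?thesis using s(2) by (meson less_imp_le order_trans)
    qed
    have fp: "close_until A (t + \<gamma>) 0 x (rerouted x)" if "coincide_until A T x (rerouted x)" for x
      unfolding close_until_iff_coincide coincide_until_iff
    proof
      fix j assume "j \<in> A"
      from coincide_untilD[OF that this] show "AE \<theta> in lebesgue. 0 \<le> \<theta> \<longrightarrow> ereal \<theta> < ereal (t + \<gamma>) \<longrightarrow> x j \<theta> = rerouted x j \<theta>"
        by eventually_elim (use \<gamma>T in \<open>blast intro: less_le_trans\<close>)
    qed
    have tg: "0 \<le> t + \<gamma>" using t(2) \<gamma>(1) by simp
    obtain K where K: "0 \<le> K" "\<And>x j. x \<in> A \<rightarrow> rates p \<Longrightarrow> j \<in> A \<Longrightarrow>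
        AE \<theta> in lebesgue. 0 \<le> \<theta> \<longrightarrow> \<theta> \<le> t + \<gamma> \<longrightarrow> \<bar>rerouted x j \<theta>\<bar> \<le> K"
      by (rule rerouted_ess_bound[OF tg]) blast
    \<comment> \<open>The induction starts from the uniform bound on the images under
      \<open>rerouted\<close>, since rates need not be bounded in general. Each round through the
      fixed point equations halves the distance.\<close>
    have "close_until A (t + \<gamma>) (2 * K / 2 ^ n) (rerouted a) (rerouted b)" for n
    proof (induction n)
      case 0
      show ?case unfolding close_until_def
      proof
        fix j assume j: "j \<in> A"
        from K(2)[OF a(1) j] K(2)[OF b(1) j]
        show "AE \<theta> in lebesgue. 0 \<le> \<theta> \<longrightarrow> \<theta> < t + \<gamma> \<longrightarrow> \<bar>rerouted a j \<theta> - rerouted b j \<theta>\<bar> \<le> 2 * K / 2 ^ 0"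
          by eventually_elim fastforce
      qed
    next
      case (Suc n)
      have "close_until A (t + \<gamma>) (2 * K / 2 ^ n) a b"
        using close_until_trans[OF close_until_trans[OF fp[OF a(2)] Suc] close_until_sym[OF fp[OF b(2)]]] by simp
      hence "close_until A (t + \<gamma>) (2 * K / 2 ^ n / 2) (rerouted a) (rerouted b)"
        using K(1) \<gamma> sup by (intro \<beta>(2) a b close_until_refl) (auto simp: close_until_iff_coincide t)
      thus ?case by (simp add: mult.commute)
    qed
    hence "close_until A (t + \<gamma>) 0 (rerouted a) (rerouted b)" by (rule close_until_0I)
    hence "close_until A (t + \<gamma>) 0 a b"
      using close_until_trans[OF close_until_trans[OF fp[OF a(2)] _] close_until_sym[OF fp[OF b(2)]], of 0] by simp
    hence "ereal (t + \<gamma>) \<in> S" using \<gamma>T tg by (simp add: S_def close_until_iff_coincide)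
    hence "ereal (t + \<gamma>) \<le> ereal t" using Sup_upper[of "ereal (t + \<gamma>)" S] t(1) by simp
    thus False using \<gamma>(1) by simp
  qed
  ultimately show ?thesis using sup by (simp add: less_le)
qed

text \<open>Banach's iteration in the supremum distance on \<open>[0, T + \<beta>)\<close>. All
  iterates agree with \<open>a\<close> until \<open>T\<close>, so the same contraction estimate
  applies to every step.\<close>

lemma rerouted_fixed_point_extension:
  assumes a: "a \<in> A \<rightarrow> rates p" "close_until A T 0 a (rerouted a)" and T: "0 \<le> T"
  obtains \<beta> b where "0 < \<beta>" "b \<in> A \<rightarrow> rates p" "close_until A (T + \<beta>) 0 b (rerouted b)"
proof -
  obtain \<beta> where \<beta>: "0 < \<beta>" "\<And>x b \<gamma> \<delta>. x \<in> A \<rightarrow> rates p \<Longrightarrow> b \<in> A \<rightarrow> rates p \<Longrightarrow>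
      close_until A T 0 a x \<Longrightarrow> close_until A T 0 a b \<Longrightarrow> 0 \<le> \<gamma> \<Longrightarrow> \<gamma> \<le> \<beta> \<Longrightarrow> 0 \<le> \<delta> \<Longrightarrow>
      close_until A (T + \<gamma>) \<delta> x b \<Longrightarrow> close_until A (T + \<gamma>) (\<delta> / 2) (rerouted x) (rerouted b)"
    by (rule local_contraction[OF a(1) T]) blast
  define N where "N = T + \<beta>"
  have N: "0 \<le> N" "T \<le> N" using T \<beta>(1) by (auto simp: N_def)
  obtain K where K: "0 \<le> K" "\<And>x j. x \<in> A \<rightarrow> rates p \<Longrightarrow> j \<in> A \<Longrightarrow>
      AE \<theta> in lebesgue. 0 \<le> \<theta> \<longrightarrow> \<theta> \<le> N \<longrightarrow> \<bar>rerouted x j \<theta>\<bar> \<le> K"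
    by (rule rerouted_ess_bound[OF N(1)]) blast
  have contr: "close_until A N (\<delta> / 2) (rerouted x) (rerouted y)"
    if "x \<in> A \<rightarrow> rates p" "y \<in> A \<rightarrow> rates p" "close_until A T 0 a x" "close_until A T 0 a y" "0 \<le> \<delta>" "close_until A N \<delta> x y" for x y \<delta>
    unfolding N_def by (rule \<beta>(2)[OF that(1-4) _ order_refl that(5)]) (use \<beta>(1) that(6) in \<open>auto simp: N_def\<close>)
  \<comment> \<open>The iteration starts at \<open>rerouted a\<close> and not at \<open>a\<close>:
    the image is bounded by \<open>K\<close>, while \<open>a\<close> may be unbounded after
    \<open>T\<close>.\<close>
  define s where "s n = (rerouted ^^ n) (rerouted a)" for n
  have s_rates: "s n \<in> A \<rightarrow> rates p" for n
    by (induction n) (simp_all add: s_def rerouted_rates a(1))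
  have s_T: "close_until A T 0 a (s n)" for n
  proof (induction n)
    case (Suc n)
    have "close_until A T 0 (rerouted a) (s (Suc n))"
      using rerouted_causal[OF a(1) s_rates T Suc] by (simp add: s_def)
    from close_until_trans[OF a(2) this] show ?case by simp
  qed (simp add: s_def a(2))
  have s_bound: "AE \<theta> in lebesgue. 0 \<le> \<theta> \<longrightarrow> \<theta> \<le> N \<longrightarrow> \<bar>s n j \<theta>\<bar> \<le> K" if "j \<in> A" for n j
  proof (cases n)
    case 0
    thus ?thesis using K(2)[OF a(1) that] by (simp add: s_def)
  next
    case (Suc m)
    thus ?thesis using K(2)[OF s_rates that, of m] by (simp add: s_def)
  qed
  have s_step: "close_until A N (2 * K / 2 ^ n) (s n) (s (Suc n))" for n
  proof (induction n)
    case 0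
    show ?case unfolding close_until_def
    proof
      fix j assume j: "j \<in> A"
      from s_bound[OF j, of 0] s_bound[OF j, of "Suc 0"]
      show "AE \<theta> in lebesgue. 0 \<le> \<theta> \<longrightarrow> \<theta> < N \<longrightarrow> \<bar>s 0 j \<theta> - s (Suc 0) j \<theta>\<bar> \<le> 2 * K / 2 ^ 0"
      proof eventually_elim
        fix \<theta> :: real
        assume "0 \<le> \<theta> \<longrightarrow> \<theta> \<le> N \<longrightarrow> \<bar>s 0 j \<theta>\<bar> \<le> K" "0 \<le> \<theta> \<longrightarrow> \<theta> \<le> N \<longrightarrow> \<bar>s (Suc 0) j \<theta>\<bar> \<le> K"
        thus "0 \<le> \<theta> \<longrightarrow> \<theta> < N \<longrightarrow> \<bar>s 0 j \<theta> - s (Suc 0) j \<theta>\<bar> \<le> 2 * K / 2 ^ 0" by auto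
      qed
    qed
  next
    case (Suc n)
    have "close_until A N (2 * K / 2 ^ n / 2) (rerouted (s n)) (rerouted (s (Suc n)))"
      using K(1) by (intro contr s_rates s_T Suc) simp
    thus ?case by (simp add: s_def mult.commute)
  qed
  \<comment> \<open>Cut at \<open>N\<close>, beyond which the iterates are not controlled.
    Divergence before \<open>N\<close> occurs only on a null set, where the value of
    \<open>lim\<close> does not matter.\<close>
  define z where "z j \<theta> = indicator (before (ereal N)) \<theta> * lim (\<lambda>n. s n j \<theta>)" for j \<theta>
  have lim: "AE \<theta> in lebesgue. 0 \<le> \<theta> \<longrightarrow> \<theta> < N \<longrightarrow> (\<lambda>n. s n j \<theta>) \<longlonglongrightarrow> z j \<theta> \<and> (\<forall>n. \<bar>z j \<theta> - s n j \<theta>\<bar> \<le> 4 * K / 2 ^ n)"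
    if j: "j \<in> A" for j
  proof -
    have "AE \<theta> in lebesgue. \<forall>n. 0 \<le> \<theta> \<longrightarrow> \<theta> < N \<longrightarrow> \<bar>s n j \<theta> - s (Suc n) j \<theta>\<bar> \<le> 2 * K / 2 ^ n"
      unfolding AE_all_countable by (intro allI close_untilD[OF s_step j])
    thus ?thesis
    proof eventually_elim
      fix \<theta> :: real assume *: "\<forall>n. 0 \<le> \<theta> \<longrightarrow> \<theta> < N \<longrightarrow> \<bar>s n j \<theta> - s (Suc n) j \<theta>\<bar> \<le> 2 * K / 2 ^ n"
      show "0 \<le> \<theta> \<longrightarrow> \<theta> < N \<longrightarrow> (\<lambda>n. s n j \<theta>) \<longlonglongrightarrow> z j \<theta> \<and> (\<forall>n. \<bar>z j \<theta> - s n j \<theta>\<bar> \<le> 4 * K / 2 ^ n)"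
      proof (intro impI conjI allI)
        assume t: "0 \<le> \<theta>" "\<theta> < N"
        have z: "z j \<theta> = lim (\<lambda>n. s n j \<theta>)" using t by (simp add: z_def before_def)
        have **: "\<bar>s n j \<theta> - s (Suc n) j \<theta>\<bar> \<le> 2 * K / 2 ^ n" for n using * t by blast
        show "(\<lambda>n. s n j \<theta>) \<longlonglongrightarrow> z j \<theta>" unfolding z by (rule geometric_limit(1)[OF **])
        show "\<bar>z j \<theta> - s n j \<theta>\<bar> \<le> 4 * K / 2 ^ n" for n
          unfolding z using geometric_limit(2)[of "\<lambda>n. s n j \<theta>" "2 * K", OF **] by simp
      qed
    qed
  qed
  have z_rates: "z \<in> A \<rightarrow> rates p"
  proof
    fix j assume j: "j \<in> A"
    have s0: "AE \<theta> in lebesgue. \<forall>n. 0 \<le> s n j \<theta>"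
      unfolding AE_all_countable by (intro allI ratesD(2)[OF funcset_mem[OF s_rates j]])
    show "z j \<in> rates p"
    proof (rule rates_if_loc_ess_bounded)
      show "0 < p" using p by simp
      show "z j \<in> borel_measurable lebesgue"
        unfolding z_def by (intro borel_measurable_times borel_measurable_indicator before_lebesgue
            borel_measurable_lim_metric ratesD(1)[OF funcset_mem[OF s_rates j]])
      show "AE \<theta> in lebesgue. 0 \<le> z j \<theta>" using s0 lim[OF j]
      proof eventually_elim
        fix \<theta> :: real
        assume *: "\<forall>n. 0 \<le> s n j \<theta>" "0 \<le> \<theta> \<longrightarrow> \<theta> < N \<longrightarrow> (\<lambda>n. s n j \<theta>) \<longlonglongrightarrow> z j \<theta> \<and> (\<forall>n. \<bar>z j \<theta> - s n j \<theta>\<bar> \<le> 4 * K / 2 ^ n)"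
        show "0 \<le> z j \<theta>"
        proof (cases "0 \<le> \<theta> \<and> \<theta> < N")
          case True
          hence "(\<lambda>n. s n j \<theta>) \<longlonglongrightarrow> z j \<theta>" using *(2) by blast
          thus ?thesis by (rule LIMSEQ_le_const) (use *(1) in blast)
        qed (simp add: z_def before_def)
      qed
      show "AE \<theta> in lebesgue. \<theta> < 0 \<longrightarrow> z j \<theta> = 0" by (intro AE_I2) (simp add: z_def before_def)
      have "AE \<theta> in lebesgue. \<bar>z j \<theta>\<bar> \<le> 5 * K" using lim[OF j] s_bound[OF j, of 0]
      proof eventually_elim
        fix \<theta> :: real
        assume *: "0 \<le> \<theta> \<longrightarrow> \<theta> < N \<longrightarrow> (\<lambda>n. s n j \<theta>) \<longlonglongrightarrow> z j \<theta> \<and> (\<forall>n. \<bar>z j \<theta> - s n j \<theta>\<bar> \<le> 4 * K / 2 ^ n)"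
          "0 \<le> \<theta> \<longrightarrow> \<theta> \<le> N \<longrightarrow> \<bar>s 0 j \<theta>\<bar> \<le> K"
        show "\<bar>z j \<theta>\<bar> \<le> 5 * K"
        proof (cases "0 \<le> \<theta> \<and> \<theta> < N")
          case True
          hence "\<forall>n. \<bar>z j \<theta> - s n j \<theta>\<bar> \<le> 4 * K / 2 ^ n" "\<bar>s 0 j \<theta>\<bar> \<le> K" using * by auto
          from spec[OF this(1), of 0] this(2) show ?thesis by simp
        qed (use K(1) in \<open>auto simp: z_def before_def\<close>)
      qed
      thus "\<exists>K. AE \<theta> in lebesgue. 0 \<le> \<theta> \<longrightarrow> \<theta> \<le> M \<longrightarrow> \<bar>z j \<theta>\<bar> \<le> K" for M
        by (intro exI[of _ "5 * K"]) (erule eventually_mono, simp)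
    qed
  qed
  have z_s: "close_until A N (4 * K / 2 ^ n) z (s n)" for n
    unfolding close_until_def
  proof
    fix j assume "j \<in> A"
    from lim[OF this] show "AE \<theta> in lebesgue. 0 \<le> \<theta> \<longrightarrow> \<theta> < N \<longrightarrow> \<bar>z j \<theta> - s n j \<theta>\<bar> \<le> 4 * K / 2 ^ n"
      by eventually_elim blast
  qed
  have z_T: "close_until A T 0 a z"
  proof (rule close_until_0I)
    fix n
    show "close_until A T (4 * K / 2 ^ n) a z"
      using close_until_trans[OF s_T close_until_mono[OF close_until_sym[OF z_s] N(2) order_refl], of n] by simp
  qed
  have "close_until A N 0 z (rerouted z)"
  proof (rule close_until_0I)
    fix n
    \<comment> \<open>The contraction contributes half of the claimed distance; the other half is
      the distance of \<open>z\<close> to the next iterate.\<close>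
    have "close_until A N (4 * K / 2 ^ n / 2) (rerouted z) (rerouted (s n))"
      using K(1) by (intro contr z_rates s_rates z_T s_T z_s) simp
    from close_until_sym[OF this] have "close_until A N (4 * K / 2 ^ n / 2) (s (Suc n)) (rerouted z)" by (simp add: s_def)
    from close_until_trans[OF z_s this] show "close_until A N (4 * K / 2 ^ n) z (rerouted z)"
      by (rule close_until_mono) simp_all
  qed
  thus ?thesis unfolding N_def by (rule that[OF \<beta>(1) z_rates])
qed

text \<open>Uniqueness makes any two of the fixed points agree on their common interval. The glued
  rates are locally bounded even when the times \<open>\<tau> n\<close> accumulate at a finite
  limit, because the bound on images under \<open>rerouted\<close> is the same for all
  \<open>n\<close>.\<close>

lemma rerouted_fixed_points_glue:
  fixes \<tau> :: "nat \<Rightarrow> real"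
  assumes a: "\<And>n. a n \<in> A \<rightarrow> rates p" "\<And>n. close_until A (\<tau> n) 0 (a n) (rerouted (a n))" and \<tau>: "\<And>n. 0 \<le> \<tau> n"
  shows "\<exists>b\<in>A \<rightarrow> rates p. \<forall>n. close_until A (\<tau> n) 0 b (rerouted b)"
proof -
  have co: "coincide_until A (ereal (min (\<tau> m) (\<tau> n))) (a m) (a n)" for m n
  proof -
    have "coincide_until A (ereal (min (\<tau> m) (\<tau> n))) (a k) (rerouted (a k))" if "min (\<tau> m) (\<tau> n) \<le> \<tau> k" for k
      using close_until_mono[OF a(2) that order_refl] unfolding close_until_iff_coincide .
    from rerouted_fixed_point_unique[OF a(1) this a(1) this, of m n] show ?thesis using \<tau>[of m] \<tau>[of n] by simp
  qed
  define S where "S n = before (ereal (\<tau> n))" for n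
  \<comment> \<open>The least index keeps the choice measurable; almost everywhere any other
    admissible index gives the same value.\<close>
  define b where "b j \<theta> = indicator (\<Union>n. S n) \<theta> * a (LEAST n. \<theta> \<in> S n) j \<theta>" for j \<theta>
  have bn: "AE \<theta> in lebesgue. \<forall>n. \<theta> \<in> S n \<longrightarrow> b j \<theta> = a n j \<theta>" if j: "j \<in> A" for j
  proof -
    have "AE \<theta> in lebesgue. \<forall>m n. 0 \<le> \<theta> \<longrightarrow> ereal \<theta> < ereal (min (\<tau> m) (\<tau> n)) \<longrightarrow> a m j \<theta> = a n j \<theta>"
      unfolding AE_all_countable by (intro allI coincide_untilD[OF co j])
    thus ?thesis
    proof eventually_elim
      fix \<theta> :: real assume *: "\<forall>m n. 0 \<le> \<theta> \<longrightarrow> ereal \<theta> < ereal (min (\<tau> m) (\<tau> n)) \<longrightarrow> a m j \<theta> = a n j \<theta>"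
      show "\<forall>n. \<theta> \<in> S n \<longrightarrow> b j \<theta> = a n j \<theta>"
      proof (intro allI impI)
        fix n assume n: "\<theta> \<in> S n"
        define m where "m = (LEAST n. \<theta> \<in> S n)"
        have m: "\<theta> \<in> S m" unfolding m_def using n by (rule LeastI)
        have "0 \<le> \<theta>" "\<theta> < min (\<tau> m) (\<tau> n)" using m n by (auto simp: S_def before_def)
        hence "a m j \<theta> = a n j \<theta>" using * by simp
        moreover have "\<theta> \<in> (\<Union>n. S n)" using n by blast
        hence "b j \<theta> = a m j \<theta>" by (simp only: b_def m_def indicator_simps mult_1)
        ultimately show "b j \<theta> = a n j \<theta>" by simp
      qed
    qed
  qed
  have b_a: "close_until A (\<tau> n) 0 b (a n)" for n
    unfolding close_until_def
  proof
    fix j assume "j \<in> A"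
    from bn[OF this] show "AE \<theta> in lebesgue. 0 \<le> \<theta> \<longrightarrow> \<theta> < \<tau> n \<longrightarrow> \<bar>b j \<theta> - a n j \<theta>\<bar> \<le> 0"
      by eventually_elim (simp add: S_def before_def)
  qed
  have b_rates: "b \<in> A \<rightarrow> rates p"
  proof
    fix j assume j: "j \<in> A"
    have S: "S n \<in> sets lebesgue" for n unfolding S_def by (rule before_lebesgue)
    have out: "b j \<theta> = 0" if "\<forall>n. \<theta> \<notin> S n" for \<theta> using that by (simp add: b_def)
    show "b j \<in> rates p"
    proof (rule rates_if_loc_ess_bounded)
      show "0 < p" using p by simp
      have "(\<lambda>\<theta>. LEAST n. \<theta> \<in> S n) \<in> measurable lebesgue (count_space UNIV)"
        by (rule measurable_Least) (use S in \<open>simp add: pred_def\<close>)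
      hence "(\<lambda>\<theta>. a (LEAST n. \<theta> \<in> S n) j \<theta>) \<in> borel_measurable lebesgue"
        by (rule measurable_compose_countable[rotated]) (rule ratesD(1)[OF funcset_mem[OF a(1) j]])
      moreover have "(\<Union>n. S n) \<in> sets lebesgue" by (intro sets.countable_UN image_subsetI S)
      ultimately show "b j \<in> borel_measurable lebesgue"
        unfolding b_def by (intro borel_measurable_times borel_measurable_indicator)
      have "AE \<theta> in lebesgue. \<forall>n. 0 \<le> a n j \<theta>"
        unfolding AE_all_countable by (intro allI ratesD(2)[OF funcset_mem[OF a(1) j]])
      with bn[OF j] show "AE \<theta> in lebesgue. 0 \<le> b j \<theta>"
      proof eventually_elim
        fix \<theta> assume "\<forall>n. \<theta> \<in> S n \<longrightarrow> b j \<theta> = a n j \<theta>" "\<forall>n. 0 \<le> a n j \<theta>"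
        thus "0 \<le> b j \<theta>" using out[of \<theta>] by (cases "\<exists>n. \<theta> \<in> S n") auto
      qed
      show "AE \<theta> in lebesgue. \<theta> < 0 \<longrightarrow> b j \<theta> = 0"
        by (intro AE_I2 impI out) (simp add: S_def before_def)
      show "\<exists>K. AE \<theta> in lebesgue. 0 \<le> \<theta> \<longrightarrow> \<theta> \<le> M \<longrightarrow> \<bar>b j \<theta>\<bar> \<le> K" for M
      proof -
        have max: "0 \<le> max 0 M" by simp
        obtain K where K: "0 \<le> K" "\<And>x j. x \<in> A \<rightarrow> rates p \<Longrightarrow> j \<in> A \<Longrightarrow>
            AE \<theta> in lebesgue. 0 \<le> \<theta> \<longrightarrow> \<theta> \<le> max 0 M \<longrightarrow> \<bar>rerouted x j \<theta>\<bar> \<le> K"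
          by (rule rerouted_ess_bound[OF max]) blast
        have "AE \<theta> in lebesgue. \<forall>n. 0 \<le> \<theta> \<longrightarrow> \<theta> \<le> max 0 M \<longrightarrow> \<bar>rerouted (a n) j \<theta>\<bar> \<le> K"
          unfolding AE_all_countable by (intro allI K(2)[OF a(1) j])
        moreover have "AE \<theta> in lebesgue. \<forall>n. 0 \<le> \<theta> \<longrightarrow> \<theta> < \<tau> n \<longrightarrow> \<bar>a n j \<theta> - rerouted (a n) j \<theta>\<bar> \<le> 0"
          unfolding AE_all_countable by (intro allI close_untilD[OF a(2) j])
        ultimately have "AE \<theta> in lebesgue. 0 \<le> \<theta> \<longrightarrow> \<theta> \<le> M \<longrightarrow> \<bar>b j \<theta>\<bar> \<le> K" using bn[OF j]
        proof eventually_elim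
          fix \<theta> :: real
          assume *: "\<forall>n. 0 \<le> \<theta> \<longrightarrow> \<theta> \<le> max 0 M \<longrightarrow> \<bar>rerouted (a n) j \<theta>\<bar> \<le> K"
            "\<forall>n. 0 \<le> \<theta> \<longrightarrow> \<theta> < \<tau> n \<longrightarrow> \<bar>a n j \<theta> - rerouted (a n) j \<theta>\<bar> \<le> 0" "\<forall>n. \<theta> \<in> S n \<longrightarrow> b j \<theta> = a n j \<theta>"
          show "0 \<le> \<theta> \<longrightarrow> \<theta> \<le> M \<longrightarrow> \<bar>b j \<theta>\<bar> \<le> K"
          proof (intro impI)
            assume t: "0 \<le> \<theta>" "\<theta> \<le> M"
            show "\<bar>b j \<theta>\<bar> \<le> K"
            proof (cases "\<exists>n. \<theta> \<in> S n")
              case True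
              then obtain n where n: "\<theta> \<in> S n" by blast
              hence "\<theta> < \<tau> n" by (simp add: S_def before_def)
              hence "a n j \<theta> = rerouted (a n) j \<theta>" using *(2)[rule_format, of n] t(1) by simp
              moreover have "\<bar>rerouted (a n) j \<theta>\<bar> \<le> K" using *(1) t by simp
              ultimately show ?thesis using *(3) n by simp
            qed (use out K(1) in simp)
          qed
        qed
        thus ?thesis by (rule exI)
      qed
    qed
  qed
  have "close_until A (\<tau> n) 0 b (rerouted b)" for n
  proof -
    have "close_until A (\<tau> n) 0 (rerouted (a n)) (rerouted b)"
      by (rule rerouted_causal[OF a(1) b_rates \<tau> close_until_sym[OF b_a]])
    from close_until_trans[OF close_until_trans[OF b_a[of n] a(2)] this] show ?thesis by simp
  qed
  thus ?thesis using b_rates by blast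
qed

text \<open>The supremum of the times until which a fixed point exists is itself realized by gluing,
  and the extension lemma rules out a finite value.\<close>

lemma rerouted_fixed_point_exists:
  obtains x where "x \<in> A \<rightarrow> rates p" "coincide_until A \<infinity> x (rerouted x)"
proof -
  define S where "S = {ereal t | t. 0 \<le> t \<and> (\<exists>a \<in> A \<rightarrow> rates p. close_until A t 0 a (rerouted a))}"
  have "(\<lambda>t. 0) \<in> rates p" by (rule rates_if_loc_ess_bounded) (use p in auto)
  hence "(\<lambda>j t. 0) \<in> A \<rightarrow> rates p" by simp
  moreover have "close_until A 0 0 a b" for a b :: "('e \<times> 'i) vec" by (simp add: close_until_def)
  ultimately have 0: "0 \<in> S" unfolding S_def zero_ereal_def by blast
  obtain \<tau>' :: "nat \<Rightarrow> ereal" where \<tau>': "range \<tau>' \<subseteq> S" "Sup S = (SUP n. \<tau>' n)"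
    using Sup_countable_SUP[of S] 0 by blast
  have "\<forall>n. \<exists>t a. \<tau>' n = ereal t \<and> 0 \<le> t \<and> a \<in> A \<rightarrow> rates p \<and> close_until A t 0 a (rerouted a)"
    using \<tau>'(1) unfolding S_def by blast
  then obtain \<tau> a where \<tau>: "\<And>n. \<tau>' n = ereal (\<tau> n)" "\<And>n. 0 \<le> \<tau> n"
    and a: "\<And>n. a n \<in> A \<rightarrow> rates p" "\<And>n. close_until A (\<tau> n) 0 (a n) (rerouted (a n))" by metis
  obtain b where b: "b \<in> A \<rightarrow> rates p" "\<And>n. close_until A (\<tau> n) 0 b (rerouted b)"
    using rerouted_fixed_points_glue[of a \<tau>, OF a \<tau>(2)] by blast
  have co: "coincide_until A (Sup S) b (rerouted b)" unfolding \<tau>'(2) \<tau>(1)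
    by (rule coincide_until_SUP) (use b(2) in \<open>simp add: close_until_iff_coincide\<close>)
  have "Sup S = \<infinity>"
  proof (rule ccontr)
    assume "Sup S \<noteq> \<infinity>"
    moreover have "0 \<le> Sup S" by (rule Sup_upper[OF 0])
    ultimately obtain t where t: "Sup S = ereal t" "0 \<le> t" by (cases "Sup S") auto
    have "close_until A t 0 b (rerouted b)" using co by (simp add: t close_until_iff_coincide)
    then obtain \<beta> c where c: "0 < \<beta>" "c \<in> A \<rightarrow> rates p" "close_until A (t + \<beta>) 0 c (rerouted c)"
      using rerouted_fixed_point_extension[OF b(1) _ t(2)] by blast
    have "0 \<le> t + \<beta>" using t(2) c(1) by simp
    hence "ereal (t + \<beta>) \<in> S" unfolding S_def using c by blast
    hence "ereal (t + \<beta>) \<le> ereal t" using Sup_upper[of "ereal (t + \<beta>)" S] t(1) by simp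
    thus False using c(1) by simp
  qed
  thus ?thesis using that b(1) co by simp
qed

section \<open>Equilibria as fixed points of rerouting\<close>

lemma equilibrium_if_rerouted_fixed_point:
  assumes x: "x \<in> A \<rightarrow> rates p" and fp: "coincide_until A \<infinity> x (rerouted x)"
  shows "prediction_equilibrium p G I d u \<Phi> \<mu> \<infinity> (join x (\<Phi> x))"
proof -
  \<comment> \<open>In the absence of ties all flow on \<open>e\<close> belongs to the class
    \<open>{e}\<close>.\<close>
  define H where "H = (\<lambda>(M, e, i) \<theta>. if M = {e} then rerouted x (e, i) \<theta> else 0)"
  define f where "f = join x (\<Phi> x)"
  have f: "f \<in> flows p G I" unfolding f_def by (rule join_loading_flows[OF x])
  have fix_AE: "AE \<theta> in lebesgue. x j \<theta> = rerouted x j \<theta>" if "j \<in> A" for j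
    by (rule coincide_rates_AE[OF fp x rerouted_rates[OF x] that])
  have H_rates: "H (M, e, i) \<in> borel_measurable lebesgue \<and> (AE \<theta> in lebesgue. 0 \<le> H (M, e, i) \<theta>)"
    if "(M, e) \<in> choice_pairs G" "i \<in> I" for M e i
  proof -
    have "(e, i) \<in> A" using that by (simp add: choice_pairs_iff)
    from ratesD(1,2)[OF funcset_mem[OF rerouted_rates[OF x] this]]
    show ?thesis by (cases "M = {e}") (simp_all add: H_def)
  qed
  show ?thesis
  proof (rule prediction_equilibriumI[where H=H])
    show "x \<in> A \<rightarrow> rates p" "\<Phi> x \<in> A \<rightarrow> rates p" by (rule x, rule \<Phi>_rates[OF x])
    show "AE \<theta> in lebesgue. ereal \<theta> < \<infinity> \<longrightarrow> \<Phi> x j \<theta> = \<Phi> x j \<theta>" for j by simp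
    show "H (M, e, i) \<in> borel_measurable lebesgue" "AE \<theta> in lebesgue. ereal \<theta> < \<infinity> \<longrightarrow> 0 \<le> H (M, e, i) \<theta>"
      if "(M, e) \<in> choice_pairs G" "i \<in> I" for M e i
      using H_rates[OF that] by simp_all
    show "AE \<theta> in lebesgue. ereal \<theta> < \<infinity> \<longrightarrow> (\<Sum>e\<in>out_arcs G v. x (e, i) \<theta>) = inflow (\<Phi> x) (v, i) \<theta>"
      if v: "v \<in> verts G" and i: "i \<in> I" for v i
    proof -
      have "AE \<theta> in lebesgue. \<forall>e\<in>out_arcs G v. x (e, i) \<theta> = rerouted x (e, i) \<theta>"
        by (intro AE_finite_allI finite_out fix_AE) (use i in auto)
      moreover have "AE \<theta> in lebesgue. v \<noteq> d i \<longrightarrow> (\<Sum>e\<in>out_arcs G v. single_prob f (e, i) \<theta>) = 1"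
        using sum_single_prob[OF f i v] by (cases "v = d i") simp_all
      ultimately show ?thesis
      proof eventually_elim
        fix \<theta> :: real
        assume *: "\<forall>e\<in>out_arcs G v. x (e, i) \<theta> = rerouted x (e, i) \<theta>"
          "v \<noteq> d i \<longrightarrow> (\<Sum>e\<in>out_arcs G v. single_prob f (e, i) \<theta>) = 1"
        have "(\<Sum>e\<in>out_arcs G v. x (e, i) \<theta>) = (\<Sum>e\<in>out_arcs G v. single_prob f (e, i) \<theta> * inflow (\<Phi> x) (v, i) \<theta>)"
          using *(1) by (intro sum.cong refl) (simp add: rerouted_def f_def)
        hence eq: "(\<Sum>e\<in>out_arcs G v. x (e, i) \<theta>) = (\<Sum>e\<in>out_arcs G v. single_prob f (e, i) \<theta>) * inflow (\<Phi> x) (v, i) \<theta>"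
          by (simp only: sum_distrib_right)
        show "ereal \<theta> < \<infinity> \<longrightarrow> (\<Sum>e\<in>out_arcs G v. x (e, i) \<theta>) = inflow (\<Phi> x) (v, i) \<theta>"
        proof (cases "v = d i")
          case True
          hence "inflow (\<Phi> x) (v, i) \<theta> = 0" by (simp add: inflow_def)
          thus ?thesis using eq by simp
        next
          case False
          thus ?thesis using eq *(2) by simp
        qed
      qed
    qed
    show "AE \<theta> in lebesgue. ereal \<theta> < \<infinity> \<longrightarrow> x (e, i) \<theta> = (\<Sum>M | (M, e) \<in> choice_pairs G. H (M, e, i) \<theta>)"
      if e: "e \<in> arcs G" and i: "i \<in> I" for e i
    proof -
      have fin: "finite {M. (M, e) \<in> choice_pairs G}"
      proof (rule finite_subset)
        show "{M. (M, e) \<in> choice_pairs G} \<subseteq> Pow (out_arcs G (tail G e))" by (auto simp: choice_pairs_iff)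
        show "finite (Pow (out_arcs G (tail G e)))" by (rule finite_Pow_iff[THEN iffD2, OF finite_out])
      qed
      have "{e} \<in> {M. (M, e) \<in> choice_pairs G}" using e by (simp add: choice_pairs_iff)
      hence "(\<Sum>M | (M, e) \<in> choice_pairs G. H (M, e, i) \<theta>) = rerouted x (e, i) \<theta>" for \<theta>
        using fin by (simp add: H_def sum.delta)
      thus ?thesis using fix_AE[of "(e, i)"] e i by simp
    qed
    show "AE \<theta> in lebesgue. ereal \<theta> < \<infinity> \<longrightarrow> (\<Sum>e\<in>M. H (M, e, i) \<theta>) =
        choice_prob G d \<mu> v M i \<theta> (join x (\<Phi> x)) * inflow (\<Phi> x) (v, i) \<theta>"
      if v: "v \<in> verts G" and M: "M \<noteq> {}" "M \<subseteq> out_arcs G v" and i: "i \<in> I" for v M i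
      using choice_prob_0[OF f i v]
    proof eventually_elim
      fix \<theta> :: real assume *: "\<forall>M. card M \<noteq> 1 \<longrightarrow> v \<noteq> d i \<or> M \<noteq> {} \<longrightarrow> choice_prob G d \<mu> v M i \<theta> f = 0"
      show "ereal \<theta> < \<infinity> \<longrightarrow> (\<Sum>e\<in>M. H (M, e, i) \<theta>) = choice_prob G d \<mu> v M i \<theta> (join x (\<Phi> x)) * inflow (\<Phi> x) (v, i) \<theta>"
      proof (cases "card M = 1")
        case True
        then obtain e where e: "M = {e}" by (rule card_1_singletonE)
        hence "tail G e = v" using M(2) by auto
        thus ?thesis by (simp add: e H_def rerouted_def single_prob_def)
      next
        case False
        hence "M \<noteq> {e}" for e by auto
        moreover have "choice_prob G d \<mu> v M i \<theta> f = 0" using * False M(1) by blast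
        ultimately show ?thesis by (simp add: f_def H_def)
      qed
    qed
  qed
qed

text \<open>For a class \<open>M\<close> that is not a singleton the splitting rates are nonnegative
  with sum 0, so they vanish. Only the class \<open>{e}\<close> remains in the routing rate of
  \<open>e\<close>, which is therefore determined by the flow.\<close>

lemma rerouted_fixed_point_if_equilibrium:
  assumes eq: "prediction_equilibrium p G I d u \<Phi> \<mu> \<infinity> f"
  shows "coincide_until A \<infinity> (edge_outflow f) (\<Phi> (edge_inflow f))"
    and "coincide_until A \<infinity> (edge_inflow f) (rerouted (edge_inflow f))"
proof -
  define x where "x = edge_inflow f"
  define y where "y = edge_outflow f"
  have f: "f \<in> flows p G I" using eq by (simp add: prediction_equilibrium_def)
  have f_join: "f = join x y" by (simp add: x_def y_def join_eta)
  have x: "x \<in> A \<rightarrow> rates p" and y: "y \<in> A \<rightarrow> rates p" using f unfolding f_join join_flows by blast+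
  obtain r where r: "r \<in> routing G I d \<mu> f" and all: "AE \<theta> in lebesgue. ereal \<theta> < \<infinity> \<longrightarrow> (\<forall>i\<in>I.
        (\<forall>e \<in> arcs G. y (e, i) \<theta> = \<Phi> x (e, i) \<theta>) \<and>
        (\<forall>v \<in> verts G. (\<Sum>e\<in>out_arcs G v. x (e, i) \<theta>) = inflow y (v, i) \<theta>) \<and>
        (\<forall>e \<in> arcs G. x (e, i) \<theta> = r (e, i) \<theta> * (\<Sum>e'\<in>out_arcs G (tail G e). x (e', i) \<theta>)))"
    using eq unfolding prediction_equilibrium_def x_def y_def inflow_def prod.case by blast
  obtain \<rho> where \<rho>: "\<forall>(M, e) \<in> choice_pairs G. \<forall>i\<in>I. \<rho> (M, e, i) \<in> splits"
    "\<forall>v \<in> verts G. \<forall>M i. M \<noteq> {} \<and> M \<subseteq> out_arcs G v \<and> i \<in> I \<longrightarrow>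
           (AE \<theta> in lebesgue. (\<Sum>e\<in>M. \<rho> (M, e, i) \<theta>) = choice_prob G d \<mu> v M i \<theta> f)"
    "ae_equal A r (\<lambda>(e, i) \<theta>. \<Sum>M | (M, e) \<in> choice_pairs G. \<rho> (M, e, i) \<theta>)"
    using r unfolding routing_def by blast
  have load: "AE \<theta> in lebesgue. y j \<theta> = \<Phi> x j \<theta>" if "j \<in> A" for j
    using all by eventually_elim (use that in auto)
  show "coincide_until A \<infinity> (edge_outflow f) (\<Phi> (edge_inflow f))"
    unfolding x_def[symmetric] y_def[symmetric] coincide_until_iff
  proof
    fix j assume "j \<in> A"
    from load[OF this] show "AE t in lebesgue. 0 \<le> t \<longrightarrow> ereal t < \<infinity> \<longrightarrow> y j t = \<Phi> x j t" by eventually_elim simp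
  qed
  have f_ae: "ae_equal (flow_index G I) f (join x (\<Phi> x))"
    unfolding ae_equal_def
  proof
    fix h assume "h \<in> flow_index G I"
    then consider j where "j \<in> A" "\<And>x y. join x y h = x j" | j where "j \<in> A" "\<And>x y. join x y h = y j"
      using join_index_cases by metis
    thus "AE t in lebesgue. f h t = join x (\<Phi> x) h t"
    proof cases
      case 1
      thus ?thesis by (simp add: f_join)
    next
      case 2
      thus ?thesis using load[OF 2(1)] by (simp add: f_join)
    qed
  qed
  \<comment> \<open>The two flows differ only on null sets, and cost predictors respect this at
    every time, so the probabilities agree at every time as well.\<close>
  have single: "single_prob f j \<theta> = single_prob (join x (\<Phi> x)) j \<theta>" if j: "j \<in> A" for j \<theta>
  proof -
    obtain e i where ei: "j = (e, i)" "e \<in> arcs G" "i \<in> I" using j by auto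
    have "best (tail G e) i (C \<theta> f) = best (tail G e) i (C \<theta> (join x (\<Phi> x)))" if C: "C \<in> space (\<mu> i)" for C
    proof -
      have "C \<theta> f q = C \<theta> (join x (\<Phi> x)) q" if "q \<in> paths (tail G e) i" for q
        by (rule cost_cong_AE[OF ei(3) C f join_loading_flows[OF x] f_ae path_simple[OF that tail_in_verts[OF ei(2)] ei(3)]])
      thus ?thesis unfolding best_def by (intro Collect_cong conj_cong bex_cong ball_cong refl) auto
    qed
    hence "{C \<in> space (\<mu> i). best (tail G e) i (C \<theta> f) = {e}} = {C \<in> space (\<mu> i). best (tail G e) i (C \<theta> (join x (\<Phi> x))) = {e}}" by auto
    thus ?thesis by (simp add: single_prob_def ei choice_prob_best)
  qed
  show "coincide_until A \<infinity> (edge_inflow f) (rerouted (edge_inflow f))"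
    unfolding x_def[symmetric] coincide_until_iff
  proof
    fix j assume j: "j \<in> A"
    obtain e i where ei: "j = (e, i)" "e \<in> arcs G" "i \<in> I" using j by auto
    define v where "v = tail G e"
    have v: "v \<in> verts G" unfolding v_def by (rule tail_in_verts[OF ei(2)])
    define Q where "Q = {M. (M, e) \<in> choice_pairs G}"
    have Q: "M \<in> Q \<longleftrightarrow> M \<subseteq> out_arcs G v \<and> e \<in> M" for M using ei(2) by (simp add: Q_def choice_pairs_iff v_def)
    have Qfin: "finite Q"
    proof (rule finite_subset)
      show "Q \<subseteq> Pow (out_arcs G v)" using Q by blast
      show "finite (Pow (out_arcs G v))" by (rule finite_Pow_iff[THEN iffD2, OF finite_out])
    qed
    have Mfin: "finite M" if "M \<in> Q" for M using that Q finite_subset[OF _ finite_out] by blast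
    have sums: "AE \<theta> in lebesgue. \<forall>M\<in>Q. (\<Sum>e\<in>M. \<rho> (M, e, i) \<theta>) = choice_prob G d \<mu> v M i \<theta> f"
      using \<rho>(2) v ei(3) by (intro AE_finite_allI[OF Qfin]) (auto simp: Q)
    have nonneg: "AE \<theta> in lebesgue. \<forall>M\<in>Q. \<forall>e'\<in>M. 0 \<le> \<rho> (M, e', i) \<theta>"
    proof (intro AE_finite_allI[OF Qfin] AE_finite_allI[OF Mfin])
      fix M e' assume M: "M \<in> Q" "e' \<in> M"
      have "(M, e') \<in> choice_pairs G" using M Q by (intro choice_pairsI) auto
      hence "AE \<theta> in lebesgue. \<rho> (M, e', i) \<theta> \<in> {0..1}" using \<rho>(1) ei(3) unfolding splits_def by blast
      thus "AE \<theta> in lebesgue. 0 \<le> \<rho> (M, e', i) \<theta>" by eventually_elim simp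
    qed
    have r_eq: "AE \<theta> in lebesgue. r (e, i) \<theta> = (\<Sum>M\<in>Q. \<rho> (M, e, i) \<theta>)"
      using \<rho>(3) j unfolding ae_equal_def Q_def ei(1) by fastforce
    from all sums nonneg r_eq choice_prob_0[OF f ei(3) v]
    show "AE t in lebesgue. 0 \<le> t \<longrightarrow> ereal t < \<infinity> \<longrightarrow> x j t = rerouted x j t"
    proof eventually_elim
      fix \<theta> :: real
      assume a: "ereal \<theta> < \<infinity> \<longrightarrow> (\<forall>i\<in>I.
        (\<forall>e \<in> arcs G. y (e, i) \<theta> = \<Phi> x (e, i) \<theta>) \<and>
        (\<forall>v \<in> verts G. (\<Sum>e\<in>out_arcs G v. x (e, i) \<theta>) = inflow y (v, i) \<theta>) \<and>
        (\<forall>e \<in> arcs G. x (e, i) \<theta> = r (e, i) \<theta> * (\<Sum>e'\<in>out_arcs G (tail G e). x (e', i) \<theta>)))"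
        and s: "\<forall>M\<in>Q. (\<Sum>e\<in>M. \<rho> (M, e, i) \<theta>) = choice_prob G d \<mu> v M i \<theta> f"
        and n: "\<forall>M\<in>Q. \<forall>e'\<in>M. 0 \<le> \<rho> (M, e', i) \<theta>"
        and re: "r (e, i) \<theta> = (\<Sum>M\<in>Q. \<rho> (M, e, i) \<theta>)"
        and c0: "\<forall>M. card M \<noteq> 1 \<longrightarrow> v \<noteq> d i \<or> M \<noteq> {} \<longrightarrow> choice_prob G d \<mu> v M i \<theta> f = 0"
      have \<rho>0: "\<rho> (M, e, i) \<theta> = 0" if M: "M \<in> Q" "M \<noteq> {e}" for M
      proof -
        have e: "e \<in> M" using M(1) Q by blast
        have "card M \<noteq> 1"
        proof
          assume "card M = 1"
          then obtain e' where "M = {e'}" by (rule card_1_singletonE)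
          thus False using e M(2) by blast
        qed
        hence "choice_prob G d \<mu> v M i \<theta> f = 0" using c0 e by blast
        hence "(\<Sum>e\<in>M. \<rho> (M, e, i) \<theta>) = 0" using s M(1) by simp
        thus ?thesis using sum_nonneg_eq_0_iff[OF Mfin[OF M(1)], of "\<lambda>e. \<rho> (M, e, i) \<theta>"] n M(1) e by blast
      qed
      have eQ: "{e} \<in> Q" using ei(2) by (simp add: Q v_def)
      have "(\<Sum>M\<in>Q. \<rho> (M, e, i) \<theta>) = (\<Sum>M\<in>{{e}}. \<rho> (M, e, i) \<theta>)"
        using eQ \<rho>0 by (intro sum.mono_neutral_right[OF Qfin]) auto
      also have "\<dots> = choice_prob G d \<mu> v {e} i \<theta> f" using bspec[OF s eQ] by simp
      finally have r1: "r (e, i) \<theta> = single_prob f j \<theta>" using re by (simp add: single_prob_def ei(1) v_def)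
      have inf: "inflow y (v, i) \<theta> = inflow (\<Phi> x) (v, i) \<theta>"
      proof -
        have "(\<Sum>e\<in>in_arcs G v. y (e, i) \<theta>) = (\<Sum>e\<in>in_arcs G v. \<Phi> x (e, i) \<theta>)"
          using a ei(3) by (intro sum.cong refl) auto
        thus ?thesis by (simp add: inflow_def)
      qed
      have "x (e, i) \<theta> = r (e, i) \<theta> * (\<Sum>e'\<in>out_arcs G v. x (e', i) \<theta>)" using a ei unfolding v_def by auto
      also have "(\<Sum>e'\<in>out_arcs G v. x (e', i) \<theta>) = inflow y (v, i) \<theta>" using mp[OF a eqTrueE[OF less_ereal.simps(4)]] ei(3) v by blast
      finally have "x (e, i) \<theta> = rerouted x (e, i) \<theta>"
        using r1 inf single[OF j, of \<theta>] by (simp add: rerouted_def ei(1) v_def)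
      thus "0 \<le> \<theta> \<longrightarrow> ereal \<theta> < \<infinity> \<longrightarrow> x j \<theta> = rerouted x j \<theta>" by (simp add: ei(1))
    qed
  qed
qed

theorem equilibrium_exists_regular: "\<exists>f. prediction_equilibrium p G I d u \<Phi> \<mu> \<infinity> f"
  using rerouted_fixed_point_exists equilibrium_if_rerouted_fixed_point by metis

theorem equilibrium_unique:
  assumes f: "prediction_equilibrium p G I d u \<Phi> \<mu> \<infinity> f" and g: "prediction_equilibrium p G I d u \<Phi> \<mu> \<infinity> g"
  shows "ae_equal (flow_index G I) f g"
proof -
  define x where "x = edge_inflow f"
  define x' where "x' = edge_inflow g"
  have "f \<in> flows p G I" "g \<in> flows p G I" using f g by (simp_all add: prediction_equilibrium_def)
  hence rates: "x \<in> A \<rightarrow> rates p" "edge_outflow f \<in> A \<rightarrow> rates p" "x' \<in> A \<rightarrow> rates p" "edge_outflow g \<in> A \<rightarrow> rates p"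
    using join_flows[of "edge_inflow f" "edge_outflow f"] join_flows[of "edge_inflow g" "edge_outflow g"]
    unfolding join_eta x_def x'_def by blast+
  note ff = rerouted_fixed_point_if_equilibrium[OF f, folded x_def] and gg = rerouted_fixed_point_if_equilibrium[OF g, folded x'_def]
  have co: "coincide_until A \<infinity> x x'" by (rule rerouted_fixed_point_unique[OF rates(1) ff(2) rates(3) gg(2)]) simp
  have x_ae: "AE t in lebesgue. x j t = x' j t" if "j \<in> A" for j
    by (rule coincide_rates_AE[OF co rates(1,3) that])
  hence \<Phi>_ae: "AE t in lebesgue. \<Phi> x j t = \<Phi> x' j t" if "j \<in> A" for j
    using \<Phi> rates(1,3) that unfolding edge_loading_operator_def ae_equal_def by blast
  have y_ae: "AE t in lebesgue. edge_outflow f j t = edge_outflow g j t" if "j \<in> A" for j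
    using coincide_rates_AE[OF ff(1) rates(2) \<Phi>_rates[OF rates(1)] that]
      coincide_rates_AE[OF gg(1) rates(4) \<Phi>_rates[OF rates(3)] that] \<Phi>_ae[OF that]
    by eventually_elim simp
  show ?thesis unfolding ae_equal_def
  proof
    fix h assume "h \<in> flow_index G I"
    then consider j where "j \<in> A" "\<And>x y. join x y h = x j" | j where "j \<in> A" "\<And>x y. join x y h = y j"
      using join_index_cases by metis
    thus "AE t in lebesgue. f h t = g h t"
    proof cases
      case 1
      have "f h = x j" "g h = x' j"
        using 1(2)[of "edge_inflow f" "edge_outflow f"] 1(2)[of "edge_inflow g" "edge_outflow g"] by (simp_all add: join_eta x_def x'_def)
      thus ?thesis using x_ae[OF 1(1)] by simp
    next
      case 2
      have "f h = edge_outflow f j" "g h = edge_outflow g j"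
        using 2(2)[of "edge_inflow f" "edge_outflow f"] 2(2)[of "edge_inflow g" "edge_outflow g"] by (simp_all add: join_eta)
      thus ?thesis using y_ae[OF 2(1)] by simp
    qed
  qed
qed

end

theorem theorem5p14:
  fixes p :: real
    and G :: "('v, 'e) pre_digraph"
    and I :: "'i set"
    and d :: "'i \<Rightarrow> 'v"
    and u :: "('v \<times> 'i) vec"
    and \<Phi> :: "('e \<times> 'i) vec \<Rightarrow> ('e \<times> 'i) vec"
    and \<mu> :: "'i \<Rightarrow> ('e, 'i) predictor measure"
  assumes "1 < p"
    and "fin_digraph G"
    and "finite I"
    and "\<And>i. i \<in> I \<Longrightarrow> d i \<in> verts G"
    and "\<And>i v. i \<in> I \<Longrightarrow> v \<in> verts G \<Longrightarrow> v \<rightarrow>\<^sup>*\<^bsub>G\<^esub> d i"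
    and "u \<in> verts G \<times> I \<rightarrow> rates p"
    and "edge_loading_operator p G I \<Phi>"
    and "locally_bounded_loading p G I \<Phi>"
    and "\<And>i. i \<in> I \<Longrightarrow> predictor_distribution p G I (\<mu> i)"
  shows
    "(\<forall>T::real\<ge>0. continuity_until p G I \<Phi> \<mu> T \<longrightarrow>
        (\<exists>f. prediction_equilibrium p G I d u \<Phi> \<mu> (ereal T) f)) \<and>
     ((\<forall>T::real\<ge>0. continuity_until p G I \<Phi> \<mu> T) \<and>
      causal_loading p G I \<Phi> \<and>
      (\<forall>i\<in>I. AE C in \<mu> i. causal_predictor p G I C) \<longrightarrow>
        (\<exists>f. prediction_equilibrium p G I d u \<Phi> \<mu> \<infinity> f)) \<and>
     (uniformly_strictly_causal_loading p G I \<Phi> \<and>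
      essentially_bounded_loading p G I \<Phi> \<and>
      (\<forall>j \<in> verts G \<times> I. locally_essentially_bounded (u j)) \<and>
      (\<forall>i\<in>I. AE C in \<mu> i. causal_predictor p G I C) \<and>
      bounded_cost_densities p G I \<mu> \<and>
      locally_Lipschitz_predictors p G I \<mu> \<longrightarrow>
        (\<exists>f. prediction_equilibrium p G I d u \<Phi> \<mu> \<infinity> f) \<and>
        (\<forall>f g. prediction_equilibrium p G I d u \<Phi> \<mu> \<infinity> f \<and>
               prediction_equilibrium p G I d u \<Phi> \<mu> \<infinity> g \<longrightarrow>
               ae_equal (flow_index G I) f g))"
proof -
  interpret network p G I d u \<Phi> \<mu> by (rule network.intro) (fact assms)+
  show ?thesis
  proof (intro conjI allI impI)
    fix T :: real assume "0 \<le> T" "continuity_until p G I \<Phi> \<mu> T"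
    thus "\<exists>f. prediction_equilibrium p G I d u \<Phi> \<mu> (ereal T) f" by (rule equilibrium_exists_until)
  next
    assume "(\<forall>T::real\<ge>0. continuity_until p G I \<Phi> \<mu> T) \<and> causal_loading p G I \<Phi> \<and>
      (\<forall>i\<in>I. AE C in \<mu> i. causal_predictor p G I C)"
    thus "\<exists>f. prediction_equilibrium p G I d u \<Phi> \<mu> \<infinity> f" by (intro equilibrium_exists_causal) blast+
  next
    assume *: "uniformly_strictly_causal_loading p G I \<Phi> \<and> essentially_bounded_loading p G I \<Phi> \<and>
      (\<forall>j \<in> verts G \<times> I. locally_essentially_bounded (u j)) \<and>
      (\<forall>i\<in>I. AE C in \<mu> i. causal_predictor p G I C) \<and>
      bounded_cost_densities p G I \<mu> \<and> locally_Lipschitz_predictors p G I \<mu>"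
    interpret regular_network p G I d u \<Phi> \<mu> by unfold_locales (use * in blast)+
    show "\<exists>f. prediction_equilibrium p G I d u \<Phi> \<mu> \<infinity> f" by (rule equilibrium_exists_regular)
    fix f g
    assume "prediction_equilibrium p G I d u \<Phi> \<mu> \<infinity> f \<and> prediction_equilibrium p G I d u \<Phi> \<mu> \<infinity> g"
    thus "ae_equal (flow_index G I) f g" using equilibrium_unique by blast
  qed
qed

end
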